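(* Let $H$ be a real Hilbert space and let $A$ be a nonnegative self-adjoint linear operator on $H$ with dense domain $D(A)$. Let $0\leq p\leq 1$, $\gamma\geq 1$, and let $(u_0,u_1)\in D(A^{3/2})\times D(A^{1/2})$ with $A^{1/2}u_0\neq 0$. For $\varepsilon>0$ small let $u_\varepsilon$ be the (global) solution of $$\varepsilon u_\varepsilon''(t)+(1+t)^{-p}u_\varepsilon'(t)+|A^{1/2}u_\varepsilon(t)|^{2\gamma}Au_\varepsilon(t)=0,\qquad u_\varepsilon(0)=u_0,\quad u_\varepsilon'(0)=u_1,$$ let $u$ be the solution of $$u'(t)+(1+t)^p|A^{1/2}u(t)|^{2\gamma}Au(t)=0,\qquad u(0)=u_0,$$ let $\theta_\varepsilon$ be the solution of $$\varepsilon\theta_\varepsilon''(t)+(1+t)^{-p}\theta_\varepsilon'(t)=0,\qquad\theta_\varepsilon(0)=0,\quad\theta_\varepsilon'(0)=u_1+|A^{1/2}u_0|^{2\gamma}Au_0,$$ and set $\rho_\varepsilon(t)=u_\varepsilon(t)-u(t)$ and $r_\varepsilon(t)=u_\varepsilon(t)-u(t)-\theta_\varepsilon(t)$. Then: (1) There exists a constant $C_3$ (independent of $\varepsilon$ and $t$) such that for every $\varepsilon$ small enough $$|\rho_\varepsilon(t)|^2+|A^{1/2}\rho_\varepsilon(t)|^2+\int_0^t\frac{|r_\varepsilon'(s)|^2}{|A^{1/2}u(s)|^{2\gamma}}\frac{1}{(1+s)^p}\,ds\leq C_3\,\varepsilon\qquad\forall t\geq 0.$$ (2) If in addition $A$ is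 coercive or $0\leq p\leq\dfrac{\gamma^2+1}{\gamma^2+2\gamma-1}$, then there exists a constant $C_4$ (independent of $\varepsilon$ and $t$) such that for every $\varepsilon$ small enough $$|\rho_\varepsilon(t)|^2+|A^{1/2}\rho_\varepsilon(t)|^2+\int_0^t\frac{|r_\varepsilon'(s)|^2}{|A^{1/2}u(s)|^{2\gamma}}\frac{1}{(1+s)^p}\,ds\leq C_4\,\varepsilon^2\qquad\forall t\geq 0.$$
   Context: $|x|$ and $\langle x,y\rangle$ denote the norm and scalar product of $H$. $A$ nonnegative means $\langle Ax,x\rangle\geq 0$ for all $x\in D(A)$; $A$ is coercive when $\inf\{\langle Ax,x\rangle/|x|^2: x\in D(A),\ x\neq 0\}>0$. For $\alpha\geq 0$, $A^\alpha$ denotes the power of $A$, with domain $D(A^\alpha)$. Under these assumptions, for all $\varepsilon>0$ small enough the second order problem has a unique global solution $u_\varepsilon\in C^2([0,+\infty[;H)\cap C^1([0,+\infty[;D(A^{1/2}))\cap C^0([0,+\infty[;D(A))$, and the first order problem has a unique global solution $u\in C^1([0,+\infty[;H)\cap C^0([0,+\infty[;D(A))$, which satisfies $A^{1/2}u(t)\neq 0$ for all $t\geq 0$. *)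

theory Defs
  imports "HOL-Analysis.Analysis"
begin

text \<open>An unbounded operator on \<open>H\<close> is a partial map \<open>A :: 'a \<rightharpoonup> 'a\<close> with domain
  \<open>D(A) = dom A\<close>. With this encoding \<open>\<circ>\<^sub>m\<close> is composition on the maximal domain,
  \<open>Some\<close> is the identity with domain \<open>H\<close>, and \<open>Map.graph A\<close> is the graph.\<close>

definition app :: "('a \<rightharpoonup> 'b) \<Rightarrow> 'a \<Rightarrow> 'b" where
  "app A x = the (A x)"

definition adjoint_graph :: "('a::real_inner \<rightharpoonup> 'a) \<Rightarrow> ('a \<times> 'a) set" where
  "adjoint_graph A = {(y, z). \<forall>x\<in>dom A. app A x \<bullet> y = x \<bullet> z}"

definition self_adjoint :: "('a::real_inner \<rightharpoonup> 'a) \<Rightarrow> bool" where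
  "self_adjoint A \<longleftrightarrow>
     subspace (Map.graph A) \<and> closure (dom A) = UNIV \<and> Map.graph A = adjoint_graph A"

definition nonneg_op :: "('a::real_inner \<rightharpoonup> 'a) \<Rightarrow> bool" where
  "nonneg_op A \<longleftrightarrow> (\<forall>x\<in>dom A. app A x \<bullet> x \<ge> 0)"

text \<open>For nonnegative \<open>A\<close> on a nonzero space the infimum is over a nonempty set bounded below.\<close>

definition coercive :: "('a::real_inner \<rightharpoonup> 'a) \<Rightarrow> bool" where
  "coercive A \<longleftrightarrow> (INF x\<in>{x \<in> dom A. x \<noteq> 0}. (app A x \<bullet> x) / (norm x)\<^sup>2) > 0"

text \<open>\<open>A\<^sup>1\<^sup>/\<^sup>2\<close>: a nonnegative self-adjoint \<open>A\<close> on a Hilbert space has exactly one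
  nonnegative self-adjoint square root (the equation below includes equality of domains),
  so the choice operator picks a determined object.\<close>

definition op_sqrt :: "('a::real_inner \<rightharpoonup> 'a) \<Rightarrow> ('a \<rightharpoonup> 'a)" where
  "op_sqrt A = (SOME B. self_adjoint B \<and> nonneg_op B \<and> B \<circ>\<^sub>m B = A)"

text \<open>\<open>half_power A n\<close> is \<open>A\<^sup>n\<^sup>/\<^sup>2\<close> with its natural domain.\<close>

primrec half_power :: "('a::real_inner \<rightharpoonup> 'a) \<Rightarrow> nat \<Rightarrow> ('a \<rightharpoonup> 'a)" where
  "half_power A 0 = Some"
| "half_power A (Suc n) = op_sqrt A \<circ>\<^sub>m half_power A n"

text \<open>Time derivative on \<open>[0,\<infinity>[\<close>, one-sided at \<open>0\<close>.\<close>

definition dt :: "(real \<Rightarrow> 'a::real_normed_vector) \<Rightarrow> real \<Rightarrow> 'a" where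
  "dt u t = vector_derivative u (at t within {0..})"

text \<open>\<open>Ck_dom B k u\<close> says \<open>u \<in> C\<^sup>k([0,\<infinity>[; D(B))\<close> for a closed operator \<open>B\<close>, where \<open>D(B)\<close> carries
  the graph norm: a limit in the graph norm is a limit of both \<open>u\<close> and \<open>B u\<close> in \<open>H\<close>.
  \<open>Ck_dom Some k u\<close> is \<open>u \<in> C\<^sup>k([0,\<infinity>[; H)\<close>.\<close>

primrec Ck_dom :: "('a::real_inner \<rightharpoonup> 'a) \<Rightarrow> nat \<Rightarrow> (real \<Rightarrow> 'a) \<Rightarrow> bool" where
  "Ck_dom B 0 u \<longleftrightarrow>
     (\<forall>t\<ge>0. u t \<in> dom B) \<and> continuous_on {0..} u \<and> continuous_on {0..} (\<lambda>t. app B (u t))"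
| "Ck_dom B (Suc k) u \<longleftrightarrow>
     (\<forall>t\<ge>0. u t \<in> dom B) \<and>
     (\<exists>v. (\<forall>t\<ge>0. (u has_vector_derivative v t) (at t within {0..}) \<and>
                  ((\<lambda>s. app B (u s)) has_vector_derivative app B (v t)) (at t within {0..})) \<and>
          Ck_dom B k v)"

definition hyperbolic_solution ::
  "('a::real_inner \<rightharpoonup> 'a) \<Rightarrow> real \<Rightarrow> real \<Rightarrow> 'a \<Rightarrow> 'a \<Rightarrow> real \<Rightarrow> (real \<Rightarrow> 'a) \<Rightarrow> bool" where
  "hyperbolic_solution A p \<gamma> u\<^sub>0 u\<^sub>1 \<epsilon> u \<longleftrightarrow>
     Ck_dom Some 2 u \<and> Ck_dom (half_power A 1) 1 u \<and> Ck_dom A 0 u \<and>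
     u 0 = u\<^sub>0 \<and> dt u 0 = u\<^sub>1 \<and>
     (\<forall>t\<ge>0. \<epsilon> *\<^sub>R dt (dt u) t + (1 + t) powr (-p) *\<^sub>R dt u t
            + norm (app (half_power A 1) (u t)) powr (2 * \<gamma>) *\<^sub>R app A (u t) = 0)"

definition parabolic_solution ::
  "('a::real_inner \<rightharpoonup> 'a) \<Rightarrow> real \<Rightarrow> real \<Rightarrow> 'a \<Rightarrow> (real \<Rightarrow> 'a) \<Rightarrow> bool" where
  "parabolic_solution A p \<gamma> u\<^sub>0 u \<longleftrightarrow>
     Ck_dom Some 1 u \<and> Ck_dom A 0 u \<and> u 0 = u\<^sub>0 \<and>
     (\<forall>t\<ge>0. dt u t
            + ((1 + t) powr p * norm (app (half_power A 1) (u t)) powr (2 * \<gamma>)) *\<^sub>R app A (u t) = 0)"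

definition corrector_solution ::
  "('a::real_inner \<rightharpoonup> 'a) \<Rightarrow> real \<Rightarrow> real \<Rightarrow> 'a \<Rightarrow> 'a \<Rightarrow> real \<Rightarrow> (real \<Rightarrow> 'a) \<Rightarrow> bool" where
  "corrector_solution A p \<gamma> u\<^sub>0 u\<^sub>1 \<epsilon> \<theta> \<longleftrightarrow>
     Ck_dom Some 2 \<theta> \<and> \<theta> 0 = 0 \<and>
     dt \<theta> 0 = u\<^sub>1 + norm (app (half_power A 1) u\<^sub>0) powr (2 * \<gamma>) *\<^sub>R app A u\<^sub>0 \<and>
     (\<forall>t\<ge>0. \<epsilon> *\<^sub>R dt (dt \<theta>) t + (1 + t) powr (-p) *\<^sub>R dt \<theta> t = 0)"

text \<open>The left-hand side of the error estimates at time \<open>t\<close>, with \<open>\<rho> = v - u\<close> and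
  \<open>r = v - u - \<theta>\<close>, where \<open>v\<close> is the hyperbolic solution.\<close>

definition error_energy ::
  "('a::real_inner \<rightharpoonup> 'a) \<Rightarrow> real \<Rightarrow> real \<Rightarrow> (real \<Rightarrow> 'a) \<Rightarrow> (real \<Rightarrow> 'a) \<Rightarrow> (real \<Rightarrow> 'a) \<Rightarrow> real \<Rightarrow> real"
  where
  "error_energy A p \<gamma> v u \<theta> t =
     (let \<rho> = (\<lambda>s. v s - u s); r = (\<lambda>s. v s - u s - \<theta> s) in
      (norm (\<rho> t))\<^sup>2 + (norm (app (half_power A 1) (\<rho> t)))\<^sup>2 +
      integral {0..t} (\<lambda>s. (norm (dt r s))\<^sup>2 / norm (app (half_power A 1) (u s)) powr (2 * \<gamma>)
                             * (1 / (1 + s) powr p)))"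

end

theory Submission
  imports Defs
begin

text \<open>Write \<open>B = A\<^sup>1\<^sup>/\<^sup>2\<close>, \<open>\<beta>(t) = (1 + t)\<^sup>p\<close>, \<open>c = |Bu|\<^sup>2\<^sup>\<gamma>\<close>, \<open>c\<^sub>\<epsilon> = |Bu\<^sub>\<epsilon>|\<^sup>2\<^sup>\<gamma>\<close>. The quantities
  \<open>c (1 + t) \<beta>\<close> and \<open>c\<^sub>\<epsilon> (1 + t) \<beta> |Au\<^sub>\<epsilon>|\<^sup>2 / |Bu\<^sub>\<epsilon>|\<^sup>2\<close> stay under control, and both solutions have a finite
  dissipation \<open>\<integral> \<beta> c |Bu|\<^sup>2\<close>; for \<open>u\<^sub>\<epsilon>\<close> this is a continuity argument that keeps
  \<open>\<epsilon> |(|Bu\<^sub>\<epsilon>|\<^sup>2)'| / |Bu\<^sub>\<epsilon>|\<^sup>2\<close> below a small multiple of \<open>1 / \<beta>\<close>. The error is measured by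
  \<open>S(t) = \<integral> \<beta> (c + c\<^sub>\<epsilon>) |B\<rho>|\<^sup>2\<close>. Since the nonlinearity is monotone, testing the equation of \<open>\<rho>\<close> with
  \<open>\<beta> \<rho>\<close> bounds \<open>|\<rho>|\<^sup>2 + S\<close> by \<open>\<epsilon>\<^sup>2\<close> and a small multiple of \<open>\<integral> \<beta> |r'|\<^sup>2\<close>: integration by parts leaves
  \<open>\<epsilon> \<integral> \<beta> \<langle>u\<^sub>\<epsilon>', \<rho>'\<rangle>\<close>, in which \<open>\<rho>' = r' + \<theta>'\<close>, \<open>\<integral> \<beta> |u\<^sub>\<epsilon>'|\<^sup>2\<close> is finite and \<open>\<integral> |\<theta>'|\<close> is of order \<open>\<epsilon>\<close>.
  Conversely, testing the equation of \<open>r\<close> with \<open>r' / c\<close> and with \<open>\<beta>\<^sup>2 r'\<close> bounds \<open>|B\<rho>|\<^sup>2\<close>,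
  \<open>\<integral> |r'|\<^sup>2 / (c \<beta>)\<close> and \<open>\<integral> \<beta> |r'|\<^sup>2\<close> by \<open>S + \<epsilon>\<^sup>2\<close>, because \<open>u''\<close> is square integrable with the
  corresponding weights. This closes with the rate \<open>\<epsilon>\<^sup>2\<close> for every \<open>0 \<le> p \<le> 1\<close> and \<open>\<gamma> \<ge> 1\<close>, and the rate
  \<open>\<epsilon>\<close> is a special case.\<close>

subsection \<open>Unbounded self-adjoint operators\<close>

text \<open>The first obstacle is uniformity in time. Both coefficients tend to zero and no
  comparison between them is used, so nonlinear remainders are measured in units of the larger
  coefficient and paid for by S, whose integrand contains the sum of both. The circle between S and
  r' closes because monotonicity yields a fixed fraction of S, whereas r' enters the equation of
  \<rho> only in a product with \<epsilon>: Young's inequality makes its factor as small as the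
  constant in the r' estimate requires, and the other half costs \<epsilon>^2 times a finite
  dissipation. Suprema are absorbed on compact intervals in place of Gronwall's inequality. The
  second obstacle is regularity: u is only C^1, and AU and BU' are only continuous. Identities are
  therefore proved after applying \<open>K n\<close>, with bounds independent of n. The assumption
  on \<open>u0\<close> enters twice: it bounds the initial energy in the estimate of u'', and it
  puts the initial slope of the boundary layer into D(B). The restriction p \<le> 1 enters through
  \<beta>(t) \<le> 1 + t and through the monotone weight (1 + t)^(p - 1).\<close>

lemma closed_subspace_orthogonal:
  fixes S :: "'a::{real_inner, complete_space} set"
  assumes "closed S" and "subspace S" and "x \<notin> S"
  obtains y where "y \<noteq> 0" and "\<And>z. z \<in> S \<Longrightarrow> y \<bullet> z = 0"
proof -
  define d where "d = infdist x S"
  have S0: "0 \<in> S" using assms(2) by (rule subspace_0)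
  have dle: "d \<le> norm (x - s)" if "s \<in> S" for s
    using infdist_le[OF that, of x] by (simp add: d_def dist_norm)
  have d0: "d \<ge> 0" by (simp add: d_def infdist_nonneg)
  have "\<exists>s\<in>S. (norm (x - s))\<^sup>2 < d\<^sup>2 + inverse (real (Suc n))" for n
  proof -
    have "d < sqrt (d\<^sup>2 + inverse (real (Suc n)))"
      using d0 by (intro real_less_rsqrt) auto
    moreover have "d = (INF a\<in>S. dist x a)" using S0 by (auto simp: d_def infdist_def)
    ultimately obtain s where s: "s \<in> S" "dist x s < sqrt (d\<^sup>2 + inverse (real (Suc n)))"
      using cINF_less_iff[of S "dist x"] S0 by (metis bdd_below.I2 empty_iff zero_le_dist)
    then have "(norm (x - s))\<^sup>2 < (sqrt (d\<^sup>2 + inverse (real (Suc n))))\<^sup>2"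
      by (intro power_strict_mono) (auto simp: dist_norm)
    then show ?thesis using s(1) by auto
  qed
  then obtain s where s: "\<And>n. s n \<in> S"
    "\<And>n. (norm (x - s n))\<^sup>2 < d\<^sup>2 + inverse (real (Suc n))" by metis
  have close: "(norm (s m - s n))\<^sup>2 \<le> 2 * (inverse (real (Suc m)) + inverse (real (Suc n)))" for m n
  proof -
    have "(1/2) *\<^sub>R (s m + s n) \<in> S"
      using assms(2) s(1) by (simp add: subspace_add subspace_scale)
    then have "d\<^sup>2 \<le> (norm (x - (1/2) *\<^sub>R (s m + s n)))\<^sup>2"
      using dle d0 by (intro power_mono) auto
    \<comment> \<open>Parallelogram identity: the midpoint lies in S, so two terms of the sequence
      differ by no more than their excess over d^2 allows.\<close>
    moreover have "(norm (s m - s n))\<^sup>2 =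
        2 * (norm (x - s m))\<^sup>2 + 2 * (norm (x - s n))\<^sup>2 - 4 * (norm (x - (1/2) *\<^sub>R (s m + s n)))\<^sup>2"
      by (simp add: power2_norm_eq_inner algebra_simps inner_commute)
    ultimately show ?thesis using s(2)[of m] s(2)[of n] by argo
  qed
  have "Cauchy s"
  proof (rule metric_CauchyI)
    fix e :: real assume "e > 0"
    then obtain N where N: "inverse (real (Suc N)) < e\<^sup>2 / 4"
      using reals_Archimedean[of "e\<^sup>2/4"] by auto
    show "\<exists>M. \<forall>m\<ge>M. \<forall>n\<ge>M. dist (s m) (s n) < e"
    proof (intro exI allI impI)
      fix m n assume "m \<ge> N" "n \<ge> N"
      then have "inverse (real (Suc m)) \<le> inverse (real (Suc N))"
        "inverse (real (Suc n)) \<le> inverse (real (Suc N))" by auto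
      then have "(norm (s m - s n))\<^sup>2 < e\<^sup>2" using close[of m n] N by argo
      then show "dist (s m) (s n) < e"
        using \<open>e > 0\<close> by (simp add: dist_norm power_less_imp_less_base)
    qed
  qed
  then obtain l where l: "s \<longlonglongrightarrow> l" using Cauchy_convergent convergent_def by blast
  have lS: "l \<in> S" using assms(1) l s(1) closed_sequentially by blast
  have "(\<lambda>n. (norm (x - s n))\<^sup>2) \<longlonglongrightarrow> (norm (x - l))\<^sup>2" by (intro tendsto_intros l)
  moreover have "(\<lambda>n. d\<^sup>2 + inverse (real (Suc n))) \<longlonglongrightarrow> d\<^sup>2 + 0"
    by (intro tendsto_intros LIMSEQ_inverse_real_of_nat)
  ultimately have "(norm (x - l))\<^sup>2 \<le> d\<^sup>2 + 0"
    using s(2) by (intro LIMSEQ_le) (auto intro: less_imp_le)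
  then have min: "(norm (x - l))\<^sup>2 \<le> (norm (x - z))\<^sup>2" if "z \<in> S" for z
    using power_mono[OF dle[OF that] d0, of 2] by linarith
  show ?thesis
  proof
    show "x - l \<noteq> 0" using lS assms(3) by auto
    fix z assume z: "z \<in> S"
    show "(x - l) \<bullet> z = 0"
    proof (cases "z = 0")
      case False
      \<comment> \<open>This t minimizes the distance from x to the points l + t z; as l is already
        optimal, the gain must vanish.\<close>
      define t where "t = ((x - l) \<bullet> z) / (z \<bullet> z)"
      have zz: "z \<bullet> z > 0" using False by simp
      have "l + t *\<^sub>R z \<in> S" using lS z assms(2) by (simp add: subspace_add subspace_scale)
      from min[OF this] have "0 \<le> t * t * (z \<bullet> z) - 2 * t * ((x - l) \<bullet> z)"
        by (simp add: power2_norm_eq_inner algebra_simps inner_commute)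
      also have "\<dots> = - (((x - l) \<bullet> z)\<^sup>2 / (z \<bullet> z))"
        using zz by (simp add: t_def field_simps power2_eq_square)
      finally have "((x - l) \<bullet> z)\<^sup>2 / (z \<bullet> z) \<le> 0" by simp
      then show ?thesis using zz by (simp add: divide_le_0_iff)
    qed simp
  qed
qed

lemma app_eq: "A x = Some y \<Longrightarrow> app A x = y"
  by (simp add: app_def)

lemma in_dom_app: "x \<in> dom A \<Longrightarrow> A x = Some (app A x)"
  by (auto simp: app_def)

lemma graph_iff: "(x, y) \<in> Map.graph A \<longleftrightarrow> x \<in> dom A \<and> app A x = y"
  by (auto simp: Map.graph_def app_def)

lemma map_comp_eq_Some: "(B \<circ>\<^sub>m A) x = Some z \<longleftrightarrow> x \<in> dom A \<and> app A x \<in> dom B \<and> app B (app A x) = z"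
  by (auto simp: map_comp_def app_def split: option.splits)

lemma self_adjoint_graph: "self_adjoint A \<Longrightarrow> subspace (Map.graph A)"
  unfolding self_adjoint_def by blast

lemma self_adjoint_add:
  assumes "self_adjoint A" "x \<in> dom A" "y \<in> dom A"
  shows "x + y \<in> dom A" "app A (x + y) = app A x + app A y"
  using subspace_add[of "Map.graph A" "(x, app A x)" "(y, app A y)"] assms(2,3)
    self_adjoint_graph[OF assms(1)]
  by (simp_all add: graph_iff)

lemma self_adjoint_scale:
  assumes "self_adjoint A" "x \<in> dom A"
  shows "r *\<^sub>R x \<in> dom A" "app A (r *\<^sub>R x) = r *\<^sub>R app A x"
  using subspace_scale[of "Map.graph A" "(x, app A x)" r] assms(2)
    self_adjoint_graph[OF assms(1)]
  by (simp_all add: graph_iff)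

lemma self_adjoint_subspace:
  assumes "self_adjoint A"
  shows "subspace (dom A)"
proof -
  have "(0, 0) \<in> Map.graph A"
    using subspace_0[OF self_adjoint_graph[OF assms]] by (simp add: zero_prod_def)
  then show ?thesis
    using self_adjoint_add(1)[OF assms] self_adjoint_scale(1)[OF assms]
    by (simp add: subspace_def graph_iff)
qed

lemma self_adjoint_diff:
  assumes "self_adjoint A" "x \<in> dom A" "y \<in> dom A"
  shows "x - y \<in> dom A" "app A (x - y) = app A x - app A y"
  using subspace_diff[of "Map.graph A" "(x, app A x)" "(y, app A y)"] assms(2,3)
    self_adjoint_graph[OF assms(1)]
  by (simp_all add: graph_iff)

lemma self_adjoint_sym:
  assumes "self_adjoint A" "x \<in> dom A" "y \<in> dom A"
  shows "app A x \<bullet> y = x \<bullet> app A y"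
proof -
  have "(y, app A y) \<in> adjoint_graph A"
    using assms graph_iff[of y "app A y" A] by (auto simp: self_adjoint_def)
  then show ?thesis using assms(2) by (auto simp: adjoint_graph_def)
qed

text \<open>The half of self-adjointness that enlarges domains: a vector is put into the domain by
  exhibiting its image weakly. Closedness and the surjectivity of 1 + l A both rest on it.\<close>

lemma self_adjoint_maximal:
  assumes "self_adjoint A" "\<And>x. x \<in> dom A \<Longrightarrow> app A x \<bullet> y = x \<bullet> z"
  shows "y \<in> dom A" "app A y = z"
proof -
  have "(y, z) \<in> Map.graph A" using assms by (auto simp: self_adjoint_def adjoint_graph_def)
  then show "y \<in> dom A" "app A y = z" by (auto simp: graph_iff)
qed

lemma self_adjoint_closed:
  assumes "self_adjoint A" "\<And>n. x n \<in> dom A" "x \<longlonglongrightarrow> y" "(\<lambda>n. app A (x n)) \<longlonglongrightarrow> z"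
  shows "y \<in> dom A" "app A y = z"
proof -
  have "app A v \<bullet> y = v \<bullet> z" if v: "v \<in> dom A" for v
  proof (rule LIMSEQ_unique)
    show "(\<lambda>n. app A v \<bullet> x n) \<longlonglongrightarrow> app A v \<bullet> y" by (intro tendsto_intros assms)
    have "(\<lambda>n. v \<bullet> app A (x n)) \<longlonglongrightarrow> v \<bullet> z" by (intro tendsto_intros assms)
    then show "(\<lambda>n. app A v \<bullet> x n) \<longlonglongrightarrow> v \<bullet> z"
      using self_adjoint_sym[OF assms(1) v assms(2)] by simp
  qed
  then show "y \<in> dom A" "app A y = z" using self_adjoint_maximal[OF assms(1)] by blast+
qed

section \<open>Resolvents of nonnegative self-adjoint operators\<close>

lemma norm_resolvent_ge:
  assumes "nonneg_op A" "x \<in> dom A" "l \<ge> 0"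
  shows "norm x \<le> norm (x + l *\<^sub>R app A x)" "norm (l *\<^sub>R app A x) \<le> norm (x + l *\<^sub>R app A x)"
proof -
  have *: "(norm (x + l *\<^sub>R app A x))\<^sup>2 = (norm x)\<^sup>2 + (norm (l *\<^sub>R app A x))\<^sup>2 + 2 * (l * (app A x \<bullet> x))"
    by (simp only: power2_norm_eq_inner) (simp add: algebra_simps inner_commute)
  have "l * (app A x \<bullet> x) \<ge> 0" using assms by (auto simp: nonneg_op_def)
  then have "(norm x)\<^sup>2 \<le> (norm (x + l *\<^sub>R app A x))\<^sup>2"
    "(norm (l *\<^sub>R app A x))\<^sup>2 \<le> (norm (x + l *\<^sub>R app A x))\<^sup>2"
    unfolding * by auto
  then show "norm x \<le> norm (x + l *\<^sub>R app A x)" "norm (l *\<^sub>R app A x) \<le> norm (x + l *\<^sub>R app A x)"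
    using power2_le_imp_le norm_ge_zero by blast+
qed

text \<open>The range is a subspace, closed because 1 + l A does not decrease norms. A nonzero y
  orthogonal to it would satisfy A y = - y / l by self-adjointness, against nonnegativity.\<close>

lemma resolvent_surj:
  fixes A :: "'a::{real_inner, complete_space} \<rightharpoonup> 'a"
  assumes sa: "self_adjoint A" and nn: "nonneg_op A" and l: "l > 0"
  shows "\<exists>x\<in>dom A. x + l *\<^sub>R app A x = f"
proof (rule ccontr)
  assume neg: "\<not> ?thesis"
  define S where "S = (\<lambda>x. x + l *\<^sub>R app A x) ` dom A"
  have "subspace S"
    unfolding subspace_def
  proof (intro conjI ballI allI)
    have "0 \<in> dom A" "app A 0 = 0"
      using subspace_0[OF self_adjoint_subspace[OF sa]] self_adjoint_scale[OF sa, of 0 0] by auto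
    then show "0 \<in> S" unfolding S_def by (intro image_eqI[where x = 0]) auto
  next
    fix a b assume "a \<in> S" "b \<in> S"
    then obtain x y where *: "x \<in> dom A" "y \<in> dom A" "a = x + l *\<^sub>R app A x" "b = y + l *\<^sub>R app A y"
      by (auto simp: S_def)
    then show "a + b \<in> S" unfolding S_def
      by (intro image_eqI[where x = "x + y"]) (auto simp: self_adjoint_add[OF sa] algebra_simps)
  next
    fix c a assume "a \<in> S"
    then obtain x where *: "x \<in> dom A" "a = x + l *\<^sub>R app A x" by (auto simp: S_def)
    then show "c *\<^sub>R a \<in> S" unfolding S_def
      by (intro image_eqI[where x = "c *\<^sub>R x"]) (auto simp: self_adjoint_scale[OF sa] algebra_simps)
  qed
  moreover have "closed S"
  proof (rule closed_sequential_limits[THEN iffD2], intro allI impI, elim conjE)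
    fix g h assume g: "\<forall>n. g n \<in> S" and gh: "g \<longlonglongrightarrow> h"
    then have "\<forall>n. \<exists>x. x \<in> dom A \<and> g n = x + l *\<^sub>R app A x" unfolding S_def by blast
    then obtain x where x: "\<And>n. x n \<in> dom A" "\<And>n. g n = x n + l *\<^sub>R app A (x n)" by metis
    have "dist (x m) (x n) \<le> dist (g m) (g n)" for m n
      using norm_resolvent_ge(1)[OF nn self_adjoint_diff(1)[OF sa x(1) x(1)], of l m n] l
      by (simp add: dist_norm x(2) self_adjoint_diff(2)[OF sa x(1) x(1)] algebra_simps)
    then have "Cauchy x"
      using LIMSEQ_imp_Cauchy[OF gh] unfolding Cauchy_def by (meson le_less_trans)
    then obtain y where y: "x \<longlonglongrightarrow> y" using Cauchy_convergent convergent_def by blast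
    have "app A (x n) = (1 / l) *\<^sub>R (g n - x n)" for n using l by (simp add: x(2))
    moreover have "(\<lambda>n. (1 / l) *\<^sub>R (g n - x n)) \<longlonglongrightarrow> (1 / l) *\<^sub>R (h - y)"
      by (intro tendsto_intros gh y)
    ultimately have "(\<lambda>n. app A (x n)) \<longlonglongrightarrow> (1 / l) *\<^sub>R (h - y)" by simp
    from self_adjoint_closed[OF sa x(1) y this] show "h \<in> S"
      unfolding S_def using l by (intro image_eqI[where x = y]) auto
  qed
  moreover have "f \<notin> S" using neg by (auto simp: S_def)
  ultimately obtain y where y: "y \<noteq> 0" "\<And>z. z \<in> S \<Longrightarrow> y \<bullet> z = 0"
    using closed_subspace_orthogonal by blast
  have "app A x \<bullet> y = x \<bullet> (- (1 / l) *\<^sub>R y)" if "x \<in> dom A" for x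
  proof -
    have "y \<bullet> (x + l *\<^sub>R app A x) = 0" using that by (intro y(2)) (auto simp: S_def)
    then show ?thesis using l by (simp add: inner_add_right inner_commute field_simps)
  qed
  from self_adjoint_maximal[OF sa this] have yA: "y \<in> dom A" "app A y = - (1 / l) *\<^sub>R y" by auto
  have "app A y \<bullet> y \<ge> 0" using yA nn unfolding nonneg_op_def by blast
  then have "y \<bullet> y \<le> 0" using l by (simp add: yA(2) field_simps)
  then show False using y(1) inner_gt_zero_iff[of y] by linarith
qed

definition resolvent :: "('a::real_inner \<rightharpoonup> 'a) \<Rightarrow> real \<Rightarrow> 'a \<Rightarrow> 'a" where
  "resolvent A l f = (SOME x. x \<in> dom A \<and> x + l *\<^sub>R app A x = f)"

lemma resolvent:
  fixes A :: "'a::{real_inner, complete_space} \<rightharpoonup> 'a"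
  assumes "self_adjoint A" and "nonneg_op A" and "l > 0"
  shows "resolvent A l f \<in> dom A" "resolvent A l f + l *\<^sub>R app A (resolvent A l f) = f"
proof -
  have "\<exists>x. x \<in> dom A \<and> x + l *\<^sub>R app A x = f" using resolvent_surj[OF assms, of f] by blast
  from someI_ex[OF this]
  show "resolvent A l f \<in> dom A" "resolvent A l f + l *\<^sub>R app A (resolvent A l f) = f"
    unfolding resolvent_def by blast+
qed

lemma resolvent_eqI:
  fixes A :: "'a::{real_inner, complete_space} \<rightharpoonup> 'a"
  assumes "self_adjoint A" and "nonneg_op A" and "l > 0"
    and "x \<in> dom A" "x + l *\<^sub>R app A x = f"
  shows "resolvent A l f = x"
proof -
  let ?y = "resolvent A l f"
  note r = resolvent[OF assms(1-3), of f]
  note d = self_adjoint_diff[OF assms(1) r(1) assms(4)]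
  have "(?y - x) + l *\<^sub>R app A (?y - x) = 0"
    unfolding d(2) using r(2) assms(5) by (simp add: algebra_simps)
  then have "norm (?y - x) \<le> 0"
    using norm_resolvent_ge(1)[OF assms(2) d(1), of l] assms(3) by simp
  then show ?thesis by simp
qed

lemma resolvent_linear:
  fixes A :: "'a::{real_inner, complete_space} \<rightharpoonup> 'a"
  assumes "self_adjoint A" and "nonneg_op A" and "l > 0"
  shows "linear (resolvent A l)"
proof (rule linearI)
  note r = resolvent[OF assms]
  show "resolvent A l (f + g) = resolvent A l f + resolvent A l g" for f g
  proof (rule resolvent_eqI[OF assms])
    show "resolvent A l f + resolvent A l g \<in> dom A"
      using self_adjoint_add(1)[OF assms(1) r(1) r(1)] .
    have "resolvent A l f + resolvent A l g + l *\<^sub>R app A (resolvent A l f + resolvent A l g)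
        = (resolvent A l f + l *\<^sub>R app A (resolvent A l f)) + (resolvent A l g + l *\<^sub>R app A (resolvent A l g))"
      by (simp add: self_adjoint_add(2)[OF assms(1) r(1) r(1)] scaleR_add_right ac_simps)
    then show "resolvent A l f + resolvent A l g + l *\<^sub>R app A (resolvent A l f + resolvent A l g) = f + g"
      unfolding r(2) .
  qed
  show "resolvent A l (c *\<^sub>R f) = c *\<^sub>R resolvent A l f" for c f
  proof (rule resolvent_eqI[OF assms])
    show "c *\<^sub>R resolvent A l f \<in> dom A" using self_adjoint_scale(1)[OF assms(1) r(1)] .
    have "c *\<^sub>R resolvent A l f + l *\<^sub>R app A (c *\<^sub>R resolvent A l f)
        = c *\<^sub>R (resolvent A l f + l *\<^sub>R app A (resolvent A l f))"
      by (simp add: self_adjoint_scale(2)[OF assms(1) r(1)] scaleR_add_right mult.commute)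
    then show "c *\<^sub>R resolvent A l f + l *\<^sub>R app A (c *\<^sub>R resolvent A l f) = c *\<^sub>R f"
      unfolding r(2) .
  qed
qed

lemma resolvent_norm:
  fixes A :: "'a::{real_inner, complete_space} \<rightharpoonup> 'a"
  assumes "self_adjoint A" and "nonneg_op A" and "l > 0"
  shows "norm (resolvent A l f) \<le> norm f" "norm (l *\<^sub>R app A (resolvent A l f)) \<le> norm f"
  using norm_resolvent_ge[OF assms(2) resolvent(1)[OF assms, of f], of l] assms(3)
  unfolding resolvent(2)[OF assms] by simp_all

lemma resolvent_sym:
  fixes A :: "'a::{real_inner, complete_space} \<rightharpoonup> 'a"
  assumes "self_adjoint A" and "nonneg_op A" and "l > 0"
  shows "resolvent A l f \<bullet> g = f \<bullet> resolvent A l g"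
proof -
  let ?x = "resolvent A l f" and ?y = "resolvent A l g"
  note r = resolvent[OF assms]
  have "?x \<bullet> g = ?x \<bullet> (?y + l *\<^sub>R app A ?y)" unfolding r(2) ..
  also have "\<dots> = (?x + l *\<^sub>R app A ?x) \<bullet> ?y"
    using self_adjoint_sym[OF assms(1) r(1)[of f] r(1)[of g]]
    by (simp add: inner_add_left inner_add_right)
  also have "\<dots> = f \<bullet> ?y" unfolding r(2) ..
  finally show ?thesis .
qed

subsection \<open>The square root\<close>

definition sym_contraction :: "('a::real_inner \<Rightarrow> 'a) \<Rightarrow> bool" where
  "sym_contraction f \<longleftrightarrow> linear f \<and> (\<forall>x y. f x \<bullet> y = x \<bullet> f y) \<and> (\<forall>x. norm (f x) \<le> norm x)"

lemma sym_contractionD: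
  assumes "sym_contraction f"
  shows "linear f" "bounded_linear f" "f x \<bullet> y = x \<bullet> f y" "norm (f x) \<le> norm x"
proof -
  show l: "linear f" and "f x \<bullet> y = x \<bullet> f y" and n: "norm (f x) \<le> norm x" for x y
    using assms by (auto simp: sym_contraction_def)
  show "bounded_linear f"
    using l n by (intro bounded_linear_intro[where K = 1]) (auto simp: linear_add linear_scale)
qed

text \<open>If \<open>0 \<le> 1 - V\<close>, then \<open>1 - Z\<close> is its square root, where \<open>Z\<close> is the limit of
  \<open>Z\<^sub>n\<^sub>+\<^sub>1 = (V + Z\<^sub>n\<^sup>2) / 2\<close>. The increments are dominated by those of the scalar iteration
  with \<open>V = 1\<close>.\<close>

primrec sqrt_iter :: "('a::real_vector \<Rightarrow> 'a) \<Rightarrow> nat \<Rightarrow> 'a \<Rightarrow> 'a" where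
  "sqrt_iter V 0 = (\<lambda>x. 0)"
| "sqrt_iter V (Suc n) = (\<lambda>x. (1/2) *\<^sub>R (V x + sqrt_iter V n (sqrt_iter V n x)))"

primrec sqrt_iter1 :: "nat \<Rightarrow> real" where
  "sqrt_iter1 0 = 0"
| "sqrt_iter1 (Suc n) = (1 + (sqrt_iter1 n)\<^sup>2) / 2"

lemma sqrt_iter1_bounds: "0 \<le> sqrt_iter1 n \<and> sqrt_iter1 n \<le> 1 \<and> sqrt_iter1 n \<le> sqrt_iter1 (Suc n)"
proof (induction n)
  case (Suc n)
  then have "(sqrt_iter1 n)\<^sup>2 \<le> 1" "(sqrt_iter1 n)\<^sup>2 \<le> (sqrt_iter1 (Suc n))\<^sup>2"
    by (auto simp: power_le_one intro!: power_mono simp del: sqrt_iter1.simps)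
  then show ?case by auto
qed simp

lemma sqrt_iter_linear: "linear V \<Longrightarrow> linear (sqrt_iter V n)"
proof (induction n)
  case (Suc n)
  show ?case
    by (rule linearI)
      (use Suc in \<open>simp_all add: linear_add linear_scale algebra_simps\<close>)
qed (simp add: linear_iff)

lemma sqrt_iter_norm:
  assumes "sym_contraction V"
  shows "norm (sqrt_iter V n x) \<le> sqrt_iter1 n * norm x"
proof (induction n arbitrary: x)
  case (Suc n)
  have "norm (sqrt_iter V n (sqrt_iter V n x)) \<le> sqrt_iter1 n * (sqrt_iter1 n * norm x)"
    using Suc[of "sqrt_iter V n x"] mult_left_mono[OF Suc[of x], of "sqrt_iter1 n"] sqrt_iter1_bounds[of n]
    by linarith
  moreover have "norm (V x) \<le> norm x" using sym_contractionD[OF assms] by simp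
  ultimately have "norm (V x + sqrt_iter V n (sqrt_iter V n x)) \<le> norm x + sqrt_iter1 n * (sqrt_iter1 n * norm x)"
    using norm_triangle_ineq[of "V x"] by (smt (verit))
  then have "norm ((1/2) *\<^sub>R (V x + sqrt_iter V n (sqrt_iter V n x)))
      \<le> (1/2) * (norm x + sqrt_iter1 n * (sqrt_iter1 n * norm x))"
    by simp
  also have "\<dots> = sqrt_iter1 (Suc n) * norm x" by (simp add: field_simps power2_eq_square)
  finally show ?case by simp
qed simp

lemma sqrt_iter_sym:
  assumes "sym_contraction V"
  shows "sqrt_iter V n x \<bullet> y = x \<bullet> sqrt_iter V n y"
proof (induction n arbitrary: x y)
  case (Suc n)
  show ?case using sym_contractionD(3)[OF assms, of x y]
    by (simp add: inner_add_left inner_add_right Suc)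
qed simp

lemma sqrt_iter_commute:
  assumes "linear W" "\<And>x. W (V x) = V (W x)"
  shows "W (sqrt_iter V n x) = sqrt_iter V n (W x)"
proof (induction n arbitrary: x)
  case 0
  show ?case using linear_0[OF assms(1)] by simp
next
  case (Suc n)
  then show ?case using assms by (simp add: linear_add linear_scale)
qed

text \<open>With Z and Y consecutive iterates, Z^2 - Y^2 = (Z - Y) Z + Y (Z - Y), and each factor is
  bounded by its scalar counterpart; the scalar bounds recombine to z^2 - y^2.\<close>

lemma sqrt_iter_step:
  assumes "sym_contraction V"
  shows "norm (sqrt_iter V (Suc n) x - sqrt_iter V n x) \<le> (sqrt_iter1 (Suc n) - sqrt_iter1 n) * norm x"
proof (induction n arbitrary: x)
  case 0
  have "norm (V x) \<le> norm x" using sym_contractionD[OF assms] by simp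
  then show ?case by simp
next
  case (Suc n)
  define Z Y z y where "Z = sqrt_iter V (Suc n)" and "Y = sqrt_iter V n"
    and "z = sqrt_iter1 (Suc n)" and "y = sqrt_iter1 n"
  have lin: "linear Y" "linear Z"
    unfolding Y_def Z_def by (rule sqrt_iter_linear[OF sym_contractionD(1)[OF assms]])+
  have zy: "0 \<le> z - y" "0 \<le> y" using sqrt_iter1_bounds[of n] by (auto simp: z_def y_def)
  have IH: "norm (Z x - Y x) \<le> (z - y) * norm x" for x
    using Suc by (simp only: Z_def Y_def z_def y_def)
  have nm: "norm (Z x) \<le> z * norm x" "norm (Y x) \<le> y * norm x" for x
    using sqrt_iter_norm[OF assms] by (simp_all only: Z_def Y_def z_def y_def)
  have "norm (Z (Z x) - Y (Z x)) \<le> (z - y) * (z * norm x)"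
    using IH[of "Z x"] mult_left_mono[OF nm(1)[of x] zy(1)] by linarith
  moreover have "norm (Y (Z x - Y x)) \<le> y * ((z - y) * norm x)"
    using nm(2)[of "Z x - Y x"] mult_left_mono[OF IH[of x] zy(2)] by linarith
  moreover have "norm (Z (Z x) - Y (Y x)) = norm ((Z (Z x) - Y (Z x)) + Y (Z x - Y x))"
    by (simp add: linear_diff[OF lin(1)])
  ultimately have "norm (Z (Z x) - Y (Y x)) \<le> (z - y) * (z * norm x) + y * ((z - y) * norm x)"
    using norm_triangle_ineq[of "Z (Z x) - Y (Z x)" "Y (Z x - Y x)"] by linarith
  also have "\<dots> = (z\<^sup>2 - y\<^sup>2) * norm x" by (simp add: algebra_simps power2_eq_square)
  finally have 1: "norm (Z (Z x) - Y (Y x)) \<le> (z\<^sup>2 - y\<^sup>2) * norm x" .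
  have e1: "sqrt_iter V (Suc (Suc n)) x - sqrt_iter V (Suc n) x = (1/2) *\<^sub>R (Z (Z x) - Y (Y x))"
    unfolding Z_def Y_def sqrt_iter.simps(2)[of V "Suc n"] by (simp add: algebra_simps)
  have e2: "sqrt_iter1 (Suc (Suc n)) - sqrt_iter1 (Suc n) = (z\<^sup>2 - y\<^sup>2) / 2"
    unfolding z_def y_def sqrt_iter1.simps(2)[of "Suc n"] by (simp add: field_simps)
  show ?case unfolding e1 e2 using 1 by simp
qed

lemma sqrt_iter_increment:
  assumes "sym_contraction V" "m \<le> n"
  shows "norm (sqrt_iter V n x - sqrt_iter V m x) \<le> (sqrt_iter1 n - sqrt_iter1 m) * norm x"
  using assms(2)
proof (induction n rule: dec_induct)
  case (step n)
  have "norm (sqrt_iter V (Suc n) x - sqrt_iter V m x)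
      \<le> norm (sqrt_iter V (Suc n) x - sqrt_iter V n x) + norm (sqrt_iter V n x - sqrt_iter V m x)"
    using norm_triangle_ineq[of "sqrt_iter V (Suc n) x - sqrt_iter V n x" "sqrt_iter V n x - sqrt_iter V m x"]
    by simp
  then show ?case using sqrt_iter_step[OF assms(1), of n x] step(3) by (simp only: left_diff_distrib)
qed simp

lemma sqrt_iter_Cauchy:
  assumes "sym_contraction V"
  shows "Cauchy (\<lambda>n. sqrt_iter V n x)"
proof -
  have "incseq sqrt_iter1" using sqrt_iter1_bounds by (intro incseq_SucI) blast
  then obtain L where "sqrt_iter1 \<longlonglongrightarrow> L"
    using incseq_convergent[of sqrt_iter1 1] sqrt_iter1_bounds by metis
  then have "(\<lambda>n. sqrt_iter1 n * norm x) \<longlonglongrightarrow> L * norm x" by (intro tendsto_intros)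
  then have c: "Cauchy (\<lambda>n. sqrt_iter1 n * norm x)" by (rule LIMSEQ_imp_Cauchy)
  have "dist (sqrt_iter V m x) (sqrt_iter V n x) \<le> dist (sqrt_iter1 m * norm x) (sqrt_iter1 n * norm x)" for m n
  proof (cases "m \<le> n")
    case True
    then show ?thesis using sqrt_iter_increment[OF assms True, of x]
      by (simp add: dist_norm norm_minus_commute algebra_simps)
  next
    case False
    then show ?thesis using sqrt_iter_increment[OF assms, of n m x]
      by (simp add: dist_norm algebra_simps)
  qed
  then show ?thesis using c unfolding Cauchy_def by (meson le_less_trans)
qed

text \<open>In the limit the recursion becomes 2 Z = V + Z^2, that is (1 - Z)^2 = 1 - V. The
  iterates are polynomials in V, so whatever commutes with V commutes with Z; this third property
  later makes roots of different operators commute.\<close>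

lemma contraction_sqrt:
  fixes V :: "'a::{real_inner, complete_space} \<Rightarrow> 'a"
  assumes V: "sym_contraction V"
  obtains Z where "sym_contraction Z" "\<And>x. (x - Z x) - Z (x - Z x) = x - V x"
    "\<And>W x. bounded_linear W \<Longrightarrow> (\<And>y. W (V y) = V (W y)) \<Longrightarrow> W (Z x) = Z (W x)"
proof -
  have "\<exists>l. (\<lambda>n. sqrt_iter V n x) \<longlonglongrightarrow> l" for x
    using sqrt_iter_Cauchy[OF V] Cauchy_convergent convergent_def by blast
  then obtain Z where Z: "\<And>x. (\<lambda>n. sqrt_iter V n x) \<longlonglongrightarrow> Z x" by metis
  note lin = sqrt_iter_linear[OF sym_contractionD(1)[OF V]]
  have Zlin: "linear Z"
  proof (rule linearI)
    fix x y
    have "(\<lambda>n. sqrt_iter V n x + sqrt_iter V n y) \<longlonglongrightarrow> Z x + Z y" by (intro tendsto_intros Z)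
    then show "Z (x + y) = Z x + Z y"
      using LIMSEQ_unique[OF Z[of "x + y"]] by (simp add: linear_add[OF lin])
  next
    fix c x
    have "(\<lambda>n. c *\<^sub>R sqrt_iter V n x) \<longlonglongrightarrow> c *\<^sub>R Z x" by (intro tendsto_intros Z)
    then show "Z (c *\<^sub>R x) = c *\<^sub>R Z x"
      using LIMSEQ_unique[OF Z[of "c *\<^sub>R x"]] by (simp add: linear_scale[OF lin])
  qed
  have itn: "norm (sqrt_iter V n x) \<le> norm x" for n x
    using sqrt_iter_norm[OF V, of n x] mult_right_mono[of "sqrt_iter1 n" 1 "norm x"] sqrt_iter1_bounds[of n]
    by simp
  have Zn: "norm (Z x) \<le> norm x" for x
    using LIMSEQ_le_const2[OF tendsto_norm[OF Z[of x]], of "norm x"] itn by blast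
  have Zsym: "Z x \<bullet> y = x \<bullet> Z y" for x y
  proof (rule LIMSEQ_unique)
    show "(\<lambda>n. sqrt_iter V n x \<bullet> y) \<longlonglongrightarrow> Z x \<bullet> y" by (intro tendsto_intros Z)
    show "(\<lambda>n. sqrt_iter V n x \<bullet> y) \<longlonglongrightarrow> x \<bullet> Z y"
      unfolding sqrt_iter_sym[OF V] by (intro tendsto_intros Z)
  qed
  have ZZ: "(\<lambda>n. sqrt_iter V n (sqrt_iter V n x)) \<longlonglongrightarrow> Z (Z x)" for x
  proof -
    have "(\<lambda>n. sqrt_iter V n (sqrt_iter V n x - Z x)) \<longlonglongrightarrow> 0"
    proof (rule Lim_null_comparison)
      show "\<forall>\<^sub>F n in sequentially. norm (sqrt_iter V n (sqrt_iter V n x - Z x)) \<le> norm (sqrt_iter V n x - Z x)"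
        using itn by simp
      show "(\<lambda>n. norm (sqrt_iter V n x - Z x)) \<longlonglongrightarrow> 0"
        using tendsto_norm[OF tendsto_diff[OF Z[of x] tendsto_const[of "Z x"]]] by simp
    qed
    from tendsto_add[OF this Z[of "Z x"]] show ?thesis by (simp add: linear_diff[OF lin])
  qed
  have fixp: "Z x = (1/2) *\<^sub>R (V x + Z (Z x))" for x
  proof (rule LIMSEQ_unique)
    show "(\<lambda>n. sqrt_iter V (Suc n) x) \<longlonglongrightarrow> Z x" using LIMSEQ_Suc[OF Z] .
    show "(\<lambda>n. sqrt_iter V (Suc n) x) \<longlonglongrightarrow> (1/2) *\<^sub>R (V x + Z (Z x))"
      by (simp only: sqrt_iter.simps) (intro tendsto_intros ZZ)
  qed
  show ?thesis
  proof
    show "sym_contraction Z" using Zlin Zn Zsym by (auto simp: sym_contraction_def)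
    show "(x - Z x) - Z (x - Z x) = x - V x" for x
    proof -
      have "2 *\<^sub>R Z x = V x + Z (Z x)" by (subst fixp) simp
      then show ?thesis by (simp add: linear_diff[OF Zlin] algebra_simps scaleR_2)
    qed
    fix W x assume W: "bounded_linear (W :: 'a \<Rightarrow> 'a)" "\<And>y. W (V y) = V (W y)"
    have "(\<lambda>n. W (sqrt_iter V n x)) \<longlonglongrightarrow> W (Z x)" by (rule bounded_linear.tendsto[OF W(1) Z])
    moreover have "W (sqrt_iter V n x) = sqrt_iter V n (W x)" for n
      using sqrt_iter_commute[of W V, OF bounded_linear.linear[OF W(1)] W(2)] .
    ultimately show "W (Z x) = Z (W x)" using LIMSEQ_unique[OF _ Z[of "W x"]] by simp
  qed
qed

lemma resolvent_sym_contraction: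
  fixes A :: "'a::{real_inner, complete_space} \<rightharpoonup> 'a"
  assumes "self_adjoint A" and "nonneg_op A" and "l > 0"
  shows "sym_contraction (resolvent A l)"
  using resolvent_linear[OF assms] resolvent_sym[OF assms] resolvent_norm(1)[OF assms]
  by (simp add: sym_contraction_def)

text \<open>Only bounded roots are constructed. With R = (1 + A)^-1 and Q = A R = 1 - R, let S and T
  be the roots of R and Q; then B = T S^-1, with graph consisting of the pairs (S z, T z). S and T
  commute and S^2 + T^2 = 1, which inverts z \<mapsto> (S z, T z) algebraically. A further root Y of
  T serves the nonnegativity of B.\<close>

lemma self_adjoint_sqrt_exists:
  fixes A :: "'a::{real_inner, complete_space} \<rightharpoonup> 'a"
  assumes sa: "self_adjoint A" and nn: "nonneg_op A"
  shows "\<exists>B. self_adjoint B \<and> nonneg_op B \<and> B \<circ>\<^sub>m B = A"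
proof -
  define R where "R = resolvent A 1"
  note Rr = resolvent[OF sa nn zero_less_one, folded R_def, simplified]
  have R: "sym_contraction R" unfolding R_def by (rule resolvent_sym_contraction[OF sa nn]) simp
  note Rl = sym_contractionD(1)[OF R]
  define Q where "Q = (\<lambda>x. x - R x)"
  have QA: "Q x = app A (R x)" for x unfolding Q_def using Rr(2)[of x] by (simp add: algebra_simps)
  have Qn: "norm (Q x) \<le> norm x" for x
    using resolvent_norm(2)[OF sa nn zero_less_one, of x] unfolding QA R_def by simp
  have Q: "sym_contraction Q"
    unfolding sym_contraction_def
  proof (intro conjI allI Qn)
    show "linear Q" unfolding Q_def by (intro linear_compose_sub Rl) (simp add: linear_iff)
    show "Q x \<bullet> y = x \<bullet> Q y" for x y
      using sym_contractionD(3)[OF R] by (simp add: Q_def inner_diff_left inner_diff_right)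
  qed
  \<comment> \<open>The construction applied to V gives a root of 1 - V, so the roles are exchanged:
    \<open>Q\<close> yields S with S^2 = R, \<open>R\<close> yields T with T^2 = Q, and
    \<open>Z2\<close> yields Y with Y^2 = T.\<close>
  obtain Z1 where Z1: "sym_contraction Z1" "\<And>x. (x - Z1 x) - Z1 (x - Z1 x) = x - Q x"
    "\<And>W x. bounded_linear W \<Longrightarrow> (\<And>y. W (Q y) = Q (W y)) \<Longrightarrow> W (Z1 x) = Z1 (W x)"
    using contraction_sqrt[OF Q] by blast
  obtain Z2 where Z2: "sym_contraction Z2" "\<And>x. (x - Z2 x) - Z2 (x - Z2 x) = x - R x"
    "\<And>W x. bounded_linear W \<Longrightarrow> (\<And>y. W (R y) = R (W y)) \<Longrightarrow> W (Z2 x) = Z2 (W x)"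
    using contraction_sqrt[OF R] by blast
  obtain Z3 where Z3: "sym_contraction Z3" "\<And>x. (x - Z3 x) - Z3 (x - Z3 x) = x - Z2 x"
    "\<And>W x. bounded_linear W \<Longrightarrow> (\<And>y. W (Z2 y) = Z2 (W y)) \<Longrightarrow> W (Z3 x) = Z3 (W x)"
    using contraction_sqrt[OF Z2(1)] by blast
  have RQ: "R (Q x) = Q (R x)" for x by (simp add: Q_def linear_diff[OF Rl])
  have RZ1: "R (Z1 x) = Z1 (R x)" for x by (rule Z1(3)[OF sym_contractionD(2)[OF R] RQ])
  have Z12: "Z1 (Z2 x) = Z2 (Z1 x)" for x
    by (rule Z2(3)[OF sym_contractionD(2)[OF Z1(1)] RZ1[symmetric]])
  have Z13: "Z1 (Z3 x) = Z3 (Z1 x)" for x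
    by (rule Z3(3)[OF sym_contractionD(2)[OF Z1(1)] Z12])
  define S T Y where "S = (\<lambda>x. x - Z1 x)" and "T = (\<lambda>x. x - Z2 x)" and "Y = (\<lambda>x. x - Z3 x)"
  note Zl = sym_contractionD(1)[OF Z1(1)] sym_contractionD(1)[OF Z2(1)] sym_contractionD(1)[OF Z3(1)]
  have lS: "linear S" and lT: "linear T" and lY: "linear Y" unfolding S_def T_def Y_def
    by (intro linear_compose_sub Zl; simp add: linear_iff)+
  have symS: "S x \<bullet> y = x \<bullet> S y" and symT: "T x \<bullet> y = x \<bullet> T y" and symY: "Y x \<bullet> y = x \<bullet> Y y" for x y
    using sym_contractionD(3)[OF Z1(1), of x y] sym_contractionD(3)[OF Z2(1), of x y]
      sym_contractionD(3)[OF Z3(1), of x y]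
    by (simp_all add: S_def T_def Y_def inner_diff_left inner_diff_right)
  have SS: "S (S x) = R x" for x using Z1(2)[of x] by (simp add: S_def Q_def)
  have TT: "T (T x) = Q x" for x using Z2(2)[of x] by (simp add: T_def Q_def)
  have YY: "Y (Y x) = T x" for x using Z3(2)[of x] by (simp add: Y_def T_def)
  have ST: "S (T x) = T (S x)" for x
    by (simp add: S_def T_def linear_diff[OF Zl(1)] linear_diff[OF Zl(2)] Z12)
  have SY: "S (Y x) = Y (S x)" for x
    by (simp add: S_def Y_def linear_diff[OF Zl(1)] linear_diff[OF Zl(3)] Z13)
  have sum: "S (S x) + T (T x) = x" for x by (simp add: SS TT Q_def)
  have A0: "app A 0 = 0"
    using self_adjoint_scale(2)[OF sa Rr(1), of 0 0] by simp
  have injS: "x = y" if "S x = S y" for x y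
  proof -
    have "R (x - y) = 0"
      using that SS[of x] SS[of y] by (simp add: linear_diff[OF Rl])
    then show ?thesis using Rr(2)[of "x - y"] A0 by simp
  qed
  define B where "B = (\<lambda>x. if \<exists>z. x = S z then Some (T (THE z. x = S z)) else None)"
  have B: "B x = Some y \<longleftrightarrow> (\<exists>z. x = S z \<and> y = T z)" for x y
  proof -
    have "(THE z'. S z = S z') = z" for z using injS by (intro the_equality) auto
    then show ?thesis by (auto simp: B_def)
  qed
  have domB: "x \<in> dom B \<longleftrightarrow> (\<exists>z. x = S z)" for x using B by (auto simp: dom_def)
  have BS: "app B (S z) = T z" for z by (rule app_eq) (use B in blast)
  have gB: "Map.graph B = (\<lambda>z. (S z, T z)) ` UNIV"
    using B by (auto simp: Map.graph_def)
  have saB: "self_adjoint B"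
    unfolding self_adjoint_def
  proof (intro conjI)
    have "linear (\<lambda>z. (S z, T z))" using lS lT by (simp add: linear_iff)
    then show "subspace (Map.graph B)" unfolding gB by (rule linear_subspace_image) simp
    have "dom A \<subseteq> dom B"
    proof
      fix x assume "x \<in> dom A"
      then have "x = R (x + app A x)"
        unfolding R_def using resolvent_eqI[OF sa nn zero_less_one, of x] by simp
      then have "x = S (S (x + app A x))" by (simp only: SS)
      then show "x \<in> dom B" using domB by blast
    qed
    then show "closure (dom B) = UNIV"
      using sa closure_mono[of "dom A" "dom B"] unfolding self_adjoint_def by blast
    show "Map.graph B = adjoint_graph B"
    proof (intro set_eqI iffI)
      fix g assume "g \<in> Map.graph B"
      then obtain z where g: "g = (S z, T z)" unfolding gB by blast
      have "app B x \<bullet> S z = x \<bullet> T z" if xB: "x \<in> dom B" for x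
      proof -
        obtain y where "x = S y" using iffD1[OF domB xB] ..
        then show ?thesis by (metis BS symS symT ST)
      qed
      then show "g \<in> adjoint_graph B" unfolding g adjoint_graph_def by blast
    next
      fix g assume "g \<in> adjoint_graph B"
      then obtain y w where g: "g = (y, w)" and "\<And>x. x \<in> dom B \<Longrightarrow> app B x \<bullet> y = x \<bullet> w"
        unfolding adjoint_graph_def by blast
      then have "T z \<bullet> y = S z \<bullet> w" for z using domB BS by metis
      then have "z \<bullet> (T y - S w) = 0" for z unfolding inner_diff_right by (metis symS symT diff_self)
      from this[of "T y - S w"] have TS: "T y = S w" by simp
      \<comment> \<open>On pairs with T y = S w, the vector S y + T w is the preimage, by S^2 + T^2
        = 1 and commutation.\<close>
      have "S (S y + T w) = y" "T (S y + T w) = w"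
        using sum[of y] sum[of w] TS ST[of w] ST[of y] unfolding linear_add[OF lS] linear_add[OF lT]
        by (metis add.commute)+
      then have "(y, w) = (\<lambda>z. (S z, T z)) (S y + T w)" by simp
      then show "g \<in> Map.graph B" unfolding gB g by blast
    qed
  qed
  moreover have "nonneg_op B"
    unfolding nonneg_op_def
  proof
    fix x assume xB: "x \<in> dom B"
    obtain z where x: "x = S z" using iffD1[OF domB xB] ..
    \<comment> \<open>One factor Y is moved across and commuted with S; then S = 1 - Z1 is
      nonnegative because Z1 is a contraction.\<close>
    have "app B x \<bullet> x = Y (Y z) \<bullet> S z" by (simp add: x BS YY)
    also have "\<dots> = Y z \<bullet> S (Y z)" by (simp add: symY SY)
    also have "\<dots> = (norm (Y z))\<^sup>2 - Y z \<bullet> Z1 (Y z)"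
      by (simp add: S_def inner_diff_right power2_norm_eq_inner)
    also have "\<dots> \<ge> 0"
    proof -
      have "Y z \<bullet> Z1 (Y z) \<le> norm (Y z) * norm (Z1 (Y z))" by (rule norm_cauchy_schwarz)
      also have "\<dots> \<le> norm (Y z) * norm (Y z)"
        using sym_contractionD(4)[OF Z1(1)] by (intro mult_left_mono) auto
      finally show ?thesis by (simp add: power2_eq_square)
    qed
    finally show "app B x \<bullet> x \<ge> 0" .
  qed
  moreover have "B \<circ>\<^sub>m B = A"
  proof -
    have "(B \<circ>\<^sub>m B) x = Some w \<longleftrightarrow> A x = Some w" for x w
    proof
      assume "(B \<circ>\<^sub>m B) x = Some w"
      then obtain z y where zy: "x = S z" "T z = S y" "w = T y"
        unfolding map_comp_eq_Some using domB BS by metis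
      define f where "f = S z + T y"
      have "z = S f"
        using sum[of z] zy(2) ST[of y] by (simp add: f_def linear_add[OF lS])
      then have x: "x = R f" using zy(1) SS by simp
      have "S (T f) = S y" using ST[of f] \<open>z = S f\<close> zy(2) by simp
      then have "T f = y" by (rule injS)
      then have "w = app A x" using TT[of f] QA[of f] zy(3) x by simp
      then show "A x = Some w" using in_dom_app[of x A] Rr(1)[of f] x by simp
    next
      assume "A x = Some w"
      then have xA: "x \<in> dom A" "app A x = w" by (auto simp: app_eq)
      define f where "f = x + w"
      have x: "x = R f"
        unfolding R_def f_def using resolvent_eqI[OF sa nn zero_less_one xA(1)] xA(2) by simp
      then have x': "x = S (S f)" by (simp add: SS)
      have w: "w = T (T f)" using TT[of f] QA[of f] x xA(2) by simp
      have "app B x = S (T f)" by (simp add: x' BS ST)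
      then show "(B \<circ>\<^sub>m B) x = Some w"
        unfolding map_comp_eq_Some using domB x' w BS by metis
    qed
    then show ?thesis by (intro ext) (metis not_Some_eq)
  qed
  ultimately show ?thesis by blast
qed

lemma op_sqrt:
  fixes A :: "'a::{real_inner, complete_space} \<rightharpoonup> 'a"
  assumes "self_adjoint A" and "nonneg_op A"
  shows "self_adjoint (op_sqrt A)" "nonneg_op (op_sqrt A)" "op_sqrt A \<circ>\<^sub>m op_sqrt A = A"
  using someI_ex[OF self_adjoint_sqrt_exists[OF assms]] unfolding op_sqrt_def by blast+

subsection \<open>Regularization by squared resolvents\<close>

text \<open>\<open>B\<close> stands for \<open>A\<^sup>1\<^sup>/\<^sup>2\<close> on its domain \<open>D\<close>, and \<open>K\<^sub>n\<close> for \<open>(1 + A / (n + 1))\<^sup>-\<^sup>2\<close>: a solution is only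
  continuous with values in \<open>D(A)\<close>, and energies involving \<open>B\<close> up to the fourth power are
  differentiated after applying \<open>K\<^sub>n\<close>.\<close>

locale regularized_operator =
  fixes D :: "'a::real_inner set" and B :: "'a \<Rightarrow> 'a" and K :: "nat \<Rightarrow> 'a \<Rightarrow> 'a"
  assumes subspace_D: "subspace D"
    and B_add: "\<And>x y. x \<in> D \<Longrightarrow> y \<in> D \<Longrightarrow> B (x + y) = B x + B y"
    and B_scale: "\<And>r x. x \<in> D \<Longrightarrow> B (r *\<^sub>R x) = r *\<^sub>R B x"
    and B_sym: "\<And>x y. x \<in> D \<Longrightarrow> y \<in> D \<Longrightarrow> B x \<bullet> y = x \<bullet> B y"
    and K_bl: "\<And>n. bounded_linear (K n)"
    and K_norm: "\<And>n x. norm (K n x) \<le> norm x"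
    and K_lim: "\<And>x. (\<lambda>n. K n x) \<longlonglongrightarrow> x"
    and K_inj: "\<And>n x. K n x = 0 \<Longrightarrow> x = 0"
    and K_commute: "\<And>n x. x \<in> D \<Longrightarrow> B (K n x) = K n (B x)"
    and K_D: "\<And>n x. K n x \<in> D" "\<And>n x. B (K n x) \<in> D" "\<And>n x. B (B (K n x)) \<in> D"
      "\<And>n x. B (B (B (K n x))) \<in> D"
    and BK_bl: "\<And>n. bounded_linear (\<lambda>x. B (K n x))"
      "\<And>n. bounded_linear (\<lambda>x. B (B (K n x)))"
      "\<And>n. bounded_linear (\<lambda>x. B (B (B (K n x))))"
      "\<And>n. bounded_linear (\<lambda>x. B (B (B (B (K n x)))))"

context
  fixes A :: "'a::{real_inner, complete_space} \<rightharpoonup> 'a" and B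
  assumes sa: "self_adjoint A" and nn: "nonneg_op A"
  defines "B \<equiv> op_sqrt A"
begin

lemma dom_sqrt: "x \<in> dom A \<longleftrightarrow> x \<in> dom B \<and> app B x \<in> dom B"
proof -
  have "x \<in> dom A \<longleftrightarrow> (\<exists>w. (B \<circ>\<^sub>m B) x = Some w)"
    unfolding B_def op_sqrt(3)[OF sa nn] by (auto simp: dom_def)
  then show ?thesis unfolding map_comp_eq_Some by blast
qed

lemma app_sqrt: "x \<in> dom A \<Longrightarrow> app B (app B x) = app A x"
  using map_comp_eq_Some[of B B x "app A x"] in_dom_app[of x A] op_sqrt(3)[OF sa nn]
  by (simp add: B_def)

lemmas saB = op_sqrt(1)[OF sa nn, folded B_def]

text \<open>The domain is the point: for y the resolvent of x, A y = (x - y) / l lies in D(B)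
  because x does, hence B y lies in D(A). Uniqueness of the resolvent then identifies B y.\<close>

lemma resolvent_commute_sqrt:
  assumes l: "l > 0" and x: "x \<in> dom B"
  shows "app B (resolvent A l x) = resolvent A l (app B x)"
proof (rule sym, rule resolvent_eqI[OF sa nn l])
  let ?y = "resolvent A l x"
  note r = resolvent[OF sa nn l, of x]
  have y: "?y \<in> dom B" "app B ?y \<in> dom B" using r(1) dom_sqrt by blast+
  have Ay: "app A ?y = (1/l) *\<^sub>R (x - ?y)" using r(2) l
    by (metis add_diff_cancel_left' divide_self_if less_irrefl scaleR_one scaleR_scaleR times_divide_eq_left mult_1)
  have AyB: "app A ?y \<in> dom B"
    unfolding Ay by (intro self_adjoint_scale(1)[OF saB] self_adjoint_diff(1)[OF saB] x y)
  then show 1: "app B ?y \<in> dom A" unfolding dom_sqrt[of "app B ?y"] using y app_sqrt[OF r(1)] by simp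
  have "app A (app B ?y) = app B (app A ?y)" using app_sqrt[OF 1] app_sqrt[OF r(1)] by simp
  then have "app B ?y + l *\<^sub>R app A (app B ?y) = app B (?y + l *\<^sub>R app A ?y)"
    using self_adjoint_add(2)[OF saB y(1) self_adjoint_scale(1)[OF saB AyB]] self_adjoint_scale(2)[OF saB AyB]
    by simp
  then show "app B ?y + l *\<^sub>R app A (app B ?y) = app B x" unfolding r(2) .
qed

lemma resolvent_commute:
  assumes l: "l > 0" and x: "x \<in> dom A"
  shows "app A (resolvent A l x) = resolvent A l (app A x)"
proof -
  have "x \<in> dom B" "app B x \<in> dom B" using x dom_sqrt by blast+
  then have "app B (app B (resolvent A l x)) = resolvent A l (app B (app B x))"
    by (simp add: resolvent_commute_sqrt[OF l])
  then show ?thesis using app_sqrt[OF x] app_sqrt[OF resolvent(1)[OF sa nn l]] by simp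
qed

lemma bounded_linear_A_resolvent:
  assumes l: "l > 0"
  shows "bounded_linear (\<lambda>x. app A (resolvent A l x))"
proof -
  have eq: "app A (resolvent A l x) = (1/l) *\<^sub>R (x - resolvent A l x)" for x
    using resolvent(2)[OF sa nn l, of x] l
    by (metis add_diff_cancel_left' divide_self_if less_irrefl scaleR_one scaleR_scaleR times_divide_eq_left mult_1)
  have "bounded_linear (resolvent A l)"
    by (rule sym_contractionD(2)[OF resolvent_sym_contraction[OF sa nn l]])
  then have "bounded_linear (\<lambda>x. (1/l) *\<^sub>R (x - resolvent A l x))"
    by (intro bounded_linear_scaleR_right bounded_linear_sub bounded_linear_ident
        bounded_linear_compose[OF bounded_linear_scaleR_right])
  then show ?thesis by (simp only: eq)
qed

text \<open>For the resolvent J, |B J x|^2 = <A J x, J x>, and the two factors are bounded by |x| /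
  l and |x|.\<close>

lemma bounded_linear_sqrt_resolvent:
  assumes l: "l > 0"
  shows "bounded_linear (\<lambda>x. app B (resolvent A l x))"
proof -
  let ?J = "resolvent A l"
  note r = resolvent[OF sa nn l]
  have J: "?J x \<in> dom B" "app B (?J x) \<in> dom B" for x using r(1)[of x] dom_sqrt by blast+
  note lin = resolvent_linear[OF sa nn l]
  have bd: "norm (app B (?J x)) \<le> norm x * sqrt (1/l)" for x
  proof -
    have "(norm (app B (?J x)))\<^sup>2 = app A (?J x) \<bullet> ?J x"
      using self_adjoint_sym[OF saB J(2)[of x] J(1)[of x]] app_sqrt[OF r(1)[of x]]
      by (simp add: power2_norm_eq_inner)
    also have "\<dots> \<le> norm (app A (?J x)) * norm (?J x)" by (rule norm_cauchy_schwarz)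
    also have "\<dots> \<le> (norm x / l) * norm x"
      using resolvent_norm[OF sa nn l, of x] l by (intro mult_mono) (auto simp: field_simps)
    also have "\<dots> = (norm x * sqrt (1/l))\<^sup>2"
      using l by (simp add: power_mult_distrib power2_eq_square[of "norm x"])
    finally show ?thesis by (rule power2_le_imp_le) (use l in simp)
  qed
  show ?thesis
  proof (rule bounded_linear_intro[OF _ _ bd])
    show "app B (?J (x + y)) = app B (?J x) + app B (?J y)" for x y
      by (simp add: linear_add[OF lin] self_adjoint_add(2)[OF saB J(1) J(1)])
    show "app B (?J (c *\<^sub>R x)) = c *\<^sub>R app B (?J x)" for c x
      by (simp add: linear_scale[OF lin] self_adjoint_scale(2)[OF saB J(1)])
  qed
qed

text \<open>On D(A) the error is at most |A y| / (n + 1); density of D(A) and the contraction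
  property extend the convergence to all of H.\<close>

lemma resolvent_tendsto:
  "((\<lambda>n. resolvent A (1 / real (Suc n)) x) \<longlonglongrightarrow> x)"
proof -
  let ?J = "\<lambda>n. resolvent A (1 / real (Suc n))"
  have l: "1 / real (Suc n) > 0" for n by simp
  have close: "norm (?J n y - y) \<le> norm (app A y) / real (Suc n)" if "y \<in> dom A" for n y
  proof -
    have "norm (?J n y - y) = norm ((1 / real (Suc n)) *\<^sub>R app A (?J n y))"
      using resolvent(2)[OF sa nn l, of n y] norm_minus_commute[of y "?J n y"]
      by (metis add_diff_cancel_left')
    also have "\<dots> \<le> norm (app A y) / real (Suc n)"
      using resolvent_norm(1)[OF sa nn l, of n "app A y"]
      by (simp add: resolvent_commute[OF l that] divide_right_mono del: of_nat_Suc)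
    finally show ?thesis .
  qed
  show ?thesis
  proof (rule metric_LIMSEQ_I)
    fix e :: real assume e: "e > 0"
    have "x \<in> closure (dom A)" using sa by (simp add: self_adjoint_def)
    then obtain y where y: "y \<in> dom A" "dist y x < e / 3" using e closure_approachable
      by (metis divide_pos_pos zero_less_numeral)
    obtain N where N: "norm (app A y) / (e/3) < real N" using reals_Archimedean2 by blast
    show "\<exists>N. \<forall>n\<ge>N. dist (?J n x) x < e"
    proof (intro exI allI impI)
      fix n assume n: "n \<ge> N"
      have "norm (app A y) / (e/3) < real (Suc n)" using n N by linarith
      then have "norm (app A y) / real (Suc n) < e / 3" using e by (simp add: field_simps)
      then have "norm (?J n y - y) < e / 3" using close[OF y(1), of n] by linarith
      moreover have "norm (?J n (x - y)) < e / 3"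
        using resolvent_norm(1)[OF sa nn l, of n "x - y"] y(2)
        by (simp add: dist_norm norm_minus_commute)
      moreover have "norm (?J n x - x) = norm (?J n (x - y) + (?J n y - y) + (y - x))"
        by (simp add: linear_diff[OF resolvent_linear[OF sa nn l]] del: of_nat_Suc)
      ultimately show "dist (?J n x) x < e"
        using y(2) norm_triangle_ineq[of "?J n (x - y) + (?J n y - y)" "y - x"]
          norm_triangle_ineq[of "?J n (x - y)" "?J n y - y"]
        unfolding dist_norm by linarith
    qed
  qed
qed

text \<open>One resolvent J absorbs two powers of B. As the fourth power has to be bounded after
  regularization, the resolvent is squared: B^4 J J = (A J) (A J).\<close>

lemma regularized_sqrt:
  "regularized_operator (dom B) (app B)
     (\<lambda>n x. resolvent A (1 / real (Suc n)) (resolvent A (1 / real (Suc n)) x))"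
proof -
  let ?J = "\<lambda>n. resolvent A (1 / real (Suc n))"
  have l: "1 / real (Suc n) > 0" for n by simp
  note r = resolvent(1)[OF sa nn l]
  have J: "?J n x \<in> dom B" "app B (?J n x) \<in> dom B" for n x using r[of n x] dom_sqrt by blast+
  note Jbl = sym_contractionD(2)[OF resolvent_sym_contraction[OF sa nn l]]
  note Jn = resolvent_norm(1)[OF sa nn l]
  note B1 = resolvent_commute_sqrt[OF l]
  have BB: "app B (app B (?J n x)) = app A (?J n x)" for n x by (rule app_sqrt[OF r])
  have BBJJ: "app B (app B (?J n (?J n x))) = ?J n (app A (?J n x))" for n x
    unfolding BB by (rule resolvent_commute[OF l r])
  have BBBJJ: "app B (app B (app B (?J n (?J n x)))) = app B (?J n (app A (?J n x)))" for n x
    by (simp only: BBJJ)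
  have BBBBJJ: "app B (app B (app B (app B (?J n (?J n x))))) = app A (?J n (app A (?J n x)))" for n x
    unfolding BBJJ unfolding BB ..
  have A0: "x = 0" if "?J n x = 0" for n x
  proof -
    have "app A 0 = 0" using self_adjoint_scale(2)[OF sa r, of 0 0 0] by simp
    then show ?thesis using resolvent(2)[OF sa nn l, of n x] that by simp
  qed
  show ?thesis
  proof (rule regularized_operator.intro)
    show "subspace (dom B)" by (rule self_adjoint_subspace[OF saB])
    show "bounded_linear (\<lambda>x. ?J n (?J n x))" for n by (rule bounded_linear_compose[OF Jbl Jbl])
    show "norm (?J n (?J n x)) \<le> norm x" for n x using Jn[of n "?J n x"] Jn[of n x] by linarith
    show "(\<lambda>n. ?J n (?J n x)) \<longlonglongrightarrow> x" for x
    proof -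
      have "(\<lambda>n. ?J n (?J n x - x)) \<longlonglongrightarrow> 0"
      proof (rule Lim_null_comparison)
        show "\<forall>\<^sub>F n in sequentially. norm (?J n (?J n x - x)) \<le> norm (?J n x - x)" using Jn by simp
        show "(\<lambda>n. norm (?J n x - x)) \<longlonglongrightarrow> 0"
          using tendsto_norm[OF tendsto_diff[OF resolvent_tendsto[of x] tendsto_const[of x]]] by simp
      qed
      from tendsto_add[OF this resolvent_tendsto[of x]] show ?thesis
        by (simp add: linear_diff[OF resolvent_linear[OF sa nn l]] del: of_nat_Suc)
    qed
    show "x = 0" if "?J n (?J n x) = 0" for n x using that A0 by blast
    show "app B (?J n (?J n x)) = ?J n (?J n (app B x))" if "x \<in> dom B" for n x
      unfolding B1[OF J(1)] B1[OF that] ..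
    show "bounded_linear (\<lambda>x. app B (?J n (?J n x)))" for n
      by (rule bounded_linear_compose[OF bounded_linear_sqrt_resolvent[OF l] Jbl])
    show "bounded_linear (\<lambda>x. app B (app B (?J n (?J n x))))" for n
      unfolding BBJJ by (rule bounded_linear_compose[OF Jbl bounded_linear_A_resolvent[OF l]])
    show "bounded_linear (\<lambda>x. app B (app B (app B (?J n (?J n x)))))" for n
      unfolding BBBJJ
      by (rule bounded_linear_compose[OF bounded_linear_sqrt_resolvent[OF l] bounded_linear_A_resolvent[OF l]])
    show "bounded_linear (\<lambda>x. app B (app B (app B (app B (?J n (?J n x))))))" for n
      unfolding BBBBJJ
      by (rule bounded_linear_compose[OF bounded_linear_A_resolvent[OF l] bounded_linear_A_resolvent[OF l]])
    show "app B (app B (?J n (?J n x))) \<in> dom B" "app B (app B (app B (?J n (?J n x)))) \<in> dom B" for n x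
      unfolding BBJJ by (rule J)+
    show "?J n (?J n x) \<in> dom B" "app B (?J n (?J n x)) \<in> dom B" for n x by (rule J)+
  qed (rule self_adjoint_add(2)[OF saB] self_adjoint_scale(2)[OF saB] self_adjoint_sym[OF saB]; assumption)+
qed

end

subsection \<open>Calculus on compact time intervals\<close>

lemma nondecreasing_within:
  fixes f :: "real \<Rightarrow> real"
  assumes "\<And>t. t \<in> {a..b} \<Longrightarrow> (f has_real_derivative f' t) (at t within {a..b})"
    and "\<And>t. t \<in> {a..b} \<Longrightarrow> f' t \<ge> 0" and "a \<le> b"
  shows "f a \<le> f b"
proof -
  have "continuous_on {a..b} f"
    using assms(1) by (meson DERIV_continuous continuous_on_eq_continuous_within)
  moreover have "\<exists>y. (f has_real_derivative y) (at x) \<and> 0 \<le> y" if "a < x" "x < b" for x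
    using assms(1,2)[of x] that at_within_Icc_at[of a x b] by force
  ultimately show ?thesis
    using DERIV_nonneg_imp_increasing_open[OF assms(3)] by blast
qed

lemma DERIV_within_le_integral:
  fixes f g :: "real \<Rightarrow> real"
  assumes "\<And>t. t \<in> {a..b} \<Longrightarrow> (f has_real_derivative f' t) (at t within {a..b})"
    and "\<And>t. t \<in> {a..b} \<Longrightarrow> f' t \<le> g t" and "continuous_on {a..b} g" and "a \<le> b"
  shows "f b - f a \<le> integral {a..b} g"
proof -
  have "((\<lambda>t. integral {a..t} g - f t) has_real_derivative g t - f' t) (at t within {a..b})"
    if "t \<in> {a..b}" for t
    by (intro DERIV_diff integral_has_real_derivative assms that)
  then have "integral {a..a} g - f a \<le> integral {a..b} g - f b"
    by (rule nondecreasing_within) (use assms(2,4) in simp_all)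
  then show ?thesis by simp
qed

lemma DERIV_within_integral:
  fixes f :: "real \<Rightarrow> real"
  assumes "\<And>t. t \<in> {a..b} \<Longrightarrow> (f has_real_derivative f' t) (at t within {a..b})" and "a \<le> b"
  shows "(f' has_integral f b - f a) {a..b}"
  using assms by (intro fundamental_theorem_of_calculus)
    (auto simp: has_real_derivative_iff_has_vector_derivative)

text \<open>Carries differentiated identities from regularized quantities to the original ones. The
  integrated identity passes to the limit by dominated convergence and can be differentiated again
  because G is continuous.\<close>

lemma DERIV_within_pointwise_limit:
  fixes f :: "nat \<Rightarrow> real \<Rightarrow> real"
  assumes d: "\<And>n t. t \<in> {a..b} \<Longrightarrow> (f n has_real_derivative f' n t) (at t within {a..b})"
    and f: "\<And>t. t \<in> {a..b} \<Longrightarrow> (\<lambda>n. f n t) \<longlonglongrightarrow> F t"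
    and f': "\<And>t. t \<in> {a..b} \<Longrightarrow> (\<lambda>n. f' n t) \<longlonglongrightarrow> G t"
    and bd: "\<And>n t. t \<in> {a..b} \<Longrightarrow> \<bar>f' n t\<bar> \<le> C"
    and G: "continuous_on {a..b} G" and t: "t \<in> {a..b}"
  shows "(F has_real_derivative G t) (at t within {a..b})"
proof -
  have eq: "F s = F a + integral {a..s} G" if s: "s \<in> {a..b}" for s
  proof -
    have int: "(f' n has_integral f n s - f n a) {a..s}" for n
      using s by (intro DERIV_within_integral DERIV_subset[OF d]) auto
    have "(\<lambda>n. integral {a..s} (f' n)) \<longlonglongrightarrow> integral {a..s} G"
    proof (rule dominated_convergence(2))
      show "f' n integrable_on {a..s}" for n using int by blast
      show "(\<lambda>_. C) integrable_on {a..s}" by (intro integrable_continuous_real continuous_on_const)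
      show "norm (f' n x) \<le> C" if "x \<in> {a..s}" for n x using bd[of x n] that s by simp
      show "(\<lambda>n. f' n x) \<longlonglongrightarrow> G x" if "x \<in> {a..s}" for x using f'[of x] that s by simp
    qed
    moreover have "integral {a..s} (f' n) = f n s - f n a" for n using int by blast
    ultimately have "(\<lambda>n. f n s - f n a) \<longlonglongrightarrow> integral {a..s} G" by simp
    moreover have "(\<lambda>n. f n s - f n a) \<longlonglongrightarrow> F s - F a" using f s by (intro tendsto_diff) auto
    ultimately show ?thesis using LIMSEQ_unique by fastforce
  qed
  have "((\<lambda>s. F a + integral {a..s} G) has_real_derivative 0 + G t) (at t within {a..b})"
    by (intro DERIV_add DERIV_const integral_has_real_derivative G t)
  then have "((\<lambda>s. F a + integral {a..s} G) has_real_derivative G t) (at t within {a..b})" by simp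
  then show ?thesis
    by (rule has_field_derivative_transform_within[OF _ zero_less_one t]) (simp only: eq)
qed

lemma integral_le_limit:
  fixes f :: "nat \<Rightarrow> real \<Rightarrow> real"
  assumes "\<And>n. continuous_on {a..b} (f n)" and "\<And>t. t \<in> {a..b} \<Longrightarrow> (\<lambda>n. f n t) \<longlonglongrightarrow> F t"
    and "\<And>n t. t \<in> {a..b} \<Longrightarrow> \<bar>f n t\<bar> \<le> h t" and "continuous_on {a..b} h"
    and "\<And>n. g n + integral {a..b} (f n) \<le> C" and "g \<longlonglongrightarrow> G"
  shows "G + integral {a..b} F \<le> C"
proof -
  have "(\<lambda>n. integral {a..b} (f n)) \<longlonglongrightarrow> integral {a..b} F"
    using assms(2,3) by (intro dominated_convergence(2)[where h = h] integrable_continuous_real assms(1,4)) auto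
  from tendsto_add[OF assms(6) this] show ?thesis
    by (rule LIMSEQ_le_const2) (use assms(5) in auto)
qed

lemma vector_derivative_zero_const:
  fixes f :: "real \<Rightarrow> 'a::real_inner"
  assumes "\<And>t. t \<in> {a..b} \<Longrightarrow> (f has_vector_derivative 0) (at t within {a..b})" and "s \<in> {a..b}"
  shows "f s = f a"
proof -
  have "((\<lambda>t. - ((f t - f a) \<bullet> (f t - f a))) has_real_derivative 0) (at t within {a..s})"
    if "t \<in> {a..s}" for t
  proof -
    have "(f has_vector_derivative 0) (at t within {a..s})"
      by (rule has_vector_derivative_within_subset[OF assms(1)]) (use that assms(2) in auto)
    then show ?thesis
      unfolding has_real_derivative_iff_has_vector_derivative has_vector_derivative_def
      by (auto intro!: derivative_eq_intros)
  qed
  then have "- ((f a - f a) \<bullet> (f a - f a)) \<le> - ((f s - f a) \<bullet> (f s - f a))"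
    by (rule nondecreasing_within) (use assms(2) in auto)
  then have "(norm (f s - f a))\<^sup>2 \<le> 0" by (simp add: power2_norm_eq_inner)
  then show ?thesis by simp
qed

text \<open>Continuity argument. Up to the first zero s of F the implication gives F \<ge> G on [0,
  s), so F(s) \<ge> G(s) > 0 by left limits. The continuous positive bound G takes the place of the
  usual openness step.\<close>

lemma positive_bootstrap:
  fixes F G :: "real \<Rightarrow> real"
  assumes F: "continuous_on {0..} F" and G: "\<And>T. T \<ge> 0 \<Longrightarrow> G T > 0" "continuous_on {0..} G"
    and F0: "F 0 > 0"
    and imp: "\<And>T. T \<ge> 0 \<Longrightarrow> (\<And>t. t \<in> {0..T} \<Longrightarrow> F t > 0) \<Longrightarrow> F T \<ge> G T"
    and t: "t \<ge> 0"
  shows "F t > 0"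
proof (rule ccontr)
  assume neg: "\<not> F t > 0"
  define S where "S = {s \<in> {0..t}. F s \<le> 0}"
  have cF: "continuous_on {0..t} F" by (rule continuous_on_subset[OF F]) simp
  have "S = {0..t} \<inter> F -` {..0}" by (auto simp: S_def)
  then have "closed S" using continuous_closed_preimage[OF cF closed_atLeastAtMost closed_atMost] by simp
  moreover have "bounded S" by (rule bounded_subset[of "{0..t}"]) (auto simp: S_def)
  ultimately have "compact S" by (simp add: compact_eq_bounded_closed)
  moreover have "S \<noteq> {}" using neg t by (auto simp: S_def)
  ultimately obtain s where s: "s \<in> S" "\<And>r. r \<in> S \<Longrightarrow> s \<le> r" using compact_attains_inf[of S] by auto
  have pos: "F r > 0" if "0 \<le> r" "r < s" for r
    using s(2)[of r] s(1) that by (force simp: S_def)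
  have s0: "0 < s" using s(1) F0 by (cases "s = 0") (auto simp: S_def)
  have st: "s \<le> t" "F s \<le> 0" using s(1) by (auto simp: S_def)
  have le: "G r \<le> F r" if "0 \<le> r" "r < s" for r
    using that pos by (intro imp) auto
  have "continuous_on {0..s} F" "continuous_on {0..s} G"
    by (rule continuous_on_subset[OF F] continuous_on_subset[OF G(2)]; simp)+
  then have "(F \<longlongrightarrow> F s) (at s within {0..s})" "(G \<longlongrightarrow> G s) (at s within {0..s})"
    using s0 by (simp_all add: continuous_on)
  then have lim: "(F \<longlongrightarrow> F s) (at_left s)" "(G \<longlongrightarrow> G s) (at_left s)"
    using s0 by (simp_all add: at_within_Icc_at_left)
  have "G s \<le> F s"
  proof (rule tendsto_le[OF _ lim])
    show "\<forall>\<^sub>F r in at_left s. G r \<le> F r"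
      using eventually_at_left_real[OF s0] by eventually_elim (use le in auto)
  qed simp
  then show False using G(1)[of s] s0 st by linarith
qed

text \<open>The supremum of f over the compact interval is attained, so it may serve as X and half
  of it is absorbed; the resulting bound does not involve T. Quantifying over all upper bounds X
  lets X appear inside auxiliary functionals.\<close>

lemma absorb_sup:
  fixes f :: "real \<Rightarrow> real"
  assumes "continuous_on {0..T} f" and "T \<ge> 0"
    and "\<And>t X. t \<in> {0..T} \<Longrightarrow> (\<And>s. s \<in> {0..T} \<Longrightarrow> f s \<le> X) \<Longrightarrow> f t \<le> A + X / 2"
    and "t \<in> {0..T}"
  shows "f t \<le> 2 * A"
proof -
  obtain s where s: "s \<in> {0..T}" "\<And>r. r \<in> {0..T} \<Longrightarrow> f r \<le> f s"
    using continuous_attains_sup[OF _ _ assms(1)] assms(2) by auto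
  have "f s \<le> A + f s / 2" using assms(3)[OF s(1), of "f s"] s(2) by blast
  then show ?thesis using s(2)[OF assms(4)] by linarith
qed

lemma DERIV_powr_const:
  fixes f :: "real \<Rightarrow> real"
  assumes "(f has_real_derivative d) (at t within S)" and "f t > 0"
  shows "((\<lambda>t. f t powr q) has_real_derivative q * (d / f t) * f t powr q) (at t within S)"
  using DERIV_chain2[OF has_real_derivative_powr[OF assms(2), of q] assms(1)] assms(2)
  by (simp add: powr_diff field_simps)

subsection \<open>A priori estimates for the hyperbolic problem\<close>

locale dissipation =
  fixes p :: real
  assumes p0: "0 \<le> p" and p1: "p \<le> 1"
begin

definition \<beta> :: "real \<Rightarrow> real" where "\<beta> t = (1 + t) powr p"

text \<open>The factor left when \<beta> is differentiated: \<beta>' = p \<sigma>. As p \<le> 1 it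
  is at most 1 and nonincreasing, so terms carrying \<epsilon> \<sigma> are small
  perturbations.\<close>

definition \<sigma> :: "real \<Rightarrow> real" where "\<sigma> t = (1 + t) powr (p - 1)"

lemma \<beta>_\<sigma>: "t \<ge> 0 \<Longrightarrow> \<beta> t = \<sigma> t * (1 + t)"
  using powr_add[of "1 + t" "p - 1" 1] by (simp add: \<beta>_def \<sigma>_def)

lemma \<sigma>_pos: "t \<ge> 0 \<Longrightarrow> \<sigma> t > 0" by (simp add: \<sigma>_def)

lemma \<sigma>_le1: "t \<ge> 0 \<Longrightarrow> \<sigma> t \<le> 1"
  using p1 powr_mono[of "p - 1" 0 "1 + t"] by (simp add: \<sigma>_def)

lemma \<beta>_ge1: "t \<ge> 0 \<Longrightarrow> \<beta> t \<ge> 1"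
  using p0 by (simp add: \<beta>_def ge_one_powr_ge_zero)

lemma \<beta>_pos: "t \<ge> 0 \<Longrightarrow> \<beta> t > 0" using \<beta>_ge1[of t] by linarith

lemma \<beta>_le: "t \<ge> 0 \<Longrightarrow> \<beta> t \<le> 1 + t"
  using p1 powr_mono[of p 1 "1 + t"] by (simp add: \<beta>_def)

lemma inverse_\<beta>: "t \<ge> 0 \<Longrightarrow> (1 + t) powr (- p) = inverse (\<beta> t)"
  by (simp add: \<beta>_def powr_minus)

lemma DERIV_\<beta>: "t \<ge> 0 \<Longrightarrow> (\<beta> has_real_derivative p * \<sigma> t) (at t within S)"
  unfolding \<beta>_def \<sigma>_def by (auto intro!: derivative_eq_intros)

lemma DERIV_\<sigma>: "t \<ge> 0 \<Longrightarrow> (\<sigma> has_real_derivative (p - 1) * (\<sigma> t / (1 + t))) (at t within S)"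
proof -
  assume t: "t \<ge> 0"
  have "(1 + t) powr (p - 1 - 1) = \<sigma> t / (1 + t)"
    using t by (simp add: powr_diff \<sigma>_def power2_eq_square)
  moreover have "(\<sigma> has_real_derivative (p - 1) * (1 + t) powr (p - 1 - 1)) (at t within S)"
    using t unfolding \<sigma>_def by (auto intro!: derivative_eq_intros)
  ultimately show ?thesis by simp
qed

lemma continuous_\<beta>: "S \<subseteq> {0..} \<Longrightarrow> continuous_on S \<beta>"
  unfolding \<beta>_def by (auto intro!: continuous_intros)

end

text \<open>The computation behind \<open>D_P\<close> without the analysis. Naming the only quotient
  by e makes it a polynomial identity. The contribution of c Q1 / e in h' cancels against Q1 times
  the derivative of 1 / M.\<close>

lemma P_deriv_algebra:
  fixes e b h g ic iM c Q1 Q2 :: real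
  assumes "c * ic = 1" "e \<noteq> 0"
  shows "- (2*b + 2*g*e*h) * Q2 * ic * iM + (- 2 * h * iM) * (e * Q2 * ic + Q1)
    - e * (2 * (Q2 * iM - (h * b + c * Q1 * iM) / e - 2 * h\<^sup>2) * h * ic + (- 2 * g * h * ic) * h\<^sup>2)
    = - ((Q2 * iM - h\<^sup>2) * ic) * (2 * b + e * (4 + 2 * g) * h)"
proof -
  define k where "k = (h * b + c * Q1 * iM) / e"
  have "e * k = h * b + c * Q1 * iM" using assms(2) by (simp add: k_def)
  then show ?thesis using assms(1) unfolding k_def[symmetric] by algebra
qed

lemma \<Psi>_deriv_algebra:
  fixes e b h g ic iM c Q1 Q2 bb p s P P' W tau :: real
  assumes "c * ic = 1" "e \<noteq> 0" "b * bb = 1" "W = Q2 * iM - h\<^sup>2" "P = e * W * ic + Q1 * iM"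
  shows "- 2 * g * h * ic
    - 2 * g * e * (((Q2 * iM - (h * b + c * Q1 * iM) / e - 2 * h\<^sup>2) * bb + p * s * h) * ic
        + (- 2 * g * h * ic) * (h * bb))
    - 4 * g * e * (P' * bb\<^sup>2 + 2 * bb * (p * s) * P)
    - e * p * ((p - 1) * (s / tau) * ic + (- 2 * g * h * ic) * s)
    = 2 * g * bb * P - 4 * g * bb * e * W * ic + (2 * g + 4 * g\<^sup>2) * e * bb * h\<^sup>2 * ic
      - 4 * g * e * P' * bb\<^sup>2 - 8 * g * e * p * P * bb * s + e * p * (1 - p) * (s / tau) * ic"
proof -
  define k where "k = (h * b + c * Q1 * iM) / e"
  have "e * k = h * b + c * Q1 * iM" using assms(2) by (simp add: k_def)
  then show ?thesis using assms(1,3,4,5) unfolding k_def[symmetric] by algebra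
qed

text \<open>In the application, \<open>M = |BU|\<^sup>2\<close>, \<open>H = \<langle>AU, U'\<rangle>\<close>, \<open>Q\<^sub>1 = |AU|\<^sup>2\<close>, \<open>Q\<^sub>2 = |BU'|\<^sup>2\<close> and \<open>Q\<^sub>3 = |U'|\<^sup>2\<close>.\<close>

locale hyperbolic_scalar = dissipation +
  fixes \<gamma> \<epsilon> T :: real and M H Q1 Q2 Q3 :: "real \<Rightarrow> real"
  assumes T0: "T \<ge> 0" and \<gamma>1: "\<gamma> \<ge> 1" and \<epsilon>0: "\<epsilon> > 0"
    and M_pos: "\<And>t. t \<in> {0..T} \<Longrightarrow> M t > 0"
    and DM: "\<And>t. t \<in> {0..T} \<Longrightarrow> (M has_real_derivative 2 * H t) (at t within {0..T})"
    and DH: "\<And>t. t \<in> {0..T} \<Longrightarrow> (H has_real_derivative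
       Q2 t - (H t * inverse (\<beta> t) + M t powr \<gamma> * Q1 t) / \<epsilon>) (at t within {0..T})"
    and DE: "\<And>t. t \<in> {0..T} \<Longrightarrow> ((\<lambda>t. \<epsilon> * Q2 t * M t powr (- \<gamma>) + Q1 t) has_real_derivative
       - (2 * inverse (\<beta> t) + 2 * \<gamma> * \<epsilon> * (H t * inverse (M t))) * Q2 t * M t powr (- \<gamma>)) (at t within {0..T})"
    and DQ3: "\<And>t. t \<in> {0..T} \<Longrightarrow> (Q3 has_real_derivative
       - (2 / \<epsilon>) * (inverse (\<beta> t) * Q3 t + M t powr \<gamma> * H t)) (at t within {0..T})"
    and CS1: "\<And>t. t \<in> {0..T} \<Longrightarrow> (H t)\<^sup>2 \<le> M t * Q2 t"
    and CS2: "\<And>t. t \<in> {0..T} \<Longrightarrow> (H t)\<^sup>2 \<le> Q1 t * Q3 t"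
    and Q_nonneg: "\<And>t. Q1 t \<ge> 0" "\<And>t. Q2 t \<ge> 0" "\<And>t. Q3 t \<ge> 0"
    and boot: "\<And>t. t \<in> {0..T} \<Longrightarrow> 8 * (\<gamma> + 1) * \<epsilon> * \<bar>H t\<bar> \<le> M t * inverse (\<beta> t)"
begin

definition "iM t = inverse (M t)"
text \<open>Half the logarithmic derivative of M, so that c' = 2 \<gamma> h c.\<close>

definition "h t = H t * iM t"
definition "c t = M t powr \<gamma>"
definition "ic t = M t powr (- \<gamma>)"
definition "b t = inverse (\<beta> t)"
text \<open>In the application, the Cauchy-Schwarz defect |BU'|^2 |BU|^2 - <BU, BU'>^2 divided by
  M^2.\<close>

definition "W t = Q2 t * iM t - (h t)\<^sup>2"
text \<open>Equal to Q1 / M + \<epsilon> W / c: the Rayleigh quotient, which is nonincreasing along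
  the first order flow, with the kinetic correction that keeps it nonincreasing here. It is written
  through the energy of \<open>DE\<close>, whose derivative is available.\<close>

definition "P t = (\<epsilon> * Q2 t * ic t + Q1 t) * iM t - \<epsilon> * ((h t)\<^sup>2 * ic t)"

lemma time: "t \<in> {0..T} \<Longrightarrow> t \<ge> 0" by simp

lemma pos: assumes "t \<in> {0..T}" shows "iM t > 0" "c t > 0" "ic t > 0" "b t > 0" "c t * ic t = 1" "b t * \<beta> t = 1"
  using M_pos[OF assms] \<beta>_pos[OF time[OF assms]]
  by (auto simp: iM_def c_def ic_def b_def powr_minus)

lemma D_iM: "t \<in> {0..T} \<Longrightarrow> (iM has_real_derivative - 2 * h t * iM t) (at t within {0..T})"
  unfolding iM_def h_def
  by (rule DERIV_cong[OF DERIV_inverse'[OF DM]]) (use M_pos[of t] in \<open>auto simp: power2_eq_square\<close>)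

lemma D_h:
  assumes "t \<in> {0..T}"
  shows "(h has_real_derivative Q2 t * iM t - (h t * b t + c t * Q1 t * iM t) / \<epsilon> - 2 * (h t)\<^sup>2) (at t within {0..T})"
  unfolding h_def[abs_def]
  by (rule DERIV_cong[OF DERIV_mult[OF DH[OF assms] D_iM[OF assms]]])
    (use \<epsilon>0 in \<open>simp add: h_def b_def c_def field_simps power2_eq_square\<close>)

lemma D_ic:
  assumes t: "t \<in> {0..T}"
  shows "(ic has_real_derivative - 2 * \<gamma> * h t * ic t) (at t within {0..T})"
  using DERIV_powr_const[OF DM[OF t] M_pos[OF t], of "- \<gamma>"]
  by (simp add: ic_def[abs_def] h_def iM_def divide_inverse mult_ac)

text \<open>Subtracting \<epsilon> h^2 / c from the energy quotient turns Q2 / M into the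
  nonnegative W, so the derivative has a sign as soon as \<epsilon> h is small against b.\<close>

lemma D_P:
  assumes t: "t \<in> {0..T}"
  shows "(P has_real_derivative - (W t * ic t) * (2 * b t + \<epsilon> * (4 + 2 * \<gamma>) * h t)) (at t within {0..T})"
proof -
  have "((\<lambda>t. (h t)\<^sup>2) has_real_derivative
      2 * (Q2 t * iM t - (h t * b t + c t * Q1 t * iM t) / \<epsilon> - 2 * (h t)\<^sup>2) * h t) (at t within {0..T})"
    by (rule DERIV_cong[OF DERIV_power[OF D_h[OF t], of 2]]) simp
  from DERIV_diff[OF DERIV_mult[OF DE[OF t] D_iM[OF t]] DERIV_cmult[OF DERIV_mult[OF this D_ic[OF t]], of \<epsilon>]]
  show ?thesis unfolding P_def[abs_def] W_def
    using P_deriv_algebra[OF pos(5)[OF t], of \<epsilon> "b t" \<gamma> "h t" "Q2 t" "iM t" "Q1 t"] \<epsilon>0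
    by (simp add: ic_def b_def h_def iM_def)
qed

lemma W_nonneg: assumes "t \<in> {0..T}" shows "W t \<ge> 0"
proof -
  have "(H t)\<^sup>2 * (iM t)\<^sup>2 \<le> M t * Q2 t * (iM t)\<^sup>2" using CS1[OF assms] by (intro mult_right_mono) auto
  also have "\<dots> = Q2 t * iM t" using M_pos[OF assms] by (simp add: iM_def power2_eq_square)
  finally show ?thesis by (simp add: W_def h_def power_mult_distrib)
qed

lemma P_eq: "P t = \<epsilon> * W t * ic t + Q1 t * iM t"
  by (simp add: P_def W_def algebra_simps)

lemma P_ge: assumes "t \<in> {0..T}" shows "P t \<ge> Q1 t * iM t" "P t \<ge> 0"
proof -
  have "\<epsilon> * W t * ic t \<ge> 0" "Q1 t * iM t \<ge> 0" using W_nonneg[OF assms] pos[OF assms] \<epsilon>0 Q_nonneg by auto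
  then show "P t \<ge> Q1 t * iM t" "P t \<ge> 0" unfolding P_eq by auto
qed

lemma boot_h: assumes "t \<in> {0..T}" shows "8 * (\<gamma> + 1) * (\<epsilon> * \<bar>h t\<bar>) \<le> b t"
proof -
  have "8 * (\<gamma> + 1) * \<epsilon> * \<bar>H t\<bar> * iM t \<le> M t * inverse (\<beta> t) * iM t"
    using boot[OF assms] pos(1)[OF assms] by (intro mult_right_mono) auto
  also have "\<dots> = b t" using M_pos[OF assms] by (simp add: b_def iM_def)
  finally show ?thesis using pos(1)[OF assms] by (simp add: h_def abs_mult mult_ac)
qed

text \<open>The constant 8 (\<gamma> + 1) in \<open>boot\<close> is sized for the largest of its
  uses: k is 4 + 2 \<gamma> for P, 8 \<gamma> for the corrections in \<Psi>, and 8 (\<gamma> + 1)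
  for V.\<close>

lemma boot_h':
  assumes "t \<in> {0..T}" "0 \<le> k" "k \<le> 8 * (\<gamma> + 1)"
  shows "k * (\<epsilon> * h t) \<le> b t" "- (k * (\<epsilon> * h t)) \<le> b t"
proof -
  have "k * (\<epsilon> * \<bar>h t\<bar>) \<le> b t"
    by (rule order_trans[OF mult_right_mono[OF assms(3)] boot_h[OF assms(1)]]) (use \<epsilon>0 in simp)
  moreover have "\<bar>k * (\<epsilon> * h t)\<bar> = k * (\<epsilon> * \<bar>h t\<bar>)" using assms(2) \<epsilon>0 by (simp add: abs_mult)
  ultimately show "k * (\<epsilon> * h t) \<le> b t" "- (k * (\<epsilon> * h t)) \<le> b t" by linarith+
qed

lemma P_deriv_le:
  assumes t: "t \<in> {0..T}"
  shows "- (W t * ic t) * (2 * b t + \<epsilon> * (4 + 2 * \<gamma>) * h t) \<le> - (W t * ic t * b t)"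
proof -
  have "b t \<le> 2 * b t + \<epsilon> * (4 + 2 * \<gamma>) * h t"
    using boot_h'(2)[OF t, of "4 + 2 * \<gamma>"] \<gamma>1 by (simp add: algebra_simps)
  then show ?thesis using mult_left_mono[of "b t" _ "W t * ic t"] W_nonneg[OF t] pos[OF t] by simp
qed

lemma P_le0: assumes t: "t \<in> {0..T}" shows "P t \<le> P 0"
proof -
  have "- P 0 \<le> - P t"
  proof (rule nondecreasing_within[where f = "\<lambda>t. - P t"])
    show "((\<lambda>t. - P t) has_real_derivative - (- (W s * ic s) * (2 * b s + \<epsilon> * (4 + 2 * \<gamma>) * h s))) (at s within {0..t})"
      if "s \<in> {0..t}" for s
      using t that by (intro DERIV_minus DERIV_subset[OF D_P]) auto
    show "- (- (W s * ic s) * (2 * b s + \<epsilon> * (4 + 2 * \<gamma>) * h s)) \<ge> 0" if "s \<in> {0..t}" for s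
    proof -
      have s: "s \<in> {0..T}" using that t by auto
      have "0 \<le> W s * ic s * b s" using W_nonneg[OF s] pos[OF s] by simp
      then show ?thesis using P_deriv_le[OF s] by linarith
    qed
  qed (use t in simp)
  then show ?thesis by simp
qed

text \<open>The corrections of order \<open>\<epsilon>\<close> turn \<open>(1 / c)' = - 2 \<gamma> h / c\<close> into \<open>2 \<gamma> \<beta> P\<close> up to terms absorbed for
  small \<open>\<epsilon>\<close>: the equation gives \<open>h \<approx> - \<beta> c |AU|\<^sup>2 / M\<close>.\<close>

definition "\<Psi> t = ic t - 2 * \<gamma> * \<epsilon> * (h t * \<beta> t * ic t) - 4 * \<gamma> * \<epsilon> * (P t * (\<beta> t)\<^sup>2) - \<epsilon> * p * (\<sigma> t * ic t)"

text \<open>The correction with P offsets the loss in W, since P' \<le> - W b / c; its factor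
  (\<beta>^2)' costs half of 2 \<gamma> \<beta> P when 8 \<epsilon> \<le> 1. The correction with
  \<sigma> cancels what \<beta>' leaves in the derivative of h \<beta> / c. There remain \<gamma>
  \<beta> P and nonnegative terms.\<close>

lemma D_\<Psi>:
  assumes t: "t \<in> {0..T}" and small: "8 * \<epsilon> \<le> 1"
  obtains d where "(\<Psi> has_real_derivative d) (at t within {0..T})" "d \<ge> \<gamma> * P t * \<beta> t"
proof -
  define P' where "P' = - (W t * ic t) * (2 * b t + \<epsilon> * (4 + 2 * \<gamma>) * h t)"
  note t0 = time[OF t]
  have "((\<lambda>t. (\<beta> t)\<^sup>2) has_real_derivative 2 * \<beta> t * (p * \<sigma> t)) (at t within {0..T})"
    by (rule DERIV_cong[OF DERIV_power[OF DERIV_\<beta>[OF t0], of 2]]) simp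
  from DERIV_diff[OF DERIV_diff[OF DERIV_diff[OF D_ic[OF t]
     DERIV_cmult[OF DERIV_mult[OF DERIV_mult[OF D_h[OF t] DERIV_\<beta>[OF t0]] D_ic[OF t]], of "2 * \<gamma> * \<epsilon>"]]
     DERIV_cmult[OF DERIV_mult[OF D_P[OF t] this], of "4 * \<gamma> * \<epsilon>"]]
     DERIV_cmult[OF DERIV_mult[OF DERIV_\<sigma>[OF t0] D_ic[OF t]], of "\<epsilon> * p"]]
  have d: "(\<Psi> has_real_derivative 2 * \<gamma> * \<beta> t * P t - 4 * \<gamma> * \<beta> t * \<epsilon> * W t * ic t
      + (2 * \<gamma> + 4 * \<gamma>\<^sup>2) * \<epsilon> * \<beta> t * (h t)\<^sup>2 * ic t
      - 4 * \<gamma> * \<epsilon> * P' * (\<beta> t)\<^sup>2 - 8 * \<gamma> * \<epsilon> * p * P t * \<beta> t * \<sigma> t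
      + \<epsilon> * p * (1 - p) * (\<sigma> t / (1 + t)) * ic t) (at t within {0..T})" (is "(_ has_real_derivative ?d) _")
    unfolding \<Psi>_def[abs_def]
    by (rule DERIV_cong, unfold P'_def[symmetric],
      intro \<Psi>_deriv_algebra pos[OF t] P_eq W_def) (use \<epsilon>0 in auto)
  have "4 * \<gamma> * \<beta> t * \<epsilon> * W t * ic t \<le> - (4 * \<gamma> * \<epsilon> * P' * (\<beta> t)\<^sup>2)"
  proof -
    have "4 * \<gamma> * \<beta> t * \<epsilon> * W t * ic t = (4 * \<gamma> * \<epsilon> * (\<beta> t)\<^sup>2) * (W t * ic t * b t)"
      using pos(6)[OF t] by algebra
    also have "\<dots> \<le> (4 * \<gamma> * \<epsilon> * (\<beta> t)\<^sup>2) * (- P')"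
      using P_deriv_le[OF t] \<gamma>1 \<epsilon>0 unfolding P'_def[symmetric] by (intro mult_left_mono) auto
    also have "\<dots> = - (4 * \<gamma> * \<epsilon> * P' * (\<beta> t)\<^sup>2)" by algebra
    finally show ?thesis .
  qed
  moreover have "8 * \<gamma> * \<epsilon> * p * P t * \<beta> t * \<sigma> t \<le> \<gamma> * P t * \<beta> t"
  proof -
    have "(8 * \<epsilon>) * (p * \<sigma> t) \<le> 1 * 1"
      using small p0 p1 \<sigma>_le1[OF t0] \<sigma>_pos[OF t0] \<epsilon>0 mult_le_one[of p "\<sigma> t"] by (intro mult_mono) auto
    then have "(8 * \<epsilon>) * (p * \<sigma> t) * (\<gamma> * P t * \<beta> t) \<le> 1 * (\<gamma> * P t * \<beta> t)"
      using \<gamma>1 P_ge(2)[OF t] \<beta>_pos[OF t0] by (intro mult_right_mono) auto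
    then show ?thesis by (simp add: mult_ac)
  qed
  moreover have "(2 * \<gamma> + 4 * \<gamma>\<^sup>2) * \<epsilon> * \<beta> t * (h t)\<^sup>2 * ic t \<ge> 0"
    "\<epsilon> * p * (1 - p) * (\<sigma> t / (1 + t)) * ic t \<ge> 0"
    using \<gamma>1 \<epsilon>0 p0 p1 pos(3)[OF t] \<beta>_pos[OF t0] \<sigma>_pos[OF t0] t0 by auto
  moreover have "2 * \<gamma> * \<beta> t * P t = 2 * (\<gamma> * P t * \<beta> t)" by simp
  ultimately have "?d \<ge> \<gamma> * P t * \<beta> t" by linarith
  with d show ?thesis using that by blast
qed

end

text \<open>Comparison by the integrating factor: L - f times the exponential of the integral of k
  is nondecreasing. The level L is a barrier whatever the size of k, which is of order 1 /
  \<epsilon> in the application.\<close>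

lemma relaxation_le:
  fixes f k :: "real \<Rightarrow> real"
  assumes "\<And>t. t \<in> {a..b} \<Longrightarrow> (f has_real_derivative f' t) (at t within {a..b})"
    and "\<And>t. t \<in> {a..b} \<Longrightarrow> f' t \<le> k t * (L - f t)"
    and "continuous_on {a..b} k" and "a \<le> b" and "f a \<le> L"
  shows "f b \<le> L"
proof -
  define E where "E t = exp (integral {a..t} k)" for t
  have "(E has_real_derivative k t * E t) (at t within {a..b})" if "t \<in> {a..b}" for t
    unfolding E_def using integral_has_real_derivative[OF assms(3) that]
    by (auto intro!: derivative_eq_intros)
  then have "((\<lambda>t. (L - f t) * E t) has_real_derivative (0 - f' t) * E t + k t * E t * (L - f t)) (at t within {a..b})"
    if "t \<in> {a..b}" for t
    using that by (intro DERIV_mult DERIV_diff DERIV_const assms(1))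
  moreover have "0 \<le> (0 - f' t) * E t + k t * E t * (L - f t)" if "t \<in> {a..b}" for t
    using mult_right_mono[OF assms(2)[OF that], of "E t"] by (simp add: E_def algebra_simps)
  ultimately have "(L - f a) * E a \<le> (L - f b) * E b"
    using assms(4) by (rule nondecreasing_within[where f = "\<lambda>t. (L - f t) * E t"])
  then have "0 \<le> (L - f b) * E b" using assms(5) by (simp add: E_def)
  then show ?thesis by (simp add: E_def zero_le_mult_iff not_le)
qed

context hyperbolic_scalar
begin

lemma zero_time: "0 \<in> {0..T}" using T0 by simp

lemma at_zero: "\<beta> 0 = 1" "\<sigma> 0 = 1" by (simp_all add: \<beta>_def \<sigma>_def)

text \<open>\<Psi> grows at least at the rate \<gamma> P \<beta>, whereas P (1 + t) \<beta> grows at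
  most at the rate 2 P \<beta>, because P is nonincreasing and p \<le> 1. So for \<kappa> \<le>
  \<gamma> / 2 the inequality at time 0 propagates, and the bootstrap bound gives \<Psi> \<le> 2 /
  c.\<close>

lemma P_decay:
  assumes small: "8 * \<epsilon> \<le> 1" and \<kappa>: "\<kappa> > 0" "\<kappa> \<le> \<gamma> / 2" "\<kappa> * Pb \<le> ic 0 / 4"
    and Pb: "P 0 \<le> Pb" "4 * \<gamma> * \<epsilon> * Pb \<le> ic 0 / 4" and t: "t \<in> {0..T}"
  shows "\<kappa> * (P t * ((1 + t) * \<beta> t)) \<le> 2 * ic t"
proof -
  define \<Omega> where "\<Omega> s = \<Psi> s - \<kappa> * (P s * ((1 + s) * \<beta> s))" for s
  have "\<exists>d. (\<Omega> has_real_derivative d) (at s within {0..t}) \<and> d \<ge> 0" if "s \<in> {0..t}" for s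
  proof -
    have s: "s \<in> {0..T}" "s \<ge> 0" using that t by auto
    obtain d where d: "(\<Psi> has_real_derivative d) (at s within {0..T})" "d \<ge> \<gamma> * P s * \<beta> s"
      by (rule D_\<Psi>[OF s(1) small])
    define P' where "P' = - (W s * ic s) * (2 * b s + \<epsilon> * (4 + 2 * \<gamma>) * h s)"
    have "0 \<le> W s * ic s * b s" using W_nonneg[OF s(1)] pos[OF s(1)] by simp
    then have P': "P' \<le> 0" using P_deriv_le[OF s(1)] unfolding P'_def by linarith
    have "((\<lambda>s. (1 + s) * \<beta> s) has_real_derivative 1 * \<beta> s + p * \<sigma> s * (1 + s)) (at s within {0..T})"
      by (rule DERIV_mult[OF _ DERIV_\<beta>[OF s(2)]]) (auto intro!: derivative_eq_intros)
    from DERIV_diff[OF d(1) DERIV_cmult[OF DERIV_mult[OF D_P[OF s(1)] this], of \<kappa>]]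
    have "(\<Omega> has_real_derivative d - \<kappa> * (P' * ((1 + s) * \<beta> s) + (\<beta> s + p * \<beta> s) * P s)) (at s within {0..T})"
      unfolding \<Omega>_def[abs_def] P'_def by (simp add: \<beta>_\<sigma>[OF s(2)] mult_ac)
    then have "(\<Omega> has_real_derivative d - \<kappa> * (P' * ((1 + s) * \<beta> s) + (\<beta> s + p * \<beta> s) * P s)) (at s within {0..t})"
      by (rule DERIV_subset) (use t in auto)
    moreover have "\<kappa> * (P' * ((1 + s) * \<beta> s)) \<le> 0"
      using P' \<kappa>(1) \<beta>_pos[OF s(2)] s(2) by (simp add: mult_le_0_iff)
    moreover have "\<kappa> * ((\<beta> s + p * \<beta> s) * P s) \<le> \<gamma> * P s * \<beta> s"
    proof -
      have "\<kappa> * (1 + p) \<le> (\<gamma> / 2) * 2" using \<kappa> p0 p1 \<gamma>1 by (intro mult_mono) auto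
      then have "\<kappa> * (1 + p) * (P s * \<beta> s) \<le> (\<gamma> / 2) * 2 * (P s * \<beta> s)"
        using P_ge(2)[OF s(1)] \<beta>_pos[OF s(2)] by (intro mult_right_mono) auto
      then show ?thesis by (simp add: algebra_simps)
    qed
    ultimately show ?thesis using d(2)
      by (intro exI[of _ "d - \<kappa> * (P' * ((1 + s) * \<beta> s) + (\<beta> s + p * \<beta> s) * P s)"])
        (simp add: distrib_left)
  qed
  then obtain \<Omega>' where "\<And>s. s \<in> {0..t} \<Longrightarrow> (\<Omega> has_real_derivative \<Omega>' s) (at s within {0..t})"
    "\<And>s. s \<in> {0..t} \<Longrightarrow> \<Omega>' s \<ge> 0" by metis
  then have "\<Omega> 0 \<le> \<Omega> t" by (rule nondecreasing_within) (use t in auto)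
  \<comment> \<open>The three corrections in \<Psi> take at most 1/4, 1/4 and 1/8 of
    \<open>ic 0\<close>, and \<kappa> P another 1/4.\<close>
  moreover have "0 \<le> \<Omega> 0"
  proof -
    note ic0 = pos(3)[OF zero_time]
    have "8 * \<gamma> * (\<epsilon> * h 0) \<le> 1"
      using boot_h'(1)[OF zero_time, of "8 * \<gamma>"] \<gamma>1 at_zero by (simp add: b_def)
    from mult_right_mono[OF this, of "ic 0"] have "8 * (\<gamma> * \<epsilon> * (h 0 * ic 0)) \<le> ic 0"
      using ic0 by (simp add: mult_ac)
    moreover have "8 * (\<epsilon> * p * ic 0) \<le> ic 0"
    proof -
      have "(8 * \<epsilon>) * p * ic 0 \<le> 1 * 1 * ic 0"
        using small p0 p1 \<epsilon>0 ic0 by (intro mult_mono) auto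
      then show ?thesis by simp
    qed
    moreover have "\<gamma> * \<epsilon> * P 0 \<le> \<gamma> * \<epsilon> * Pb" using Pb(1) \<gamma>1 \<epsilon>0 by (intro mult_left_mono) auto
    moreover have "\<kappa> * P 0 \<le> \<kappa> * Pb" using Pb(1) \<kappa>(1) by (intro mult_left_mono) auto
    moreover have "\<Omega> 0 = ic 0 - 2 * (\<gamma> * \<epsilon> * (h 0 * ic 0)) - 4 * (\<gamma> * \<epsilon> * P 0) - \<epsilon> * p * ic 0 - \<kappa> * P 0"
      unfolding \<Omega>_def \<Psi>_def at_zero by simp
    moreover have "4 * \<gamma> * \<epsilon> * Pb = 4 * (\<gamma> * \<epsilon> * Pb)" by simp
    ultimately show ?thesis using Pb(2) \<kappa>(3) ic0 by linarith
  qed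
  moreover have "\<Psi> t \<le> 2 * ic t"
  proof -
    note t0 = time[OF t] and pt = pos[OF t]
    have "- (8 * \<gamma> * (\<epsilon> * h t)) \<le> b t"
      using boot_h'(2)[OF t, of "8 * \<gamma>"] \<gamma>1 by simp
    from mult_right_mono[OF this, of "\<beta> t * ic t"]
    have "- (8 * \<gamma> * (\<epsilon> * h t)) * (\<beta> t * ic t) \<le> b t * (\<beta> t * ic t)"
      using pt \<beta>_pos[OF t0] by simp
    also have "\<dots> = ic t" using pt(6) by algebra
    finally have "- (8 * (\<gamma> * \<epsilon> * (h t * \<beta> t * ic t))) \<le> ic t" by (simp add: mult_ac)
    moreover have "4 * \<gamma> * \<epsilon> * (P t * (\<beta> t)\<^sup>2) \<ge> 0" "\<epsilon> * p * (\<sigma> t * ic t) \<ge> 0"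
      using P_ge(2)[OF t] \<gamma>1 \<epsilon>0 p0 \<sigma>_pos[OF t0] pt by auto
    moreover have "2 * \<gamma> * \<epsilon> * (h t * \<beta> t * ic t) = 2 * (\<gamma> * \<epsilon> * (h t * \<beta> t * ic t))" by simp
    ultimately show ?thesis using pt(3) unfolding \<Psi>_def by linarith
  qed
  ultimately show ?thesis unfolding \<Omega>_def by linarith
qed

lemma D_b: "t \<in> {0..T} \<Longrightarrow> (b has_real_derivative - (p * \<sigma> t * (b t)\<^sup>2)) (at t within {0..T})"
  unfolding b_def
  by (rule DERIV_cong[OF DERIV_inverse'[OF DERIV_\<beta>]]) (use \<beta>_pos[of t] in \<open>auto simp: power2_eq_square\<close>)

text \<open>Normalized so as to stay bounded: if U' were - \<beta> c AU, as for the first order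
  equation, V would be c |AU|^2 (1 + t) \<beta> / M, the quantity already controlled through
  P.\<close>

definition "V t = Q3 t * ((1 + t) * (b t * (ic t * iM t)))"

lemma V_nonneg: "t \<in> {0..T} \<Longrightarrow> V t \<ge> 0"
  using pos[of t] Q_nonneg by (simp add: V_def)

text \<open>H^2 \<le> Q1 Q3 splits exactly into the decay quantity bounded by C and V, so h decays
  like 1 / (1 + t) once V is bounded.\<close>

lemma h_bound:
  assumes t: "t \<in> {0..T}" and C: "Q1 t * iM t * ((1 + t) * \<beta> t) \<le> C * ic t"
  shows "(h t * (1 + t))\<^sup>2 \<le> C * V t"
proof -
  note pt = pos[OF t] and t0 = time[OF t]
  have "(h t)\<^sup>2 \<le> Q1 t * Q3 t * (iM t)\<^sup>2"
    using mult_right_mono[OF CS2[OF t], of "(iM t)\<^sup>2"] by (simp add: h_def power_mult_distrib)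
  then have "(h t * (1 + t))\<^sup>2 \<le> Q1 t * Q3 t * (iM t)\<^sup>2 * (1 + t)\<^sup>2"
    using mult_right_mono[of _ _ "(1 + t)\<^sup>2"] by (simp add: power_mult_distrib)
  also have "\<dots> = (Q1 t * iM t * ((1 + t) * \<beta> t)) * (Q3 t * (1 + t) * b t * iM t)"
    using pt(6) by algebra
  also have "\<dots> \<le> (C * ic t) * (Q3 t * (1 + t) * b t * iM t)"
    using C Q_nonneg pt t0 by (intro mult_right_mono) auto
  also have "\<dots> = C * V t" by (simp add: V_def mult_ac)
  finally show ?thesis .
qed

lemma V_deriv_algebra:
  assumes "t \<in> {0..T}"
  shows "- (2 / \<epsilon>) * (inverse (\<beta> t) * Q3 t + M t powr \<gamma> * H t) * ((1 + t) * (b t * (ic t * iM t)))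
     + (1 * (b t * (ic t * iM t)) + (- (p * \<sigma> t * (b t)\<^sup>2) * (ic t * iM t)
        + (- 2 * \<gamma> * h t * ic t * iM t + - 2 * h t * iM t * ic t) * b t) * (1 + t)) * Q3 t
    = (b t / \<epsilon>) * (- 2 * V t - 2 * (h t * (1 + t)))
      + (1 - p) * Q3 t * (b t * (ic t * iM t)) - (2 * \<gamma> + 2) * h t * V t"
proof -
  define k where "k = 1 / \<epsilon>"
  have "\<beta> t = \<sigma> t * (1 + t)" "c t * ic t = 1" "b t * \<beta> t = 1"
    using \<beta>_\<sigma>[OF time[OF assms]] pos[OF assms] by auto
  moreover have "h t = H t * iM t" "V t = Q3 t * ((1 + t) * (b t * (ic t * iM t)))"
    by (simp_all add: h_def V_def)
  moreover have "- (2 / \<epsilon>) = - 2 * k" "b t / \<epsilon> = b t * k" by (simp_all add: k_def)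
  ultimately show ?thesis unfolding b_def[of t, symmetric] c_def[symmetric] by algebra
qed

text \<open>V relaxes at the rate b / \<epsilon>. In units of this rate, its derivative is - 2 V,
  plus the drift - 2 h (1 + t) \<le> 2 C + V / 2, plus a weight term of at most V / 8 and a term
  from c and M of at most V / 4. The sum 2 C - 9/8 V makes every L \<ge> 2 C a barrier.\<close>

lemma V_bound:
  assumes small: "8 * \<epsilon> \<le> 1" and C: "\<And>t. t \<in> {0..T} \<Longrightarrow> Q1 t * iM t * ((1 + t) * \<beta> t) \<le> C * ic t"
    and L: "2 * C \<le> L" "V 0 \<le> L" and t: "t \<in> {0..T}"
  shows "V t \<le> L"
proof (rule relaxation_le[where a = 0 and b = t and f = V and k = "\<lambda>t. b t / \<epsilon>"])
  show "continuous_on {0..t} (\<lambda>t. b t / \<epsilon>)"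
    using \<epsilon>0 t \<beta>_pos unfolding b_def
    by (intro continuous_intros continuous_\<beta>) (auto simp: less_imp_neq[symmetric])
  fix s assume "s \<in> {0..t}"
  then have s: "s \<in> {0..T}" "s \<ge> 0" using t by auto
  note ps = pos[OF s(1)]
  let ?d = "(b s / \<epsilon>) * (- 2 * V s - 2 * (h s * (1 + s)))
      + (1 - p) * Q3 s * (b s * (ic s * iM s)) - (2 * \<gamma> + 2) * h s * V s"
  have "((\<lambda>t. (1 + t) * (b t * (ic t * iM t))) has_real_derivative
     1 * (b s * (ic s * iM s)) + (- (p * \<sigma> s * (b s)\<^sup>2) * (ic s * iM s)
        + (- 2 * \<gamma> * h s * ic s * iM s + - 2 * h s * iM s * ic s) * b s) * (1 + s)) (at s within {0..T})"
    by (intro DERIV_mult D_b D_ic D_iM s) (auto intro!: derivative_eq_intros)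
  from DERIV_mult[OF DQ3[OF s(1)] this]
  have "(V has_real_derivative ?d) (at s within {0..T})"
    unfolding V_def[abs_def, symmetric] V_deriv_algebra[OF s(1)] .
  then show "(V has_real_derivative ?d) (at s within {0..t})" by (rule DERIV_subset) (use t in auto)
  note V0 = V_nonneg[OF s(1)]
  have "- (2 * (h s * (1 + s))) \<le> 2 * C + V s / 2"
  proof (rule abs_le_D2, rule abs_le_square_iff[THEN iffD2, of _ "2 * C + V s / 2", THEN order_trans])
    show "(2 * (h s * (1 + s)))\<^sup>2 \<le> (2 * C + V s / 2)\<^sup>2"
      using h_bound[OF s(1) C[OF s(1)]] zero_le_power2[of "2 * C - V s / 2"]
      by (simp add: power2_eq_square algebra_simps)
    have "0 \<le> C * ic s"
      using C[OF s(1)] ps Q_nonneg(1)[of s] \<beta>_pos[OF s(2)] s(2)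
      by (intro order_trans[OF _ C[OF s(1)]]) auto
    then have "C \<ge> 0" using ps(3) by (simp add: zero_le_mult_iff)
    then show "\<bar>2 * C + V s / 2\<bar> \<le> 2 * C + V s / 2" using V0 by simp
  qed
  then have 1: "(b s / \<epsilon>) * (- 2 * V s - 2 * (h s * (1 + s))) \<le> (b s / \<epsilon>) * (2 * C - 3 / 2 * V s)"
    using ps \<epsilon>0 by (intro mult_left_mono) auto
  have 2: "(1 - p) * Q3 s * (b s * (ic s * iM s)) \<le> (b s / \<epsilon>) * (V s / 8)"
  proof -
    have "1 \<le> (1 + s) * b s"
      using \<beta>_le[OF s(2)] ps(4,6) by (metis mult.commute mult_right_mono less_imp_le)
    moreover have "8 \<le> 1 / \<epsilon>" using small \<epsilon>0 by (simp add: field_simps)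
    ultimately have "8 * 1 \<le> (1 / \<epsilon>) * ((1 + s) * b s)" (is "_ \<le> ?z")
      using \<epsilon>0 by (intro mult_mono) auto
    then have "1 - p \<le> ?z / 8" using p0 by argo
    then have "(1 - p) * (Q3 s * (b s * (ic s * iM s))) \<le> ((1 / \<epsilon>) * ((1 + s) * b s) / 8) * (Q3 s * (b s * (ic s * iM s)))"
      using ps Q_nonneg by (intro mult_right_mono) auto
    then show ?thesis by (simp add: V_def mult_ac)
  qed
  have 3: "- ((2 * \<gamma> + 2) * h s * V s) \<le> (b s / \<epsilon>) * (V s / 4)"
  proof -
    have "- (8 * (\<gamma> + 1) * (\<epsilon> * h s)) \<le> b s" using boot_h'(2)[OF s(1), of "8 * (\<gamma> + 1)"] \<gamma>1 by simp
    then have "- ((2 * \<gamma> + 2) * h s) \<le> (b s / \<epsilon>) / 4" using \<epsilon>0 by (simp add: field_simps)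
    from mult_right_mono[OF this V0] show ?thesis by simp
  qed
  have "(b s / \<epsilon>) * (2 * C - 3 / 2 * V s) + (b s / \<epsilon>) * (V s / 8) + (b s / \<epsilon>) * (V s / 4)
      = (b s / \<epsilon>) * (2 * C - 9 / 8 * V s)" by (simp add: algebra_simps)
  also have "\<dots> \<le> (b s / \<epsilon>) * (L - V s)" using V0 L(1) ps \<epsilon>0 by (intro mult_left_mono) auto
  finally show "?d \<le> (b s / \<epsilon>) * (L - V s)" using 1 2 3 by linarith
qed (use t L in auto)

text \<open>4 / \<kappa> is twice the decay constant 2 / \<kappa> that P delivers, as the barrier
  for V demands. The last bound is crude in t; its purpose is to keep M away from zero in the
  bootstrap.\<close>

lemma hyperbolic_bounds:
  assumes small: "8 * \<epsilon> \<le> 1" and \<kappa>: "\<kappa> > 0" "\<kappa> \<le> \<gamma> / 2" "\<kappa> * Pb \<le> ic 0 / 4"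
    and Pb: "P 0 \<le> Pb" "4 * \<gamma> * \<epsilon> * Pb \<le> ic 0 / 4"
    and L: "4 / \<kappa> \<le> L" "V 0 \<le> L" and t: "t \<in> {0..T}"
  shows "c t * Q1 t * ((1 + t) * \<beta> t) \<le> L * M t" "Q1 t \<le> Pb * M t"
    "Q3 t * (1 + t) \<le> L * (\<beta> t * c t * M t)" "\<bar>H t\<bar> * (1 + t) \<le> L * M t"
    "M 0 * exp (- (2 * L * t)) \<le> M t"
proof -
  have L0: "L > 0" using L(1) \<kappa>(1) by (metis divide_pos_pos less_le_trans zero_less_numeral)
  have C: "Q1 t * iM t * ((1 + t) * \<beta> t) \<le> (2 / \<kappa>) * ic t" if t: "t \<in> {0..T}" for t
  proof -
    have "\<kappa> * (Q1 t * iM t * ((1 + t) * \<beta> t)) \<le> \<kappa> * (P t * ((1 + t) * \<beta> t))"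
      using \<kappa>(1) P_ge(1)[OF t] \<beta>_pos[OF time[OF t]] time[OF t] by (intro mult_left_mono mult_right_mono) auto
    also have "\<dots> \<le> 2 * ic t" by (rule P_decay[OF small \<kappa> Pb t])
    finally show ?thesis using \<kappa>(1) by (simp add: field_simps)
  qed
  have V: "V t \<le> L" if "t \<in> {0..T}" for t
    using V_bound[OF small C _ L(2) that] L(1) by simp
  have h: "\<bar>h t\<bar> * (1 + t) \<le> L" if t: "t \<in> {0..T}" for t
  proof -
    have "(h t * (1 + t))\<^sup>2 \<le> (2 / \<kappa>) * V t" by (rule h_bound[OF t C[OF t]])
    also have "\<dots> \<le> L * L" using L(1) V[OF t] V_nonneg[OF t] \<kappa>(1) L0
      by (intro mult_mono) (auto simp: field_simps)
    finally have "(h t * (1 + t))\<^sup>2 \<le> L\<^sup>2" by (simp add: power2_eq_square)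
    then show ?thesis using time[OF t] L0 by (simp add: abs_le_square_iff[symmetric] abs_mult)
  qed
  note pt = pos[OF t] and t0 = time[OF t] and Mt = M_pos[OF t]
  have iMM: "iM t * M t = 1" using Mt by (simp add: iM_def)
  have "c t * Q1 t * ((1 + t) * \<beta> t) = (Q1 t * iM t * ((1 + t) * \<beta> t)) * (c t * M t)"
    using iMM by algebra
  also have "\<dots> \<le> ((2 / \<kappa>) * ic t) * (c t * M t)"
    using C[OF t] pt Mt by (intro mult_right_mono) auto
  also have "\<dots> = (2 / \<kappa>) * M t" using pt(5) by algebra
  also have "\<dots> \<le> L * M t" using L(1) \<kappa>(1) Mt by (intro mult_right_mono) (auto simp: field_simps)
  finally show "c t * Q1 t * ((1 + t) * \<beta> t) \<le> L * M t" .
  have "Q1 t * iM t \<le> Pb" using P_ge(1)[OF t] P_le0[OF t] Pb(1) by linarith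
  from mult_right_mono[OF this, of "M t"] have "Q1 t * (iM t * M t) \<le> Pb * M t" using Mt by (simp add: mult_ac)
  then show "Q1 t \<le> Pb * M t" unfolding iMM by simp
  have "Q3 t * (1 + t) = V t * (\<beta> t * c t * M t)" unfolding V_def using iMM pt(5,6) by algebra
  also have "\<dots> \<le> L * (\<beta> t * c t * M t)"
    using V[OF t] \<beta>_pos[OF t0] pt Mt by (intro mult_right_mono) auto
  finally show "Q3 t * (1 + t) \<le> L * (\<beta> t * c t * M t)" .
  have "\<bar>H t\<bar> = \<bar>h t\<bar> * M t" using Mt by (simp add: h_def iM_def abs_mult)
  then show "\<bar>H t\<bar> * (1 + t) \<le> L * M t"
    using mult_right_mono[OF h[OF t], of "M t"] Mt by (simp add: mult_ac)
  have "M 0 * exp (2 * L * 0) \<le> M t * exp (2 * L * t)"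
  proof (rule nondecreasing_within[where f = "\<lambda>t. M t * exp (2 * L * t)"])
    fix s assume "s \<in> {0..t}"
    then have s: "s \<in> {0..T}" using t by auto
    have "((\<lambda>t. exp (2 * L * t)) has_real_derivative 2 * L * exp (2 * L * s)) (at s within {0..T})"
      by (auto intro!: derivative_eq_intros)
    from DERIV_mult[OF DM[OF s] this]
    show "((\<lambda>t. M t * exp (2 * L * t)) has_real_derivative
        2 * H s * exp (2 * L * s) + 2 * L * exp (2 * L * s) * M s) (at s within {0..t})"
      by (rule DERIV_subset) (use t in auto)
    have "\<bar>h s\<bar> * 1 \<le> \<bar>h s\<bar> * (1 + s)" using time[OF s] by (intro mult_left_mono) auto
    then have "- h s \<le> L" using h[OF s] by linarith
    from mult_right_mono[OF this, of "M s"] have "- H s \<le> L * M s"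
      using M_pos[OF s] by (simp add: h_def iM_def mult.assoc)
    then have "0 \<le> (H s + L * M s) * exp (2 * L * s)" by simp
    then show "0 \<le> 2 * H s * exp (2 * L * s) + 2 * L * exp (2 * L * s) * M s" by (simp add: algebra_simps)
  qed (use t in simp)
  then show "M 0 * exp (- (2 * L * t)) \<le> M t" by (simp add: exp_minus field_simps)
qed

end

section \<open>Integrated dissipation and the scalar parabolic estimates\<close>

context dissipation
begin

lemma D_time_\<beta>: "t \<ge> 0 \<Longrightarrow> ((\<lambda>s. (1 + s) * \<beta> s) has_real_derivative (1 + p) * \<beta> t) (at t within S)"
  by (rule DERIV_cong[OF DERIV_mult[OF _ DERIV_\<beta>]]) (auto intro!: derivative_eq_intros simp: \<beta>_\<sigma> algebra_simps)

text \<open>Turns integrability of \<beta> e into a pointwise decay rate: e grows at most at the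
  logarithmic rate k / (1 + t), so the derivative of e (1 + t) \<beta> is at most (k + 2) \<beta> e.
  It is applied to e = c |BU|^2 and its parabolic analogue.\<close>

lemma weighted_energy_le:
  assumes e: "\<And>t. t \<in> {0..T} \<Longrightarrow> (e has_real_derivative e' t) (at t within {0..T})"
    and e': "\<And>t. t \<in> {0..T} \<Longrightarrow> e' t * (1 + t) \<le> k * e t" and "\<And>t. t \<in> {0..T} \<Longrightarrow> e t \<ge> 0"
    and t: "t \<in> {0..T}"
  shows "e t * ((1 + t) * \<beta> t) \<le> e 0 + (k + 2) * integral {0..t} (\<lambda>s. \<beta> s * e s)"
proof -
  have ce: "continuous_on {0..t} e"
    using DERIV_continuous_on[OF e] by (rule continuous_on_subset) (use t in auto)
  have "e t * ((1 + t) * \<beta> t) - e 0 * ((1 + 0) * \<beta> 0) \<le> integral {0..t} (\<lambda>s. (k + 2) * (\<beta> s * e s))"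
  proof (rule DERIV_within_le_integral[where f = "\<lambda>t. e t * ((1 + t) * \<beta> t)"])
    fix s assume "s \<in> {0..t}"
    then have s: "s \<in> {0..T}" "s \<ge> 0" using t by auto
    show "((\<lambda>t. e t * ((1 + t) * \<beta> t)) has_real_derivative e' s * ((1 + s) * \<beta> s) + (1 + p) * \<beta> s * e s)
        (at s within {0..t})"
      by (rule DERIV_mult[OF DERIV_subset[OF e[OF s(1)]] D_time_\<beta>[OF s(2)]]) (use t in auto)
    have "e' s * (1 + s) * \<beta> s \<le> k * e s * \<beta> s"
      using e'[OF s(1)] \<beta>_pos[OF s(2)] by (intro mult_right_mono) auto
    moreover have "(1 + p) * (\<beta> s * e s) \<le> 2 * (\<beta> s * e s)"
      using p1 \<beta>_pos[OF s(2)] assms(3)[OF s(1)] by (intro mult_right_mono) auto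
    ultimately show "e' s * ((1 + s) * \<beta> s) + (1 + p) * \<beta> s * e s \<le> (k + 2) * (\<beta> s * e s)"
      by (simp add: algebra_simps)
  next
    show "continuous_on {0..t} (\<lambda>s. (k + 2) * (\<beta> s * e s))"
      by (intro continuous_intros continuous_\<beta> ce) auto
  qed (use t in auto)
  then show ?thesis by (simp add: \<beta>_def)
qed

text \<open>Testing the equation of U with \<beta> U, where X, Y, Qd and e stand for |U|^2, <U', U>,
  |U'|^2 and c |BU|^2. The kinetic term \<epsilon> \<beta> |U'|^2 is absorbed by half of \<beta> e,
  and the boundary term \<epsilon> \<beta> <U', U> by the pointwise decay of e.\<close>

lemma hyperbolic_integral_bound:
  fixes \<epsilon> L k T :: real and X Y Qd e :: "real \<Rightarrow> real"
  assumes T0: "T \<ge> 0" and \<epsilon>: "0 < \<epsilon>" "8 * \<epsilon> \<le> 1" "2 * \<epsilon>\<^sup>2 * L \<le> 1" "8 * \<epsilon>\<^sup>2 * L * (k + 2) \<le> 1" "2 * \<epsilon> * L \<le> 1"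
    and L0: "L \<ge> 0" and k0: "k \<ge> 0"
    and DX: "\<And>t. t \<in> {0..T} \<Longrightarrow> (X has_real_derivative 2 * Y t) (at t within {0..T})"
    and DY: "\<And>t. t \<in> {0..T} \<Longrightarrow> (Y has_real_derivative Qd t - (Y t * inverse (\<beta> t) + e t) / \<epsilon>) (at t within {0..T})"
    and De: "\<And>t. t \<in> {0..T} \<Longrightarrow> (e has_real_derivative e' t) (at t within {0..T})"
    and e': "\<And>t. t \<in> {0..T} \<Longrightarrow> e' t * (1 + t) \<le> k * e t"
    and e0: "\<And>t. t \<in> {0..T} \<Longrightarrow> e t \<ge> 0" and X0: "\<And>t. t \<in> {0..T} \<Longrightarrow> X t \<ge> 0"
    and Qd: "\<And>t. t \<in> {0..T} \<Longrightarrow> Qd t * (1 + t) \<le> L * (\<beta> t * e t)"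
    and YQ: "\<And>t. t \<in> {0..T} \<Longrightarrow> (Y t)\<^sup>2 \<le> Qd t * X t"
    and t: "t \<in> {0..T}"
  shows "X t + integral {0..t} (\<lambda>s. \<beta> s * e s) \<le> 8 * (X 0 + \<bar>Y 0\<bar> + e 0)"
proof -
  define I where "I t = integral {0..t} (\<lambda>s. \<beta> s * e s)" for t
  have ce: "continuous_on {0..T} e" by (rule DERIV_continuous_on[OF De])
  have c\<beta>e: "continuous_on {0..T} (\<lambda>s. \<beta> s * e s)"
    by (intro continuous_intros continuous_\<beta> ce) auto
  have DI: "(I has_real_derivative \<beta> s * e s) (at s within {0..T})" if "s \<in> {0..T}" for s
    unfolding I_def by (rule integral_has_real_derivative[OF c\<beta>e that])
  have I0: "I s \<ge> 0" if "s \<in> {0..T}" for s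
    unfolding I_def using that
    by (intro integral_nonneg integrable_continuous_real continuous_on_subset[OF c\<beta>e]
        mult_nonneg_nonneg e0 less_imp_le[OF \<beta>_pos]) auto
  have z: "0 \<in> {0..T}" using T0 by simp
  have main: "X t + I t \<le> 4 * (X 0 + \<bar>Y 0\<bar> + e 0) + Xb / 2"
    if t: "t \<in> {0..T}" and Xb: "\<And>s. s \<in> {0..T} \<Longrightarrow> X s + I s \<le> Xb" for t Xb
  proof -
    have Xb': "X s \<le> Xb" if "s \<in> {0..T}" for s using Xb[OF that] I0[OF that] by linarith
    have Xb0: "Xb \<ge> 0" using Xb'[OF z] X0[OF z] by linarith
    \<comment> \<open>The summand with \<sigma> X removes the term \<epsilon> p \<sigma> Y that
      \<beta>' leaves, but the derivative of \<sigma> in it has the wrong sign. The multiple of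
      \<sigma> with the upper bound Xb decreases and outweighs this, as X \<le> Xb. The other half
      of the dissipation is kept in I / 2.\<close>
    define E where "E t = X t / 2 + \<epsilon> * (\<beta> t * Y t) - (\<epsilon> / 2 * p) * (\<sigma> t * X t) + I t / 2 + (\<epsilon> / 2 * p * Xb) * \<sigma> t" for t
    have "- E 0 \<le> - E t"
    proof (rule nondecreasing_within[where f = "\<lambda>t. - E t"])
      fix s assume "s \<in> {0..t}"
      then have s: "s \<in> {0..T}" "s \<ge> 0" using t by auto
      let ?d = "2 * Y s / 2 + \<epsilon> * (p * \<sigma> s * Y s + (Qd s - (Y s * inverse (\<beta> s) + e s) / \<epsilon>) * \<beta> s)
         - (\<epsilon> / 2 * p) * ((p - 1) * (\<sigma> s / (1 + s)) * X s + 2 * Y s * \<sigma> s) + \<beta> s * e s / 2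
         + (\<epsilon> / 2 * p * Xb) * ((p - 1) * (\<sigma> s / (1 + s)))"
      have "(E has_real_derivative ?d) (at s within {0..T})"
        unfolding E_def[abs_def]
        by (intro DERIV_add DERIV_diff DERIV_cdivide DERIV_cmult DERIV_mult DX DY DERIV_\<beta> DERIV_\<sigma> DI s)
      from DERIV_minus[OF this] show "((\<lambda>t. - E t) has_real_derivative - ?d) (at s within {0..t})"
        by (rule DERIV_subset) (use t in auto)
      have "?d = \<epsilon> * \<beta> s * Qd s - \<beta> s * e s / 2 - (\<epsilon> / 2 * p * (1 - p) * (\<sigma> s / (1 + s))) * (Xb - X s)"
      proof -
        define q r \<delta> w where "q = (Y s * inverse (\<beta> s) + e s) / \<epsilon>" and "r = \<sigma> s / (1 + s)"
          and "\<delta> = \<epsilon> / 2" and "w = \<beta> s * e s / 2"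
        have "\<epsilon> * q = Y s * inverse (\<beta> s) + e s" "inverse (\<beta> s) * \<beta> s = 1" "2 * \<delta> = \<epsilon>" "2 * w = \<beta> s * e s"
          using \<epsilon>(1) \<beta>_pos[OF s(2)] by (auto simp: q_def \<delta>_def w_def)
        moreover have "2 * Y s / 2 = Y s" by simp
        ultimately show ?thesis unfolding q_def[symmetric] r_def[symmetric] \<delta>_def[symmetric] w_def[symmetric]
          by algebra
      qed
      moreover have "\<epsilon> * \<beta> s * Qd s \<le> \<beta> s * e s / 2"
      proof -
        have "Qd s * \<beta> s \<le> L * (\<beta> s * e s)"
        proof (cases "Qd s \<ge> 0")
          case True
          then show ?thesis using Qd[OF s(1)] mult_left_mono[OF \<beta>_le[OF s(2)] True] by linarith
        next
          case False
          then have "Qd s * \<beta> s \<le> 0" using \<beta>_pos[OF s(2)] by (intro mult_nonpos_nonneg) auto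
          moreover have "0 \<le> L * (\<beta> s * e s)" using \<beta>_pos[OF s(2)] e0[OF s(1)] L0 by simp
          ultimately show ?thesis by linarith
        qed
        then have "2 * \<epsilon> * (Qd s * \<beta> s) \<le> 2 * \<epsilon> * (L * (\<beta> s * e s))" using \<epsilon>(1) by simp
        also have "\<dots> \<le> 1 * (\<beta> s * e s)"
          using mult_right_mono[OF \<epsilon>(5), of "\<beta> s * e s"] \<beta>_pos[OF s(2)] e0[OF s(1)] by (simp add: mult_ac)
        finally show ?thesis by (simp add: mult_ac)
      qed
      moreover have "(\<epsilon> / 2 * p * (1 - p) * (\<sigma> s / (1 + s))) * (Xb - X s) \<ge> 0"
        using \<epsilon>(1) p0 p1 \<sigma>_pos[OF s(2)] s(2) Xb'[OF s(1)] by simp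
      ultimately show "0 \<le> - ?d" by linarith
    qed (use t in simp)
    moreover have "E 0 \<le> X 0 + \<bar>Y 0\<bar> + Xb / 16"
    proof -
      have "\<epsilon> * Y 0 \<le> \<epsilon> * \<bar>Y 0\<bar>" "\<epsilon> * \<bar>Y 0\<bar> \<le> 1 * \<bar>Y 0\<bar>"
        using \<epsilon> by (intro mult_left_mono mult_right_mono; simp)+
      moreover have "\<epsilon> / 2 * p * Xb \<le> 1 / 16 * 1 * Xb" using \<epsilon> p0 p1 Xb0 by (intro mult_mono) auto
      moreover have "(\<epsilon> / 2 * p) * X 0 \<ge> 0" using \<epsilon> p0 X0[OF z] by simp
      moreover have "E 0 = X 0 / 2 + \<epsilon> * Y 0 - (\<epsilon> / 2 * p) * X 0 + \<epsilon> / 2 * p * Xb"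
        by (simp add: E_def I_def \<beta>_def \<sigma>_def)
      ultimately show ?thesis using X0[OF z] by argo
    qed
    moreover have "X t / 2 - X t / 8 - X t / 16 - e 0 - I t / 4 + I t / 2 \<le> E t"
    proof -
      note t0 = t[unfolded atLeastAtMost_iff, THEN conjunct1]
      have w: "e t * ((1 + t) * \<beta> t) \<le> e 0 + (k + 2) * I t"
        unfolding I_def by (rule weighted_energy_le[OF De e' e0 t])
      have "(\<beta> t)\<^sup>2 * Qd t \<le> L * (e 0 + (k + 2) * I t)"
      proof (cases "Qd t \<ge> 0")
        case True
        have "(\<beta> t)\<^sup>2 * Qd t \<le> \<beta> t * ((1 + t) * Qd t)"
          using mult_right_mono[OF \<beta>_le[OF t0], of "\<beta> t * Qd t"] True \<beta>_pos[OF t0]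
          by (simp add: power2_eq_square mult_ac)
        also have "\<dots> \<le> \<beta> t * (L * (\<beta> t * e t))"
          using Qd[OF t] \<beta>_pos[OF t0] by (intro mult_left_mono) (auto simp: mult_ac)
        also have "\<dots> = L * (e t * (\<beta> t * \<beta> t))" by simp
        also have "\<dots> \<le> L * (e t * ((1 + t) * \<beta> t))"
          using \<beta>_le[OF t0] \<beta>_pos[OF t0] L0 e0[OF t] by (intro mult_left_mono mult_right_mono) auto
        also have "\<dots> \<le> L * (e 0 + (k + 2) * I t)" using w L0 by (rule mult_left_mono)
        finally show ?thesis .
      next
        case False
        then have "(\<beta> t)\<^sup>2 * Qd t \<le> 0" by (simp add: mult_le_0_iff)
        moreover have "0 \<le> L * (e 0 + (k + 2) * I t)" using L0 e0[OF z] k0 I0[OF t] by simp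
        ultimately show ?thesis by linarith
      qed
      from mult_left_mono[OF this, of "2 * \<epsilon>\<^sup>2"]
      have "2 * (\<epsilon>\<^sup>2 * ((\<beta> t)\<^sup>2 * Qd t)) \<le> (2 * \<epsilon>\<^sup>2 * L) * e 0 + (8 * \<epsilon>\<^sup>2 * L * (k + 2)) * (I t / 4)"
        by (simp add: algebra_simps)
      also have "\<dots> \<le> 1 * e 0 + 1 * (I t / 4)"
        using \<epsilon>(3,4) e0[OF z] I0[OF t] by (intro add_mono mult_right_mono) auto
      finally have q: "2 * (\<epsilon>\<^sup>2 * ((\<beta> t)\<^sup>2 * Qd t)) \<le> e 0 + I t / 4" by simp
      have "(\<epsilon> * (\<beta> t * Y t))\<^sup>2 \<le> \<epsilon>\<^sup>2 * ((\<beta> t)\<^sup>2 * (Qd t * X t))"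
        using YQ[OF t] by (simp add: power_mult_distrib mult_left_mono)
      also have "\<dots> = (\<epsilon>\<^sup>2 * ((\<beta> t)\<^sup>2 * Qd t)) * X t" by simp
      also have "\<dots> \<le> ((e 0 + I t / 4) / 2) * X t" using q X0[OF t] by (intro mult_right_mono) auto
      also have "\<dots> \<le> (X t / 8 + (e 0 + I t / 4))\<^sup>2"
        using zero_le_power2[of "X t / 8 - (e 0 + I t / 4)"] by (simp add: power2_eq_square algebra_simps)
      finally have "\<bar>\<epsilon> * (\<beta> t * Y t)\<bar> \<le> X t / 8 + (e 0 + I t / 4)"
        using X0[OF t] e0[OF z] I0[OF t] abs_le_square_iff[of "\<epsilon> * (\<beta> t * Y t)" "X t / 8 + (e 0 + I t / 4)"]
        by auto
      moreover have "(\<epsilon> / 2 * p) * (\<sigma> t * X t) \<le> (1 / 16 * 1) * (1 * X t)"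
        using \<epsilon> p0 p1 \<sigma>_le1[OF t0] \<sigma>_pos[OF t0] X0[OF t] by (intro mult_mono) auto
      moreover have "(\<epsilon> / 2 * p * Xb) * \<sigma> t \<ge> 0" using \<epsilon> p0 Xb0 \<sigma>_pos[OF t0] by simp
      ultimately show ?thesis unfolding E_def by argo
    qed
    ultimately show ?thesis using X0[OF t] X0[OF z] e0[OF z] I0[OF t] Xb0 by argo
  qed
  have "X t + I t \<le> 2 * (4 * (X 0 + \<bar>Y 0\<bar> + e 0))"
  proof (rule absorb_sup[OF _ T0 main t])
    show "continuous_on {0..T} (\<lambda>t. X t + I t)"
      by (intro continuous_intros DERIV_continuous_on[OF DX] DERIV_continuous_on[OF DI])
  qed
  then show ?thesis by (simp add: I_def)
qed

text \<open>The derivative of M^(-\<gamma>) is 2 \<gamma> \<beta> N, where N = Q1 / M is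
  nonincreasing. Bounding N above by its initial value gives the upper bound on
  M^(-\<gamma>).\<close>

lemma parabolic_scalar_bounds:
  fixes T \<gamma> :: real and M Q1 :: "real \<Rightarrow> real"
  assumes \<gamma>1: "\<gamma> \<ge> 1"
    and M_pos: "\<And>t. t \<in> {0..T} \<Longrightarrow> M t > 0" and Q1: "\<And>t. Q1 t \<ge> 0"
    and DM: "\<And>t. t \<in> {0..T} \<Longrightarrow> (M has_real_derivative - 2 * \<beta> t * M t powr \<gamma> * Q1 t) (at t within {0..T})"
    and mono: "\<And>s t. s \<in> {0..T} \<Longrightarrow> t \<in> {0..T} \<Longrightarrow> s \<le> t \<Longrightarrow> Q1 t * M s \<le> Q1 s * M t"
    and \<kappa>: "\<kappa> > 0" "\<kappa> \<le> \<gamma>" "\<kappa> * (Q1 0 / M 0) \<le> M 0 powr (- \<gamma>)" and t: "t \<in> {0..T}"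
  shows "M t powr (- \<gamma>) \<le> M 0 powr (- \<gamma>) + 2 * \<gamma> * (Q1 0 / M 0) * ((1 + t) * \<beta> t)"
    and "\<kappa> * (M t powr \<gamma> * Q1 t * ((1 + t) * \<beta> t)) \<le> M t" and "M t \<le> M 0" and "Q1 t \<le> (Q1 0 / M 0) * M t"
proof -
  define N where "N t = Q1 t / M t" for t
  have z: "0 \<in> {0..T}" using t by simp
  have N: "N t \<le> N s" if "s \<in> {0..T}" "t \<in> {0..T}" "s \<le> t" for s t
    using mono[OF that] M_pos[OF that(1)] M_pos[OF that(2)] by (simp add: N_def field_simps)
  have N0: "N s \<ge> 0" if "s \<in> {0..T}" for s using M_pos[OF that] Q1 by (simp add: N_def)
  have Dic: "((\<lambda>t. M t powr (- \<gamma>)) has_real_derivative 2 * \<gamma> * \<beta> s * N s) (at s within {0..T})" if s: "s \<in> {0..T}" for s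
    by (rule DERIV_cong[OF DERIV_powr_const[OF DM[OF s] M_pos[OF s]]])
      (use M_pos[OF s] in \<open>simp add: N_def powr_minus field_simps\<close>)
  have t0: "t \<ge> 0" using t by simp
  have "0 - M 0 powr (- \<gamma>) + 2 * \<gamma> * N 0 * ((1 + 0) * \<beta> 0) \<le> 0 - M t powr (- \<gamma>) + 2 * \<gamma> * N 0 * ((1 + t) * \<beta> t)"
  proof (rule nondecreasing_within[where f = "\<lambda>t. 0 - M t powr (- \<gamma>) + 2 * \<gamma> * N 0 * ((1 + t) * \<beta> t)"])
    fix s assume "s \<in> {0..t}"
    then have s: "s \<in> {0..T}" "s \<ge> 0" using t by auto
    show "((\<lambda>t. 0 - M t powr (- \<gamma>) + 2 * \<gamma> * N 0 * ((1 + t) * \<beta> t)) has_real_derivative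
       0 - 2 * \<gamma> * \<beta> s * N s + 2 * \<gamma> * N 0 * ((1 + p) * \<beta> s)) (at s within {0..t})"
      by (intro DERIV_add DERIV_diff DERIV_const DERIV_cmult D_time_\<beta> DERIV_subset[OF Dic] s) (use t in auto)
    have "2 * \<gamma> * \<beta> s * N s * 1 \<le> 2 * \<gamma> * \<beta> s * N 0 * (1 + p)"
      using N[OF z s(1) s(2)] N0[OF s(1)] N0[OF z] \<gamma>1 \<beta>_pos[OF s(2)] p0 by (intro mult_mono) auto
    then show "0 \<le> 0 - 2 * \<gamma> * \<beta> s * N s + 2 * \<gamma> * N 0 * ((1 + p) * \<beta> s)" by (simp add: mult_ac)
  qed (use t in auto)
  moreover have "2 * \<gamma> * N 0 * ((1 + 0) * \<beta> 0) \<ge> 0" using \<gamma>1 N0[OF z] by (simp add: \<beta>_def)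
  ultimately show "M t powr (- \<gamma>) \<le> M 0 powr (- \<gamma>) + 2 * \<gamma> * (Q1 0 / M 0) * ((1 + t) * \<beta> t)"
    unfolding N_def by linarith
  \<comment> \<open>N is frozen at the final time t, where it is smallest on [0, t]; this gives the
    lower bound on the growth of M^(-\<gamma>), hence the decay.\<close>
  have "M 0 powr (- \<gamma>) - \<kappa> * N t * ((1 + 0) * \<beta> 0) \<le> M t powr (- \<gamma>) - \<kappa> * N t * ((1 + t) * \<beta> t)"
  proof (rule nondecreasing_within[where f = "\<lambda>s. M s powr (- \<gamma>) - \<kappa> * N t * ((1 + s) * \<beta> s)"])
    fix s assume "s \<in> {0..t}"
    then have s: "s \<in> {0..T}" "s \<ge> 0" "s \<le> t" using t by auto
    show "((\<lambda>s. M s powr (- \<gamma>) - \<kappa> * N t * ((1 + s) * \<beta> s)) has_real_derivative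
       2 * \<gamma> * \<beta> s * N s - \<kappa> * N t * ((1 + p) * \<beta> s)) (at s within {0..t})"
      by (intro DERIV_diff DERIV_cmult D_time_\<beta> DERIV_subset[OF Dic] s) (use t in auto)
    have "(\<kappa> * N t * \<beta> s) * (1 + p) \<le> (\<gamma> * N s * \<beta> s) * 2"
      using \<kappa> N[OF s(1) t s(3)] N0[OF s(1)] N0[OF t] \<gamma>1 \<beta>_pos[OF s(2)] p0 p1 by (intro mult_mono) auto
    then show "0 \<le> 2 * \<gamma> * \<beta> s * N s - \<kappa> * N t * ((1 + p) * \<beta> s)" by (simp add: mult_ac)
  qed (use t in auto)
  moreover have "\<kappa> * N t \<le> M 0 powr (- \<gamma>)"
    using \<kappa>(3) mult_left_mono[OF N[OF z t t0], of \<kappa>] \<kappa>(1) by (simp add: N_def)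
  ultimately have "\<kappa> * N t * ((1 + t) * \<beta> t) \<le> M t powr (- \<gamma>)" by (simp add: \<beta>_def)
  from mult_right_mono[OF this, of "M t powr \<gamma> * M t"]
  show "\<kappa> * (M t powr \<gamma> * Q1 t * ((1 + t) * \<beta> t)) \<le> M t"
    using M_pos[OF t] by (simp add: N_def powr_minus mult_ac)
  have "- M 0 \<le> - M t"
  proof (rule nondecreasing_within[where f = "\<lambda>t. - M t"])
    fix s assume s: "s \<in> {0..t}"
    show "((\<lambda>t. - M t) has_real_derivative - (- 2 * \<beta> s * M s powr \<gamma> * Q1 s)) (at s within {0..t})"
      by (intro DERIV_minus DERIV_subset[OF DM]) (use s t in auto)
    show "0 \<le> - (- 2 * \<beta> s * M s powr \<gamma> * Q1 s)" using \<beta>_pos[of s] Q1[of s] s by simp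
  qed (use t in simp)
  then show "M t \<le> M 0" by simp
  show "Q1 t \<le> (Q1 0 / M 0) * M t" using N[OF z t t0] M_pos[OF t] by (simp add: N_def field_simps)
qed

end

text \<open>A product rule for a merely continuous G: the left factor vanishes at t, so only the
  difference quotient of F enters. It serves where BU' or Au is continuous without being known to be
  differentiable.\<close>

lemma DERIV_inner_vanishing:
  fixes F G :: "real \<Rightarrow> 'a::real_inner"
  assumes "(F has_vector_derivative F') (at t within S)" and "continuous (at t within S) G"
  shows "((\<lambda>s. (F s - F t) \<bullet> G s) has_real_derivative F' \<bullet> G t) (at t within S)"
proof -
  have "((\<lambda>s. norm ((1 / (s - t)) *\<^sub>R (F s - F t) - F')) \<longlongrightarrow> 0) (at t within S)"
  proof (rule Lim_transform_within[OF _ zero_less_one])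
    show "((\<lambda>s. norm ((F s - F t) - (s - t) *\<^sub>R F') / norm (s - t)) \<longlongrightarrow> 0) (at t within S)"
      using assms(1) by (simp add: has_vector_derivative_def has_derivative_iff_norm)
    fix s assume "0 < dist s t"
    then have "(1 / (s - t)) *\<^sub>R (F s - F t) - F' = (1 / (s - t)) *\<^sub>R ((F s - F t) - (s - t) *\<^sub>R F')"
      by (simp add: scaleR_diff_right)
    then show "norm ((F s - F t) - (s - t) *\<^sub>R F') / norm (s - t) = norm ((1 / (s - t)) *\<^sub>R (F s - F t) - F')"
      by simp
  qed
  then have "((\<lambda>s. (1 / (s - t)) *\<^sub>R (F s - F t)) \<longlongrightarrow> F') (at t within S)"
    using Lim_null[of "\<lambda>s. (1 / (s - t)) *\<^sub>R (F s - F t)"] tendsto_norm_zero_iff by blast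
  then have "((\<lambda>s. ((1 / (s - t)) *\<^sub>R (F s - F t)) \<bullet> G s) \<longlongrightarrow> F' \<bullet> G t) (at t within S)"
    using assms(2) unfolding continuous_within by (intro tendsto_inner)
  then show ?thesis by (simp add: has_field_derivative_iff)
qed

lemma DERIV_inner:
  fixes F G :: "real \<Rightarrow> 'a::real_inner"
  assumes "(F has_vector_derivative F') (at t within S)" and "(G has_vector_derivative G') (at t within S)"
  shows "((\<lambda>s. F s \<bullet> G s) has_real_derivative F' \<bullet> G t + F t \<bullet> G') (at t within S)"
  using bounded_bilinear.has_vector_derivative[OF bounded_bilinear_inner assms]
  by (simp add: has_real_derivative_iff_has_vector_derivative add.commute)

lemma DERIV_norm_square:
  fixes F :: "real \<Rightarrow> 'a::real_inner"
  assumes "(F has_vector_derivative F') (at t within S)"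
  shows "((\<lambda>s. (norm (F s))\<^sup>2) has_real_derivative 2 * (F t \<bullet> F')) (at t within S)"
  using DERIV_inner[OF assms assms] by (simp add: power2_norm_eq_inner inner_commute)

lemma vector_derivative_continuous_on:
  "(\<And>t. t \<in> S \<Longrightarrow> (f has_vector_derivative f' t) (at t within S)) \<Longrightarrow> continuous_on S f"
  by (auto simp: continuous_on_eq_continuous_within intro: has_vector_derivative_continuous)

lemma inner_square_le: "((x::'a::real_inner) \<bullet> y)\<^sup>2 \<le> (norm x)\<^sup>2 * (norm y)\<^sup>2"
  using Cauchy_Schwarz_ineq[of x y] by (simp add: power2_norm_eq_inner)

lemma continuous_on_interval_bounded:
  fixes f :: "real \<Rightarrow> real"
  assumes "continuous_on {a..b} f"
  obtains C where "\<And>t. t \<in> {a..b} \<Longrightarrow> \<bar>f t\<bar> \<le> C"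
proof -
  have "bounded (f ` {a..b})"
    by (rule compact_imp_bounded[OF compact_continuous_image[OF assms compact_Icc]])
  then obtain C where "\<forall>x\<in>f ` {a..b}. norm x \<le> C" unfolding bounded_iff ..
  then show ?thesis by (intro that[of C]) auto
qed

section \<open>Hyperbolic solutions in the abstract setting\<close>

locale kirchhoff = regularized_operator D B K + dissipation p
  for D :: "'a::real_inner set" and B :: "'a \<Rightarrow> 'a" and K :: "nat \<Rightarrow> 'a \<Rightarrow> 'a" and p :: real +
  fixes \<gamma> :: real
  assumes \<gamma>1: "\<gamma> \<ge> 1"
begin

lemma K_commute2: "x \<in> D \<Longrightarrow> B x \<in> D \<Longrightarrow> B (B (K n x)) = K n (B (B x))"
  by (simp add: K_commute)

lemma B_minus: "x \<in> D \<Longrightarrow> y \<in> D \<Longrightarrow> B (x - y) = B x - B y"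
  using B_add[of x "(-1) *\<^sub>R y"] B_scale[of y "-1"] subspace_scale[OF subspace_D, of y "-1"] by simp

lemma norm_B_square: "x \<in> D \<Longrightarrow> B x \<in> D \<Longrightarrow> (norm (B x))\<^sup>2 = B (B x) \<bullet> x"
  using B_sym[of "B x" x] by (simp add: power2_norm_eq_inner)

definition hyp_sol :: "real \<Rightarrow> (real \<Rightarrow> 'a) \<Rightarrow> (real \<Rightarrow> 'a) \<Rightarrow> (real \<Rightarrow> 'a) \<Rightarrow> bool" where
  "hyp_sol \<epsilon> U U1 U2 \<longleftrightarrow>
    (\<forall>t\<ge>0. (U has_vector_derivative U1 t) (at t within {0..}) \<and>
       (U1 has_vector_derivative U2 t) (at t within {0..}) \<and>
       ((\<lambda>s. B (U s)) has_vector_derivative B (U1 t)) (at t within {0..}) \<and>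
       U t \<in> D \<and> B (U t) \<in> D \<and> U1 t \<in> D \<and>
       \<epsilon> *\<^sub>R U2 t + inverse (\<beta> t) *\<^sub>R U1 t + ((norm (B (U t)))\<^sup>2) powr \<gamma> *\<^sub>R B (B (U t)) = 0) \<and>
    continuous_on {0..} (\<lambda>t. B (U1 t)) \<and> continuous_on {0..} (\<lambda>t. B (B (U t)))"

context
  fixes \<epsilon> :: real and U U1 U2 :: "real \<Rightarrow> 'a"
  assumes sol: "hyp_sol \<epsilon> U U1 U2" and \<epsilon>0: "\<epsilon> > 0"
begin

private definition "M t = (norm (B (U t)))\<^sup>2"
private definition "H t = B (B (U t)) \<bullet> U1 t"

lemma hyp_D: assumes "t \<ge> 0"
  shows "(U has_vector_derivative U1 t) (at t within {0..})"
    "(U1 has_vector_derivative U2 t) (at t within {0..})"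
    "((\<lambda>s. B (U s)) has_vector_derivative B (U1 t)) (at t within {0..})"
    "U t \<in> D" "B (U t) \<in> D" "U1 t \<in> D"
    "U2 t = (- 1 / \<epsilon>) *\<^sub>R (inverse (\<beta> t) *\<^sub>R U1 t + ((norm (B (U t)))\<^sup>2) powr \<gamma> *\<^sub>R B (B (U t)))"
proof -
  let ?r = "inverse (\<beta> t) *\<^sub>R U1 t + ((norm (B (U t)))\<^sup>2) powr \<gamma> *\<^sub>R B (B (U t))"
  have "\<epsilon> *\<^sub>R U2 t + ?r = 0" using sol assms by (simp add: hyp_sol_def add.assoc)
  then have "\<epsilon> *\<^sub>R U2 t = - ?r" by (rule add_eq_0_iff2[THEN iffD1])
  then have "(1 / \<epsilon>) *\<^sub>R (\<epsilon> *\<^sub>R U2 t) = (1 / \<epsilon>) *\<^sub>R (- ?r)" by (rule arg_cong)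
  moreover have "(1 / \<epsilon>) *\<^sub>R (\<epsilon> *\<^sub>R U2 t) = U2 t" using \<epsilon>0 by simp
  moreover have "(1 / \<epsilon>) *\<^sub>R (- x) = (- 1 / \<epsilon>) *\<^sub>R x" for x :: 'a by simp
  ultimately show "U2 t = (- 1 / \<epsilon>) *\<^sub>R ?r" by metis
qed (use sol assms in \<open>auto simp: hyp_sol_def\<close>)

lemma hyp_U2_inner:
  "t \<ge> 0 \<Longrightarrow> x \<bullet> U2 t = - (1 / \<epsilon>) * (inverse (\<beta> t) * (x \<bullet> U1 t) + ((norm (B (U t)))\<^sup>2) powr \<gamma> * (x \<bullet> B (B (U t))))"
  by (simp add: hyp_D(7) inner_add_right)

lemma hyp_continuous:
  "continuous_on {0..} U" "continuous_on {0..} U1" "continuous_on {0..} (\<lambda>t. B (U t))"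
  "continuous_on {0..} (\<lambda>t. B (U1 t))" "continuous_on {0..} (\<lambda>t. B (B (U t)))"
proof -
  show "continuous_on {0..} U" by (rule vector_derivative_continuous_on[of _ U U1]) (simp add: hyp_D)
  show "continuous_on {0..} U1" by (rule vector_derivative_continuous_on[of _ U1 U2]) (simp add: hyp_D(2))
  show "continuous_on {0..} (\<lambda>t. B (U t))"
    by (rule vector_derivative_continuous_on[of _ _ "\<lambda>t. B (U1 t)"]) (simp add: hyp_D)
qed (use sol in \<open>auto simp: hyp_sol_def\<close>)

lemma hyp_H_eq: "t \<ge> 0 \<Longrightarrow> B (B (U t)) \<bullet> U1 t = B (U t) \<bullet> B (U1 t)"
  by (simp add: B_sym hyp_D)

lemma hyp_DM: "t \<ge> 0 \<Longrightarrow> ((\<lambda>t. (norm (B (U t)))\<^sup>2) has_real_derivative 2 * (B (B (U t)) \<bullet> U1 t)) (at t within {0..})"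
  using DERIV_norm_square[OF hyp_D(3)] by (simp add: hyp_H_eq)

text \<open>AU is only known to be continuous. Near t the product at time s is split as <BU(s) -
  BU(t), BU'(s)> + <AU(t), U'(s)>: the first left factor vanishes at t, the second is
  constant.\<close>

lemma hyp_DH:
  assumes t: "t \<ge> 0"
  shows "((\<lambda>t. B (B (U t)) \<bullet> U1 t) has_real_derivative (norm (B (U1 t)))\<^sup>2
    - ((B (B (U t)) \<bullet> U1 t) * inverse (\<beta> t) + ((norm (B (U t)))\<^sup>2) powr \<gamma> * (norm (B (B (U t))))\<^sup>2) / \<epsilon>)
    (at t within {0..})" (is "(_ has_real_derivative ?d) _")
proof -
  have "((\<lambda>s. (B (U s) - B (U t)) \<bullet> B (U1 s)) has_real_derivative B (U1 t) \<bullet> B (U1 t)) (at t within {0..})"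
    by (rule DERIV_inner_vanishing[OF hyp_D(3)[OF t]])
      (use hyp_continuous(4) t in \<open>simp add: continuous_on_eq_continuous_within\<close>)
  from DERIV_add[OF this DERIV_inner[OF has_vector_derivative_const[of "B (B (U t))"] hyp_D(2)[OF t]]]
  have "((\<lambda>s. (B (U s) - B (U t)) \<bullet> B (U1 s) + B (B (U t)) \<bullet> U1 s) has_real_derivative ?d) (at t within {0..})"
    by (rule DERIV_cong) (simp add: hyp_U2_inner[OF t] power2_norm_eq_inner mult.commute)
  then show ?thesis
    by (rule has_field_derivative_transform_within[OF _ zero_less_one])
      (use t in \<open>auto simp: inner_diff_left B_sym hyp_D\<close>)
qed

lemma hyp_DQ3:
  assumes t: "t \<ge> 0"
  shows "((\<lambda>t. (norm (U1 t))\<^sup>2) has_real_derivative - (2 / \<epsilon>) * (inverse (\<beta> t) * (norm (U1 t))\<^sup>2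
    + ((norm (B (U t)))\<^sup>2) powr \<gamma> * (B (B (U t)) \<bullet> U1 t))) (at t within {0..})"
  by (rule DERIV_cong[OF DERIV_norm_square[OF hyp_D(2)[OF t]]])
    (simp add: hyp_U2_inner[OF t] power2_norm_eq_inner inner_commute)

text \<open>The formal derivative contains the product of AU with B applied to BU', which need not
  make sense. After applying \<open>K n\<close> its two occurrences cancel, because the weight
  M^(-\<gamma>) is inverse to the coefficient of the equation. What remains is quadratic in BU', so
  it converges and is dominated.\<close>

lemma hyp_DE:
  assumes pos: "\<And>t. t \<in> {0..T} \<Longrightarrow> (norm (B (U t)))\<^sup>2 > 0" and t: "t \<in> {0..T}"
  shows "((\<lambda>t. \<epsilon> * (norm (B (U1 t)))\<^sup>2 * ((norm (B (U t)))\<^sup>2) powr (- \<gamma>) + (norm (B (B (U t))))\<^sup>2)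
     has_real_derivative - (2 * inverse (\<beta> t) + 2 * \<gamma> * \<epsilon> * (H t * inverse (M t))) * (norm (B (U1 t)))\<^sup>2
       * M t powr (- \<gamma>)) (at t within {0..T})"
proof -
  define ic where "ic t = M t powr (- \<gamma>)" for t
  define w where "w t = - (2 * inverse (\<beta> t) + 2 * \<gamma> * \<epsilon> * (H t * inverse (M t)))" for t
  have Mp: "M s > 0" if "s \<in> {0..T}" for s using pos[OF that] by (simp add: M_def)
  have sub: "{0..T} \<subseteq> {0..}" by auto
  have Dic: "(ic has_real_derivative (- \<gamma>) * (2 * H s / M s) * ic s) (at s within {0..T})" if s: "s \<in> {0..T}" for s
    unfolding ic_def[abs_def] M_def[abs_def] H_def
    by (rule DERIV_powr_const[OF DERIV_subset[OF hyp_DM sub]]) (use s pos in auto)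
  have cM: "continuous_on {0..T} M" unfolding M_def[abs_def]
    by (intro continuous_intros continuous_on_subset[OF hyp_continuous(3)] sub)
  have cw: "continuous_on {0..T} (\<lambda>t. w t * (norm (B (U1 t)))\<^sup>2 * ic t)" unfolding w_def H_def[abs_def] ic_def
    using Mp \<beta>_pos
    by (intro continuous_intros continuous_on_subset[OF hyp_continuous(2)] continuous_on_subset[OF hyp_continuous(4)]
      continuous_on_subset[OF hyp_continuous(5)] continuous_\<beta> cM sub) (force simp: less_imp_neq)+
  obtain C where C: "\<And>t. t \<in> {0..T} \<Longrightarrow> \<bar>w t * (norm (B (U1 t)))\<^sup>2 * ic t\<bar> \<le> C"
    using continuous_on_interval_bounded[OF cw] by blast
  have lim: "(\<lambda>n. (norm (K n x))\<^sup>2) \<longlonglongrightarrow> (norm x)\<^sup>2" for x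
    by (intro tendsto_intros K_lim)
  have "((\<lambda>t. \<epsilon> * (norm (B (U1 t)))\<^sup>2 * ic t + (norm (B (B (U t))))\<^sup>2)
     has_real_derivative w t * (norm (B (U1 t)))\<^sup>2 * ic t) (at t within {0..T})"
  proof (rule DERIV_within_pointwise_limit[OF _ _ _ _ cw t])
    fix n s assume s: "s \<in> {0..T}"
    then have s0: "s \<ge> 0" by simp
    note sp = hyp_D[OF s0]
    let ?x = "B (K n (U1 s))" and ?y = "B (B (K n (U s)))"
    have d1: "((\<lambda>s. B (K n (U1 s))) has_vector_derivative B (K n (U2 s))) (at s within {0..T})"
      by (rule bounded_linear.has_vector_derivative[OF BK_bl(1)])
        (rule has_vector_derivative_within_subset[OF sp(2) sub])
    have d2: "((\<lambda>s. B (B (K n (U s)))) has_vector_derivative B (B (K n (U1 s)))) (at s within {0..T})"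
      by (rule bounded_linear.has_vector_derivative[OF BK_bl(2)])
        (rule has_vector_derivative_within_subset[OF sp(1) sub])
    have "K n (U2 s) = (- 1 / \<epsilon>) *\<^sub>R (inverse (\<beta> s) *\<^sub>R K n (U1 s) + M s powr \<gamma> *\<^sub>R ?y)"
      unfolding sp(7) M_def K_commute2[OF sp(4,5)]
      by (simp only: linear_simps[OF K_bl])
    moreover have "?x \<bullet> B (K n (U2 s)) = B ?x \<bullet> K n (U2 s)" by (rule B_sym[OF K_D(2) K_D(1), symmetric])
    moreover have "B ?x \<bullet> K n (U1 s) = (norm ?x)\<^sup>2"
      unfolding power2_norm_eq_inner by (rule B_sym[OF K_D(2) K_D(1)])
    ultimately have "?x \<bullet> B (K n (U2 s)) = (- 1 / \<epsilon>) * (inverse (\<beta> s) * (norm ?x)\<^sup>2 + M s powr \<gamma> * (?y \<bullet> B ?x))"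
      by (simp only: inner_scaleR_right inner_add_right inner_commute[of ?y])
    then have "\<epsilon> * (?x \<bullet> B (K n (U2 s))) = - (inverse (\<beta> s) * (norm ?x)\<^sup>2 + M s powr \<gamma> * (?y \<bullet> B ?x))"
      using \<epsilon>0 by simp
    moreover have "M s powr \<gamma> * ic s = 1" using Mp[OF s] by (simp add: ic_def powr_minus)
    ultimately have "\<epsilon> * ((2 * (?x \<bullet> B (K n (U2 s)))) * ic s + ((- \<gamma>) * (2 * H s / M s) * ic s) * (norm ?x)\<^sup>2)
       + 2 * (?y \<bullet> B ?x) = w s * (norm ?x)\<^sup>2 * ic s"
      unfolding w_def divide_inverse by algebra
    moreover from DERIV_add[OF DERIV_cmult[OF DERIV_mult[OF DERIV_norm_square[OF d1] Dic[OF s]], of \<epsilon>] DERIV_norm_square[OF d2]]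
    have "((\<lambda>t. \<epsilon> * ((norm (B (K n (U1 t))))\<^sup>2 * ic t) + (norm (B (B (K n (U t)))))\<^sup>2) has_real_derivative
      \<epsilon> * ((2 * (?x \<bullet> B (K n (U2 s)))) * ic s + ((- \<gamma>) * (2 * H s / M s) * ic s) * (norm ?x)\<^sup>2)
       + 2 * (?y \<bullet> B ?x)) (at s within {0..T})" .
    ultimately show "((\<lambda>t. \<epsilon> * (norm (B (K n (U1 t))))\<^sup>2 * ic t + (norm (B (B (K n (U t)))))\<^sup>2) has_real_derivative
      w s * (norm (B (K n (U1 s))))\<^sup>2 * ic s) (at s within {0..T})"
      by (simp add: mult.assoc)
    have "\<bar>w s * ic s\<bar> * (norm (B (K n (U1 s))))\<^sup>2 \<le> \<bar>w s * ic s\<bar> * (norm (B (U1 s)))\<^sup>2"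
      unfolding K_commute[OF sp(6)] by (intro mult_left_mono power_mono K_norm) auto
    then show "\<bar>w s * (norm (B (K n (U1 s))))\<^sup>2 * ic s\<bar> \<le> C"
      using C[OF s] by (simp add: abs_mult mult_ac)
  next
    fix s assume s: "s \<in> {0..T}"
    then have s0: "s \<ge> 0" by simp
    note sp = hyp_D[OF s0]
    show "(\<lambda>n. \<epsilon> * (norm (B (K n (U1 s))))\<^sup>2 * ic s + (norm (B (B (K n (U s)))))\<^sup>2)
       \<longlonglongrightarrow> \<epsilon> * (norm (B (U1 s)))\<^sup>2 * ic s + (norm (B (B (U s))))\<^sup>2"
      unfolding K_commute[OF sp(6)] K_commute2[OF sp(4,5)] by (intro tendsto_intros lim)
    show "(\<lambda>n. w s * (norm (B (K n (U1 s))))\<^sup>2 * ic s) \<longlonglongrightarrow> w s * (norm (B (U1 s)))\<^sup>2 * ic s"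
      unfolding K_commute[OF sp(6)] by (intro tendsto_intros lim)
  qed
  then show ?thesis by (simp add: ic_def w_def M_def)
qed

lemma hyp_scalar:
  assumes "T \<ge> 0" and "\<And>t. t \<in> {0..T} \<Longrightarrow> (norm (B (U t)))\<^sup>2 > 0"
    and "\<And>t. t \<in> {0..T} \<Longrightarrow> 8 * (\<gamma> + 1) * \<epsilon> * \<bar>B (B (U t)) \<bullet> U1 t\<bar> \<le> (norm (B (U t)))\<^sup>2 * inverse (\<beta> t)"
  shows "hyperbolic_scalar p \<gamma> \<epsilon> T (\<lambda>t. (norm (B (U t)))\<^sup>2) (\<lambda>t. B (B (U t)) \<bullet> U1 t)
    (\<lambda>t. (norm (B (B (U t))))\<^sup>2) (\<lambda>t. (norm (B (U1 t)))\<^sup>2) (\<lambda>t. (norm (U1 t))\<^sup>2)"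
proof (unfold_locales, goal_cases)
  case (5 t)
  show ?case by (rule DERIV_subset[OF hyp_DM]) (use 5 in auto)
next
  case (6 t)
  show ?case by (rule DERIV_subset[OF hyp_DH]) (use 6 in auto)
next
  case (7 t)
  show ?case using hyp_DE[OF assms(2) 7] by (simp add: M_def H_def)
next
  case (8 t)
  show ?case by (rule DERIV_subset[OF hyp_DQ3]) (use 8 in auto)
next
  case (9 t)
  show ?case using inner_square_le[of "B (U t)" "B (U1 t)"] 9 by (simp add: hyp_H_eq)
next
  case (10 t)
  show ?case by (rule inner_square_le)
qed (use assms \<gamma>1 \<epsilon>0 in auto)

end

end

lemma eventually_at_right_mult_le:
  fixes c d :: real
  assumes "d > 0"
  shows "\<forall>\<^sub>F \<epsilon> in at_right 0. c * \<epsilon> \<le> d"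
proof -
  have "((\<lambda>\<epsilon>. c * \<epsilon>) \<longlongrightarrow> c * 0) (at_right 0)" by (intro tendsto_intros)
  then have "\<forall>\<^sub>F \<epsilon> in at_right 0. c * \<epsilon> < d" using assms by (intro order_tendstoD) auto
  then show ?thesis by eventually_elim simp
qed

context kirchhoff
begin

text \<open>Formulated for a position and a velocity, so that the hyperbolic and the parabolic
  solution satisfy the same list with one constant and can exchange roles in the error
  estimates.\<close>

definition decay_bounds :: "real \<Rightarrow> (real \<Rightarrow> 'a) \<Rightarrow> (real \<Rightarrow> 'a) \<Rightarrow> real \<Rightarrow> bool" where
  "decay_bounds L U U1 t \<longleftrightarrow> (let M = \<lambda>t. (norm (B (U t)))\<^sup>2 in
     M t > 0 \<and> M t powr \<gamma> * (norm (B (B (U t))))\<^sup>2 * ((1 + t) * \<beta> t) \<le> L * M t \<and>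
     (norm (B (B (U t))))\<^sup>2 \<le> L * M t \<and> (norm (U1 t))\<^sup>2 * (1 + t) \<le> L * (\<beta> t * (M t powr \<gamma> * M t)) \<and>
     \<bar>B (B (U t)) \<bullet> U1 t\<bar> * (1 + t) \<le> L * M t \<and>
     integral {0..t} (\<lambda>s. \<beta> s * (M s powr \<gamma> * M s)) \<le> L \<and> (M t powr \<gamma> * M t) * ((1 + t) * \<beta> t) \<le> L)"

text \<open>Together with \<beta>(T) \<le> 1 + T, the bound on |H| (1 + T) returns the bootstrap
  hypothesis with half the constant when 16 (\<gamma> + 1) L \<epsilon> \<le> 1. The remaining
  margin M / (2 \<beta>) is bounded below by the exponential estimate, which provides the function
  \<open>G\<close>.\<close>

lemma hyp_bootstrap:
  assumes sol: "hyp_sol \<epsilon> U U1 U2" and \<epsilon>0: "\<epsilon> > 0" and t: "t \<ge> 0"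
    and init: "8 * (\<gamma> + 1) * \<epsilon> * \<bar>B (B (U 0)) \<bullet> U1 0\<bar> < (norm (B (U 0)))\<^sup>2"
    and L0: "16 * (\<gamma> + 1) * L * \<epsilon> \<le> 1"
    and imp: "\<And>T. T \<ge> 0 \<Longrightarrow> hyperbolic_scalar p \<gamma> \<epsilon> T (\<lambda>t. (norm (B (U t)))\<^sup>2) (\<lambda>t. B (B (U t)) \<bullet> U1 t)
      (\<lambda>t. (norm (B (B (U t))))\<^sup>2) (\<lambda>t. (norm (B (U1 t)))\<^sup>2) (\<lambda>t. (norm (U1 t))\<^sup>2) \<Longrightarrow>
      \<bar>B (B (U T)) \<bullet> U1 T\<bar> * (1 + T) \<le> L * (norm (B (U T)))\<^sup>2 \<and>
      (norm (B (U 0)))\<^sup>2 * exp (- (2 * L * T)) \<le> (norm (B (U T)))\<^sup>2"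
  shows "hyperbolic_scalar p \<gamma> \<epsilon> t (\<lambda>t. (norm (B (U t)))\<^sup>2) (\<lambda>t. B (B (U t)) \<bullet> U1 t)
      (\<lambda>t. (norm (B (B (U t))))\<^sup>2) (\<lambda>t. (norm (B (U1 t)))\<^sup>2) (\<lambda>t. (norm (U1 t))\<^sup>2)"
proof -
  define M where "M t = (norm (B (U t)))\<^sup>2" for t
  define H where "H t = B (B (U t)) \<bullet> U1 t" for t
  define F where "F t = M t * inverse (\<beta> t) - 8 * (\<gamma> + 1) * \<epsilon> * \<bar>H t\<bar>" for t
  define G where "G t = M 0 * exp (- (2 * L * t)) * inverse (\<beta> t) / 2" for t
  note cont = hyp_continuous[OF sol \<epsilon>0]
  have M0: "M 0 > 0" using init \<gamma>1 \<epsilon>0 unfolding M_def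
    by (intro le_less_trans[OF _ init]) auto
  have scal: "hyperbolic_scalar p \<gamma> \<epsilon> T (\<lambda>t. (norm (B (U t)))\<^sup>2) (\<lambda>t. B (B (U t)) \<bullet> U1 t)
      (\<lambda>t. (norm (B (B (U t))))\<^sup>2) (\<lambda>t. (norm (B (U1 t)))\<^sup>2) (\<lambda>t. (norm (U1 t))\<^sup>2)"
    if T: "T \<ge> 0" and pos: "\<And>t. t \<in> {0..T} \<Longrightarrow> F t > 0" for T
  proof (rule hyp_scalar[OF sol \<epsilon>0 T])
    fix s assume s: "s \<in> {0..T}"
    have *: "8 * (\<gamma> + 1) * \<epsilon> * \<bar>H s\<bar> < M s * inverse (\<beta> s)" using pos[OF s] by (simp add: F_def)
    then show "8 * (\<gamma> + 1) * \<epsilon> * \<bar>B (B (U s)) \<bullet> U1 s\<bar> \<le> (norm (B (U s)))\<^sup>2 * inverse (\<beta> s)"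
      by (simp add: M_def H_def)
    have "0 \<le> 8 * (\<gamma> + 1) * \<epsilon> * \<bar>H s\<bar>" using \<gamma>1 \<epsilon>0 by simp
    then have "0 < M s * inverse (\<beta> s)" using * by linarith
    then show "0 < (norm (B (U s)))\<^sup>2" using \<beta>_pos[of s] s by (simp add: M_def zero_less_mult_iff)
  qed
  have "F s > 0" if "s \<ge> 0" for s
  proof (rule positive_bootstrap[of F G])
    show "continuous_on {0..} F" unfolding F_def M_def H_def
      using \<beta>_pos by (intro continuous_intros cont continuous_\<beta>) (auto simp: less_imp_neq[symmetric])
    show "continuous_on {0..} G" unfolding G_def
      using \<beta>_pos by (intro continuous_intros continuous_\<beta>) (auto simp: less_imp_neq[symmetric])
    show "G T > 0" if "T \<ge> 0" for T using M0 \<beta>_pos[OF that] by (simp add: G_def)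
    show "F 0 > 0" using init by (simp add: F_def M_def H_def \<beta>_def)
    fix T assume T: "T \<ge> 0" and pos: "\<And>t. t \<in> {0..T} \<Longrightarrow> F t > 0"
    have b: "\<bar>H T\<bar> * (1 + T) \<le> L * M T" "M 0 * exp (- (2 * L * T)) \<le> M T"
      using imp[OF T scal[OF T pos]] by (auto simp: M_def H_def)
    have \<beta>T: "\<beta> T > 0" "inverse (1 + T) \<le> inverse (\<beta> T)" using \<beta>_pos[OF T] \<beta>_le[OF T] by auto
    have "8 * (\<gamma> + 1) * \<epsilon> * (\<bar>H T\<bar> * (1 + T)) \<le> 8 * (\<gamma> + 1) * \<epsilon> * (L * M T)"
      using b(1) \<gamma>1 \<epsilon>0 by (intro mult_left_mono) auto
    also have "\<dots> = (1 / 2) * ((16 * (\<gamma> + 1) * L * \<epsilon>) * M T)" by simp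
    also have "\<dots> \<le> (1 / 2) * (1 * M T)"
      using L0 by (intro mult_left_mono mult_right_mono) (auto simp: M_def)
    finally have "(8 * (\<gamma> + 1) * \<epsilon> * \<bar>H T\<bar>) * (1 + T) \<le> (1 / 2) * M T" by (simp only: mult.assoc mult_1)
    then have "8 * (\<gamma> + 1) * \<epsilon> * \<bar>H T\<bar> \<le> ((1 / 2) * M T) * inverse (1 + T)"
      using T by (simp add: field_simps)
    also have "\<dots> \<le> ((1 / 2) * M T) * inverse (\<beta> T)"
      using \<beta>T by (intro mult_left_mono) (auto simp: M_def)
    finally have "M T * inverse (\<beta> T) / 2 \<le> F T" by (simp add: F_def)
    moreover have "G T \<le> M T * inverse (\<beta> T) / 2"
      unfolding G_def using b(2) \<beta>T by (intro divide_right_mono mult_right_mono) auto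
    ultimately show "G T \<le> F T" by linarith
  qed (use that in simp)
  then show ?thesis by (intro scal t) auto
qed

lemma hyperbolic_estimates:
  assumes u: "u0 \<in> D" "B u0 \<in> D" "u1 \<in> D" "B u0 \<noteq> 0"
  obtains L where "L > 0" and "\<forall>\<^sub>F \<epsilon> in at_right 0. \<epsilon> > 0 \<and> (\<forall>U U1 U2 t.
    hyp_sol \<epsilon> U U1 U2 \<longrightarrow> U 0 = u0 \<longrightarrow> U1 0 = u1 \<longrightarrow> t \<ge> 0 \<longrightarrow> decay_bounds L U U1 t)"
proof -
  define M0 where "M0 = (norm (B u0))\<^sup>2"
  define i0 where "i0 = M0 powr (- \<gamma>)"
  \<comment> \<open>All constants are fixed before \<epsilon>. \<open>Pb\<close> bounds P at time 0
    for every \<epsilon> \<le> 1, the 1 keeping it positive; \<open>L1\<close> adds the initial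
    value of V to 4 / \<kappa>; \<open>k\<close> bounds 1 + t times the logarithmic derivative (2
    \<gamma> + 2) h of c M.\<close>
  define Pb where "Pb = ((norm (B u1))\<^sup>2 * i0 + (norm (B (B u0)))\<^sup>2) * inverse M0 + 1"
  define \<kappa> where "\<kappa> = min (\<gamma> / 2) (i0 / (4 * Pb))"
  define L1 where "L1 = 4 / \<kappa> + (norm u1)\<^sup>2 * (i0 * inverse M0)"
  define k where "k = (2 * \<gamma> + 2) * L1"
  define e0 where "e0 = M0 powr \<gamma> * M0"
  define C0 where "C0 = 8 * ((norm u0)\<^sup>2 + \<bar>u1 \<bullet> u0\<bar> + e0)"
  define L where "L = L1 + Pb + C0 + (e0 + (k + 2) * C0)"
  have M0: "M0 > 0" and i0: "i0 > 0" using u(4) by (auto simp: M0_def i0_def)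
  have Pb: "Pb \<ge> 1" using M0 i0 by (simp add: Pb_def)
  have \<kappa>: "\<kappa> > 0" "\<kappa> \<le> \<gamma> / 2" "\<kappa> \<le> i0 / (4 * Pb)" using \<gamma>1 i0 Pb by (auto simp: \<kappa>_def)
  have "\<kappa> * (4 * Pb) \<le> i0" using \<kappa>(3) Pb by (subst (asm) pos_le_divide_eq) auto
  then have \<kappa>3: "\<kappa> * Pb \<le> i0 / 4" by simp
  have L1: "L1 > 0" "4 / \<kappa> \<le> L1" "(norm u1)\<^sup>2 * (i0 * inverse M0) \<le> L1"
    using \<kappa>(1) M0 i0 by (auto simp: L1_def add_pos_nonneg)
  have pos: "e0 > 0" "C0 \<ge> 0" "k \<ge> 0" using M0 L1 \<gamma>1 by (auto simp: e0_def C0_def k_def)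
  have LL: "L1 \<le> L" "Pb \<le> L" "C0 \<le> L" "e0 + (k + 2) * C0 \<le> L"
    using pos L1 Pb by (auto simp: L_def)
  have "\<forall>\<^sub>F \<epsilon> in at_right 0. 0 < (\<epsilon>::real)" by (simp add: eventually_at_right_less)
  moreover have "\<forall>\<^sub>F \<epsilon> in at_right 0. 8 * \<epsilon> \<le> (1::real)"
    "\<forall>\<^sub>F \<epsilon> in at_right 0. 4 * \<gamma> * Pb * \<epsilon> \<le> i0 / 4"
    "\<forall>\<^sub>F \<epsilon> in at_right 0. 16 * (\<gamma> + 1) * L1 * \<epsilon> \<le> 1"
    "\<forall>\<^sub>F \<epsilon> in at_right 0. 8 * (\<gamma> + 1) * \<bar>B (B u0) \<bullet> u1\<bar> * \<epsilon> \<le> M0 / 2"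
    "\<forall>\<^sub>F \<epsilon> in at_right 0. 8 * L1 * (k + 2) * \<epsilon> \<le> 1"
    using i0 M0 by (intro eventually_at_right_mult_le; simp)+
  ultimately have "\<forall>\<^sub>F \<epsilon> in at_right 0. \<epsilon> > 0 \<and> (\<forall>U U1 U2 t.
    hyp_sol \<epsilon> U U1 U2 \<longrightarrow> U 0 = u0 \<longrightarrow> U1 0 = u1 \<longrightarrow> t \<ge> 0 \<longrightarrow> decay_bounds L U U1 t)"
  proof eventually_elim
    case (elim \<epsilon>)
    have "decay_bounds L U U1 t" if sol: "hyp_sol \<epsilon> U U1 U2" and U0: "U 0 = u0" "U1 0 = u1" and t: "t \<ge> 0"
      for U U1 U2 t
    proof -
      let ?M = "\<lambda>t. (norm (B (U t)))\<^sup>2" and ?H = "\<lambda>t. B (B (U t)) \<bullet> U1 t"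
      let ?Q1 = "\<lambda>t. (norm (B (B (U t))))\<^sup>2" and ?Q2 = "\<lambda>t. (norm (B (U1 t)))\<^sup>2" and ?Q3 = "\<lambda>t. (norm (U1 t))\<^sup>2"
      have bounds: "?M t powr \<gamma> * ?Q1 t * ((1 + t) * \<beta> t) \<le> L1 * ?M t" "?Q1 t \<le> Pb * ?M t"
        "?Q3 t * (1 + t) \<le> L1 * (\<beta> t * ?M t powr \<gamma> * ?M t)" "\<bar>?H t\<bar> * (1 + t) \<le> L1 * ?M t"
        "?M 0 * exp (- (2 * L1 * t)) \<le> ?M t"
        if "hyperbolic_scalar p \<gamma> \<epsilon> t ?M ?H ?Q1 ?Q2 ?Q3" "t \<ge> 0" for t
      proof -
        interpret hs: hyperbolic_scalar p \<gamma> \<epsilon> t ?M ?H ?Q1 ?Q2 ?Q3 by (rule that(1))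
        have ic0: "hs.ic 0 = i0" by (simp add: hs.ic_def i0_def M0_def U0)
        have "hs.P 0 \<le> Pb"
        proof -
          have *: "\<epsilon> * (norm (B u1))\<^sup>2 * i0 \<le> 1 * (norm (B u1))\<^sup>2 * i0"
            using elim i0 by (intro mult_right_mono) auto
          have "(\<epsilon> * (norm (B u1))\<^sup>2 * i0 + (norm (B (B u0)))\<^sup>2) * inverse M0 \<le> Pb - 1"
            using mult_right_mono[OF add_right_mono[OF *], of "inverse M0" "(norm (B (B u0)))\<^sup>2"] M0
            by (simp add: Pb_def)
          moreover have "\<epsilon> * ((hs.h 0)\<^sup>2 * hs.ic 0) \<ge> 0" using elim(1) i0 by (simp add: ic0)
          ultimately show ?thesis by (simp add: hs.P_def ic0 hs.iM_def U0 flip: M0_def)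
        qed
        moreover have "4 * \<gamma> * \<epsilon> * Pb \<le> hs.ic 0 / 4" using elim(3) by (simp add: ic0 mult_ac)
        moreover have "hs.V 0 \<le> L1" using L1(3)
          by (simp add: hs.V_def hs.b_def ic0 hs.iM_def U0 \<beta>_def flip: M0_def)
        ultimately show "?M t powr \<gamma> * ?Q1 t * ((1 + t) * \<beta> t) \<le> L1 * ?M t" "?Q1 t \<le> Pb * ?M t"
          "?Q3 t * (1 + t) \<le> L1 * (\<beta> t * ?M t powr \<gamma> * ?M t)" "\<bar>?H t\<bar> * (1 + t) \<le> L1 * ?M t"
          "?M 0 * exp (- (2 * L1 * t)) \<le> ?M t"
          using hs.hyperbolic_bounds[of \<kappa> Pb L1 t] elim(2) \<kappa> \<kappa>3 L1(2) that(2) ic0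
          by (simp_all only: hs.c_def atLeastAtMost_iff order_refl)
      qed
      have scal: "hyperbolic_scalar p \<gamma> \<epsilon> t ?M ?H ?Q1 ?Q2 ?Q3" if "t \<ge> 0" for t
      proof (rule hyp_bootstrap[OF sol elim(1) that _ elim(4)])
        show "8 * (\<gamma> + 1) * \<epsilon> * \<bar>?H 0\<bar> < ?M 0" using elim(5) M0 by (simp add: U0 M0_def[symmetric] mult_ac)
      qed (use bounds in blast)
      note bd = bounds[OF scal]
      have Mp: "?M s > 0" if "s \<ge> 0" for s
        using bd(5)[OF that that] M0 by (intro less_le_trans[OF _ bd(5)[OF that that]]) (simp add: U0 flip: M0_def)
      define e where "e t = ?M t powr \<gamma> * ?M t" for t
      define e' where "e' s = (\<gamma> + 1) * (2 * ?H s / ?M s) * e s" for s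
      have sub: "{0..t} \<subseteq> {0..}" by auto
      have De: "(e has_real_derivative e' s) (at s within {0..t})" if "s \<in> {0..t}" for s
      proof -
        have s: "s \<ge> 0" using that by simp
        note dM = DERIV_subset[OF hyp_DM[OF sol elim(1) s] sub]
        show ?thesis unfolding e_def[abs_def] e'_def
          by (rule DERIV_cong[OF DERIV_mult[OF DERIV_powr_const[OF dM Mp[OF s]] dM]])
            (use Mp[OF s] in \<open>simp add: field_simps\<close>)
      qed
      have e'le: "e' s * (1 + s) \<le> k * e s" if "s \<in> {0..t}" for s
      proof -
        have s: "s \<ge> 0" using that by simp
        have "?H s * (1 + s) \<le> \<bar>?H s\<bar> * (1 + s)" using s by (intro mult_right_mono) auto
        then have "?H s * (1 + s) / ?M s \<le> L1"
          using bd(4)[OF s s] Mp[OF s] by (subst pos_divide_le_eq) auto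
        then have "(?H s * (1 + s) / ?M s) * ((2 * \<gamma> + 2) * e s) \<le> L1 * ((2 * \<gamma> + 2) * e s)"
          using \<gamma>1 by (intro mult_right_mono) (auto simp: e_def)
        then show ?thesis by (simp add: e'_def k_def algebra_simps)
      qed
      have e_nonneg: "e s \<ge> 0" for s by (simp add: e_def)
      have XI: "(norm (U s))\<^sup>2 + integral {0..s} (\<lambda>s. \<beta> s * e s) \<le> C0" if s: "s \<in> {0..t}" for s
      proof -
        have "(norm (U s))\<^sup>2 + integral {0..s} (\<lambda>s. \<beta> s * e s) \<le> 8 * ((norm (U 0))\<^sup>2 + \<bar>U1 0 \<bullet> U 0\<bar> + e 0)"
        proof (rule hyperbolic_integral_bound[where \<epsilon> = \<epsilon> and L = L1 and k = k and T = t and e' = e'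
              and X = "\<lambda>t. (norm (U t))\<^sup>2" and Y = "\<lambda>t. U1 t \<bullet> U t" and Qd = ?Q3])
          have sq: "\<epsilon>\<^sup>2 \<le> \<epsilon>" using elim(1,2) by (simp add: power2_eq_square mult_left_le)
          have Lk: "1 * L1 \<le> (k + 2) * L1" using pos L1(1) by (intro mult_right_mono) auto
          have 1: "8 * \<epsilon>\<^sup>2 * L1 * (k + 2) \<le> 8 * L1 * (k + 2) * \<epsilon>"
          proof -
            have "\<epsilon>\<^sup>2 * (8 * L1 * (k + 2)) \<le> \<epsilon> * (8 * L1 * (k + 2))"
              using sq pos L1(1) by (intro mult_right_mono) auto
            then show ?thesis by (simp only: mult_ac)
          qed
          then show "8 * \<epsilon>\<^sup>2 * L1 * (k + 2) \<le> 1" using elim(6) by linarith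
          have "2 * (1 * L1) * \<epsilon> \<le> 8 * ((k + 2) * L1) * \<epsilon>" using Lk elim(1) L1(1) by (intro mult_right_mono) auto
          then show 2: "2 * \<epsilon> * L1 \<le> 1" using elim(6) by (simp add: mult_ac)
          have "2 * \<epsilon>\<^sup>2 * L1 \<le> 2 * \<epsilon> * L1" using sq L1(1) by simp
          then show "2 * \<epsilon>\<^sup>2 * L1 \<le> 1" using 2 by linarith
        next
          fix s assume "s \<in> {0..t}"
          then have s: "s \<ge> 0" by simp
          note hD = hyp_D[OF sol elim(1) s]
          note d1 = has_vector_derivative_within_subset[OF hD(1) sub]
            and d2 = has_vector_derivative_within_subset[OF hD(2) sub]
          show "((\<lambda>t. (norm (U t))\<^sup>2) has_real_derivative 2 * (U1 s \<bullet> U s)) (at s within {0..t})"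
            using DERIV_norm_square[OF d1] by (simp add: inner_commute)
          have "U s \<bullet> B (B (U s)) = ?M s" using norm_B_square[OF hD(4,5)] by (simp add: inner_commute)
          then have "U2 s \<bullet> U s + U1 s \<bullet> U1 s = ?Q3 s - ((U1 s \<bullet> U s) * inverse (\<beta> s) + e s) / \<epsilon>"
            using hyp_U2_inner[OF sol elim(1) s, of "U s"]
            by (simp add: power2_norm_eq_inner e_def inner_commute mult.commute)
          then show "((\<lambda>t. U1 t \<bullet> U t) has_real_derivative ?Q3 s - ((U1 s \<bullet> U s) * inverse (\<beta> s) + e s) / \<epsilon>)
             (at s within {0..t})"
            using DERIV_inner[OF d2 d1] by simp
          show "?Q3 s * (1 + s) \<le> L1 * (\<beta> s * e s)" using bd(3)[OF s s] by (simp add: e_def mult.assoc)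
          show "(U1 s \<bullet> U s)\<^sup>2 \<le> ?Q3 s * (norm (U s))\<^sup>2" by (rule inner_square_le)
        qed (use elim L1 pos e_nonneg De e'le s t in auto)
        also have "\<dots> = C0" by (simp add: C0_def U0 e_def e0_def M0_def)
        finally show ?thesis .
      qed
      have tt: "t \<in> {0..t}" using t by simp
      have I: "integral {0..t} (\<lambda>s. \<beta> s * e s) \<le> C0" using XI[OF tt] zero_le_power2[of "norm (U t)"] by linarith
      have "e t * ((1 + t) * \<beta> t) \<le> e 0 + (k + 2) * integral {0..t} (\<lambda>s. \<beta> s * e s)"
        by (rule weighted_energy_le[OF De e'le e_nonneg tt])
      also have "\<dots> \<le> e0 + (k + 2) * C0"
        using I pos by (intro add_mono mult_left_mono) (auto simp: e_def e0_def U0 M0_def)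
      finally have w: "e t * ((1 + t) * \<beta> t) \<le> e0 + (k + 2) * C0" .
      have "L1 * x \<le> L * x" "Pb * x \<le> L * x" if "x \<ge> 0" for x
        using LL that by (auto intro: mult_right_mono)
      note up = this[THEN order_trans[rotated]]
      have "?M t powr \<gamma> * ?Q1 t * ((1 + t) * \<beta> t) \<le> L * ?M t" by (rule up(1)[OF _ bd(1)[OF t t]]) simp
      moreover have "?Q1 t \<le> L * ?M t" by (rule up(2)[OF _ bd(2)[OF t t]]) simp
      moreover have "?Q3 t * (1 + t) \<le> L * (\<beta> t * (?M t powr \<gamma> * ?M t))"
        using up(1)[OF _ bd(3)[OF t t]] \<beta>_pos[OF t] by (simp add: mult.assoc)
      moreover have "\<bar>?H t\<bar> * (1 + t) \<le> L * ?M t" by (rule up(1)[OF _ bd(4)[OF t t]]) simp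
      ultimately show ?thesis
        unfolding decay_bounds_def Let_def using Mp[OF t] I w LL(3,4) unfolding e_def by auto
    qed
    then show ?case using elim(1) by blast
  qed
  moreover have "L > 0" using LL(1) L1(1) by linarith
  ultimately show ?thesis using that by blast
qed

end

subsection \<open>A priori estimates for the parabolic problem\<close>

context kirchhoff
begin

definition par_sol :: "(real \<Rightarrow> 'a) \<Rightarrow> (real \<Rightarrow> 'a) \<Rightarrow> bool" where
  "par_sol u v \<longleftrightarrow>
    (\<forall>t\<ge>0. (u has_vector_derivative v t) (at t within {0..}) \<and> u t \<in> D \<and> B (u t) \<in> D \<and>
       v t = - (\<beta> t * ((norm (B (u t)))\<^sup>2) powr \<gamma>) *\<^sub>R B (B (u t))) \<and>
    continuous_on {0..} (\<lambda>t. B (B (u t)))"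

context
  fixes u v :: "real \<Rightarrow> 'a"
  assumes sol: "par_sol u v"
begin

definition "\<mu> t = (norm (B (u t)))\<^sup>2"
definition "\<nu> t = (norm (B (B (u t))))\<^sup>2"
definition "a t = \<beta> t * \<mu> t powr \<gamma>"

lemma par_D: assumes "t \<ge> 0"
  shows "(u has_vector_derivative v t) (at t within {0..})" "u t \<in> D" "B (u t) \<in> D"
    "v t = - a t *\<^sub>R B (B (u t))"
  using sol assms by (auto simp: par_sol_def a_def \<mu>_def)

text \<open>Continuity of Bu is recovered from that of u and Au: |B x|^2 = <A x, x> with x = u(s) -
  u(t).\<close>

lemma par_continuous: "continuous_on {0..} u" "continuous_on {0..} (\<lambda>t. B (B (u t)))" "continuous_on {0..} (\<lambda>t. B (u t))"
proof -
  show 1: "continuous_on {0..} u" by (rule vector_derivative_continuous_on[of _ u v]) (simp add: par_D(1))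
  show 2: "continuous_on {0..} (\<lambda>t. B (B (u t)))" using sol by (simp add: par_sol_def)
  show "continuous_on {0..} (\<lambda>t. B (u t))"
    unfolding continuous_on
  proof
    fix t :: real assume t: "t \<in> {0..}"
    have l: "(u \<longlongrightarrow> u t) (at t within {0..})" "((\<lambda>t. B (B (u t))) \<longlongrightarrow> B (B (u t))) (at t within {0..})"
      using 1 2 t by (auto simp: continuous_on)
    have "((\<lambda>s. sqrt ((B (B (u s)) - B (B (u t))) \<bullet> (u s - u t))) \<longlongrightarrow>
        sqrt ((B (B (u t)) - B (B (u t))) \<bullet> (u t - u t))) (at t within {0..})"
      by (intro tendsto_intros l)
    moreover have "sqrt ((B (B (u s)) - B (B (u t))) \<bullet> (u s - u t)) = norm (B (u s) - B (u t))" if "s \<ge> 0" for s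
    proof -
      note ps = par_D(2,3)[OF that] and pt = par_D(2,3)[of t, OF t[simplified]]
      have d: "B (u s - u t) = B (u s) - B (u t)" "B (B (u s) - B (u t)) = B (B (u s)) - B (B (u t))"
        using ps pt by (simp_all add: B_minus)
      have "u s - u t \<in> D" "B (u s - u t) \<in> D"
        unfolding d using ps pt by (simp_all add: subspace_diff[OF subspace_D])
      from norm_B_square[OF this] show ?thesis unfolding d by (metis norm_ge_zero real_sqrt_unique)
    qed
    ultimately have "((\<lambda>s. norm (B (u s) - B (u t))) \<longlongrightarrow>
        sqrt ((B (B (u t)) - B (B (u t))) \<bullet> (u t - u t))) (at t within {0..})"
      by (elim Lim_transform_within[OF _ zero_less_one]) auto
    then have "((\<lambda>s. norm (B (u s) - B (u t))) \<longlongrightarrow> 0) (at t within {0..})" by simp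
    then show "((\<lambda>s. B (u s)) \<longlongrightarrow> B (u t)) (at t within {0..})"
      using Lim_null[of "\<lambda>s. B (u s)"] tendsto_norm_zero_iff by blast
  qed
qed

text \<open>Au is only continuous, so symmetry is used to write |Bu(s)|^2 - |Bu(t)|^2 = <u(s) -
  u(t), Au(s) + Au(t)>, whose left factor vanishes at s = t.\<close>

lemma par_DM:
  assumes t: "t \<ge> 0"
  shows "(\<mu> has_real_derivative - 2 * \<beta> t * \<mu> t powr \<gamma> * \<nu> t) (at t within {0..})"
proof -
  have "((\<lambda>s. (u s - u t) \<bullet> (B (B (u s)) + B (B (u t)))) has_real_derivative
      v t \<bullet> (B (B (u t)) + B (B (u t)))) (at t within {0..})"
    using par_continuous(2) t
    by (intro DERIV_inner_vanishing par_D(1) continuous_intros) (auto simp: continuous_on_eq_continuous_within)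
  then have "((\<lambda>s. (u s - u t) \<bullet> (B (B (u s)) + B (B (u t))) + \<mu> t) has_real_derivative
      v t \<bullet> (B (B (u t)) + B (B (u t))) + 0) (at t within {0..})"
    by (rule DERIV_add[OF _ DERIV_const])
  moreover have "v t \<bullet> (B (B (u t)) + B (B (u t))) + 0 = - 2 * \<beta> t * \<mu> t powr \<gamma> * \<nu> t"
    unfolding par_D(4)[OF t] by (simp add: \<nu>_def a_def power2_norm_eq_inner inner_add_right)
  ultimately have "((\<lambda>s. (u s - u t) \<bullet> (B (B (u s)) + B (B (u t))) + \<mu> t) has_real_derivative
     - 2 * \<beta> t * \<mu> t powr \<gamma> * \<nu> t) (at t within {0..})" by simp
  then show ?thesis
  proof (rule has_field_derivative_transform_within[OF _ zero_less_one])
    fix s :: real assume "s \<in> {0..}"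
    then have ps: "u s \<in> D" "B (u s) \<in> D" and pt: "u t \<in> D" "B (u t) \<in> D" using par_D t by auto
    have "u s \<bullet> B (B (u t)) = u t \<bullet> B (B (u s))"
      using B_sym[OF ps(1) pt(2)] B_sym[OF pt(1) ps(2)] by (simp add: inner_commute)
    then show "(u s - u t) \<bullet> (B (B (u s)) + B (B (u t))) + \<mu> t = \<mu> s"
      using norm_B_square[OF ps] norm_B_square[OF pt]
      by (simp add: \<mu>_def inner_diff_left inner_diff_right inner_add_right inner_commute)
  qed (use t in auto)
qed

lemma par_DK:
  assumes t: "t \<ge> 0"
  shows "((\<lambda>s. K n (u s)) has_vector_derivative - a t *\<^sub>R B (B (K n (u t)))) (at t within {0..})"
    "((\<lambda>s. (norm (B (K n (u s))))\<^sup>2) has_real_derivative - 2 * a t * (norm (B (B (K n (u t)))))\<^sup>2) (at t within {0..})"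
    "((\<lambda>s. (norm (B (B (K n (u s)))))\<^sup>2) has_real_derivative - 2 * a t * (norm (B (B (B (K n (u t))))))\<^sup>2) (at t within {0..})"
    "((\<lambda>s. (norm (B (B (B (K n (u s))))))\<^sup>2) has_real_derivative - 2 * a t * (norm (B (B (B (B (K n (u t)))))))\<^sup>2) (at t within {0..})"
proof -
  note pt = par_D[OF t]
  have Kv: "K n (v t) = - a t *\<^sub>R B (B (K n (u t)))"
    unfolding pt(4) K_commute2[OF pt(2,3)] by (rule linear_simps(5)[OF K_bl])
  have BKv: "B (K n (v t)) = - a t *\<^sub>R B (B (B (K n (u t))))"
    unfolding Kv by (rule B_scale[OF K_D(3)])
  have BBKv: "B (B (K n (v t))) = - a t *\<^sub>R B (B (B (B (K n (u t)))))"
    unfolding BKv by (rule B_scale[OF K_D(4)])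
  show "((\<lambda>s. K n (u s)) has_vector_derivative - a t *\<^sub>R B (B (K n (u t)))) (at t within {0..})"
    using bounded_linear.has_vector_derivative[OF K_bl[of n] pt(1)] by (simp only: Kv)
  from DERIV_norm_square[OF bounded_linear.has_vector_derivative[OF BK_bl(1)[of n] pt(1)]]
  show "((\<lambda>s. (norm (B (K n (u s))))\<^sup>2) has_real_derivative - 2 * a t * (norm (B (B (K n (u t)))))\<^sup>2) (at t within {0..})"
    unfolding BKv by (simp add: power2_norm_eq_inner B_sym[OF K_D(2,3)] mult.assoc)
  from DERIV_norm_square[OF bounded_linear.has_vector_derivative[OF BK_bl(2)[of n] pt(1)]]
  show "((\<lambda>s. (norm (B (B (K n (u s)))))\<^sup>2) has_real_derivative - 2 * a t * (norm (B (B (B (K n (u t))))))\<^sup>2) (at t within {0..})"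
    unfolding BBKv by (simp add: power2_norm_eq_inner B_sym[OF K_D(3,4)] mult.assoc)
  have "B (B (B (K n (v t)))) \<bullet> B (B (B (K n (u t)))) = B (B (K n (v t))) \<bullet> B (B (B (B (K n (u t)))))"
    by (rule B_sym[OF K_D(3,4)])
  also have "\<dots> = - a t * (norm (B (B (B (B (K n (u t)))))))\<^sup>2" unfolding BBKv by (simp add: power2_norm_eq_inner)
  finally show "((\<lambda>s. (norm (B (B (B (K n (u s))))))\<^sup>2) has_real_derivative - 2 * a t * (norm (B (B (B (B (K n (u t)))))))\<^sup>2) (at t within {0..})"
    using DERIV_norm_square[OF bounded_linear.has_vector_derivative[OF BK_bl(3)[of n] pt(1)]]
    by (simp add: inner_commute mult.assoc)
qed

text \<open>For the regularized solution the quotient Y / X has a nonpositive derivative, because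
  |B^2 x|^4 \<le> |B x|^2 |B^3 x|^2. Injectivity of \<open>K n\<close> keeps its denominator
  positive, and the product form passes to the limit.\<close>

lemma par_Rayleigh:
  assumes pos: "\<And>t. t \<in> {0..T} \<Longrightarrow> \<mu> t > 0" and s: "s \<in> {0..T}" and t: "t \<in> {0..T}" and st: "s \<le> t"
  shows "\<nu> t * \<mu> s \<le> \<nu> s * \<mu> t"
proof -
  define X where "X n r = (norm (B (K n (u r))))\<^sup>2" for n r
  define Y where "Y n r = (norm (B (B (K n (u r)))))\<^sup>2" for n r
  define Z where "Z n r = (norm (B (B (B (K n (u r))))))\<^sup>2" for n r
  have le: "Y n t * X n s \<le> Y n s * X n t" for n
  proof -
    have Xp: "X n r > 0" if "r \<in> {0..T}" for r
      using pos[OF that] K_inj[of n "B (u r)"] that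
      by (auto simp: X_def \<mu>_def K_commute par_D)
    have "- (Y n s / X n s) \<le> - (Y n t / X n t)"
    proof (rule nondecreasing_within[where f = "\<lambda>r. - (Y n r / X n r)" and a = s and b = t])
      fix r assume r: "r \<in> {s..t}"
      then have r0: "r \<ge> 0" and rT: "r \<in> {0..T}" using s t by auto
      have sub: "{s..t} \<subseteq> {0..}" using s by auto
      show "((\<lambda>r. - (Y n r / X n r)) has_real_derivative
         - ((- 2 * a r * Z n r * X n r - Y n r * (- 2 * a r * Y n r)) / (X n r * X n r))) (at r within {s..t})"
        unfolding X_def Y_def Z_def
        by (intro DERIV_minus DERIV_divide DERIV_subset[OF par_DK(2)[OF r0] sub] DERIV_subset[OF par_DK(3)[OF r0] sub])
          (use Xp[OF rT] in \<open>auto simp: X_def\<close>)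
      have "(B (B (K n (u r))) \<bullet> B (B (K n (u r))))\<^sup>2 \<le> X n r * Z n r"
        using inner_square_le[of "B (K n (u r))" "B (B (B (K n (u r))))"]
        unfolding X_def Z_def B_sym[OF K_D(2,3), symmetric] .
      then have "Y n r * Y n r \<le> Z n r * X n r"
        unfolding Y_def power2_norm_eq_inner by (simp only: power2_eq_square mult.commute)
      then have "2 * a r * (Y n r * Y n r) \<le> 2 * a r * (Z n r * X n r)"
        using \<beta>_pos[OF r0] by (intro mult_left_mono) (auto simp: a_def)
      then have "(- 2 * a r * Z n r * X n r - Y n r * (- 2 * a r * Y n r)) / (X n r * X n r) \<le> 0"
        by (intro divide_nonpos_nonneg) (auto simp: mult_ac)
      then show "0 \<le> - ((- 2 * a r * Z n r * X n r - Y n r * (- 2 * a r * Y n r)) / (X n r * X n r))" by simp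
    qed (use st in simp)
    then show ?thesis using Xp[OF s] Xp[OF t] by (simp add: field_simps)
  qed
  have lim: "(\<lambda>n. X n r) \<longlonglongrightarrow> \<mu> r" "(\<lambda>n. Y n r) \<longlonglongrightarrow> \<nu> r" if "r \<ge> 0" for r
    unfolding X_def Y_def \<mu>_def \<nu>_def K_commute[OF par_D(2)[OF that]] K_commute2[OF par_D(2,3)[OF that]]
      K_commute[OF par_D(3)[OF that]]
    by (intro tendsto_intros K_lim)+
  have "(\<lambda>n. Y n t * X n s) \<longlonglongrightarrow> \<nu> t * \<mu> s" "(\<lambda>n. Y n s * X n t) \<longlonglongrightarrow> \<nu> s * \<mu> t"
    using s t by (intro tendsto_mult lim; simp)+
  then show ?thesis by (rule LIMSEQ_le) (use le in auto)
qed

lemma par_scalar_bounds: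
  assumes pos: "\<And>t. t \<in> {0..T} \<Longrightarrow> \<mu> t > 0"
    and \<kappa>: "\<kappa> > 0" "\<kappa> \<le> \<gamma>" "\<kappa> * (\<nu> 0 / \<mu> 0) \<le> \<mu> 0 powr (- \<gamma>)" and t: "t \<in> {0..T}"
  shows "\<mu> t powr (- \<gamma>) \<le> \<mu> 0 powr (- \<gamma>) + 2 * \<gamma> * (\<nu> 0 / \<mu> 0) * ((1 + t) * \<beta> t)"
    and "\<kappa> * (\<mu> t powr \<gamma> * \<nu> t * ((1 + t) * \<beta> t)) \<le> \<mu> t" and "\<mu> t \<le> \<mu> 0" and "\<nu> t \<le> (\<nu> 0 / \<mu> 0) * \<mu> t"
proof -
  have DM: "(\<mu> has_real_derivative - 2 * \<beta> t * \<mu> t powr \<gamma> * \<nu> t) (at t within {0..T})" if "t \<in> {0..T}" for t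
    by (rule DERIV_subset[OF par_DM]) (use that in auto)
  have Q0: "\<nu> t \<ge> 0" for t by (simp add: \<nu>_def)
  note par = parabolic_scalar_bounds[OF \<gamma>1 pos Q0 DM par_Rayleigh[OF pos] \<kappa> t]
  show "\<mu> t powr (- \<gamma>) \<le> \<mu> 0 powr (- \<gamma>) + 2 * \<gamma> * (\<nu> 0 / \<mu> 0) * ((1 + t) * \<beta> t)"
    by (rule par(1))
  show "\<kappa> * (\<mu> t powr \<gamma> * \<nu> t * ((1 + t) * \<beta> t)) \<le> \<mu> t" by (rule par(2))
  show "\<mu> t \<le> \<mu> 0" by (rule par(3))
  show "\<nu> t \<le> (\<nu> 0 / \<mu> 0) * \<mu> t" by (rule par(4))
qed

text \<open>On every interval where \<mu> is positive, \<mu>^(-\<gamma>) is bounded by the explicit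
  X, so \<mu> stays above the positive function X^(-1/\<gamma>), which serves as the lower bound of
  the continuity argument.\<close>

lemma par_pos:
  assumes "\<mu> 0 > 0" and "t \<ge> 0"
  shows "\<mu> t > 0"
proof -
  define X where "X t = \<mu> 0 powr (- \<gamma>) + 2 * \<gamma> * (\<nu> 0 / \<mu> 0) * ((1 + t) * \<beta> t)" for t
  have Xp: "X t > 0" if "t \<ge> 0" for t
    using assms(1) \<beta>_pos[OF that] \<gamma>1 that unfolding X_def by (intro add_pos_nonneg) (auto simp: \<nu>_def)
  show ?thesis
  proof (rule positive_bootstrap[where F = \<mu> and G = "\<lambda>t. X t powr (- (1 / \<gamma>))"])
  show "continuous_on {0..} \<mu>" unfolding \<mu>_def[abs_def] by (intro continuous_intros par_continuous)
  show "continuous_on {0..} (\<lambda>t. X t powr (- (1 / \<gamma>)))"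
    using Xp unfolding X_def by (intro continuous_intros continuous_\<beta>) (auto simp: less_imp_neq[symmetric])
  show "X T powr (- (1 / \<gamma>)) > 0" if "T \<ge> 0" for T using Xp[OF that] by simp
  fix T assume T: "T \<ge> 0" and pos: "\<And>t. t \<in> {0..T} \<Longrightarrow> \<mu> t > 0"
  define \<kappa> where "\<kappa> = min \<gamma> (\<mu> 0 powr (- \<gamma>) / (\<nu> 0 / \<mu> 0 + 1))"
  have N0: "\<nu> 0 / \<mu> 0 \<ge> 0" using assms(1) by (simp add: \<nu>_def)
  have \<kappa>: "\<kappa> > 0" "\<kappa> \<le> \<gamma>" using assms(1) \<gamma>1 N0 by (auto simp: \<kappa>_def)
  have "\<kappa> * (\<nu> 0 / \<mu> 0 + 1) \<le> \<mu> 0 powr (- \<gamma>)"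
    using N0 by (subst pos_le_divide_eq[symmetric]) (auto simp: \<kappa>_def)
  then have \<kappa>3: "\<kappa> * (\<nu> 0 / \<mu> 0) \<le> \<mu> 0 powr (- \<gamma>)" using \<kappa>(1) by (simp add: distrib_left)
  have "\<mu> T powr (- \<gamma>) \<le> X T" unfolding X_def
    by (rule par_scalar_bounds(1)[OF pos \<kappa> \<kappa>3]) (use T in auto)
  then have "X T powr (- (1 / \<gamma>)) \<le> (\<mu> T powr (- \<gamma>)) powr (- (1 / \<gamma>))"
    using pos[of T] T \<gamma>1 by (intro powr_mono2') auto
  also have "\<dots> = \<mu> T" using pos[of T] T \<gamma>1 by (simp add: powr_powr)
  finally show "X T powr (- (1 / \<gamma>)) \<le> \<mu> T" .
  qed (use assms in auto)
qed

text \<open>The parabolic counterpart of h: half the logarithmic derivative of \<mu>.\<close>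

definition "\<eta> t = (B (B (u t)) \<bullet> v t) / \<mu> t"
definition "c t = \<mu> t powr \<gamma>"
definition "a' t = a t * (p * inverse (1 + t) + 2 * \<gamma> * \<eta> t)"
text \<open>The second derivative of the regularized solution, from differentiating - a A u once
  more after applying \<open>K n\<close>; u itself is only assumed to be C^1.\<close>

definition "w n t = - a' t *\<^sub>R B (B (K n (u t))) + (a t)\<^sup>2 *\<^sub>R B (B (B (B (K n (u t)))))"

lemma par_H: "t \<ge> 0 \<Longrightarrow> B (B (u t)) \<bullet> v t = - a t * \<nu> t"
  by (simp add: par_D(4) \<nu>_def power2_norm_eq_inner)

lemma D_c:
  assumes "t \<ge> 0" "\<mu> t > 0"
  shows "(c has_real_derivative 2 * \<gamma> * \<eta> t * c t) (at t within {0..})"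
  unfolding c_def[abs_def]
  by (rule DERIV_cong[OF DERIV_powr_const[OF par_DM[OF assms(1)] assms(2)]])
    (simp add: \<eta>_def par_H[OF assms(1)] a_def)

lemma p\<sigma>: "t \<ge> 0 \<Longrightarrow> p * \<sigma> t = p * inverse (1 + t) * \<beta> t"
  by (simp add: \<beta>_\<sigma>)

lemma D_a:
  assumes "t \<ge> 0" "\<mu> t > 0"
  shows "(a has_real_derivative a' t) (at t within {0..})"
proof -
  have "((\<lambda>t. \<beta> t * c t) has_real_derivative a' t) (at t within {0..})"
    by (rule DERIV_cong[OF DERIV_mult[OF DERIV_\<beta>[OF assms(1)] D_c[OF assms]]])
      (simp add: a'_def a_def p\<sigma>[OF assms(1)] c_def algebra_simps)
  then show ?thesis by (simp add: a_def[abs_def] c_def)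
qed

lemma par_D_Kv:
  assumes pos: "\<And>t. t \<ge> 0 \<Longrightarrow> \<mu> t > 0" and t: "t \<ge> 0"
  shows "((\<lambda>s. K n (v s)) has_vector_derivative w n t) (at t within {0..})"
proof -
  note pt = par_D[OF t]
  have Kv: "K n (v s) = - a s *\<^sub>R B (B (K n (u s)))" if "s \<ge> 0" for s
    unfolding par_D(4)[OF that] K_commute2[OF par_D(2,3)[OF that]] by (rule linear_simps(5)[OF K_bl])
  have "B (B (K n (v t))) = - a t *\<^sub>R B (B (B (B (K n (u t)))))"
    unfolding Kv[OF t] B_scale[OF K_D(3)] by (rule B_scale[OF K_D(4)])
  then have "((\<lambda>s. B (B (K n (u s)))) has_vector_derivative - a t *\<^sub>R B (B (B (B (K n (u t)))))) (at t within {0..})"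
    using bounded_linear.has_vector_derivative[OF BK_bl(2)[of n] pt(1)] by simp
  from has_vector_derivative_scaleR[OF DERIV_minus[OF D_a[OF t pos[OF t]]] this]
  have "((\<lambda>s. - a s *\<^sub>R B (B (K n (u s)))) has_vector_derivative w n t) (at t within {0..})"
    by (simp add: w_def power2_eq_square add.commute)
  then show ?thesis
    by (rule has_vector_derivative_transform[rotated 2]) (use t Kv in auto)
qed

lemma par_continuous_w:
  assumes pos: "\<And>t. t \<ge> 0 \<Longrightarrow> \<mu> t > 0"
  shows "continuous_on {0..} c" "continuous_on {0..} \<mu>" "continuous_on {0..} (w n)"
proof -
  show \<mu>: "continuous_on {0..} \<mu>" unfolding \<mu>_def[abs_def] by (intro continuous_intros par_continuous)
  show c: "continuous_on {0..} c" unfolding c_def[abs_def]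
    using pos by (intro continuous_intros \<mu>) (auto simp: less_imp_neq[symmetric])
  have a: "continuous_on {0..} a" unfolding a_def[abs_def] c_def[symmetric]
    by (intro continuous_intros c continuous_\<beta>) auto
  have "continuous_on {0..} (\<lambda>t. B (B (u t)) \<bullet> v t)"
    by (rule continuous_on_cong[THEN iffD2, OF refl, of _ _ "\<lambda>t. - a t * \<nu> t"])
      (auto simp: par_H \<nu>_def intro!: continuous_intros a par_continuous)
  then have "continuous_on {0..} \<eta>" unfolding \<eta>_def[abs_def]
    by (rule continuous_on_divide[OF _ \<mu>]) (use pos in \<open>auto simp: less_imp_neq[symmetric]\<close>)
  then have "continuous_on {0..} a'" unfolding a'_def[abs_def] by (intro continuous_intros a) auto
  then show "continuous_on {0..} (w n)" unfolding w_def[abs_def]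
    by (intro continuous_intros a bounded_linear.continuous_on[OF BK_bl(2)]
        bounded_linear.continuous_on[OF BK_bl(4)] par_continuous)
qed

text \<open>As \<beta> \<ge> 1, the decay of c \<mu> makes \<mu> at most (L / (1 + s))^(1 /
  (\<gamma> + 1)), which is integrable against 1 / (1 + s).\<close>

lemma par_integral_\<mu>:
  assumes L0: "L > 0" and t: "t \<ge> 0" and pos: "\<And>t. t \<ge> 0 \<Longrightarrow> \<mu> t > 0"
    and e: "\<And>t. t \<ge> 0 \<Longrightarrow> c t * \<mu> t * ((1 + t) * \<beta> t) \<le> L"
  shows "integral {0..t} (\<lambda>s. \<mu> s * inverse (1 + s)) \<le> L powr (1 / (\<gamma> + 1)) * (\<gamma> + 1)"
proof -
  define q where "q = 1 / (\<gamma> + 1)"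
  have q: "q > 0" "(\<gamma> + 1) * q = 1" using \<gamma>1 by (auto simp: q_def)
  have le: "\<mu> s * inverse (1 + s) \<le> L powr q * (1 + s) powr (- q - 1)" if s: "s \<ge> 0" for s
  proof -
    have "c s * \<mu> s * ((1 + s) * 1) \<le> c s * \<mu> s * ((1 + s) * \<beta> s)"
      using \<beta>_ge1[OF s] s pos[OF s] by (intro mult_left_mono) (auto simp: c_def)
    also have "\<dots> \<le> L" by (rule e[OF s])
    finally have "\<mu> s powr (\<gamma> + 1) \<le> L / (1 + s)"
      using s pos[OF s] by (simp add: c_def powr_add pos_le_divide_eq)
    then have "(\<mu> s powr (\<gamma> + 1)) powr q \<le> (L / (1 + s)) powr q" using q by (intro powr_mono2) auto
    moreover have "(L / (1 + s)) powr q = L powr q * (1 + s) powr (- q)"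
      using s L0 by (simp add: powr_divide powr_minus_divide)
    ultimately have "\<mu> s \<le> L powr q * (1 + s) powr (- q)"
      using pos[OF s] q by (simp add: powr_powr)
    from mult_right_mono[OF this, of "inverse (1 + s)"] s show ?thesis
      by (simp add: powr_diff divide_inverse mult.assoc)
  qed
  have c1: "continuous_on {0..t} (\<lambda>s. \<mu> s * inverse (1 + s))"
    by (intro continuous_intros continuous_on_subset[OF par_continuous_w(2)[OF pos]]) auto
  have c2: "continuous_on {0..t} (\<lambda>s. L powr q * (1 + s) powr (- q - 1))"
    by (intro continuous_intros) auto
  have "integral {0..t} (\<lambda>s. \<mu> s * inverse (1 + s)) \<le> integral {0..t} (\<lambda>s. L powr q * (1 + s) powr (- q - 1))"
    using le by (intro integral_le integrable_continuous_real c1 c2) auto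
  also have "((\<lambda>s. L powr q * (1 + s) powr (- q - 1)) has_integral
       - (L powr q / q) * (1 + t) powr (- q) - - (L powr q / q) * (1 + 0) powr (- q)) {0..t}"
    by (rule DERIV_within_integral) (use t q in \<open>auto intro!: derivative_eq_intros\<close>)
  then have "integral {0..t} (\<lambda>s. L powr q * (1 + s) powr (- q - 1)) \<le> L powr q / q"
    using q L0 by (subst integral_unique) auto
  finally show ?thesis by (simp add: q_def)
qed

text \<open>By its definition, |w|^2 is controlled by K2 and K4. The weight \<psi> of K3 is dictated
  by a^4 \<omega> = a \<psi>, where \<omega> = \<beta> / c + \<beta>^3: the derivative of \<psi> K3
  then contains the K4 term with the good sign. Its error k \<psi> r K3 is absorbed by the
  derivative of k \<phi> K2, since a \<phi> = \<psi> r. The last error, from \<phi>' K2, is at most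
  a multiple of g = \<mu> r + \<beta> c \<mu>, which has a bounded integral. The bound is the same
  for all n.\<close>

lemma par_second_derivative_bound:
  assumes L0: "L > 0" and t: "t \<ge> 0" and pos: "\<And>t. t \<ge> 0 \<Longrightarrow> \<mu> t > 0"
    and bQ: "\<And>t. t \<ge> 0 \<Longrightarrow> c t * \<nu> t * ((1 + t) * \<beta> t) \<le> L * \<mu> t"
    and bH: "\<And>t. t \<ge> 0 \<Longrightarrow> \<bar>B (B (u t)) \<bullet> v t\<bar> * (1 + t) \<le> L * \<mu> t"
    and be: "\<And>t. t \<ge> 0 \<Longrightarrow> c t * \<mu> t * ((1 + t) * \<beta> t) \<le> L"
    and bI: "integral {0..t} (\<lambda>s. \<beta> s * (c s * \<mu> s)) \<le> L"
    and D0: "B (B (u 0)) \<in> D"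
  shows "integral {0..t} (\<lambda>s. (norm (w n s))\<^sup>2 * (\<beta> s * inverse (c s) + (\<beta> s)^3))
    \<le> ((c 0)\<^sup>2 + (c 0)^3) * (norm (B (B (B (u 0)))))\<^sup>2 + (6 * \<gamma> * L + 6) * ((c 0 + (c 0)\<^sup>2) * \<nu> 0)
      + 3 * (6 * \<gamma> * L + 6)\<^sup>2 * L * (L powr (1 / (\<gamma> + 1)) * (\<gamma> + 1) + L)"
proof -
  \<comment> \<open>The highest powers in the weights are c^3 and \<beta>^6; with |\<eta>| \<le> L r
    their logarithmic derivatives add up to at most 6 \<gamma> L r + 6 p r.\<close>
  define k where "k = 6 * \<gamma> * L + 6"
  define r where "r s = inverse (1 + s)" for s :: real
  define \<psi> where "\<psi> s = (c s)\<^sup>2 * (\<beta> s)^4 + (c s)^3 * (\<beta> s)^6" for s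
  define \<phi> where "\<phi> s = (c s * (\<beta> s)^3 + (c s)\<^sup>2 * (\<beta> s)^5) * r s" for s
  define K2 where "K2 s = (norm (B (B (K n (u s)))))\<^sup>2" for s
  define K3 where "K3 s = (norm (B (B (B (K n (u s))))))\<^sup>2" for s
  define K4 where "K4 s = (norm (B (B (B (B (K n (u s)))))))\<^sup>2" for s
  define g where "g s = \<mu> s * r s + \<beta> s * (c s * \<mu> s)" for s
  define W where "W s = (norm (w n s))\<^sup>2 * (\<beta> s * inverse (c s) + (\<beta> s)^3)" for s
  define d\<psi> where "d\<psi> s = (c s)\<^sup>2 * (\<beta> s)^4 * (4 * \<gamma> * \<eta> s + 4 * p * r s) + (c s)^3 * (\<beta> s)^6 * (6 * \<gamma> * \<eta> s + 6 * p * r s)" for s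
  define d\<phi> where "d\<phi> s = (c s * (\<beta> s)^3 * (2 * \<gamma> * \<eta> s + 3 * p * r s)
      + (c s)\<^sup>2 * (\<beta> s)^5 * (4 * \<gamma> * \<eta> s + 5 * p * r s) - (c s * (\<beta> s)^3 + (c s)\<^sup>2 * (\<beta> s)^5) * r s) * r s" for s
  have k0: "k > 0" using \<gamma>1 L0 by (simp add: k_def add_pos_pos)
  have nn: "c s > 0" "r s > 0" "r s * (1 + s) = 1" "\<beta> s > 0" "\<beta> s * r s \<le> 1" "a s = \<beta> s * c s" "\<bar>\<eta> s\<bar> \<le> L * r s" if s: "s \<ge> 0" for s
  proof -
    show "c s > 0" using pos[OF s] by (simp add: c_def)
    show "r s > 0" "r s * (1 + s) = 1" "\<beta> s > 0" "\<beta> s * r s \<le> 1" "a s = \<beta> s * c s"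
      using s \<beta>_pos[OF s] \<beta>_le[OF s] by (auto simp: r_def a_def c_def field_simps)
    have "\<bar>\<eta> s\<bar> * (1 + s) \<le> L" using bH[OF s] pos[OF s] by (simp add: \<eta>_def field_simps)
    then show "\<bar>\<eta> s\<bar> \<le> L * r s" using s by (simp add: r_def field_simps)
  qed
  have lin: "x * \<gamma> * \<eta> s + y * p * r s \<le> k * r s" if s: "s \<ge> 0" and "0 \<le> x" "x \<le> 6" "0 \<le> y" "y \<le> 6" for x y s
  proof -
    have "x * \<gamma> * \<eta> s \<le> x * \<gamma> * (L * r s)"
      using nn(7)[OF s] \<gamma>1 that by (intro mult_left_mono) auto
    also have "\<dots> \<le> 6 * \<gamma> * (L * r s)" using nn(2)[OF s] \<gamma>1 L0 that by (intro mult_right_mono) auto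
    finally have 1: "x * \<gamma> * \<eta> s \<le> 6 * \<gamma> * L * r s" by simp
    have "y * p * r s \<le> 6 * 1 * r s" using nn(2)[OF s] p0 p1 that by (intro mult_right_mono mult_mono) auto
    with 1 show ?thesis by (simp add: k_def distrib_right)
  qed
  have sub: "{0..t} \<subseteq> {0..}" by auto
  have D\<beta>: "(\<beta> has_real_derivative p * r s * \<beta> s) (at s within {0..t})" if "s \<ge> 0" for s
    using DERIV_\<beta>[OF that] unfolding p\<sigma>[OF that] r_def .
  have Dc: "(c has_real_derivative 2 * \<gamma> * \<eta> s * c s) (at s within {0..t})" if "s \<ge> 0" for s
    by (rule DERIV_subset[OF D_c[OF that pos[OF that]] sub])
  have Dr: "(r has_real_derivative - (r s * r s)) (at s within {0..t})" if "s \<ge> 0" for s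
    unfolding r_def[abs_def] using that by (auto intro!: derivative_eq_intros simp: power2_eq_square)
  have D\<psi>: "(\<psi> has_real_derivative d\<psi> s) (at s within {0..t})" if "s \<ge> 0" for s
    unfolding \<psi>_def[abs_def]
    by (rule derivative_eq_intros D\<beta>[OF that] Dc[OF that] refl)+ (simp add: d\<psi>_def eval_nat_numeral algebra_simps)
  have D\<phi>: "(\<phi> has_real_derivative d\<phi> s) (at s within {0..t})" if "s \<ge> 0" for s
    unfolding \<phi>_def[abs_def]
    by (rule derivative_eq_intros D\<beta>[OF that] Dc[OF that] Dr[OF that] refl)+ (simp add: d\<phi>_def eval_nat_numeral algebra_simps)
  have d\<psi>_le: "d\<psi> s \<le> k * (\<psi> s * r s)" if s: "s \<ge> 0" for s
  proof -
    have "d\<psi> s \<le> (c s)\<^sup>2 * (\<beta> s)^4 * (k * r s) + (c s)^3 * (\<beta> s)^6 * (k * r s)"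
      unfolding d\<psi>_def using lin[OF s] nn[OF s] by (intro add_mono mult_left_mono) auto
    then show ?thesis by (simp add: \<psi>_def algebra_simps)
  qed
  have d\<phi>_le: "d\<phi> s \<le> k * (\<phi> s * r s)" if s: "s \<ge> 0" for s
  proof -
    have "d\<phi> s \<le> (c s * (\<beta> s)^3 * (k * r s) + (c s)\<^sup>2 * (\<beta> s)^5 * (k * r s) - 0) * r s"
      unfolding d\<phi>_def using lin[OF s] nn[OF s] by (intro mult_right_mono diff_mono add_mono mult_left_mono) auto
    then show ?thesis by (simp add: \<phi>_def algebra_simps)
  qed
  have aux: "\<phi> s * r s * K2 s \<le> L * g s" if s: "s \<ge> 0" for s
  proof -
    have "K2 s \<le> \<nu> s"
      unfolding K2_def \<nu>_def K_commute2[OF par_D(2,3)[OF s]] by (intro power_mono K_norm) auto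
    then have "\<phi> s * r s * K2 s \<le> \<phi> s * r s * \<nu> s"
      using nn[OF s] by (intro mult_left_mono) (auto simp: \<phi>_def)
    also have "\<dots> = (c s * \<nu> s * ((1 + s) * \<beta> s)) * ((\<beta> s)\<^sup>2 + c s * (\<beta> s)^4) * (r s)^3"
      unfolding \<phi>_def using nn(3)[OF s] by algebra
    also have "\<dots> \<le> (L * \<mu> s) * ((\<beta> s)\<^sup>2 + c s * (\<beta> s)^4) * (r s)^3"
      using bQ[OF s] nn[OF s] by (intro mult_right_mono) auto
    also have "\<dots> = L * (\<mu> s * r s * (\<beta> s * r s)^2 + \<beta> s * (c s * \<mu> s) * (\<beta> s * r s)^3)" by algebra
    also have "\<dots> \<le> L * (\<mu> s * r s * 1 + \<beta> s * (c s * \<mu> s) * 1)"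
      using nn[OF s] L0 pos[OF s] by (intro mult_left_mono add_mono power_le_one) auto
    finally show ?thesis by (simp add: g_def)
  qed
  have a\<phi>: "a s * \<phi> s = \<psi> s * r s" if s: "s \<ge> 0" for s
    unfolding \<phi>_def \<psi>_def nn(6)[OF s] by algebra
  have W_le: "W s \<le> 2 * k\<^sup>2 * L * g s + 2 * a s * (\<psi> s * K4 s)" if s: "s \<ge> 0" for s
  proof -
    define \<omega> where "\<omega> = \<beta> s * inverse (c s) + (\<beta> s)^3"
    have \<omega>0: "\<omega> > 0" using nn[OF s] by (simp add: \<omega>_def add_pos_pos)
    have ci: "c s * inverse (c s) = 1" using nn[OF s] by simp
    let ?x = "- a' s *\<^sub>R B (B (K n (u s)))" and ?y = "(a s)\<^sup>2 *\<^sub>R B (B (B (B (K n (u s)))))"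
    have "(norm (?x + ?y))\<^sup>2 \<le> 2 * (norm ?x)\<^sup>2 + 2 * (norm ?y)\<^sup>2"
      using zero_le_power2[of "norm (?x - ?y)"] by (simp only: power2_norm_eq_inner)
        (simp add: inner_add_left inner_add_right inner_diff_left inner_diff_right inner_commute)
    also have "\<dots> = 2 * ((a' s)\<^sup>2 * K2 s) + 2 * ((a s)^4 * K4 s)"
      by (simp add: K2_def K4_def power_mult_distrib flip: power_mult)
    finally have "W s \<le> (2 * ((a' s)\<^sup>2 * K2 s) + 2 * ((a s)^4 * K4 s)) * \<omega>"
      unfolding W_def w_def \<omega>_def[symmetric] using \<omega>0 by (intro mult_right_mono) auto
    also have "(a s)^4 * K4 s * \<omega> = a s * (\<psi> s * K4 s)"
      unfolding nn(6)[OF s] \<omega>_def \<psi>_def using ci by algebra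
    then have "(2 * ((a' s)\<^sup>2 * K2 s) + 2 * ((a s)^4 * K4 s)) * \<omega> = 2 * ((a' s)\<^sup>2 * (K2 s * \<omega>)) + 2 * a s * (\<psi> s * K4 s)"
      by (simp add: algebra_simps)
    also have "(a' s)\<^sup>2 \<le> (a s * (k * r s))\<^sup>2"
    proof -
      have "\<bar>p * r s + 2 * \<gamma> * \<eta> s\<bar> \<le> k * r s"
      proof (rule abs_leI)
        show "p * r s + 2 * \<gamma> * \<eta> s \<le> k * r s" using lin[OF s, of 2 1] by simp
        have "2 * \<gamma> * (- \<eta> s) \<le> 2 * \<gamma> * (L * r s)" using nn(7)[OF s] \<gamma>1 by (intro mult_left_mono) auto
        moreover have "0 \<le> p * r s" "0 \<le> \<gamma> * (L * r s)" using p0 \<gamma>1 L0 nn[OF s] by auto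
        moreover have "k * r s = 6 * (\<gamma> * (L * r s)) + 6 * r s" by (simp add: k_def algebra_simps)
        ultimately show "- (p * r s + 2 * \<gamma> * \<eta> s) \<le> k * r s" using nn(2)[OF s] by linarith
      qed
      then have "\<bar>a' s\<bar> \<le> \<bar>a s * (k * r s)\<bar>"
        unfolding a'_def abs_mult r_def[symmetric] using k0 nn[OF s] by (intro mult_left_mono) auto
      then show ?thesis by (simp add: abs_le_square_iff)
    qed
    then have "2 * ((a' s)\<^sup>2 * (K2 s * \<omega>)) \<le> 2 * ((a s * (k * r s))\<^sup>2 * (K2 s * \<omega>))"
      using \<omega>0 by (intro mult_left_mono mult_right_mono) (auto simp: K2_def)
    also have "\<dots> = 2 * k\<^sup>2 * (\<phi> s * r s * K2 s)"
      unfolding nn(6)[OF s] \<omega>_def \<phi>_def using ci by algebra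
    also have "\<dots> \<le> 2 * k\<^sup>2 * (L * g s)" using aux[OF s] by (intro mult_left_mono) auto
    finally show ?thesis by (simp add: mult.assoc)
  qed
  have cW: "continuous_on {0..t} W" and cg: "continuous_on {0..t} g"
    unfolding W_def g_def r_def using nn(1)
    by (intro continuous_intros continuous_\<beta> continuous_on_subset[OF par_continuous_w(3)[OF pos] sub]
      continuous_on_subset[OF par_continuous_w(1)[OF pos] sub] continuous_on_subset[OF par_continuous_w(2)[OF pos] sub];
      force)+
  have "(\<psi> t * K3 t + k * (\<phi> t * K2 t)) - (\<psi> 0 * K3 0 + k * (\<phi> 0 * K2 0)) \<le> integral {0..t} (\<lambda>s. 3 * k\<^sup>2 * L * g s - W s)"
  proof (rule DERIV_within_le_integral[where f = "\<lambda>t. \<psi> t * K3 t + k * (\<phi> t * K2 t)"])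
    fix s assume "s \<in> {0..t}"
    then have s: "s \<ge> 0" by simp
    show "((\<lambda>t. \<psi> t * K3 t + k * (\<phi> t * K2 t)) has_real_derivative
       (d\<psi> s * K3 s + - 2 * a s * K4 s * \<psi> s) + k * (d\<phi> s * K2 s + - 2 * a s * K3 s * \<phi> s)) (at s within {0..t})"
      unfolding K2_def K3_def K4_def
      by (intro DERIV_add DERIV_cmult DERIV_mult D\<psi> D\<phi> s DERIV_subset[OF par_DK(3)[OF s] sub] DERIV_subset[OF par_DK(4)[OF s] sub])
    have "d\<psi> s * K3 s \<le> k * (\<psi> s * r s) * K3 s" using d\<psi>_le[OF s] by (intro mult_right_mono) (auto simp: K3_def)
    moreover have "k * (d\<phi> s * K2 s) \<le> k * (k * (\<phi> s * r s) * K2 s)"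
      using d\<phi>_le[OF s] k0 by (intro mult_left_mono mult_right_mono) (auto simp: K2_def)
    moreover have "k * (k * (\<phi> s * r s) * K2 s) \<le> k\<^sup>2 * L * g s"
      using mult_left_mono[OF aux[OF s], of "k\<^sup>2"] by (simp add: power2_eq_square mult_ac)
    moreover have "a s * K3 s * \<phi> s = \<psi> s * r s * K3 s" using a\<phi>[OF s] by algebra
    moreover have "0 \<le> k * (\<psi> s * r s * K3 s)" using k0 nn[OF s] by (auto simp: \<psi>_def K3_def)
    moreover have "(d\<psi> s * K3 s + - 2 * a s * K4 s * \<psi> s) + k * (d\<phi> s * K2 s + - 2 * a s * K3 s * \<phi> s)
       = d\<psi> s * K3 s - 2 * a s * (\<psi> s * K4 s) + k * (d\<phi> s * K2 s) - 2 * (k * (a s * K3 s * \<phi> s))" by (simp add: algebra_simps)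
    moreover have "k * (\<psi> s * r s) * K3 s = k * (\<psi> s * r s * K3 s)" by simp
    moreover have "3 * k\<^sup>2 * L * g s = 2 * k\<^sup>2 * L * g s + k\<^sup>2 * L * g s" by simp
    ultimately show "(d\<psi> s * K3 s + - 2 * a s * K4 s * \<psi> s) + k * (d\<phi> s * K2 s + - 2 * a s * K3 s * \<phi> s)
       \<le> 3 * k\<^sup>2 * L * g s - W s" using W_le[OF s] by (simp only:)
  qed (intro continuous_intros cW cg t)+
  also have "\<dots> = 3 * k\<^sup>2 * L * integral {0..t} g - integral {0..t} W"
    by (simp add: integral_diff integrable_continuous_real cW cg continuous_on_mult_left)
  finally have *: "integral {0..t} W \<le> 3 * k\<^sup>2 * L * integral {0..t} g
      + (\<psi> 0 * K3 0 + k * (\<phi> 0 * K2 0)) - (\<psi> t * K3 t + k * (\<phi> t * K2 t))" by simp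
  have "0 \<le> \<psi> t * K3 t + k * (\<phi> t * K2 t)"
    using k0 nn[OF t] by (auto simp: \<psi>_def \<phi>_def K2_def K3_def intro!: add_nonneg_nonneg mult_nonneg_nonneg)
  moreover have "integral {0..t} g \<le> L powr (1 / (\<gamma> + 1)) * (\<gamma> + 1) + L"
  proof -
    have c1: "continuous_on {0..t} (\<lambda>s. \<mu> s * r s)" "continuous_on {0..t} (\<lambda>s. \<beta> s * (c s * \<mu> s))"
      unfolding r_def by (intro continuous_intros continuous_\<beta>
      continuous_on_subset[OF par_continuous_w(1)[OF pos] sub] continuous_on_subset[OF par_continuous_w(2)[OF pos] sub]; force)+
    have "integral {0..t} g = integral {0..t} (\<lambda>s. \<mu> s * r s) + integral {0..t} (\<lambda>s. \<beta> s * (c s * \<mu> s))"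
      unfolding g_def[abs_def] by (intro integral_add integrable_continuous_real c1)
    then show ?thesis using par_integral_\<mu>[OF L0 t pos be] bI unfolding r_def by linarith
  qed
  then have "3 * k\<^sup>2 * L * integral {0..t} g \<le> 3 * k\<^sup>2 * L * (L powr (1 / (\<gamma> + 1)) * (\<gamma> + 1) + L)"
    using L0 by (intro mult_left_mono) auto
  moreover have "\<psi> 0 * K3 0 \<le> ((c 0)\<^sup>2 + (c 0)^3) * (norm (B (B (B (u 0)))))\<^sup>2"
  proof -
    have "B (B (B (K n (u 0)))) = K n (B (B (B (u 0))))"
      using K_commute2[OF par_D(2,3)[of 0]] K_commute[OF D0] by simp
    then have "K3 0 \<le> (norm (B (B (B (u 0)))))\<^sup>2" unfolding K3_def by (simp add: K_norm power_mono)
    then show ?thesis using nn(1)[of 0] unfolding \<psi>_def by (intro mult_mono) (auto simp: \<beta>_def K3_def)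
  qed
  moreover have "\<phi> 0 * K2 0 \<le> (c 0 + (c 0)\<^sup>2) * \<nu> 0"
  proof -
    have "K2 0 \<le> \<nu> 0" unfolding K2_def \<nu>_def using K_commute2[OF par_D(2,3)[of 0]] by (simp add: K_norm power_mono)
    then show ?thesis using nn(1)[of 0] unfolding \<phi>_def by (intro mult_mono) (auto simp: \<beta>_def r_def K2_def)
  qed
  then have "k * (\<phi> 0 * K2 0) \<le> k * ((c 0 + (c 0)\<^sup>2) * \<nu> 0)" using k0 by (intro mult_left_mono) auto
  ultimately show ?thesis using * unfolding W_def[abs_def] k_def[symmetric] by linarith
qed

end

end

context kirchhoff
begin

lemma parabolic_estimates:
  assumes sol: "par_sol u v" and B0: "B (u 0) \<noteq> 0" and D0: "B (B (u 0)) \<in> D"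
  obtains L w where "L > 0" and "\<And>t. t \<ge> 0 \<Longrightarrow> decay_bounds L u v t"
    and "\<And>t. t \<ge> 0 \<Longrightarrow> 1 \<le> L * (((norm (B (u t)))\<^sup>2) powr \<gamma> * ((1 + t) * \<beta> t))"
    and "\<And>t. t \<ge> 0 \<Longrightarrow> ((norm (B (u t)))\<^sup>2) powr \<gamma> \<le> L"
    and "\<And>n t. t \<ge> 0 \<Longrightarrow> ((\<lambda>s. K n (v s)) has_vector_derivative w n t) (at t within {0..})"
    and "\<And>n. continuous_on {0..} (w n)"
    and "\<And>n t. t \<ge> 0 \<Longrightarrow> integral {0..t} (\<lambda>s. (norm (w n s))\<^sup>2 *
           (\<beta> s * inverse (((norm (B (u s)))\<^sup>2) powr \<gamma>) + (\<beta> s)^3)) \<le> L"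
proof -
  note pD = par_D[OF sol]
  define M where "M t = (norm (B (u t)))\<^sup>2" for t
  define c where "c t = M t powr \<gamma>" for t
  define Q where "Q t = (norm (B (B (u t))))\<^sup>2" for t
  have eqs: "\<mu> u = M" "\<nu> u = Q" "kirchhoff.c B \<gamma> u = c" "a u = (\<lambda>t. \<beta> t * c t)"
    by (auto simp: fun_eq_iff \<mu>_def[OF sol] \<nu>_def[OF sol] kirchhoff.c_def[OF kirchhoff_axioms sol] a_def[OF sol] M_def Q_def c_def)
  have pos: "M t > 0" if "t \<ge> 0" for t
    using par_pos[OF sol _ that] B0 unfolding eqs by (simp add: M_def)
  define N where "N = Q 0 / M 0"
  define i0 where "i0 = M 0 powr (- \<gamma>)"
  define \<kappa> where "\<kappa> = min \<gamma> (i0 / (N + 1))"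
  have N0: "N \<ge> 0" and i0: "i0 > 0" using pos[of 0] by (auto simp: N_def Q_def i0_def)
  have \<kappa>: "\<kappa> > 0" "\<kappa> \<le> \<gamma>" using i0 \<gamma>1 N0 by (auto simp: \<kappa>_def)
  have "\<kappa> * (N + 1) \<le> i0" using N0 by (subst pos_le_divide_eq[symmetric]) (auto simp: \<kappa>_def)
  then have \<kappa>3: "\<kappa> * N \<le> i0" using \<kappa>(1) by (simp add: distrib_left)
  define I where "I = (norm (u 0))\<^sup>2 / 2"
  define L1 where "L1 = 1 / \<kappa> + N + I + (c 0 * M 0 + 2 * I) + (i0 + 2 * \<gamma> * N) + c 0"
  have c0: "c 0 > 0" using pos[of 0] by (simp add: c_def)
  have I0: "I \<ge> 0" by (simp add: I_def)
  have "1 / \<kappa> > 0" "2 * \<gamma> * N \<ge> 0" "c 0 * M 0 \<ge> 0" using \<kappa>(1) \<gamma>1 N0 c0 by (auto simp: M_def)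
  then have L1: "1 / \<kappa> \<le> L1" "N \<le> L1" "I \<le> L1" "c 0 * M 0 + 2 * I \<le> L1" "i0 + 2 * \<gamma> * N \<le> L1" "c 0 \<le> L1" "L1 > 0"
    using N0 i0 I0 c0 unfolding L1_def by linarith+
  have bs: "M t powr (- \<gamma>) \<le> i0 + 2 * \<gamma> * N * ((1 + t) * \<beta> t)"
    "c t * Q t * ((1 + t) * \<beta> t) \<le> L1 * M t" "M t \<le> M 0" "Q t \<le> L1 * M t" if t: "t \<ge> 0" for t
  proof -
    have p: "\<mu> u s > 0" if "s \<in> {0..t}" for s using pos[of s] that unfolding eqs by simp
    have \<kappa>3': "\<kappa> * (\<nu> u 0 / \<mu> u 0) \<le> \<mu> u 0 powr (- \<gamma>)" using \<kappa>3 by (simp add: eqs N_def i0_def)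
    have tt: "t \<in> {0..t}" using t by simp
    note b = par_scalar_bounds[OF sol p \<kappa> \<kappa>3' tt, unfolded eqs]
    show "M t powr (- \<gamma>) \<le> i0 + 2 * \<gamma> * N * ((1 + t) * \<beta> t)" using b(1) by (simp add: N_def i0_def)
    have "c t * Q t * ((1 + t) * \<beta> t) \<le> (1 / \<kappa>) * M t"
      using b(2) \<kappa>(1) by (simp add: c_def pos_le_divide_eq mult.commute)
    also have "\<dots> \<le> L1 * M t" using L1(1) pos[OF t] by (intro mult_right_mono) auto
    finally show "c t * Q t * ((1 + t) * \<beta> t) \<le> L1 * M t" .
    show "M t \<le> M 0" by (rule b(3))
    show "Q t \<le> L1 * M t" using b(4) L1(2) pos[OF t] mult_right_mono[OF L1(2), of "M t"] by (simp add: N_def)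
  qed
  have H: "B (B (u t)) \<bullet> v t = - (\<beta> t * c t * Q t)" if "t \<ge> 0" for t
    using par_H[OF sol that] unfolding eqs by simp
  have bH: "\<bar>B (B (u t)) \<bullet> v t\<bar> * (1 + t) \<le> L1 * M t" if t: "t \<ge> 0" for t
    using bs(2)[OF t] \<beta>_pos[OF t] unfolding H[OF t] by (simp add: abs_mult Q_def c_def mult_ac)
  have bv: "(norm (v t))\<^sup>2 * (1 + t) \<le> L1 * (\<beta> t * (c t * M t))" if t: "t \<ge> 0" for t
  proof -
    have "(norm (v t))\<^sup>2 * (1 + t) = (\<beta> t * c t) * (c t * Q t * ((1 + t) * \<beta> t))"
      unfolding pD(4)[OF t] eqs by (simp add: Q_def power_mult_distrib power2_eq_square mult_ac)
    also have "\<dots> \<le> (\<beta> t * c t) * (L1 * M t)" using bs(2)[OF t] \<beta>_pos[OF t] by (intro mult_left_mono) (auto simp: c_def)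
    finally show ?thesis by (simp add: mult_ac)
  qed
  have bI: "integral {0..t} (\<lambda>s. \<beta> s * (c s * M s)) \<le> I" if t: "t \<ge> 0" for t
  proof -
    \<comment> \<open>Testing with u: the dissipation is an exact derivative, so its integral is at
      most half of |u(0)|^2.\<close>
    have "((\<lambda>s. - (1/2) * (norm (u s))\<^sup>2) has_real_derivative \<beta> s * (c s * M s)) (at s within {0..t})" if "s \<in> {0..t}" for s
    proof -
      have s: "s \<ge> 0" using that by simp
      have d: "(u has_vector_derivative v s) (at s within {0..t})"
        by (rule has_vector_derivative_within_subset[OF pD(1)[OF s]]) auto
      have "u s \<bullet> v s = - (\<beta> s * c s * M s)"
        unfolding pD(4)[OF s] eqs using norm_B_square[OF pD(2,3)[OF s]] by (simp add: M_def inner_commute)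
      then show ?thesis using DERIV_cmult[OF DERIV_norm_square[OF d], of "- (1/2)"] by (simp add: mult_ac)
    qed
    from integral_unique[OF DERIV_within_integral[OF this t]] show ?thesis by (simp add: I_def)
  qed
  have be: "c t * M t * ((1 + t) * \<beta> t) \<le> c 0 * M 0 + 2 * I" if t: "t \<ge> 0" for t
  proof -
    have "c t * M t * ((1 + t) * \<beta> t) \<le> c 0 * M 0 + (0 + 2) * integral {0..t} (\<lambda>s. \<beta> s * (c s * M s))"
    \<comment> \<open>Here k = 0, because c M is nonincreasing along the first order flow.\<close>
    proof (rule weighted_energy_le[where T = t and e = "\<lambda>t. c t * M t" and k = 0])
      fix s assume "s \<in> {0..t}"
      then have s: "s \<ge> 0" by simp
      have "M s > 0" by (rule pos[OF s])
      note d = DERIV_subset[OF par_DM[OF sol s, unfolded eqs], of "{0..t}"]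
      have d: "(M has_real_derivative - 2 * \<beta> s * c s * Q s) (at s within {0..t})" unfolding c_def by (rule d) auto
      show "((\<lambda>t. c t * M t) has_real_derivative
          \<gamma> * (- 2 * \<beta> s * c s * Q s / M s) * M s powr \<gamma> * M s + (- 2 * \<beta> s * c s * Q s) * c s) (at s within {0..t})"
        unfolding c_def[abs_def] by (rule DERIV_mult[OF DERIV_powr_const[OF d[unfolded c_def] pos[OF s]] d[unfolded c_def]])
      have "0 \<le> \<gamma> * (\<beta> s * c s * Q s / M s) * (M s powr \<gamma> * M s)" "0 \<le> (\<beta> s * c s * Q s) * c s"
        using \<gamma>1 pos[OF s] \<beta>_pos[OF s] by (simp_all add: c_def Q_def)
      then have "\<gamma> * (- 2 * \<beta> s * c s * Q s / M s) * M s powr \<gamma> * M s + (- 2 * \<beta> s * c s * Q s) * c s \<le> 0"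
        using pos[OF s] by (simp add: mult_ac)
      then show "(\<gamma> * (- 2 * \<beta> s * c s * Q s / M s) * M s powr \<gamma> * M s + (- 2 * \<beta> s * c s * Q s) * c s) * (1 + s) \<le> 0 * (c s * M s)"
        using s by (simp add: mult_nonpos_nonneg)
      show "0 \<le> c s * M s" by (simp add: c_def M_def)
    qed (use t in simp)
    then show ?thesis using bI[OF t] unfolding add_0 by linarith
  qed
  have lower: "1 \<le> L1 * (c t * ((1 + t) * \<beta> t))" if t: "t \<ge> 0" for t
  proof -
    have tb: "1 \<le> (1 + t) * \<beta> t" using mult_mono[of 1 "1 + t" 1 "\<beta> t"] t \<beta>_ge1[OF t] by simp
    have "M t powr (- \<gamma>) \<le> i0 * ((1 + t) * \<beta> t) + 2 * \<gamma> * N * ((1 + t) * \<beta> t)"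
      using bs(1)[OF t] mult_left_mono[OF tb, of i0] i0 by linarith
    also have "\<dots> \<le> L1 * ((1 + t) * \<beta> t)"
      using mult_right_mono[OF L1(5), of "(1 + t) * \<beta> t"] tb by (simp add: distrib_right)
    finally have "c t * M t powr (- \<gamma>) \<le> c t * (L1 * ((1 + t) * \<beta> t))" by (rule mult_left_mono) (simp add: c_def)
    moreover have "c t * M t powr (- \<gamma>) = 1" using pos[OF t] by (simp add: c_def powr_minus)
    ultimately show ?thesis by (simp add: mult_ac)
  qed
  define X where "X = ((c 0)\<^sup>2 + (c 0)^3) * (norm (B (B (B (u 0)))))\<^sup>2 + (6 * \<gamma> * L1 + 6) * ((c 0 + (c 0)\<^sup>2) * Q 0)
      + 3 * (6 * \<gamma> * L1 + 6)\<^sup>2 * L1 * (L1 powr (1 / (\<gamma> + 1)) * (\<gamma> + 1) + L1)"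
  have X0: "X \<ge> 0" using c0 L1(7) \<gamma>1 unfolding X_def by (intro add_nonneg_nonneg mult_nonneg_nonneg) (auto simp: Q_def)
  define L where "L = L1 + X"
  have LL: "L1 \<le> L" "X \<le> L" using X0 L1(7) by (auto simp: L_def)
  have up: "y \<le> L1 * x \<Longrightarrow> x \<ge> 0 \<Longrightarrow> y \<le> L * x" for x y using mult_right_mono[OF LL(1), of x] by linarith
  show ?thesis
  proof (rule that[of L "w u v"])
    show "L > 0" using LL(1) L1(7) by linarith
    fix t :: real assume t: "t \<ge> 0"
    have Lup: "x \<le> L1 \<Longrightarrow> x \<le> L" for x using LL(1) by linarith
    show "decay_bounds L u v t"
      unfolding decay_bounds_def Let_def M_def[symmetric] Q_def[symmetric] c_def[symmetric]
      using pos[OF t] up[OF bs(2)[OF t]] up[OF bs(4)[OF t]] up[OF bv[OF t]] up[OF bH[OF t]]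
        bI[OF t] be[OF t] L1 Lup \<beta>_pos[OF t] by (force simp: c_def Q_def)
    have cpos: "0 \<le> c t * ((1 + t) * \<beta> t)" using \<beta>_pos[OF t] t by (simp add: c_def)
    show "1 \<le> L * (((norm (B (u t)))\<^sup>2) powr \<gamma> * ((1 + t) * \<beta> t))"
      using up[OF lower[OF t] cpos] unfolding c_def M_def .
    have "c t \<le> c 0" unfolding c_def using bs(3)[OF t] pos[OF t] \<gamma>1 by (intro powr_mono2) auto
    then show "((norm (B (u t)))\<^sup>2) powr \<gamma> \<le> L" using L1(6) LL(1) unfolding c_def M_def by linarith
    fix n
    show "((\<lambda>s. K n (v s)) has_vector_derivative w u v n t) (at t within {0..})"
      by (rule par_D_Kv[OF sol _ t]) (use pos eqs in auto)
    have "integral {0..t} (\<lambda>s. (norm (w u v n s))\<^sup>2 * (\<beta> s * inverse (c s) + (\<beta> s)^3)) \<le> X"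
      unfolding X_def
    proof (rule par_second_derivative_bound[OF sol L1(7) t, unfolded eqs])
      show "integral {0..t} (\<lambda>s. \<beta> s * (c s * M s)) \<le> L1" using bI[OF t] L1(3) by linarith
      show "c t * M t * ((1 + t) * \<beta> t) \<le> L1" if "t \<ge> 0" for t using be[OF that] L1(4) by linarith
    qed (use pos bs bH D0 in auto)
    then show "integral {0..t} (\<lambda>s. (norm (w u v n s))\<^sup>2 *
           (\<beta> s * inverse (((norm (B (u s)))\<^sup>2) powr \<gamma>) + (\<beta> s)^3)) \<le> L"
      using LL(2) unfolding c_def M_def by linarith
  next
    show "continuous_on {0..} (w u v n)" for n
      by (rule par_continuous_w(3)[OF sol]) (use pos eqs in auto)
  qed
qed

end

subsection \<open>Error estimates\<close>

lemma inner_Young: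
  fixes x y :: "'a::real_inner"
  assumes "b > 0"
  shows "- (x \<bullet> y) \<le> (norm x)\<^sup>2 / (4 * b) + b * (norm y)\<^sup>2"
proof -
  have "0 \<le> (norm (x + (2 * b) *\<^sub>R y))\<^sup>2" by simp
  also have "\<dots> = (norm x)\<^sup>2 + 4 * b * (x \<bullet> y) + 4 * b * (b * (norm y)\<^sup>2)"
    unfolding power2_norm_eq_inner by (simp add: inner_add_left inner_add_right inner_commute algebra_simps)
  finally show ?thesis using assms by (simp add: field_simps)
qed

text \<open>One L serves both solutions. \<open>lower\<close> makes 1 / c at most L (1 + t) \<beta>,
  which tames the multiplier 1 / c. The function \<open>e\<close> abstracts the boundary layer; the
  weight (1 + s)^2 in \<open>e_int\<close> matches the largest multiplier, of size \<beta>^2, used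
  on the equation of r.\<close>

locale singular_perturbation = kirchhoff D B K p \<gamma>
  for D :: "'a::real_inner set" and B :: "'a \<Rightarrow> 'a" and K :: "nat \<Rightarrow> 'a \<Rightarrow> 'a" and p \<gamma> :: real +
  fixes \<epsilon> L :: real and U U1 U2 u v :: "real \<Rightarrow> 'a" and w :: "nat \<Rightarrow> real \<Rightarrow> 'a" and w0 :: 'a and e :: "real \<Rightarrow> real"
  assumes hyp: "hyp_sol \<epsilon> U U1 U2" and par: "par_sol u v"
    and \<epsilon>0: "\<epsilon> > 0" and \<epsilon>_small: "8 * \<epsilon> \<le> 1" "4 * \<gamma> * L * \<epsilon> \<le> 1" and L1: "L \<ge> 1"
    and init: "U 0 = u 0" "U1 0 - v 0 = w0" and w0_D: "w0 \<in> D"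
    and e_0: "e 0 = 1" and e_pos: "\<And>t. t \<ge> 0 \<Longrightarrow> e t > 0"
    and De: "\<And>t. t \<ge> 0 \<Longrightarrow> (e has_real_derivative - (e t / (\<epsilon> * \<beta> t))) (at t within {0..})"
    and e_int: "\<And>t. t \<ge> 0 \<Longrightarrow> integral {0..t} (\<lambda>s. (1 + s)\<^sup>2 * e s) \<le> 2 * \<epsilon>"
    and decU: "\<And>t. t \<ge> 0 \<Longrightarrow> decay_bounds L U U1 t"
    and decu: "\<And>t. t \<ge> 0 \<Longrightarrow> decay_bounds L u v t"
    and lower: "\<And>t. t \<ge> 0 \<Longrightarrow> 1 \<le> L * (((norm (B (u t)))\<^sup>2) powr \<gamma> * ((1 + t) * \<beta> t))"
    and upper: "\<And>t. t \<ge> 0 \<Longrightarrow> ((norm (B (u t)))\<^sup>2) powr \<gamma> \<le> L"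
    and Dw: "\<And>n t. t \<ge> 0 \<Longrightarrow> ((\<lambda>s. K n (v s)) has_vector_derivative w n t) (at t within {0..})"
    and cont_w: "\<And>n. continuous_on {0..} (w n)"
    and w_int: "\<And>n t. t \<ge> 0 \<Longrightarrow> integral {0..t} (\<lambda>s. (norm (w n s))\<^sup>2 *
           (\<beta> s * inverse (((norm (B (u s)))\<^sup>2) powr \<gamma>) + (\<beta> s)^3)) \<le> L"
begin

definition "Mu t = (norm (B (u t)))\<^sup>2"
definition "MU t = (norm (B (U t)))\<^sup>2"
definition "cu t = Mu t powr \<gamma>"
definition "cU t = MU t powr \<gamma>"
definition "\<rho> t = U t - u t"

text \<open>\<open>e\<close> is the scalar boundary layer, so that \<open>\<theta>' = e w\<^sub>0\<close> and \<open>r\<close> is the derivative \<open>\<rho>' - \<theta>'\<close> of the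
  remainder \<open>r\<^sub>\<epsilon>\<close>.\<close>

definition "r t = U1 t - v t - e t *\<^sub>R w0"
definition "S t = integral {0..t} (\<lambda>s. \<beta> s * ((cu s + cU s) * (norm (B (\<rho> s)))\<^sup>2))"
text \<open>As \<rho>' = r + e w0, differentiating |B\<rho>|^2 also produces e <B\<rho>, B w0>; this
  integral measures that contribution under the largest weight.\<close>

definition "\<Sigma> t = integral {0..t} (\<lambda>s. (1 + s)\<^sup>2 * e s * norm (B (\<rho> s)))"

lemmas hD = hyp_D[OF hyp \<epsilon>0]
lemmas pD = par_D(1-3)[OF par]

lemma v_eq: "t \<ge> 0 \<Longrightarrow> v t = - (\<beta> t * cu t) *\<^sub>R B (B (u t))"
  using par by (simp add: par_sol_def cu_def Mu_def)

lemma \<rho>_D: assumes "t \<ge> 0"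
  shows "\<rho> t \<in> D" "B (\<rho> t) = B (U t) - B (u t)" "B (\<rho> t) \<in> D" "B (B (\<rho> t)) = B (B (U t)) - B (B (u t))"
  using hD[OF assms] pD[OF assms] by (simp_all add: \<rho>_def B_minus subspace_diff[OF subspace_D])

lemma D\<rho>: "t \<ge> 0 \<Longrightarrow> (\<rho> has_vector_derivative r t + e t *\<^sub>R w0) (at t within {0..})"
  using has_vector_derivative_diff[OF hD(1) pD(1)] by (simp add: \<rho>_def[abs_def] r_def)

lemma bounds_u: assumes "t \<ge> 0"
  shows "Mu t > 0" "cu t * (norm (B (B (u t))))\<^sup>2 * ((1 + t) * \<beta> t) \<le> L * Mu t"
    "(norm (B (B (u t))))\<^sup>2 \<le> L * Mu t" "(norm (v t))\<^sup>2 * (1 + t) \<le> L * (\<beta> t * (cu t * Mu t))"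
    "\<bar>B (B (u t)) \<bullet> v t\<bar> * (1 + t) \<le> L * Mu t" "integral {0..t} (\<lambda>s. \<beta> s * (cu s * Mu s)) \<le> L"
    "(cu t * Mu t) * ((1 + t) * \<beta> t) \<le> L"
  using decu[OF assms] unfolding decay_bounds_def Let_def cu_def Mu_def by auto

lemma bounds_U: assumes "t \<ge> 0"
  shows "MU t > 0" "cU t * (norm (B (B (U t))))\<^sup>2 * ((1 + t) * \<beta> t) \<le> L * MU t"
    "(norm (B (B (U t))))\<^sup>2 \<le> L * MU t" "(norm (U1 t))\<^sup>2 * (1 + t) \<le> L * (\<beta> t * (cU t * MU t))"
    "\<bar>B (B (U t)) \<bullet> U1 t\<bar> * (1 + t) \<le> L * MU t" "integral {0..t} (\<lambda>s. \<beta> s * (cU s * MU s)) \<le> L"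
    "(cU t * MU t) * ((1 + t) * \<beta> t) \<le> L"
  using decU[OF assms] unfolding decay_bounds_def Let_def cU_def MU_def by auto

lemma c_pos: "t \<ge> 0 \<Longrightarrow> cu t > 0" "t \<ge> 0 \<Longrightarrow> cU t > 0"
  using bounds_u(1)[of t] bounds_U(1)[of t] by (auto simp: cu_def cU_def)

lemma D_Mu: "t \<ge> 0 \<Longrightarrow> (Mu has_real_derivative 2 * (B (B (u t)) \<bullet> v t)) (at t within {0..})"
proof -
  assume t: "t \<ge> 0"
  have "\<mu> u = Mu" by (simp add: fun_eq_iff \<mu>_def[OF par] Mu_def)
  then show ?thesis using par_DM[OF par t] par_H[OF par t] by (simp add: a_def[OF par] mult_ac)
qed

lemma D_cu: assumes "t \<ge> 0"
  obtains \<eta> where "\<bar>\<eta>\<bar> * (1 + t) \<le> L" "(cu has_real_derivative 2 * \<gamma> * \<eta> * cu t) (at t within {0..})"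
proof (rule that)
  show "\<bar>(B (B (u t)) \<bullet> v t) / Mu t\<bar> * (1 + t) \<le> L"
    using bounds_u(1,5)[OF assms] by (simp add: field_simps)
  show "(cu has_real_derivative 2 * \<gamma> * ((B (B (u t)) \<bullet> v t) / Mu t) * cu t) (at t within {0..})"
    unfolding cu_def[abs_def]
    by (rule DERIV_cong[OF DERIV_powr_const[OF D_Mu[OF assms] bounds_u(1)[OF assms]]]) simp
qed

lemma D_cU: assumes "t \<ge> 0"
  obtains \<eta> where "\<bar>\<eta>\<bar> * (1 + t) \<le> L" "(cU has_real_derivative 2 * \<gamma> * \<eta> * cU t) (at t within {0..})"
proof (rule that)
  show "\<bar>(B (B (U t)) \<bullet> U1 t) / MU t\<bar> * (1 + t) \<le> L"
    using bounds_U(1,5)[OF assms] by (simp add: field_simps)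
  have "(MU has_real_derivative 2 * (B (B (U t)) \<bullet> U1 t)) (at t within {0..})"
    using hyp_DM[OF hyp \<epsilon>0 assms] by (simp add: MU_def[abs_def])
  from DERIV_powr_const[OF this bounds_U(1)[OF assms]]
  show "(cU has_real_derivative 2 * \<gamma> * ((B (B (U t)) \<bullet> U1 t) / MU t) * cU t) (at t within {0..})"
    unfolding cU_def[abs_def] by (rule DERIV_cong) simp
qed

lemma cont: "continuous_on {0..} cu" "continuous_on {0..} cU" "continuous_on {0..} Mu" "continuous_on {0..} MU"
  "continuous_on {0..} (\<lambda>t. B (\<rho> t))" "continuous_on {0..} e" "continuous_on {0..} \<rho>" "continuous_on {0..} v"
  "continuous_on {0..} U1" "continuous_on {0..} r" "continuous_on {0..} (\<lambda>t. B (u t))"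
proof -
  note c = hyp_continuous[OF hyp \<epsilon>0] par_continuous[OF par]
  show M: "continuous_on {0..} Mu" "continuous_on {0..} MU" unfolding Mu_def[abs_def] MU_def[abs_def]
    by (intro continuous_intros c)+
  show cu: "continuous_on {0..} cu" "continuous_on {0..} cU"
    unfolding cu_def[abs_def] cU_def[abs_def] using bounds_u(1) bounds_U(1)
    by (intro continuous_intros M; force)+
  show "continuous_on {0..} (\<lambda>t. B (\<rho> t))"
    by (rule continuous_on_cong[THEN iffD2, OF refl, of _ _ "\<lambda>t. B (U t) - B (u t)"])
      (auto simp: \<rho>_D intro!: continuous_intros c)
  show e: "continuous_on {0..} e" by (rule DERIV_continuous_on[OF De]) simp
  show "continuous_on {0..} \<rho>" unfolding \<rho>_def[abs_def] by (intro continuous_intros c)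
  show v: "continuous_on {0..} v"
    by (rule continuous_on_cong[THEN iffD2, OF refl, of _ _ "\<lambda>t. - (\<beta> t * cu t) *\<^sub>R B (B (u t))"])
      (auto simp: v_eq intro!: continuous_intros c cu continuous_\<beta>)
  show "continuous_on {0..} r" unfolding r_def[abs_def] by (intro continuous_intros c v e)
qed (rule hyp_continuous[OF hyp \<epsilon>0] par_continuous[OF par])+

lemma sub: "{0..T} \<subseteq> {0..}" for T :: real by auto

lemma at_zero: "\<rho> 0 = 0" "B (\<rho> 0) = 0" "r 0 = 0"
  using init e_0 \<rho>_D(2)[of 0] by (simp_all add: \<rho>_def r_def)

text \<open>The equation of \<open>r\<close> is regularized by \<open>K\<^sub>n\<close> and tested with \<open>g K\<^sub>n r\<close>, after the difference of the
  nonlinear terms has been split into \<open>l A\<rho> + R\<close>.\<close>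

lemma pairing:
  fixes g gl g' gl' l :: "real \<Rightarrow> real" and R :: "real \<Rightarrow> 'a"
  assumes t: "t \<ge> 0" and C0: "C \<ge> 0"
    and Dg: "\<And>t. t \<ge> 0 \<Longrightarrow> (g has_real_derivative g' t) (at t within {0..})"
    and Dgl: "\<And>t. t \<ge> 0 \<Longrightarrow> (gl has_real_derivative gl' t) (at t within {0..})"
    and g: "\<And>t. t \<ge> 0 \<Longrightarrow> g t > 0" "\<And>t. t \<ge> 0 \<Longrightarrow> gl t = g t * l t" "\<And>t. t \<ge> 0 \<Longrightarrow> gl t \<ge> 0"
    and g': "\<And>t. t \<ge> 0 \<Longrightarrow> 2 * (\<epsilon> * g' t) * \<beta> t \<le> g t"
    and gl': "\<And>t. t \<ge> 0 \<Longrightarrow> gl' t \<le> 2 * C * (\<beta> t * (cu t + cU t))"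
    and gl_le: "\<And>t. t \<ge> 0 \<Longrightarrow> gl t \<le> C * (1 + t)\<^sup>2"
    and split: "\<And>t. t \<ge> 0 \<Longrightarrow> cU t *\<^sub>R B (B (U t)) - cu t *\<^sub>R B (B (u t)) = l t *\<^sub>R B (B (\<rho> t)) + R t"
    and R: "\<And>t. t \<ge> 0 \<Longrightarrow> g t * \<beta> t * (norm (R t))\<^sup>2 \<le> C * (\<beta> t * ((cu t + cU t) * (norm (B (\<rho> t)))\<^sup>2))"
    and W: "\<And>n. integral {0..t} (\<lambda>s. g s * \<beta> s * (norm (w n s))\<^sup>2) \<le> C"
  shows "gl t * (norm (B (\<rho> t)))\<^sup>2 / 2 + integral {0..t} (\<lambda>s. g s / \<beta> s * (norm (r s))\<^sup>2 / 4)
    \<le> 2 * C * S t + C * \<epsilon>\<^sup>2 + C * norm (B w0) * \<Sigma> t"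
\<comment> \<open>The estimate is proved after applying \<open>K n\<close>, with a right-hand side
  free of n; the contraction property supplies the dominating function.\<close>
proof (rule integral_le_limit[where g = "\<lambda>n. gl t * (norm (B (K n (\<rho> t))))\<^sup>2 / 2"
      and f = "\<lambda>n s. g s / \<beta> s * (norm (K n (r s)))\<^sup>2 / 4" and h = "\<lambda>s. g s / \<beta> s * (norm (r s))\<^sup>2 / 4"])
  have cg: "continuous_on {0..t} g" by (rule continuous_on_subset[OF DERIV_continuous_on[OF Dg] sub]) simp
  have c\<beta>: "continuous_on {0..t} \<beta>" by (rule continuous_\<beta>[OF sub])
  note ct = cont[THEN continuous_on_subset, OF sub]
  have \<beta>nz: "\<forall>s\<in>{0..t}. \<beta> s \<noteq> 0" using \<beta>_pos by force
  have cf: "continuous_on {0..t} (\<lambda>s. g s / \<beta> s * (norm (K n (r s)))\<^sup>2 / 4)" for n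
    by (intro continuous_intros cg c\<beta> bounded_linear.continuous_on[OF K_bl] ct \<beta>nz) simp
  then show "\<And>n. continuous_on {0..t} (\<lambda>s. g s / \<beta> s * (norm (K n (r s)))\<^sup>2 / 4)" .
  show "continuous_on {0..t} (\<lambda>s. g s / \<beta> s * (norm (r s))\<^sup>2 / 4)"
    by (intro continuous_intros cg c\<beta> ct \<beta>nz) simp
  show "(\<lambda>n. g s / \<beta> s * (norm (K n (r s)))\<^sup>2 / 4) \<longlonglongrightarrow> g s / \<beta> s * (norm (r s))\<^sup>2 / 4" for s
    by (intro tendsto_intros K_lim) simp
  show "\<bar>g s / \<beta> s * (norm (K n (r s)))\<^sup>2 / 4\<bar> \<le> g s / \<beta> s * (norm (r s))\<^sup>2 / 4" if "s \<in> {0..t}" for n s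
    using g(1)[of s] \<beta>_pos[of s] that by (simp add: abs_mult divide_right_mono mult_left_mono power_mono K_norm)
  show "(\<lambda>n. gl t * (norm (B (K n (\<rho> t))))\<^sup>2 / 2) \<longlonglongrightarrow> gl t * (norm (B (\<rho> t)))\<^sup>2 / 2"
    unfolding K_commute[OF \<rho>_D(1)[OF t]] by (intro tendsto_intros K_lim) simp
  fix n
  define q where "q s = (norm (K n (r s)))\<^sup>2" for s
  define X where "X s = (norm (B (K n (\<rho> s))))\<^sup>2" for s
  define z where "z s = K n (U2 s) - w n s + (e s / (\<epsilon> * \<beta> s)) *\<^sub>R K n w0" for s
  define y where "y s = (cu s + cU s) * (norm (B (\<rho> s)))\<^sup>2" for s
  define x0 where "x0 s = B (K n (\<rho> s)) \<bullet> K n (B w0)" for s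
  define h where "h s = 2 * C * (\<beta> s * y s) + \<epsilon>\<^sup>2 * (g s * \<beta> s * (norm (w n s))\<^sup>2)
     + C * norm (B w0) * ((1 + s)\<^sup>2 * e s * norm (B (\<rho> s)))" for s
  note lin = linear_simps[OF K_bl[of n]]
  have Dq: "(q has_real_derivative 2 * (K n (r s) \<bullet> z s)) (at s within {0..t})" if s: "s \<ge> 0" for s
  proof -
    have "((\<lambda>s. K n (U1 s) - K n (v s) - e s *\<^sub>R K n w0) has_vector_derivative
        K n (U2 s) - w n s - (e s *\<^sub>R 0 + (- (e s / (\<epsilon> * \<beta> s))) *\<^sub>R K n w0)) (at s within {0..})"
      by (intro has_vector_derivative_diff bounded_linear.has_vector_derivative[OF K_bl] hD(2) Dw s
        has_vector_derivative_scaleR De has_vector_derivative_const)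
    then have "((\<lambda>s. K n (r s)) has_vector_derivative z s) (at s within {0..})"
      by (simp add: r_def lin z_def)
    from DERIV_norm_square[OF has_vector_derivative_within_subset[OF this sub]]
    show ?thesis by (simp add: q_def[abs_def])
  qed
  have DX: "(X has_real_derivative 2 * (K n (r s) \<bullet> B (B (K n (\<rho> s)))) + 2 * (e s * x0 s)) (at s within {0..t})"
    if s: "s \<ge> 0" for s
  proof -
    have "((\<lambda>s. B (K n (\<rho> s))) has_vector_derivative B (K n (r s + e s *\<^sub>R w0))) (at s within {0..t})"
      by (rule has_vector_derivative_within_subset[OF bounded_linear.has_vector_derivative[OF BK_bl(1) D\<rho>[OF s]] sub])
    moreover have "B (K n (\<rho> s)) \<bullet> B (K n (r s + e s *\<^sub>R w0)) = B (B (K n (\<rho> s))) \<bullet> K n (r s + e s *\<^sub>R w0)"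
      by (rule B_sym[OF K_D(2) K_D(1), symmetric])
    \<comment> \<open>Here w0 \<in> D(B) is used: one B moves onto w0, so that B\<rho>
      suffices.\<close>
    moreover have "B (B (K n (\<rho> s))) \<bullet> K n w0 = x0 s"
      unfolding x0_def K_commute[OF w0_D, symmetric] by (rule B_sym[OF K_D(2) K_D(1)])
    ultimately show ?thesis using DERIV_norm_square
      by (fastforce simp: X_def[abs_def] lin inner_add_right inner_commute)
  qed
  have \<epsilon>z: "\<epsilon> * (K n (r s) \<bullet> z s) = - (q s / \<beta> s) - l s * (K n (r s) \<bullet> B (B (K n (\<rho> s))))
      - K n (r s) \<bullet> K n (R s) - \<epsilon> * (K n (r s) \<bullet> w n s)" if s: "s \<ge> 0" for s
  proof -
    have "K n (cU s *\<^sub>R B (B (U s)) - cu s *\<^sub>R B (B (u s))) = l s *\<^sub>R B (B (K n (\<rho> s))) + K n (R s)"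
      unfolding split[OF s] K_commute2[OF \<rho>_D(1,3)[OF s]] by (simp only: lin)
    then have 1: "cU s *\<^sub>R K n (B (B (U s))) = cu s *\<^sub>R K n (B (B (u s))) + l s *\<^sub>R B (B (K n (\<rho> s))) + K n (R s)"
      by (simp add: lin algebra_simps)
    have 2: "\<epsilon> *\<^sub>R K n (U2 s) = - (inverse (\<beta> s) *\<^sub>R K n (U1 s) + cU s *\<^sub>R K n (B (B (U s))))"
      unfolding hD(7)[OF s] cU_def MU_def using \<epsilon>0 by (simp add: lin)
    have 3: "inverse (\<beta> s) *\<^sub>R K n (v s) = - cu s *\<^sub>R K n (B (B (u s)))"
      unfolding v_eq[OF s] using \<beta>_pos[OF s] by (simp add: lin)
    have "\<epsilon> *\<^sub>R z s = \<epsilon> *\<^sub>R K n (U2 s) - \<epsilon> *\<^sub>R w n s + (e s * inverse (\<beta> s)) *\<^sub>R K n w0"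
      using \<epsilon>0 by (simp add: z_def scaleR_diff_right scaleR_add_right divide_inverse)
    also have "\<dots> = - (inverse (\<beta> s) *\<^sub>R K n (U1 s)) + inverse (\<beta> s) *\<^sub>R K n (v s) + (e s * inverse (\<beta> s)) *\<^sub>R K n w0
        - l s *\<^sub>R B (B (K n (\<rho> s))) - K n (R s) - \<epsilon> *\<^sub>R w n s"
      unfolding 2 3 1 by simp
    also have "\<dots> = - (inverse (\<beta> s) *\<^sub>R K n (r s)) - l s *\<^sub>R B (B (K n (\<rho> s))) - K n (R s) - \<epsilon> *\<^sub>R w n s"
      by (simp add: r_def lin scaleR_diff_right mult.commute)
    finally have "K n (r s) \<bullet> (\<epsilon> *\<^sub>R z s) = K n (r s) \<bullet> (- (inverse (\<beta> s) *\<^sub>R K n (r s)) - l s *\<^sub>R B (B (K n (\<rho> s))) - K n (R s) - \<epsilon> *\<^sub>R w n s)"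
      by simp
    then show ?thesis by (simp add: inner_diff_right q_def power2_norm_eq_inner divide_inverse mult.commute)
  qed
  have "(\<epsilon> / 2 * (g t * q t) + gl t * X t / 2) - (\<epsilon> / 2 * (g 0 * q 0) + gl 0 * X 0 / 2)
    \<le> integral {0..t} (\<lambda>s. h s - g s / \<beta> s * q s / 4)"
  proof (rule DERIV_within_le_integral[where f = "\<lambda>t. \<epsilon> / 2 * (g t * q t) + gl t * X t / 2"])
    fix s assume "s \<in> {0..t}"
    then have s: "s \<ge> 0" by simp
    let ?a = "K n (r s) \<bullet> B (B (K n (\<rho> s)))" and ?k = "K n (r s) \<bullet> K n (R s)" and ?w = "K n (r s) \<bullet> w n s"
    show "((\<lambda>t. \<epsilon> / 2 * (g t * q t) + gl t * X t / 2) has_real_derivative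
      \<epsilon> / 2 * (g' s * q s + 2 * (K n (r s) \<bullet> z s) * g s) + (gl' s * X s + (2 * ?a + 2 * (e s * x0 s)) * gl s) / 2) (at s within {0..t})"
      by (intro DERIV_add DERIV_cdivide DERIV_cmult DERIV_mult Dq DX s DERIV_subset[OF Dg[OF s] sub] DERIV_subset[OF Dgl[OF s] sub])
    have "\<epsilon> / 2 * (g' s * q s + 2 * (K n (r s) \<bullet> z s) * g s) + (gl' s * X s + (2 * ?a + 2 * (e s * x0 s)) * gl s) / 2
       = \<epsilon> * g' s / 2 * q s + g s * (\<epsilon> * (K n (r s) \<bullet> z s)) + gl' s * X s / 2 + gl s * ?a + gl s * (e s * x0 s)"
      by (simp add: algebra_simps add_divide_distrib)
    \<comment> \<open>The relation gl = g l makes the two products of K r with A K \<rho>, which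
      have no bound of their own, cancel.\<close>
    also have "\<dots> = \<epsilon> * g' s / 2 * q s - g s * (q s / \<beta> s) + g s * (- ?k) + g s * (\<epsilon> * (- ?w)) + gl' s * X s / 2 + gl s * (e s * x0 s)"
      unfolding \<epsilon>z[OF s] g(2)[OF s] by (simp add: algebra_simps)
    \<comment> \<open>The damping supplies g q / \<beta>; the terms with g', R and w spend a quarter
      of it each, which leaves the quarter in the conclusion.\<close>
    also have "\<dots> \<le> (g s / \<beta> s) * q s / 4 - g s * (q s / \<beta> s) + ((g s / \<beta> s) * q s / 4 + C * (\<beta> s * y s))
        + ((g s / \<beta> s) * q s / 4 + \<epsilon>\<^sup>2 * (g s * \<beta> s * (norm (w n s))\<^sup>2)) + C * (\<beta> s * y s) + C * norm (B w0) * ((1 + s)\<^sup>2 * e s * norm (B (\<rho> s)))"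
    proof (intro add_mono diff_mono order_refl)
      note bs = \<beta>_pos[OF s] and gs = g(1)[OF s]
      have q0: "q s \<ge> 0" by (simp add: q_def)
      have "\<epsilon> * g' s / 2 \<le> (g s / \<beta> s) / 4" using g'[OF s] bs by (simp add: field_simps)
      from mult_right_mono[OF this q0] show "\<epsilon> * g' s / 2 * q s \<le> (g s / \<beta> s) * q s / 4" by simp
      have "g s * (- ?k) \<le> g s * (q s / (4 * \<beta> s) + \<beta> s * (norm (K n (R s)))\<^sup>2)"
        unfolding q_def using gs by (intro mult_left_mono inner_Young bs) auto
      also have "\<dots> \<le> (g s / \<beta> s) * q s / 4 + g s * \<beta> s * (norm (R s))\<^sup>2"
      proof -
        have "g s * (\<beta> s * (norm (K n (R s)))\<^sup>2) \<le> g s * (\<beta> s * (norm (R s))\<^sup>2)"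
          using gs bs by (intro mult_left_mono power_mono K_norm) auto
        then show ?thesis by (simp add: distrib_left mult.assoc mult.commute[of "\<beta> s" 4])
      qed
      finally show "g s * (- ?k) \<le> (g s / \<beta> s) * q s / 4 + C * (\<beta> s * y s)" using R[OF s] unfolding y_def by linarith
      have "- (K n (r s) \<bullet> (\<epsilon> *\<^sub>R w n s)) \<le> q s / (4 * \<beta> s) + \<beta> s * (norm (\<epsilon> *\<^sub>R w n s))\<^sup>2"
        unfolding q_def by (rule inner_Young[OF bs])
      from mult_left_mono[OF this, of "g s"] gs
      show "g s * (\<epsilon> * (- ?w)) \<le> (g s / \<beta> s) * q s / 4 + \<epsilon>\<^sup>2 * (g s * \<beta> s * (norm (w n s))\<^sup>2)"
        by (simp add: power_mult_distrib algebra_simps)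
      have Xy: "X s \<le> (norm (B (\<rho> s)))\<^sup>2" "X s \<ge> 0"
        unfolding X_def K_commute[OF \<rho>_D(1)[OF s]] by (auto intro!: power_mono K_norm)
      have "gl' s * X s \<le> 2 * C * (\<beta> s * (cu s + cU s)) * X s" using gl'[OF s] Xy(2) by (rule mult_right_mono)
      also have "\<dots> \<le> 2 * C * (\<beta> s * (cu s + cU s)) * (norm (B (\<rho> s)))\<^sup>2"
        using Xy(1) C0 bs c_pos[of s] s by (intro mult_left_mono) auto
      finally show "gl' s * X s / 2 \<le> C * (\<beta> s * y s)" by (simp add: y_def)
      have "x0 s \<le> norm (B (K n (\<rho> s))) * norm (K n (B w0))" unfolding x0_def by (rule norm_cauchy_schwarz)
      also have "\<dots> \<le> norm (B (\<rho> s)) * norm (B w0)"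
        unfolding K_commute[OF \<rho>_D(1)[OF s]] by (intro mult_mono K_norm) auto
      finally have "gl s * (e s * x0 s) \<le> gl s * (e s * (norm (B (\<rho> s)) * norm (B w0)))"
        using g(3)[OF s] e_pos[OF s] by (intro mult_left_mono) auto
      also have "\<dots> \<le> C * (1 + s)\<^sup>2 * (e s * (norm (B (\<rho> s)) * norm (B w0)))"
        using gl_le[OF s] e_pos[OF s] by (intro mult_right_mono) auto
      finally show "gl s * (e s * x0 s) \<le> C * norm (B w0) * ((1 + s)\<^sup>2 * e s * norm (B (\<rho> s)))" by (simp add: mult_ac)
    qed
    also have "\<dots> = h s - g s / \<beta> s * q s / 4" by (simp add: h_def)
    finally show "\<epsilon> / 2 * (g' s * q s + 2 * (K n (r s) \<bullet> z s) * g s) + (gl' s * X s + (2 * ?a + 2 * (e s * x0 s)) * gl s) / 2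
      \<le> h s - g s / \<beta> s * q s / 4" .
  next
    show "continuous_on {0..t} (\<lambda>s. h s - g s / \<beta> s * q s / 4)"
      unfolding h_def y_def q_def
      by (intro continuous_intros cg c\<beta> ct \<beta>nz bounded_linear.continuous_on[OF K_bl] continuous_on_subset[OF cont_w sub]) simp
  qed (rule t)
  moreover have "integral {0..t} (\<lambda>s. h s - g s / \<beta> s * q s / 4) = 2 * C * S t + \<epsilon>\<^sup>2 * integral {0..t} (\<lambda>s. g s * \<beta> s * (norm (w n s))\<^sup>2)
     + C * norm (B w0) * \<Sigma> t - integral {0..t} (\<lambda>s. g s / \<beta> s * q s / 4)"
  proof -
    have i1: "(\<lambda>s. \<beta> s * y s) integrable_on {0..t}" "(\<lambda>s. g s * \<beta> s * (norm (w n s))\<^sup>2) integrable_on {0..t}"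
      "(\<lambda>s. (1 + s)\<^sup>2 * e s * norm (B (\<rho> s))) integrable_on {0..t}" unfolding y_def
      by (intro integrable_continuous_real continuous_intros cg c\<beta> ct continuous_on_subset[OF cont_w sub])+
    have i2: "(\<lambda>s. g s / \<beta> s * q s / 4) integrable_on {0..t}" unfolding q_def by (rule integrable_continuous_real[OF cf])
    note hi = integrable_integral[OF i1(1)] integrable_integral[OF i1(2)] integrable_integral[OF i1(3)] integrable_integral[OF i2]
    show ?thesis
      unfolding h_def S_def \<Sigma>_def y_def[symmetric]
      by (rule integral_unique) (intro has_integral_diff has_integral_add has_integral_mult_right hi)
  qed
  moreover have "\<epsilon>\<^sup>2 * integral {0..t} (\<lambda>s. g s * \<beta> s * (norm (w n s))\<^sup>2) \<le> C * \<epsilon>\<^sup>2"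
    using mult_left_mono[OF W[of n], of "\<epsilon>\<^sup>2"] by (simp add: mult.commute)
  moreover have "q 0 = 0" "X 0 = 0"
    using at_zero lin(1)[of 0 0] by (simp_all add: q_def X_def at_zero K_commute[OF \<rho>_D(1)] linear_0[OF bounded_linear.linear[OF K_bl]])
  moreover have "\<epsilon> / 2 * (g t * q t) \<ge> 0" using \<epsilon>0 g(1)[OF t] by (simp add: q_def)
  ultimately show "gl t * (norm (B (K n (\<rho> t))))\<^sup>2 / 2 + integral {0..t} (\<lambda>s. g s / \<beta> s * (norm (K n (r s)))\<^sup>2 / 4)
    \<le> 2 * C * S t + C * \<epsilon>\<^sup>2 + C * norm (B w0) * \<Sigma> t"
    unfolding X_def q_def by simp
qed

end

section \<open>Comparison of the two nonlinear coefficients\<close>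

lemma powr_diff_le:
  fixes x y q :: real
  assumes "0 < y" "y \<le> x" "1 \<le> q"
  shows "x powr q - y powr q \<le> q * (x powr q / x) * (x - y)"
proof -
  have "q * (x powr q / x) * y - y powr q \<le> q * (x powr q / x) * x - x powr q"
  proof (rule nondecreasing_within[where f = "\<lambda>z. q * (x powr q / x) * z - z powr q"])
    fix z assume z: "z \<in> {y..x}"
    then have z0: "z > 0" using assms by simp
    show "((\<lambda>z. q * (x powr q / x) * z - z powr q) has_real_derivative
        q * (x powr q / x) * 1 - q * (1 / z) * z powr q) (at z within {y..x})"
      by (intro DERIV_diff DERIV_cmult DERIV_ident DERIV_powr_const[where f = "\<lambda>z. z"] z0)
    have "z powr (q - 1) \<le> x powr (q - 1)" using z z0 assms by (intro powr_mono2) auto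
    then have "z powr q / z \<le> x powr q / x" using z0 z assms by (simp add: powr_diff)
    then have "q * (z powr q / z) \<le> q * (x powr q / x)" using assms by (intro mult_left_mono) auto
    then show "0 \<le> q * (x powr q / x) * 1 - q * (1 / z) * z powr q" by (simp add: mult_ac)
  qed (use assms in simp)
  then show ?thesis by (simp add: right_diff_distrib)
qed

text \<open>Multiplying by the square of the larger argument clears the denominator of the mean
  value estimate, so the bound contains the larger coefficient only and is insensitive to how small
  y is.\<close>

lemma powr_square_diff_le:
  fixes x y :: real
  assumes "0 < y" "y \<le> x" "1 \<le> \<gamma>"
  shows "((x\<^sup>2) powr \<gamma> - (y\<^sup>2) powr \<gamma>)\<^sup>2 * x\<^sup>2 \<le> 4 * \<gamma>\<^sup>2 * ((x\<^sup>2) powr \<gamma>)\<^sup>2 * (x - y)\<^sup>2"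
    and "(y\<^sup>2) powr \<gamma> \<le> (x\<^sup>2) powr \<gamma>"
proof -
  have x: "x > 0" using assms by simp
  have eq: "(z\<^sup>2) powr \<gamma> = z powr (2 * \<gamma>)" if "z > 0" for z :: real
    using that powr_powr[of z 2 \<gamma>] by simp
  show le: "(y\<^sup>2) powr \<gamma> \<le> (x\<^sup>2) powr \<gamma>" using assms by (intro powr_mono2 power_mono) auto
  have "(x\<^sup>2) powr \<gamma> - (y\<^sup>2) powr \<gamma> \<le> 2 * \<gamma> * ((x\<^sup>2) powr \<gamma> / x) * (x - y)"
    unfolding eq[OF assms(1)] eq[OF x] using assms by (intro powr_diff_le) auto
  then have "((x\<^sup>2) powr \<gamma> - (y\<^sup>2) powr \<gamma>) * x \<le> 2 * \<gamma> * (x\<^sup>2) powr \<gamma> * (x - y)"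
    using x by (simp add: field_simps)
  then have "(((x\<^sup>2) powr \<gamma> - (y\<^sup>2) powr \<gamma>) * x)\<^sup>2 \<le> (2 * \<gamma> * (x\<^sup>2) powr \<gamma> * (x - y))\<^sup>2"
    using le x by (intro power_mono) auto
  then show "((x\<^sup>2) powr \<gamma> - (y\<^sup>2) powr \<gamma>)\<^sup>2 * x\<^sup>2 \<le> 4 * \<gamma>\<^sup>2 * ((x\<^sup>2) powr \<gamma>)\<^sup>2 * (x - y)\<^sup>2"
    by (simp add: power_mult_distrib)
qed

context singular_perturbation
begin

text \<open>\<open>Mu\<close> and \<open>MU\<close> are not known to be comparable uniformly in
  time, so each case measures the difference by the larger of the two. The factor comes from the
  triangle inequality for |BU| - |Bu|.\<close>

lemma c_diff:
  assumes t: "t \<ge> 0"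
  shows "MU t \<le> Mu t \<Longrightarrow> (cU t - cu t)\<^sup>2 * Mu t \<le> 4 * \<gamma>\<^sup>2 * (cu t)\<^sup>2 * (norm (B (\<rho> t)))\<^sup>2"
    "Mu t \<le> MU t \<Longrightarrow> (cU t - cu t)\<^sup>2 * MU t \<le> 4 * \<gamma>\<^sup>2 * (cU t)\<^sup>2 * (norm (B (\<rho> t)))\<^sup>2"
    "MU t \<le> Mu t \<Longrightarrow> cU t \<le> cu t" "Mu t \<le> MU t \<Longrightarrow> cu t \<le> cU t"
proof -
  let ?x = "norm (B (U t))" and ?y = "norm (B (u t))"
  have pos: "?x > 0" "?y > 0" using bounds_u(1)[OF t] bounds_U(1)[OF t] by (auto simp: Mu_def MU_def)
  have "\<bar>?x - ?y\<bar> \<le> norm (B (\<rho> t))" unfolding \<rho>_D(2)[OF t] by (rule norm_triangle_ineq3)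
  then have d: "(?x - ?y)\<^sup>2 \<le> (norm (B (\<rho> t)))\<^sup>2"
    using power_mono[of "\<bar>?x - ?y\<bar>" _ 2] by simp
  show "(cU t - cu t)\<^sup>2 * Mu t \<le> 4 * \<gamma>\<^sup>2 * (cu t)\<^sup>2 * (norm (B (\<rho> t)))\<^sup>2" "cU t \<le> cu t" if "MU t \<le> Mu t"
  proof -
    have "?x \<le> ?y" by (rule power2_le_imp_le[OF that[unfolded MU_def Mu_def] norm_ge_zero])
    note pd = powr_square_diff_le[OF pos(1) this \<gamma>1]
    have "(cU t - cu t)\<^sup>2 * Mu t \<le> 4 * \<gamma>\<^sup>2 * (cu t)\<^sup>2 * (?x - ?y)\<^sup>2"
      using pd(1) unfolding cu_def cU_def Mu_def MU_def by (simp only: power2_commute)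
    also have "\<dots> \<le> 4 * \<gamma>\<^sup>2 * (cu t)\<^sup>2 * (norm (B (\<rho> t)))\<^sup>2" using d by (intro mult_left_mono) auto
    finally show "(cU t - cu t)\<^sup>2 * Mu t \<le> 4 * \<gamma>\<^sup>2 * (cu t)\<^sup>2 * (norm (B (\<rho> t)))\<^sup>2" .
    show "cU t \<le> cu t" using pd(2) by (simp add: cu_def cU_def Mu_def MU_def)
  qed
  show "(cU t - cu t)\<^sup>2 * MU t \<le> 4 * \<gamma>\<^sup>2 * (cU t)\<^sup>2 * (norm (B (\<rho> t)))\<^sup>2" "cu t \<le> cU t" if "Mu t \<le> MU t"
  proof -
    have "?y \<le> ?x" by (rule power2_le_imp_le[OF that[unfolded MU_def Mu_def] norm_ge_zero])
    note pd = powr_square_diff_le[OF pos(2) this \<gamma>1]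
    have "(cU t - cu t)\<^sup>2 * MU t \<le> 4 * \<gamma>\<^sup>2 * (cU t)\<^sup>2 * (?x - ?y)\<^sup>2"
      using pd(1) unfolding cu_def cU_def Mu_def MU_def .
    also have "\<dots> \<le> 4 * \<gamma>\<^sup>2 * (cU t)\<^sup>2 * (norm (B (\<rho> t)))\<^sup>2" using d by (intro mult_left_mono) auto
    finally show "(cU t - cu t)\<^sup>2 * MU t \<le> 4 * \<gamma>\<^sup>2 * (cU t)\<^sup>2 * (norm (B (\<rho> t)))\<^sup>2" .
    show "cu t \<le> cU t" using pd(2) by (simp add: cu_def cU_def Mu_def MU_def)
  qed
qed

text \<open>A common majorant of the constants that occur in the two applications of
  \<open>pairing\<close>.\<close>

definition "C = 16 * \<gamma>\<^sup>2 * L\<^sup>2"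

lemma C_bounds: "4 * \<gamma>\<^sup>2 * L \<le> C" "4 * \<gamma>\<^sup>2 * L\<^sup>2 \<le> C" "16 * \<gamma>\<^sup>2 * L \<le> C" "1 + \<gamma> * L \<le> C" "2 * L \<le> C" "L \<le> C" "1 \<le> C" "0 < C"
proof -
  have g: "\<gamma>\<^sup>2 \<ge> 1" "\<gamma> \<le> \<gamma>\<^sup>2" and l: "L\<^sup>2 \<ge> L" "L\<^sup>2 \<ge> 1" using \<gamma>1 L1 by (auto simp: power2_eq_square mult_ge1_I intro: mult_ge1_I)
  have 1: "\<gamma>\<^sup>2 * L \<le> \<gamma>\<^sup>2 * L\<^sup>2" using l by (intro mult_left_mono) auto
  have 2: "\<gamma> * L \<le> \<gamma>\<^sup>2 * L" using g L1 by (intro mult_right_mono) auto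
  have 3: "1 * L \<le> \<gamma>\<^sup>2 * L" using g L1 by (intro mult_right_mono) auto
  have 4: "C = 16 * (\<gamma>\<^sup>2 * L\<^sup>2)" by (simp add: C_def)
  show "4 * \<gamma>\<^sup>2 * L \<le> C" "4 * \<gamma>\<^sup>2 * L\<^sup>2 \<le> C" "16 * \<gamma>\<^sup>2 * L \<le> C" "1 + \<gamma> * L \<le> C" "2 * L \<le> C" "L \<le> C" "1 \<le> C" "0 < C"
    using 1 2 3 L1 unfolding 4 by linarith+
qed

lemma w_weight_integral:
  assumes t: "t \<ge> 0" and f: "continuous_on {0..t} f" and le: "\<And>s. s \<in> {0..t} \<Longrightarrow> f s \<le> \<beta> s * inverse (cu s) + (\<beta> s)^3"
  shows "integral {0..t} (\<lambda>s. f s * (norm (w n s))\<^sup>2) \<le> C"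
proof -
  note ct = cont[THEN continuous_on_subset, OF sub]
  have "integral {0..t} (\<lambda>s. f s * (norm (w n s))\<^sup>2) \<le> integral {0..t} (\<lambda>s. (norm (w n s))\<^sup>2 * (\<beta> s * inverse (cu s) + (\<beta> s)^3))"
  proof (intro integral_le integrable_continuous_real continuous_intros f ct continuous_\<beta> sub continuous_on_subset[OF cont_w sub])
    show "\<forall>x\<in>{0..t}. cu x \<noteq> 0" using c_pos by force
    show "f s * (norm (w n s))\<^sup>2 \<le> (norm (w n s))\<^sup>2 * (\<beta> s * inverse (cu s) + (\<beta> s)^3)" if "s \<in> {0..t}" for s
      using mult_right_mono[OF le[OF that], of "(norm (w n s))\<^sup>2"] by (simp add: mult.commute)
  qed
  also have "\<dots> \<le> L" unfolding cu_def Mu_def by (rule w_int[OF t])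
  finally show ?thesis using C_bounds(6) by linarith
qed

text \<open>The multiplier 1 / c with l = c makes gl = 1, so |B\<rho>|^2 appears unweighted and
  without a derivative term. The price is the remainder (cU - cu) AU under the growing weight 1 /
  c.\<close>

lemma estimate_B\<rho>:
  assumes t: "t \<ge> 0"
  shows "(norm (B (\<rho> t)))\<^sup>2 / 2 + integral {0..t} (\<lambda>s. inverse (cu s) / \<beta> s * (norm (r s))\<^sup>2 / 4)
    \<le> 2 * C * S t + C * \<epsilon>\<^sup>2 + C * norm (B w0) * \<Sigma> t"
proof -
  have "\<forall>t. \<exists>\<eta>. t \<ge> 0 \<longrightarrow> \<bar>\<eta>\<bar> * (1 + t) \<le> L \<and> (cu has_real_derivative 2 * \<gamma> * \<eta> * cu t) (at t within {0..})"
    using D_cu by metis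
  then obtain \<eta> where \<eta>: "\<And>t. t \<ge> 0 \<Longrightarrow> \<bar>\<eta> t\<bar> * (1 + t) \<le> L"
    "\<And>t. t \<ge> 0 \<Longrightarrow> (cu has_real_derivative 2 * \<gamma> * \<eta> t * cu t) (at t within {0..})" by metis
  have "1 * (norm (B (\<rho> t)))\<^sup>2 / 2 + integral {0..t} (\<lambda>s. inverse (cu s) / \<beta> s * (norm (r s))\<^sup>2 / 4)
    \<le> 2 * C * S t + C * \<epsilon>\<^sup>2 + C * norm (B w0) * \<Sigma> t"
  proof (rule pairing[OF t, where g = "\<lambda>s. inverse (cu s)" and gl = "\<lambda>_. 1" and gl' = "\<lambda>_. 0" and l = cu
        and g' = "\<lambda>s. - (2 * \<gamma> * \<eta> s * inverse (cu s))" and R = "\<lambda>s. (cU s - cu s) *\<^sub>R B (B (U s))"])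
    show "C \<ge> 0" using C_bounds by simp
    fix s :: real assume s: "s \<ge> 0"
    note cs = c_pos(1)[OF s] c_pos(2)[OF s] and bs = \<beta>_pos[OF s]
    show "((\<lambda>s. inverse (cu s)) has_real_derivative - (2 * \<gamma> * \<eta> s * inverse (cu s))) (at s within {0..})"
      by (rule DERIV_cong[OF DERIV_inverse'[OF \<eta>(2)[OF s]]]) (use cs in auto)
    show "inverse (cu s) > 0" "1 = inverse (cu s) * cu s" using cs by auto
    show "2 * (\<epsilon> * - (2 * \<gamma> * \<eta> s * inverse (cu s))) * \<beta> s \<le> inverse (cu s)"
    proof -
      have "- \<eta> s * \<beta> s \<le> \<bar>\<eta> s\<bar> * (1 + s)" using \<beta>_le[OF s] bs by (intro mult_mono) auto
      then have "4 * \<gamma> * \<epsilon> * (- \<eta> s * \<beta> s) \<le> 4 * \<gamma> * \<epsilon> * L"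
        using \<eta>(1)[OF s] \<gamma>1 \<epsilon>0 by (intro mult_left_mono) auto
      then have "4 * \<gamma> * \<epsilon> * (- \<eta> s * \<beta> s) * inverse (cu s) \<le> 1 * inverse (cu s)"
        using \<epsilon>_small(2) cs by (intro mult_right_mono) (auto simp: mult_ac)
      then show ?thesis by (simp add: mult_ac)
    qed
    show "0 \<le> 2 * C * (\<beta> s * (cu s + cU s))" using C_bounds bs cs by simp
    have "1 * 1 \<le> C * (1 + s)\<^sup>2" using C_bounds s by (intro mult_mono) auto
    then show "1 \<le> C * (1 + s)\<^sup>2" by simp
    show "cU s *\<^sub>R B (B (U s)) - cu s *\<^sub>R B (B (u s)) = cu s *\<^sub>R B (B (\<rho> s)) + (cU s - cu s) *\<^sub>R B (B (U s))"
      unfolding \<rho>_D(4)[OF s] by (simp add: algebra_simps)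
    have "inverse (cu s) * ((cU s - cu s)\<^sup>2 * (norm (B (B (U s))))\<^sup>2) \<le> C * ((cu s + cU s) * (norm (B (\<rho> s)))\<^sup>2)"
    \<comment> \<open>If \<open>cu\<close> is the larger coefficient, it compensates its own inverse
      and the bounded Rayleigh quotient of U suffices. Otherwise 1 / cu is replaced by L (1 + s)
      \<beta>, and the decay of cU |AU|^2 pays for this weight.\<close>
    proof (cases "MU s \<le> Mu s")
      case True
      have "(norm (B (B (U s))))\<^sup>2 \<le> L * Mu s"
        using bounds_U(3)[OF s] mult_left_mono[OF True, of L] L1 by linarith
      then have "(cU s - cu s)\<^sup>2 * (norm (B (B (U s))))\<^sup>2 \<le> (cU s - cu s)\<^sup>2 * (L * Mu s)" by (rule mult_left_mono) simp
      also have "\<dots> = L * ((cU s - cu s)\<^sup>2 * Mu s)" by simp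
      also have "\<dots> \<le> L * (4 * \<gamma>\<^sup>2 * (cu s)\<^sup>2 * (norm (B (\<rho> s)))\<^sup>2)"
        using c_diff(1)[OF s True] L1 by (intro mult_left_mono) auto
      finally have "inverse (cu s) * ((cU s - cu s)\<^sup>2 * (norm (B (B (U s))))\<^sup>2) \<le> inverse (cu s) * (L * (4 * \<gamma>\<^sup>2 * (cu s)\<^sup>2 * (norm (B (\<rho> s)))\<^sup>2))"
        using cs by (intro mult_left_mono) auto
      also have "\<dots> = (4 * \<gamma>\<^sup>2 * L) * (cu s * (norm (B (\<rho> s)))\<^sup>2)" using cs by (simp add: power2_eq_square)
      also have "\<dots> \<le> C * ((cu s + cU s) * (norm (B (\<rho> s)))\<^sup>2)"
        using C_bounds cs by (intro mult_mono mult_right_mono) auto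
      finally show ?thesis .
    next
      case False
      define T where "T = (1 + s) * \<beta> s"
      have T: "T > 0" using bs s by (simp add: T_def)
      have "((cU s - cu s)\<^sup>2 * (norm (B (B (U s))))\<^sup>2 * T) * cU s = (cU s - cu s)\<^sup>2 * (cU s * (norm (B (B (U s))))\<^sup>2 * T)"
        by simp
      also have "\<dots> \<le> (cU s - cu s)\<^sup>2 * (L * MU s)" using bounds_U(2)[OF s] unfolding T_def by (rule mult_left_mono) simp
      also have "\<dots> = L * ((cU s - cu s)\<^sup>2 * MU s)" by simp
      also have "\<dots> \<le> L * (4 * \<gamma>\<^sup>2 * (cU s)\<^sup>2 * (norm (B (\<rho> s)))\<^sup>2)"
        using c_diff(2)[OF s] False L1 by (intro mult_left_mono) auto
      also have "\<dots> = (L * (4 * \<gamma>\<^sup>2 * cU s * (norm (B (\<rho> s)))\<^sup>2)) * cU s" by (simp add: power2_eq_square)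
      finally have "(cU s - cu s)\<^sup>2 * (norm (B (B (U s))))\<^sup>2 * T \<le> L * (4 * \<gamma>\<^sup>2 * cU s * (norm (B (\<rho> s)))\<^sup>2)"
        by (rule mult_right_le_imp_le[OF _ cs(2)])
      then have 1: "L * (T * ((cU s - cu s)\<^sup>2 * (norm (B (B (U s))))\<^sup>2)) \<le> L * (L * (4 * \<gamma>\<^sup>2 * cU s * (norm (B (\<rho> s)))\<^sup>2))"
        using L1 by (intro mult_left_mono) (auto simp: mult_ac)
      have "inverse (cu s) \<le> L * T"
        using lower[OF s] cs unfolding cu_def[symmetric] Mu_def[symmetric] T_def by (simp add: field_simps)
      then have "inverse (cu s) * ((cU s - cu s)\<^sup>2 * (norm (B (B (U s))))\<^sup>2) \<le> (L * T) * ((cU s - cu s)\<^sup>2 * (norm (B (B (U s))))\<^sup>2)"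
        by (rule mult_right_mono) simp
      also have "\<dots> \<le> (4 * \<gamma>\<^sup>2 * L\<^sup>2) * (cU s * (norm (B (\<rho> s)))\<^sup>2)" using 1 by (simp add: power2_eq_square mult_ac)
      also have "\<dots> \<le> C * ((cu s + cU s) * (norm (B (\<rho> s)))\<^sup>2)"
        using C_bounds cs by (intro mult_mono mult_right_mono) auto
      finally show ?thesis .
    qed
    from mult_left_mono[OF this, of "\<beta> s"] bs
    show "inverse (cu s) * \<beta> s * (norm ((cU s - cu s) *\<^sub>R B (B (U s))))\<^sup>2 \<le> C * (\<beta> s * ((cu s + cU s) * (norm (B (\<rho> s)))\<^sup>2))"
      by (simp add: power_mult_distrib mult_ac)
  next
    fix n
    show "integral {0..t} (\<lambda>s. inverse (cu s) * \<beta> s * (norm (w n s))\<^sup>2) \<le> C"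
      using c_pos \<beta>_pos
      by (intro w_weight_integral t continuous_intros continuous_\<beta> cont[THEN continuous_on_subset, OF sub] sub) force+
  qed simp_all
  then show ?thesis by simp
qed

text \<open>The multiplier is \<beta>^2, and l is the harmonic mean of the two coefficients. It is
  at most 2 cu, hence bounded, and the remainder becomes (cU - cu) / (cu + cU) times cU AU + cu Au,
  where AU and Au each carry the coefficient with which their decay is known.\<close>

lemma estimate_r:
  assumes t: "t \<ge> 0"
  shows "integral {0..t} (\<lambda>s. \<beta> s * (norm (r s))\<^sup>2 / 4) \<le> 2 * C * S t + C * \<epsilon>\<^sup>2 + C * norm (B w0) * \<Sigma> t"
proof -
  have "\<forall>t. \<exists>\<eta>. t \<ge> 0 \<longrightarrow> \<bar>\<eta>\<bar> * (1 + t) \<le> L \<and> (cu has_real_derivative 2 * \<gamma> * \<eta> * cu t) (at t within {0..})"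
    using D_cu by metis
  then obtain \<eta> where \<eta>: "\<And>t. t \<ge> 0 \<Longrightarrow> \<bar>\<eta> t\<bar> * (1 + t) \<le> L"
    "\<And>t. t \<ge> 0 \<Longrightarrow> (cu has_real_derivative 2 * \<gamma> * \<eta> t * cu t) (at t within {0..})" by metis
  have "\<forall>t. \<exists>\<eta>. t \<ge> 0 \<longrightarrow> \<bar>\<eta>\<bar> * (1 + t) \<le> L \<and> (cU has_real_derivative 2 * \<gamma> * \<eta> * cU t) (at t within {0..})"
    using D_cU by metis
  then obtain \<zeta> where \<zeta>: "\<And>t. t \<ge> 0 \<Longrightarrow> \<bar>\<zeta> t\<bar> * (1 + t) \<le> L"
    "\<And>t. t \<ge> 0 \<Longrightarrow> (cU has_real_derivative 2 * \<gamma> * \<zeta> t * cU t) (at t within {0..})" by metis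
  define l where "l s = 2 * cu s * cU s / (cu s + cU s)" for s
  \<comment> \<open>The logarithmic derivative of l is 2 \<gamma> times a convex combination of
    \<eta> and \<zeta>, so it inherits their decay however the two coefficients compare.\<close>
  define l' where "l' s = 2 * \<gamma> * l s * ((\<eta> s * cU s + \<zeta> s * cu s) / (cu s + cU s))" for s
  have l: "0 \<le> l s" "l s \<le> 2 * cu s" "l s \<le> cu s + cU s" if s: "s \<ge> 0" for s
  proof -
    note cs = c_pos(1)[OF s] c_pos(2)[OF s]
    show "0 \<le> l s" using cs by (simp add: l_def)
    show "l s \<le> 2 * cu s" using cs by (simp add: l_def pos_divide_le_eq algebra_simps)
    show "l s \<le> cu s + cU s" using cs by (simp add: l_def pos_divide_le_eq algebra_simps)
  qed
  have "(\<beta> t)\<^sup>2 * l t * (norm (B (\<rho> t)))\<^sup>2 / 2 + integral {0..t} (\<lambda>s. (\<beta> s)\<^sup>2 / \<beta> s * (norm (r s))\<^sup>2 / 4)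
    \<le> 2 * C * S t + C * \<epsilon>\<^sup>2 + C * norm (B w0) * \<Sigma> t"
  proof (rule pairing[OF t, where g = "\<lambda>s. (\<beta> s)\<^sup>2" and gl = "\<lambda>s. (\<beta> s)\<^sup>2 * l s" and l = l
        and g' = "\<lambda>s. 2 * \<beta> s * (p * \<sigma> s)" and gl' = "\<lambda>s. 2 * \<beta> s * (p * \<sigma> s) * l s + l' s * (\<beta> s)\<^sup>2"
        and R = "\<lambda>s. ((cU s - cu s) / (cu s + cU s)) *\<^sub>R (cU s *\<^sub>R B (B (U s)) + cu s *\<^sub>R B (B (u s)))"])
    show "C \<ge> 0" using C_bounds by simp
    fix s :: real assume s: "s \<ge> 0"
    note cs = c_pos(1)[OF s] c_pos(2)[OF s] and bs = \<beta>_pos[OF s]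
    show Dg: "((\<lambda>s. (\<beta> s)\<^sup>2) has_real_derivative 2 * \<beta> s * (p * \<sigma> s)) (at s within {0..})"
      by (rule DERIV_cong[OF DERIV_power[OF DERIV_\<beta>[OF s], of 2]]) simp
    have "(l has_real_derivative l' s) (at s within {0..})"
      unfolding l_def[abs_def]
      by (rule DERIV_cong[OF DERIV_divide[OF DERIV_mult[OF DERIV_cmult[OF \<eta>(2)[OF s]] \<zeta>(2)[OF s]] DERIV_add[OF \<eta>(2)[OF s] \<zeta>(2)[OF s]]]])
        (use cs in \<open>auto simp: l'_def l_def field_simps\<close>)
    then show "((\<lambda>s. (\<beta> s)\<^sup>2 * l s) has_real_derivative 2 * \<beta> s * (p * \<sigma> s) * l s + l' s * (\<beta> s)\<^sup>2) (at s within {0..})"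
      by (rule DERIV_mult[OF Dg])
    show "(\<beta> s)\<^sup>2 > 0" "0 \<le> (\<beta> s)\<^sup>2 * l s" using bs l[OF s] by auto
    have p\<sigma>: "p * \<sigma> s \<le> 1" "0 \<le> p * \<sigma> s" using p0 p1 \<sigma>_le1[OF s] \<sigma>_pos[OF s] mult_le_one[of p "\<sigma> s"] by auto
    show "2 * (\<epsilon> * (2 * \<beta> s * (p * \<sigma> s))) * \<beta> s \<le> (\<beta> s)\<^sup>2"
    proof -
      have "(4 * \<epsilon>) * (p * \<sigma> s) \<le> 1 * 1" using p\<sigma> \<epsilon>_small(1) \<epsilon>0 by (intro mult_mono) auto
      from mult_right_mono[OF this, of "(\<beta> s)\<^sup>2"] show ?thesis by (simp add: power2_eq_square mult_ac)
    qed
    show "2 * \<beta> s * (p * \<sigma> s) * l s + l' s * (\<beta> s)\<^sup>2 \<le> 2 * C * (\<beta> s * (cu s + cU s))"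
    proof -
      have "\<beta> s * x \<le> (1 + s) * \<bar>x\<bar>" for x
        using mult_right_mono[OF \<beta>_le[OF s], of "\<bar>x\<bar>"] mult_left_mono[OF abs_ge_self, of "\<beta> s" x] bs by linarith
      then have "\<beta> s * \<eta> s \<le> (1 + s) * \<bar>\<eta> s\<bar>" "\<beta> s * \<zeta> s \<le> (1 + s) * \<bar>\<zeta> s\<bar>" by blast+
      then have "\<beta> s * \<eta> s \<le> L" "\<beta> s * \<zeta> s \<le> L" using \<eta>(1)[OF s] \<zeta>(1)[OF s] by (simp_all add: mult.commute)
      then have "(\<beta> s * \<eta> s) * cU s + (\<beta> s * \<zeta> s) * cu s \<le> L * cU s + L * cu s"
        using cs by (intro add_mono mult_right_mono) auto
      then have "((\<beta> s * \<eta> s) * cU s + (\<beta> s * \<zeta> s) * cu s) / (cu s + cU s) \<le> L"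
        using cs by (simp add: pos_divide_le_eq algebra_simps)
      then have "2 * \<gamma> * l s * (((\<beta> s * \<eta> s) * cU s + (\<beta> s * \<zeta> s) * cu s) / (cu s + cU s)) * \<beta> s \<le> 2 * \<gamma> * l s * L * \<beta> s"
        using l[OF s] \<gamma>1 bs by (intro mult_right_mono mult_left_mono) auto
      then have "l' s * (\<beta> s)\<^sup>2 \<le> 2 * \<gamma> * l s * L * \<beta> s"
        by (simp add: l'_def power2_eq_square distrib_left mult_ac)
      moreover have "2 * \<beta> s * (p * \<sigma> s) * l s \<le> 2 * \<beta> s * 1 * l s"
        using p\<sigma> bs l[OF s] by (intro mult_right_mono mult_left_mono) auto
      moreover have "(2 * (1 + \<gamma> * L)) * (\<beta> s * l s) \<le> (2 * C) * (\<beta> s * (cu s + cU s))"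
        using C_bounds bs l[OF s] \<gamma>1 L1 by (intro mult_mono mult_left_mono) auto
      ultimately show ?thesis by (simp add: algebra_simps)
    qed
    have "(\<beta> s)\<^sup>2 * l s \<le> (1 + s)\<^sup>2 * (2 * L)"
      using l[OF s] upper[OF s, folded Mu_def cu_def] \<beta>_le[OF s] bs by (intro mult_mono power_mono) auto
    also have "\<dots> \<le> (1 + s)\<^sup>2 * C" using C_bounds by (intro mult_left_mono) auto
    finally show "(\<beta> s)\<^sup>2 * l s \<le> C * (1 + s)\<^sup>2" by (simp add: mult.commute)
    show "cU s *\<^sub>R B (B (U s)) - cu s *\<^sub>R B (B (u s)) = l s *\<^sub>R B (B (\<rho> s)) +
       ((cU s - cu s) / (cu s + cU s)) *\<^sub>R (cU s *\<^sub>R B (B (U s)) + cu s *\<^sub>R B (B (u s)))"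
    proof -
      have 1: "l s + (cU s - cu s) / (cu s + cU s) * cU s = cU s" "- l s + (cU s - cu s) / (cu s + cU s) * cu s = - cu s"
      proof -
        have N: "cu s + cU s \<noteq> 0" using cs by simp
        have "l s + (cU s - cu s) / (cu s + cU s) * cU s = (2 * cu s * cU s + (cU s - cu s) * cU s) / (cu s + cU s)"
          "- l s + (cU s - cu s) / (cu s + cU s) * cu s = (- (2 * cu s * cU s) + (cU s - cu s) * cu s) / (cu s + cU s)"
          by (simp_all only: l_def add_divide_distrib times_divide_eq_left minus_divide_left)
        then show "l s + (cU s - cu s) / (cu s + cU s) * cU s = cU s" "- l s + (cU s - cu s) / (cu s + cU s) * cu s = - cu s"
          using N by (simp_all only: nonzero_divide_eq_eq[OF N] nonzero_divide_eq_eq) (simp_all add: algebra_simps)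
      qed
      have "l s *\<^sub>R B (B (\<rho> s)) + ((cU s - cu s) / (cu s + cU s)) *\<^sub>R (cU s *\<^sub>R B (B (U s)) + cu s *\<^sub>R B (B (u s)))
        = (l s + (cU s - cu s) / (cu s + cU s) * cU s) *\<^sub>R B (B (U s)) + (- l s + (cU s - cu s) / (cu s + cU s) * cu s) *\<^sub>R B (B (u s))"
        unfolding \<rho>_D(4)[OF s] by (simp only: scaleR_add_left scaleR_add_right scaleR_diff_right scaleR_minus_left scaleR_scaleR) simp
      then show ?thesis unfolding 1 by simp
    qed
    define T where "T = (1 + s) * \<beta> s"
    define x where "x = (norm (B (\<rho> s)))\<^sup>2"
    let ?v = "cU s *\<^sub>R B (B (U s)) + cu s *\<^sub>R B (B (u s))"
    have T: "T > 0" "\<beta> s * \<beta> s \<le> T" using bs s \<beta>_le[OF s] by (auto simp: T_def)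
    have "(norm ?v)\<^sup>2 \<le> 2 * (norm (cU s *\<^sub>R B (B (U s))))\<^sup>2 + 2 * (norm (cu s *\<^sub>R B (B (u s))))\<^sup>2"
      using zero_le_power2[of "norm (cU s *\<^sub>R B (B (U s)) - cu s *\<^sub>R B (B (u s)))"] by (simp only: power2_norm_eq_inner)
        (simp add: inner_add_left inner_add_right inner_diff_left inner_diff_right inner_commute)
    then have "T * (norm ?v)\<^sup>2 \<le> T * (2 * (norm (cU s *\<^sub>R B (B (U s))))\<^sup>2 + 2 * (norm (cu s *\<^sub>R B (B (u s))))\<^sup>2)"
      using T by (intro mult_left_mono) auto
    also have "\<dots> = 2 * (cU s * (cU s * (norm (B (B (U s))))\<^sup>2 * T)) + 2 * (cu s * (cu s * (norm (B (B (u s))))\<^sup>2 * T))"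
      by (simp add: power_mult_distrib power2_eq_square[of "cu s"] power2_eq_square[of "cU s"] algebra_simps)
    also have "\<dots> \<le> 2 * (cU s * (L * MU s)) + 2 * (cu s * (L * Mu s))"
      using bounds_U(2)[OF s] bounds_u(2)[OF s] cs unfolding T_def by (intro add_mono mult_left_mono) auto
    finally have v: "T * (norm ?v)\<^sup>2 \<le> 2 * (cU s * (L * MU s)) + 2 * (cu s * (L * Mu s))" .
    have "(cU s - cu s)\<^sup>2 * (2 * (cU s * (L * MU s)) + 2 * (cu s * (L * Mu s))) \<le> (16 * \<gamma>\<^sup>2 * L) * (cu s + cU s)^3 * x"
    proof -
      \<comment> \<open>Stated for an ordered pair of coefficients and energies, so that both cases
        follow by exchanging the two solutions.\<close>
      have key: "d\<^sup>2 * (2 * (c2 * (L * m2)) + 2 * (c1 * (L * m1))) \<le> (16 * \<gamma>\<^sup>2 * L) * (c1 + c2)^3 * x"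
        if "d\<^sup>2 * m2 \<le> 4 * \<gamma>\<^sup>2 * c2\<^sup>2 * x" "m1 \<le> m2" "0 < c1" "c1 \<le> c2" "0 < m1" for d c1 c2 m1 m2
      proof -
        have "c1 * (L * m1) \<le> c2 * (L * m2)" using that L1 by (intro mult_mono) auto
        then have "d\<^sup>2 * (2 * (c2 * (L * m2)) + 2 * (c1 * (L * m1))) \<le> d\<^sup>2 * (4 * (c2 * (L * m2)))"
          by (intro mult_left_mono zero_le_power2) linarith
        also have "\<dots> = (4 * c2 * L) * (d\<^sup>2 * m2)" by simp
        also have "\<dots> \<le> (4 * c2 * L) * (4 * \<gamma>\<^sup>2 * c2\<^sup>2 * x)" using that L1 by (intro mult_left_mono) auto
        also have "\<dots> = (16 * \<gamma>\<^sup>2 * L) * c2^3 * x" by (simp add: power3_eq_cube power2_eq_square)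
        also have "\<dots> \<le> (16 * \<gamma>\<^sup>2 * L) * (c1 + c2)^3 * x"
          using that L1 by (intro mult_right_mono mult_left_mono power_mono) (auto simp: x_def)
        finally show ?thesis .
      qed
      show ?thesis
      proof (cases "MU s \<le> Mu s")
        case True
        show ?thesis
          using key[OF c_diff(1)[OF s True, folded x_def] True cs(2) c_diff(3)[OF s True] bounds_U(1)[OF s]]
          by (simp add: add.commute)
      next
        case False
        then have F: "Mu s \<le> MU s" by simp
        show ?thesis
          using key[OF c_diff(2)[OF s F, folded x_def] F cs(1) c_diff(4)[OF s F] bounds_u(1)[OF s]] .
      qed
    qed
    moreover have "(cU s - cu s)\<^sup>2 * (T * (norm ?v)\<^sup>2) \<le> (cU s - cu s)\<^sup>2 * (2 * (cU s * (L * MU s)) + 2 * (cu s * (L * Mu s)))"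
      using v by (rule mult_left_mono) simp
    ultimately have "(cU s - cu s)\<^sup>2 * (T * (norm ?v)\<^sup>2) \<le> (16 * \<gamma>\<^sup>2 * L) * (cu s + cU s)^3 * x" by linarith
    then have "(cU s - cu s)\<^sup>2 * (T * (norm ?v)\<^sup>2) / (cu s + cU s)\<^sup>2 \<le> (16 * \<gamma>\<^sup>2 * L) * (cu s + cU s) * x"
      using cs by (simp add: pos_divide_le_eq power3_eq_cube power2_eq_square mult_ac)
    then have "T * (norm (((cU s - cu s) / (cu s + cU s)) *\<^sub>R ?v))\<^sup>2 \<le> (16 * \<gamma>\<^sup>2 * L) * ((cu s + cU s) * x)"
      by (simp add: power_mult_distrib power_divide mult_ac)
    also have "\<dots> \<le> C * ((cu s + cU s) * x)" using C_bounds cs by (intro mult_right_mono) (auto simp: x_def)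
    finally have "(\<beta> s * \<beta> s) * (norm (((cU s - cu s) / (cu s + cU s)) *\<^sub>R ?v))\<^sup>2 \<le> C * ((cu s + cU s) * x)"
      using mult_right_mono[OF T(2), of "(norm (((cU s - cu s) / (cu s + cU s)) *\<^sub>R ?v))\<^sup>2"] by simp
    from mult_left_mono[OF this, of "\<beta> s"] bs
    show "(\<beta> s)\<^sup>2 * \<beta> s * (norm (((cU s - cu s) / (cu s + cU s)) *\<^sub>R ?v))\<^sup>2 \<le> C * (\<beta> s * ((cu s + cU s) * (norm (B (\<rho> s)))\<^sup>2))"
      unfolding x_def by (simp only: power2_eq_square[of "\<beta> s"] mult_ac)
  next
    fix n
    show "integral {0..t} (\<lambda>s. (\<beta> s)\<^sup>2 * \<beta> s * (norm (w n s))\<^sup>2) \<le> C"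
    proof (rule w_weight_integral[OF t])
      show "continuous_on {0..t} (\<lambda>s. (\<beta> s)\<^sup>2 * \<beta> s)" by (intro continuous_intros continuous_\<beta> sub)
      show "(\<beta> s)\<^sup>2 * \<beta> s \<le> \<beta> s * inverse (cu s) + (\<beta> s)^3" if "s \<in> {0..t}" for s
        using c_pos(1)[of s] \<beta>_pos[of s] that by (simp add: power3_eq_cube power2_eq_square)
    qed
  qed simp_all
  moreover have "integral {0..t} (\<lambda>s. (\<beta> s)\<^sup>2 / \<beta> s * (norm (r s))\<^sup>2 / 4) = integral {0..t} (\<lambda>s. \<beta> s * (norm (r s))\<^sup>2 / 4)"
    using \<beta>_pos by (intro integral_cong) (simp add: power2_eq_square)
  moreover have "0 \<le> (\<beta> t)\<^sup>2 * l t * (norm (B (\<rho> t)))\<^sup>2 / 2" using l(1)[OF t] by simp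
  ultimately show ?thesis by linarith
qed

end

section \<open>Closing the error estimate\<close>

context singular_perturbation
begin

lemma S_integrand: "continuous_on {0..t} (\<lambda>s. \<beta> s * ((cu s + cU s) * (norm (B (\<rho> s)))\<^sup>2))"
  "s \<ge> 0 \<Longrightarrow> 0 \<le> \<beta> s * ((cu s + cU s) * (norm (B (\<rho> s)))\<^sup>2)"
  using c_pos[of s] \<beta>_pos[of s]
  by (auto intro!: continuous_intros continuous_\<beta> cont[THEN continuous_on_subset, OF sub] mult_nonneg_nonneg add_nonneg_nonneg)

lemma S_mono: "0 \<le> s \<Longrightarrow> s \<le> t \<Longrightarrow> S s \<le> S t"
  unfolding S_def using S_integrand
  by (intro integral_subset_le integrable_continuous_real) auto

lemma S_nonneg: "0 \<le> t \<Longrightarrow> 0 \<le> S t"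
  using S_mono[of 0 t] by (simp add: S_def)

text \<open>Young's inequality with the weights 1 / (16 \<epsilon>) and 4 \<epsilon>: the layer has
  weighted mass at most 2 \<epsilon>, so one half contributes X / 8 and the other is of order
  \<epsilon>^2.\<close>

lemma \<Sigma>_le:
  assumes t: "t \<ge> 0" and X: "\<And>s. s \<in> {0..t} \<Longrightarrow> (norm (B (\<rho> s)))\<^sup>2 \<le> X"
  shows "C * norm (B w0) * \<Sigma> t \<le> X / 8 + 8 * C\<^sup>2 * (norm (B w0))\<^sup>2 * \<epsilon>\<^sup>2"
proof -
  define k where "k = C * norm (B w0)"
  have k0: "k \<ge> 0" using C_bounds by (simp add: k_def)
  have X0: "X \<ge> 0" by (rule order_trans[OF zero_le_power2 X[of 0]]) (use t in simp)
  have pt: "k * norm (B (\<rho> s)) \<le> X / (16 * \<epsilon>) + 4 * k\<^sup>2 * \<epsilon>" if "s \<in> {0..t}" for s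
  proof -
    have "0 \<le> (norm (B (\<rho> s)) - 8 * k * \<epsilon>)\<^sup>2" by simp
    then have "16 * \<epsilon> * (k * norm (B (\<rho> s))) \<le> (norm (B (\<rho> s)))\<^sup>2 + 64 * k\<^sup>2 * \<epsilon>\<^sup>2"
      by (simp add: power2_eq_square algebra_simps)
    then have "(k * norm (B (\<rho> s))) * (16 * \<epsilon>) \<le> X + 64 * k\<^sup>2 * \<epsilon>\<^sup>2" using X[OF that] by (simp add: mult_ac)
    then have "k * norm (B (\<rho> s)) \<le> (X + 64 * k\<^sup>2 * \<epsilon>\<^sup>2) / (16 * \<epsilon>)" using \<epsilon>0 by (simp add: pos_le_divide_eq)
    then show ?thesis using \<epsilon>0 by (simp add: add_divide_distrib power2_eq_square mult_ac)
  qed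
  note ct = cont[THEN continuous_on_subset, OF sub]
  have c1: "continuous_on {0..t} (\<lambda>s. (1 + s)\<^sup>2 * e s * norm (B (\<rho> s)))" by (intro continuous_intros ct)
  have c2: "continuous_on {0..t} (\<lambda>s. (1 + s)\<^sup>2 * e s)" by (intro continuous_intros ct)
  have "k * \<Sigma> t = integral {0..t} (\<lambda>s. k * ((1 + s)\<^sup>2 * e s * norm (B (\<rho> s))))" by (simp add: \<Sigma>_def)
  also have "\<dots> \<le> integral {0..t} (\<lambda>s. (X / (16 * \<epsilon>) + 4 * k\<^sup>2 * \<epsilon>) * ((1 + s)\<^sup>2 * e s))"
  proof (intro integral_le integrable_continuous_real continuous_on_mult_left c1 c2)
    fix s assume s: "s \<in> {0..t}"
    have "(k * norm (B (\<rho> s))) * ((1 + s)\<^sup>2 * e s) \<le> (X / (16 * \<epsilon>) + 4 * k\<^sup>2 * \<epsilon>) * ((1 + s)\<^sup>2 * e s)"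
      using pt[OF s] e_pos[of s] s by (intro mult_right_mono) auto
    then show "k * ((1 + s)\<^sup>2 * e s * norm (B (\<rho> s))) \<le> (X / (16 * \<epsilon>) + 4 * k\<^sup>2 * \<epsilon>) * ((1 + s)\<^sup>2 * e s)"
      by (simp add: mult_ac)
  qed
  also have "\<dots> = (X / (16 * \<epsilon>) + 4 * k\<^sup>2 * \<epsilon>) * integral {0..t} (\<lambda>s. (1 + s)\<^sup>2 * e s)" by simp
  also have "\<dots> \<le> (X / (16 * \<epsilon>) + 4 * k\<^sup>2 * \<epsilon>) * (2 * \<epsilon>)" using e_int[OF t] X0 \<epsilon>0 by (intro mult_left_mono) auto
  also have "\<dots> = X / 8 + 8 * k\<^sup>2 * \<epsilon>\<^sup>2" using \<epsilon>0 by (simp add: distrib_right power2_eq_square)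
  finally show ?thesis by (simp add: k_def power_mult_distrib mult_ac)
qed

definition "K1 = C + 8 * C\<^sup>2 * (norm (B w0))\<^sup>2"

lemma K1_bounds: "C \<le> K1" "8 * C\<^sup>2 * (norm (B w0))\<^sup>2 * x \<le> K1 * x - C * x" "0 \<le> K1"
  using C_bounds by (auto simp: K1_def algebra_simps)

text \<open>The layer returns the supremum of |B\<rho>|^2 with the factor 1/8; after doubling
  \<open>estimate_B\<rho>\<close> this is X / 4, which can be absorbed. The absorbed bound is then
  inserted into \<Sigma> again to obtain the two integral bounds.\<close>

lemma B\<rho>_by_S:
  assumes T: "T \<ge> 0"
  shows "(norm (B (\<rho> T)))\<^sup>2 \<le> 8 * C * S T + 4 * K1 * \<epsilon>\<^sup>2"
    "integral {0..T} (\<lambda>s. inverse (cu s) / \<beta> s * (norm (r s))\<^sup>2 / 4) \<le> 3 * C * S T + 3 / 2 * K1 * \<epsilon>\<^sup>2"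
    "integral {0..T} (\<lambda>s. \<beta> s * (norm (r s))\<^sup>2 / 4) \<le> 3 * C * S T + 3 / 2 * K1 * \<epsilon>\<^sup>2"
proof -
  note ct = cont[THEN continuous_on_subset, OF sub]
  have Ir: "0 \<le> integral {0..t} (\<lambda>s. inverse (cu s) / \<beta> s * (norm (r s))\<^sup>2 / 4)" if "t \<ge> 0" for t
  proof (intro integral_nonneg integrable_continuous_real continuous_intros ct continuous_\<beta> sub)
    show "\<forall>s\<in>{0..t}. cu s \<noteq> 0" "\<forall>s\<in>{0..t}. \<beta> s \<noteq> 0" using c_pos \<beta>_pos by force+
    show "0 \<le> inverse (cu s) / \<beta> s * (norm (r s))\<^sup>2 / 4" if "s \<in> {0..t}" for s
      using c_pos(1)[of s] \<beta>_pos[of s] that by simp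
  qed simp
  have B: "(norm (B (\<rho> t)))\<^sup>2 \<le> 2 * (4 * (C * S T) + 2 * (K1 * \<epsilon>\<^sup>2))" if t: "t \<in> {0..T}" for t
  proof (rule absorb_sup[OF _ T _ t])
    show "continuous_on {0..T} (\<lambda>t. (norm (B (\<rho> t)))\<^sup>2)" by (intro continuous_intros ct)
    fix t X assume t: "t \<in> {0..T}" and X: "\<And>s. s \<in> {0..T} \<Longrightarrow> (norm (B (\<rho> s)))\<^sup>2 \<le> X"
    then have t0: "t \<ge> 0" by simp
    have X0: "X \<ge> 0" using X[OF t] zero_le_power2[of "norm (B (\<rho> t))"] by linarith
    have "C * S t \<le> C * S T" using S_mono[of t T] t C_bounds by (intro mult_left_mono) auto
    moreover have "C * norm (B w0) * \<Sigma> t \<le> X / 8 + 8 * C\<^sup>2 * (norm (B w0))\<^sup>2 * \<epsilon>\<^sup>2"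
      by (rule \<Sigma>_le[OF t0]) (use X t in auto)
    ultimately show "(norm (B (\<rho> t)))\<^sup>2 \<le> (4 * (C * S T) + 2 * (K1 * \<epsilon>\<^sup>2)) + X / 2"
      using estimate_B\<rho>[OF t0] Ir[OF t0] K1_bounds(2)[of "\<epsilon>\<^sup>2"] X0 by linarith
  qed
  from B[of T] T show B': "(norm (B (\<rho> T)))\<^sup>2 \<le> 8 * C * S T + 4 * K1 * \<epsilon>\<^sup>2" by simp
  have \<Sigma>: "C * norm (B w0) * \<Sigma> T \<le> (2 * (4 * (C * S T) + 2 * (K1 * \<epsilon>\<^sup>2))) / 8 + 8 * C\<^sup>2 * (norm (B w0))\<^sup>2 * \<epsilon>\<^sup>2"
    by (rule \<Sigma>_le[OF T B])
  have eqs: "2 * C * S T = 2 * (C * S T)" "3 * C * S T = 3 * (C * S T)" "3 / 2 * K1 * \<epsilon>\<^sup>2 = 3 / 2 * (K1 * \<epsilon>\<^sup>2)" by simp_all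
  show "integral {0..T} (\<lambda>s. inverse (cu s) / \<beta> s * (norm (r s))\<^sup>2 / 4) \<le> 3 * C * S T + 3 / 2 * K1 * \<epsilon>\<^sup>2"
    using estimate_B\<rho>[OF T] \<Sigma> K1_bounds(2)[of "\<epsilon>\<^sup>2"] zero_le_power2[of "norm (B (\<rho> T))"] unfolding eqs by argo
  show "integral {0..T} (\<lambda>s. \<beta> s * (norm (r s))\<^sup>2 / 4) \<le> 3 * C * S T + 3 / 2 * K1 * \<epsilon>\<^sup>2"
    using estimate_r[OF T] \<Sigma> K1_bounds(2)[of "\<epsilon>\<^sup>2"] unfolding eqs by argo
qed

text \<open>With x = BU and y = Bu, the right-hand side is <cU x - cu y, x - y> = (cu + cU) |x -
  y|^2 / 2 + (cU - cu) (|x|^2 - |y|^2) / 2; the last product is nonnegative because the coefficient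
  increases with the norm.\<close>

lemma monotone_nonlinearity:
  assumes s: "s \<ge> 0"
  shows "(cu s + cU s) * (norm (B (\<rho> s)))\<^sup>2 / 2 \<le> cU s * (\<rho> s \<bullet> B (B (U s))) - cu s * (\<rho> s \<bullet> B (B (u s)))"
proof -
  let ?x = "B (U s)" and ?y = "B (u s)"
  have e12: "\<rho> s \<bullet> B ?x = (?x - ?y) \<bullet> ?x" "\<rho> s \<bullet> B ?y = (?x - ?y) \<bullet> ?y"
    unfolding \<rho>_D(2)[OF s, symmetric]
    by (rule B_sym[OF \<rho>_D(1)[OF s] hD(5)[OF s], symmetric] B_sym[OF \<rho>_D(1)[OF s] pD(3)[OF s], symmetric])+
  have "cU s * (\<rho> s \<bullet> B ?x) - cu s * (\<rho> s \<bullet> B ?y)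
      = (cu s + cU s) * (norm (B (\<rho> s)))\<^sup>2 / 2 + (cU s - cu s) * (MU s - Mu s) / 2"
    unfolding e12 \<rho>_D(2)[OF s] MU_def Mu_def power2_norm_eq_inner
    by (simp add: inner_diff_left inner_diff_right inner_commute field_simps)
  moreover have "0 \<le> (cU s - cu s) * (MU s - Mu s)"
  proof (cases "MU s \<le> Mu s")
    case True
    then show ?thesis using c_diff(3)[OF s] by (intro mult_nonpos_nonpos) auto
  next
    case False
    then show ?thesis using c_diff(4)[OF s] by (intro mult_nonneg_nonneg) auto
  qed
  ultimately show ?thesis by simp
qed

text \<open>The summands are the costs of, in order, the integral of \<beta> |r|^2, its Young
  partner with U', the term \<epsilon> p \<sigma> <\<rho>, v>, the layer, and the boundary term
  \<epsilon> \<beta> <U', \<rho>>.\<close>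

definition "K2 = K1 + 24 * C * L\<^sup>2 + L + 2 * L * norm w0 + 4 * L\<^sup>2"

text \<open>The budget for the integrand of S: monotonicity supplies 1/2 of it, the term \<epsilon>
  p \<sigma> <\<rho>, v> takes 1/4 and the feedback of r takes 1/8, so that 1/8 survives. Everything
  else is of order \<epsilon>^2 or a multiple of the supremum that can be absorbed.\<close>

lemma \<rho>_S_le:
  assumes T: "T \<ge> 0"
  shows "(norm (\<rho> T))\<^sup>2 + S T \<le> 16 * (K2 * \<epsilon>\<^sup>2)"
proof -
  note ct = cont[THEN continuous_on_subset, OF sub]
  have main: "(norm (\<rho> t))\<^sup>2 + S t \<le> 8 * (K2 * \<epsilon>\<^sup>2) + X / 2"
    if t: "t \<in> {0..T}" and Xf: "\<And>s. s \<in> {0..T} \<Longrightarrow> (norm (\<rho> s))\<^sup>2 + S s \<le> X" for t X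
  proof -
    have t0: "t \<ge> 0" using t by simp
    have X: "(norm (\<rho> s))\<^sup>2 \<le> X" if "s \<in> {0..T}" for s using Xf[OF that] S_nonneg[of s] that by simp
    have X0: "X \<ge> 0" using X[OF t] zero_le_power2[of "norm (\<rho> t)"] by linarith
    \<comment> \<open>The boundary term contains U' and not \<rho>', so no second derivative of u
      appears. As in the integral bound for U, the \<sigma> terms compensate \<beta>', with X
      dominating |\<rho>|^2; since \<rho>' = U' - v, a term in <\<rho>, v> is left over.\<close>
    define F where "F t = (norm (\<rho> t))\<^sup>2 / 2 + \<epsilon> * (\<beta> t * (U1 t \<bullet> \<rho> t)) - (\<epsilon> / 2 * p) * (\<sigma> t * (norm (\<rho> t))\<^sup>2)
       + (\<epsilon> / 2 * p * X) * \<sigma> t" for t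
    define y where "y s = \<beta> s * ((cu s + cU s) * (norm (B (\<rho> s)))\<^sup>2)" for s
    define g where "g s = - (1/4) * y s + (1 / (24 * C)) * (\<beta> s * (norm (r s))\<^sup>2 / 4) + (24 * C * L * \<epsilon>\<^sup>2) * (\<beta> s * (cU s * MU s))
        + (\<epsilon> * L * norm w0) * ((1 + s)\<^sup>2 * e s) + \<epsilon>\<^sup>2 * (\<beta> s * (cu s * Mu s))" for s
    have \<beta>U1: "\<beta> s * norm (U1 s) \<le> L" "\<beta> s * (norm (U1 s))\<^sup>2 \<le> L * (\<beta> s * (cU s * MU s))" if s: "s \<ge> 0" for s
    proof -
      note bs = \<beta>_pos[OF s] and bl = \<beta>_le[OF s]
      have "\<beta> s * (norm (U1 s))\<^sup>2 \<le> (1 + s) * (norm (U1 s))\<^sup>2" using bl by (intro mult_right_mono) auto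
      then show 1: "\<beta> s * (norm (U1 s))\<^sup>2 \<le> L * (\<beta> s * (cU s * MU s))" using bounds_U(4)[OF s] by (simp add: mult.commute)
      have "(\<beta> s * norm (U1 s))\<^sup>2 = \<beta> s * (\<beta> s * (norm (U1 s))\<^sup>2)" by (simp add: power2_eq_square)
      also have "\<dots> \<le> \<beta> s * (L * (\<beta> s * (cU s * MU s)))" using 1 bs by (intro mult_left_mono) auto
      also have "\<dots> = L * ((cU s * MU s) * (\<beta> s * \<beta> s))" by simp
      also have "\<dots> \<le> L * ((cU s * MU s) * ((1 + s) * \<beta> s))"
        using bl bs L1 c_pos(2)[OF s] bounds_U(1)[OF s] by (intro mult_left_mono mult_right_mono) auto
      also have "\<dots> \<le> L * L" using bounds_U(7)[OF s] L1 by (intro mult_left_mono) auto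
      finally have "(\<beta> s * norm (U1 s))\<^sup>2 \<le> L\<^sup>2" by (simp add: power2_eq_square)
      then show "\<beta> s * norm (U1 s) \<le> L" by (rule power2_le_imp_le) (use L1 in simp)
    qed
    have "F t - F 0 \<le> integral {0..t} g"
    proof (rule DERIV_within_le_integral)
      fix s assume "s \<in> {0..t}"
      then have s: "s \<ge> 0" and sT: "s \<in> {0..T}" using t by auto
      note bs = \<beta>_pos[OF s]
      define \<rho>' where "\<rho>' = r s + e s *\<^sub>R w0"
      have \<rho>': "\<rho>' = U1 s - v s" by (simp add: \<rho>'_def r_def)
      have dn: "((\<lambda>s. (norm (\<rho> s))\<^sup>2) has_real_derivative 2 * (\<rho> s \<bullet> \<rho>')) (at s within {0..})"
        unfolding \<rho>'_def by (rule DERIV_norm_square[OF D\<rho>[OF s]])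
      have di: "((\<lambda>s. U1 s \<bullet> \<rho> s) has_real_derivative U2 s \<bullet> \<rho> s + U1 s \<bullet> \<rho>') (at s within {0..})"
        unfolding \<rho>'_def by (rule DERIV_inner[OF hD(2)[OF s] D\<rho>[OF s]])
      let ?d = "2 * (\<rho> s \<bullet> \<rho>') / 2 + \<epsilon> * (p * \<sigma> s * (U1 s \<bullet> \<rho> s) + (U2 s \<bullet> \<rho> s + U1 s \<bullet> \<rho>') * \<beta> s)
         - (\<epsilon> / 2 * p) * ((p - 1) * (\<sigma> s / (1 + s)) * (norm (\<rho> s))\<^sup>2 + 2 * (\<rho> s \<bullet> \<rho>') * \<sigma> s)
         + (\<epsilon> / 2 * p * X) * ((p - 1) * (\<sigma> s / (1 + s)))"
      have "(F has_real_derivative ?d) (at s within {0..})"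
        unfolding F_def[abs_def]
        by (intro DERIV_add DERIV_diff DERIV_cdivide DERIV_cmult DERIV_mult dn di DERIV_\<beta> DERIV_\<sigma> s)
      then show "(F has_real_derivative ?d) (at s within {0..t})" by (rule DERIV_subset[OF _ sub])
      let ?G = "cU s * (\<rho> s \<bullet> B (B (U s))) - cu s * (\<rho> s \<bullet> B (B (u s)))"
      have d_eq: "?d = - (\<beta> s * ?G) + \<epsilon> * (\<beta> s * (U1 s \<bullet> \<rho>')) + \<epsilon> * (p * \<sigma> s * (\<rho> s \<bullet> v s))
         - (\<epsilon> / 2 * p * (1 - p) * (\<sigma> s / (1 + s))) * (X - (norm (\<rho> s))\<^sup>2)"
      proof -
        define q k \<delta> where "q = \<sigma> s / (1 + s)" and "k = 1 / \<epsilon>" and "\<delta> = \<epsilon> / 2"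
        have 1: "\<epsilon> * k = 1" "inverse (\<beta> s) * \<beta> s = 1" "2 * \<delta> = \<epsilon>" using \<epsilon>0 bs by (auto simp: k_def \<delta>_def)
        have 2: "U2 s \<bullet> \<rho> s = - k * (inverse (\<beta> s) * (U1 s \<bullet> \<rho> s) + cU s * (\<rho> s \<bullet> B (B (U s))))"
          using hyp_U2_inner[OF hyp \<epsilon>0 s, of "\<rho> s"] by (simp add: k_def cU_def MU_def inner_commute)
        have 3: "\<rho> s \<bullet> v s = - (\<beta> s * cu s) * (\<rho> s \<bullet> B (B (u s)))" by (simp add: v_eq[OF s])
        have 4: "\<rho> s \<bullet> \<rho>' = U1 s \<bullet> \<rho> s - \<rho> s \<bullet> v s" by (simp add: \<rho>' inner_diff_right inner_commute)
        have 5: "2 * (\<rho> s \<bullet> \<rho>') / 2 = \<rho> s \<bullet> \<rho>'" by simp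
        show ?thesis using 1 2 3 4 unfolding 5 q_def[symmetric] \<delta>_def[symmetric] by algebra
      qed
      have G: "y s / 2 \<le> \<beta> s * ?G"
        using mult_left_mono[OF monotone_nonlinearity[OF s], of "\<beta> s"] bs by (simp add: y_def)
      \<comment> \<open>The weight 24 C is chosen against the constant 3 C in the bound for the
        integral of \<beta> |r|^2 / 4: the feedback is 1/8 of S.\<close>
      have Ur: "\<epsilon> * (\<beta> s * (U1 s \<bullet> r s)) \<le> (1 / (24 * C)) * (\<beta> s * (norm (r s))\<^sup>2 / 4) + (24 * C * L * \<epsilon>\<^sup>2) * (\<beta> s * (cU s * MU s))"
      proof -
        have Cp: "24 * C > 0" using C_bounds by simp
        have "- ((- r s) \<bullet> (\<epsilon> *\<^sub>R U1 s)) \<le> (norm (- r s))\<^sup>2 / (4 * (24 * C)) + (24 * C) * (norm (\<epsilon> *\<^sub>R U1 s))\<^sup>2"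
          by (rule inner_Young[OF Cp])
        then have "\<epsilon> * (U1 s \<bullet> r s) \<le> (1 / (24 * C)) * ((norm (r s))\<^sup>2 / 4) + 24 * C * \<epsilon>\<^sup>2 * (norm (U1 s))\<^sup>2"
          by (simp add: power_mult_distrib inner_commute)
        from mult_left_mono[OF this, of "\<beta> s"]
        have "\<epsilon> * (\<beta> s * (U1 s \<bullet> r s)) \<le> (1 / (24 * C)) * (\<beta> s * (norm (r s))\<^sup>2 / 4) + 24 * C * \<epsilon>\<^sup>2 * (\<beta> s * (norm (U1 s))\<^sup>2)"
          using bs by (simp add: distrib_left mult_ac)
        also have "24 * C * \<epsilon>\<^sup>2 * (\<beta> s * (norm (U1 s))\<^sup>2) \<le> 24 * C * \<epsilon>\<^sup>2 * (L * (\<beta> s * (cU s * MU s)))"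
          using \<beta>U1(2)[OF s] C_bounds by (intro mult_left_mono) auto
        finally show ?thesis by (simp add: mult_ac)
      qed
      have Uw: "\<epsilon> * (\<beta> s * (U1 s \<bullet> (e s *\<^sub>R w0))) \<le> (\<epsilon> * L * norm w0) * ((1 + s)\<^sup>2 * e s)"
      proof -
        have "\<beta> s * (U1 s \<bullet> w0) \<le> \<beta> s * (norm (U1 s) * norm w0)" using bs by (intro mult_left_mono norm_cauchy_schwarz) auto
        also have "\<dots> \<le> L * norm w0" using mult_right_mono[OF \<beta>U1(1)[OF s], of "norm w0"] by (simp add: mult.assoc)
        also have "\<dots> \<le> L * norm w0 * (1 + s)\<^sup>2"
          using mult_left_mono[of 1 "(1 + s)\<^sup>2" "L * norm w0"] s L1 by simp
        finally have "(\<epsilon> * e s) * (\<beta> s * (U1 s \<bullet> w0)) \<le> (\<epsilon> * e s) * (L * norm w0 * (1 + s)\<^sup>2)"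
          using \<epsilon>0 e_pos[OF s] by (intro mult_left_mono) auto
        then show ?thesis by (simp add: mult_ac)
      qed
      have v: "\<epsilon> * (p * \<sigma> s * (\<rho> s \<bullet> v s)) \<le> y s / 4 + \<epsilon>\<^sup>2 * (\<beta> s * (cu s * Mu s))"
      proof -
        have p\<sigma>: "p * \<sigma> s \<le> 1" "0 \<le> p * \<sigma> s" using p0 p1 \<sigma>_le1[OF s] \<sigma>_pos[OF s] mult_le_one[of p "\<sigma> s"] by auto
        have "\<rho> s \<bullet> v s = - (\<beta> s * cu s) * (B (\<rho> s) \<bullet> B (u s))"
          unfolding v_eq[OF s] using B_sym[OF \<rho>_D(1)[OF s] pD(3)[OF s]] by simp
        then have "\<epsilon> * (p * \<sigma> s * (\<rho> s \<bullet> v s)) = (\<beta> s * cu s) * (- (B (\<rho> s) \<bullet> ((\<epsilon> * (p * \<sigma> s)) *\<^sub>R B (u s))))" by simp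
        also have "\<dots> \<le> (\<beta> s * cu s) * ((norm (B (\<rho> s)))\<^sup>2 / (4 * 1) + 1 * (norm ((\<epsilon> * (p * \<sigma> s)) *\<^sub>R B (u s)))\<^sup>2)"
          using bs c_pos(1)[OF s] by (intro mult_left_mono inner_Young) auto
        also have "\<dots> \<le> (\<beta> s * cu s) * ((norm (B (\<rho> s)))\<^sup>2 / 4 + \<epsilon>\<^sup>2 * Mu s)"
        proof -
          have "(\<epsilon> * (p * \<sigma> s))\<^sup>2 \<le> (\<epsilon> * 1)\<^sup>2" using p\<sigma> \<epsilon>0 by (intro power_mono mult_left_mono) auto
          then have "(\<epsilon> * (p * \<sigma> s))\<^sup>2 * Mu s \<le> \<epsilon>\<^sup>2 * Mu s" using bounds_u(1)[OF s] by (intro mult_right_mono) auto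
          then have "(norm ((\<epsilon> * (p * \<sigma> s)) *\<^sub>R B (u s)))\<^sup>2 \<le> \<epsilon>\<^sup>2 * Mu s"
            by (simp add: Mu_def power_mult_distrib)
          then show ?thesis using bs c_pos(1)[OF s] by (intro mult_left_mono) auto
        qed
        also have "\<dots> \<le> y s / 4 + \<epsilon>\<^sup>2 * (\<beta> s * (cu s * Mu s))"
        proof -
          have "0 \<le> \<beta> s * (cU s * (norm (B (\<rho> s)))\<^sup>2)" using bs c_pos(2)[OF s] by simp
          then show ?thesis by (simp add: y_def algebra_simps)
        qed
        finally show ?thesis .
      qed
      have "0 \<le> (\<epsilon> / 2 * p * (1 - p) * (\<sigma> s / (1 + s))) * (X - (norm (\<rho> s))\<^sup>2)"
        using \<epsilon>0 p0 p1 \<sigma>_pos[OF s] s X[OF sT] by simp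
      moreover have "\<epsilon> * (\<beta> s * (U1 s \<bullet> \<rho>')) = \<epsilon> * (\<beta> s * (U1 s \<bullet> r s)) + \<epsilon> * (\<beta> s * (U1 s \<bullet> (e s *\<^sub>R w0)))"
        unfolding \<rho>'_def inner_add_right distrib_left ..
      ultimately show "?d \<le> g s" unfolding d_eq g_def using G Ur Uw v by linarith
    next
      show "continuous_on {0..t} g" unfolding g_def y_def by (intro continuous_intros ct continuous_\<beta> sub) simp
    qed (rule t0)
    also have "integral {0..t} g \<le> - (1/8) * S t + (K1 + 24 * C * L\<^sup>2 + L + 2 * L * norm w0) * \<epsilon>\<^sup>2"
    proof -
      have i: "(\<lambda>s. y s) integrable_on {0..t}" "(\<lambda>s. \<beta> s * (norm (r s))\<^sup>2 / 4) integrable_on {0..t}"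
        "(\<lambda>s. \<beta> s * (cU s * MU s)) integrable_on {0..t}" "(\<lambda>s. (1 + s)\<^sup>2 * e s) integrable_on {0..t}"
        "(\<lambda>s. \<beta> s * (cu s * Mu s)) integrable_on {0..t}" unfolding y_def
        by (intro integrable_continuous_real continuous_intros ct continuous_\<beta> sub; simp)+
      have Ig: "integral {0..t} g = - (1/4) * S t + (1 / (24 * C)) * integral {0..t} (\<lambda>s. \<beta> s * (norm (r s))\<^sup>2 / 4)
        + (24 * C * L * \<epsilon>\<^sup>2) * integral {0..t} (\<lambda>s. \<beta> s * (cU s * MU s))
        + (\<epsilon> * L * norm w0) * integral {0..t} (\<lambda>s. (1 + s)\<^sup>2 * e s) + \<epsilon>\<^sup>2 * integral {0..t} (\<lambda>s. \<beta> s * (cu s * Mu s))"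
        unfolding g_def[abs_def] S_def y_def[symmetric]
        by (rule integral_unique) (intro has_integral_add has_integral_mult_right integrable_integral i)
      have "(1 / (24 * C)) * integral {0..t} (\<lambda>s. \<beta> s * (norm (r s))\<^sup>2 / 4) \<le> (1 / (24 * C)) * (3 * C * S t + 3 / 2 * K1 * \<epsilon>\<^sup>2)"
        using B\<rho>_by_S(3)[OF t0] C_bounds by (intro mult_left_mono) auto
      also have "\<dots> = (1/8) * S t + (1 / (16 * C)) * (K1 * \<epsilon>\<^sup>2)" using C_bounds(8) by (simp add: field_simps)
      also have "\<dots> \<le> (1/8) * S t + 1 * (K1 * \<epsilon>\<^sup>2)"
        using C_bounds(7) K1_bounds(3) by (intro add_left_mono mult_right_mono) auto
      finally have 1: "(1 / (24 * C)) * integral {0..t} (\<lambda>s. \<beta> s * (norm (r s))\<^sup>2 / 4) \<le> (1/8) * S t + K1 * \<epsilon>\<^sup>2" by simp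
      have 2: "(24 * C * L * \<epsilon>\<^sup>2) * integral {0..t} (\<lambda>s. \<beta> s * (cU s * MU s)) \<le> (24 * C * L * \<epsilon>\<^sup>2) * L"
        using bounds_U(6)[OF t0] C_bounds L1 by (intro mult_left_mono) auto
      have 3: "(\<epsilon> * L * norm w0) * integral {0..t} (\<lambda>s. (1 + s)\<^sup>2 * e s) \<le> (\<epsilon> * L * norm w0) * (2 * \<epsilon>)"
        using e_int[OF t0] \<epsilon>0 L1 by (intro mult_left_mono) auto
      have 4: "\<epsilon>\<^sup>2 * integral {0..t} (\<lambda>s. \<beta> s * (cu s * Mu s)) \<le> \<epsilon>\<^sup>2 * L"
        using bounds_u(6)[OF t0] by (intro mult_left_mono) auto
      have 5: "(24 * C * L * \<epsilon>\<^sup>2) * L = 24 * C * L\<^sup>2 * \<epsilon>\<^sup>2" "(\<epsilon> * L * norm w0) * (2 * \<epsilon>) = 2 * L * norm w0 * \<epsilon>\<^sup>2" "\<epsilon>\<^sup>2 * L = L * \<epsilon>\<^sup>2"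
        by (simp_all add: power2_eq_square)
      show ?thesis using 1 2 3 4 unfolding Ig 5 distrib_right by linarith
    qed
    finally have F: "F t \<le> F 0 - (1/8) * S t + (K1 + 24 * C * L\<^sup>2 + L + 2 * L * norm w0) * \<epsilon>\<^sup>2" by linarith
    have "F 0 \<le> X / 16"
    proof -
      have "\<epsilon> / 2 * p * X \<le> 1 / 16 * 1 * X" using \<epsilon>_small(1) \<epsilon>0 p0 p1 X0 by (intro mult_right_mono mult_mono) auto
      then show ?thesis by (simp add: F_def at_zero \<sigma>_def)
    qed
    moreover have "(3/8) * (norm (\<rho> t))\<^sup>2 - 4 * L\<^sup>2 * \<epsilon>\<^sup>2 \<le> F t"
    proof -
      have "- ((\<rho> t) \<bullet> ((\<epsilon> * \<beta> t) *\<^sub>R U1 t)) \<le> (norm (\<rho> t))\<^sup>2 / (4 * 4) + 4 * (norm ((\<epsilon> * \<beta> t) *\<^sub>R U1 t))\<^sup>2"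
        by (rule inner_Young) simp
      moreover have "(norm ((\<epsilon> * \<beta> t) *\<^sub>R U1 t))\<^sup>2 \<le> (\<epsilon> * L)\<^sup>2"
        using mult_left_mono[OF \<beta>U1(1)[OF t0], of \<epsilon>] \<epsilon>0 \<beta>_pos[OF t0] by (intro power_mono) (auto simp: mult.assoc)
      moreover have "(\<rho> t) \<bullet> ((\<epsilon> * \<beta> t) *\<^sub>R U1 t) = \<epsilon> * (\<beta> t * (U1 t \<bullet> \<rho> t))" by (simp add: inner_commute)
      moreover have "(\<epsilon> / 2 * p) * (\<sigma> t * (norm (\<rho> t))\<^sup>2) \<le> (1 / 16 * 1) * (1 * (norm (\<rho> t))\<^sup>2)"
        using \<epsilon>_small(1) \<epsilon>0 p0 p1 \<sigma>_le1[OF t0] \<sigma>_pos[OF t0] by (intro mult_mono mult_right_mono) auto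
      moreover have "0 \<le> (\<epsilon> / 2 * p * X) * \<sigma> t" using \<epsilon>0 p0 X0 \<sigma>_pos[OF t0] by simp
      moreover have "(\<epsilon> * L)\<^sup>2 = L\<^sup>2 * \<epsilon>\<^sup>2" by (simp add: power_mult_distrib)
      ultimately show ?thesis unfolding F_def by argo
    qed
    moreover have "K2 * \<epsilon>\<^sup>2 = (K1 + 24 * C * L\<^sup>2 + L + 2 * L * norm w0) * \<epsilon>\<^sup>2 + 4 * L\<^sup>2 * \<epsilon>\<^sup>2"
      by (simp add: K2_def algebra_simps)
    ultimately show ?thesis using F zero_le_power2[of "norm (\<rho> t)"] by linarith
  qed
  have "(norm (\<rho> T))\<^sup>2 + S T \<le> 2 * (8 * (K2 * \<epsilon>\<^sup>2))"
  proof (rule absorb_sup[OF _ T main])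
    have "continuous_on {0..T} S" unfolding S_def[abs_def]
      by (rule DERIV_continuous_on[OF integral_has_real_derivative[OF S_integrand(1)]])
    then show "continuous_on {0..T} (\<lambda>t. (norm (\<rho> t))\<^sup>2 + S t)" by (intro continuous_intros ct)
  qed (use T in auto)
  then show ?thesis by simp
qed

lemma error_bound:
  assumes T: "T \<ge> 0"
  shows "(norm (\<rho> T))\<^sup>2 + (norm (B (\<rho> T)))\<^sup>2 + integral {0..T} (\<lambda>s. (norm (r s))\<^sup>2 / cu s * (1 / \<beta> s))
    \<le> (16 * K2 + 20 * C * (16 * K2) + 10 * K1) * \<epsilon>\<^sup>2"
proof -
  have "x / c * (1 / b) = 4 * (inverse c / b * x / 4)" for x b c :: real by (simp add: field_simps)
  then have "integral {0..T} (\<lambda>s. (norm (r s))\<^sup>2 / cu s * (1 / \<beta> s)) = integral {0..T} (\<lambda>s. 4 * (inverse (cu s) / \<beta> s * (norm (r s))\<^sup>2 / 4))"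
    by presburger
  also have "\<dots> = 4 * integral {0..T} (\<lambda>s. inverse (cu s) / \<beta> s * (norm (r s))\<^sup>2 / 4)"
    by (rule integral_mult_right)
  finally have I: "integral {0..T} (\<lambda>s. (norm (r s))\<^sup>2 / cu s * (1 / \<beta> s)) \<le> 12 * (C * S T) + 6 * (K1 * \<epsilon>\<^sup>2)"
    using B\<rho>_by_S(2)[OF T] by linarith
  have S: "S T \<le> 16 * (K2 * \<epsilon>\<^sup>2)" and \<rho>: "(norm (\<rho> T))\<^sup>2 \<le> 16 * (K2 * \<epsilon>\<^sup>2)"
    using \<rho>_S_le[OF T] S_nonneg[OF T] zero_le_power2[of "norm (\<rho> T)"] by linarith+
  have "C * S T \<le> C * (16 * (K2 * \<epsilon>\<^sup>2))" using S C_bounds by (intro mult_left_mono) auto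
  moreover have "(16 * K2 + 20 * C * (16 * K2) + 10 * K1) * \<epsilon>\<^sup>2 = 16 * (K2 * \<epsilon>\<^sup>2) + 20 * (C * (16 * (K2 * \<epsilon>\<^sup>2))) + 10 * (K1 * \<epsilon>\<^sup>2)"
    by (simp add: algebra_simps)
  ultimately show ?thesis using I \<rho> B\<rho>_by_S(1)[OF T] by linarith
qed

end

subsection \<open>The boundary layer\<close>

context dissipation
begin

text \<open>The solution of \<epsilon> e' + e / \<beta> = 0 with e(0) = 1.\<close>

definition layer :: "real \<Rightarrow> real \<Rightarrow> real" where
  "layer \<epsilon> t = exp (- (integral {0..t} (\<lambda>s. inverse (\<beta> s)) / \<epsilon>))"

lemma layer_pos: "layer \<epsilon> t > 0" and layer_0: "layer \<epsilon> 0 = 1"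
  by (simp_all add: layer_def)

lemma DERIV_layer:
  assumes t: "t \<ge> 0" and \<epsilon>: "\<epsilon> > 0"
  shows "(layer \<epsilon> has_real_derivative - (layer \<epsilon> t / (\<epsilon> * \<beta> t))) (at t within {0..})"
proof -
  have "continuous_on {0..t + 1} (\<lambda>s. inverse (\<beta> s))"
    using \<beta>_pos by (intro continuous_intros continuous_\<beta>) (auto simp: less_imp_neq[symmetric])
  then have "((\<lambda>t. integral {0..t} (\<lambda>s. inverse (\<beta> s))) has_real_derivative inverse (\<beta> t)) (at t within {0..t + 1})"
    using t by (intro integral_has_real_derivative) auto
  moreover have "at t within {0..t + 1} = at t within {0..}"
    by (rule at_within_nhd[where S = "{..<t + 1}"]) auto
  ultimately have d: "((\<lambda>t. integral {0..t} (\<lambda>s. inverse (\<beta> s))) has_real_derivative inverse (\<beta> t)) (at t within {0..})"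
    by simp
  show ?thesis
    unfolding layer_def[abs_def]
    by (rule DERIV_cong[OF DERIV_chain2[OF DERIV_exp DERIV_minus[OF DERIV_cdivide[OF d]]]]) (simp add: divide_inverse)
qed

text \<open>As \<beta> \<le> 1 + t, the function 2 \<epsilon> (1 + t)^3 e has a derivative of at
  most 6 \<epsilon> - 2 \<le> - 1 times (1 + t)^2 e, and its initial value is 2 \<epsilon>.\<close>

lemma layer_integral:
  assumes t: "t \<ge> 0" and \<epsilon>: "\<epsilon> > 0" "8 * \<epsilon> \<le> 1"
  shows "integral {0..t} (\<lambda>s. (1 + s)\<^sup>2 * layer \<epsilon> s) \<le> 2 * \<epsilon>"
proof -
  have sub: "{0..t} \<subseteq> {0..}" by auto
  have ce: "continuous_on {0..t} (layer \<epsilon>)"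
    by (rule continuous_on_subset[OF DERIV_continuous_on[OF DERIV_layer[OF _ \<epsilon>(1)]] sub]) simp
  have le: "2 * \<epsilon> * ((1 + t)^3 * layer \<epsilon> t) - 2 * \<epsilon> * ((1 + 0)^3 * layer \<epsilon> 0) \<le> integral {0..t} (\<lambda>s. - ((1 + s)\<^sup>2 * layer \<epsilon> s))"
  proof (rule DERIV_within_le_integral[where f = "\<lambda>t. 2 * \<epsilon> * ((1 + t)^3 * layer \<epsilon> t)"])
    fix s assume "s \<in> {0..t}"
    then have s: "s \<ge> 0" by simp
    have d3: "((\<lambda>s. (1 + s)^3) has_real_derivative 3 * (1 + s)\<^sup>2) (at s within {0..t})"
      by (auto intro!: derivative_eq_intros)
    show "((\<lambda>t. 2 * \<epsilon> * ((1 + t)^3 * layer \<epsilon> t)) has_real_derivative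
      2 * \<epsilon> * (3 * (1 + s)\<^sup>2 * layer \<epsilon> s + - (layer \<epsilon> s / (\<epsilon> * \<beta> s)) * (1 + s)^3)) (at s within {0..t})"
      by (rule DERIV_cmult[OF DERIV_mult[OF d3 DERIV_subset[OF DERIV_layer[OF s \<epsilon>(1)] sub]]])
    define x where "x = (1 + s)\<^sup>2 * layer \<epsilon> s"
    have x: "x > 0" using s layer_pos by (simp add: x_def)
    have "1 * x \<le> ((1 + s) / \<beta> s) * x" using \<beta>_le[OF s] \<beta>_pos[OF s] x by (intro mult_right_mono) auto
    moreover have "6 * \<epsilon> * x \<le> 1 * x" using \<epsilon> x by (intro mult_right_mono) auto
    moreover have "2 * \<epsilon> * (3 * (1 + s)\<^sup>2 * layer \<epsilon> s + - (layer \<epsilon> s / (\<epsilon> * \<beta> s)) * (1 + s)^3) = 6 * \<epsilon> * x - 2 * (((1 + s) / \<beta> s) * x)"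
    proof -
      have "\<epsilon> * (layer \<epsilon> s / (\<epsilon> * \<beta> s)) = layer \<epsilon> s / \<beta> s" using \<epsilon> by simp
      then show ?thesis unfolding x_def divide_inverse by algebra
    qed
    ultimately show "2 * \<epsilon> * (3 * (1 + s)\<^sup>2 * layer \<epsilon> s + - (layer \<epsilon> s / (\<epsilon> * \<beta> s)) * (1 + s)^3) \<le> - ((1 + s)\<^sup>2 * layer \<epsilon> s)"
      unfolding x_def[symmetric] by linarith
  next
    show "continuous_on {0..t} (\<lambda>s. - ((1 + s)\<^sup>2 * layer \<epsilon> s))" by (intro continuous_intros ce)
  qed (rule t)
  have "0 \<le> 2 * \<epsilon> * ((1 + t)^3 * layer \<epsilon> t)" using \<epsilon> t layer_pos[of \<epsilon> t] by simp
  with le[unfolded layer_0 integral_neg] show ?thesis by (simp only: power_one add_0_right mult_1_right)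
qed

text \<open>Uniqueness for the first order equation of the corrector's velocity: divided by the
  scalar layer, it has derivative zero.\<close>

lemma layer_ode:
  fixes \<theta>' :: "real \<Rightarrow> 'a::real_inner"
  assumes \<epsilon>: "\<epsilon> > 0" and t: "t \<ge> 0"
    and d: "\<And>t. t \<ge> 0 \<Longrightarrow> (\<theta>' has_vector_derivative \<theta>'' t) (at t within {0..})"
    and ode: "\<And>t. t \<ge> 0 \<Longrightarrow> \<epsilon> *\<^sub>R \<theta>'' t + inverse (\<beta> t) *\<^sub>R \<theta>' t = 0"
  shows "\<theta>' t = layer \<epsilon> t *\<^sub>R \<theta>' 0"
proof -
  have "inverse (layer \<epsilon> t) *\<^sub>R \<theta>' t = inverse (layer \<epsilon> 0) *\<^sub>R \<theta>' 0"
  proof (rule vector_derivative_zero_const[where f = "\<lambda>s. inverse (layer \<epsilon> s) *\<^sub>R \<theta>' s" and b = t])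
    fix s assume "s \<in> {0..t}"
    then have s: "s \<ge> 0" by simp
    have di: "((\<lambda>s. inverse (layer \<epsilon> s)) has_real_derivative inverse (layer \<epsilon> s) / (\<epsilon> * \<beta> s)) (at s within {0..})"
      by (rule DERIV_cong[OF DERIV_inverse'[OF DERIV_layer[OF s \<epsilon>]]]) (use layer_pos[of \<epsilon> s] in auto)
    have "\<epsilon> *\<^sub>R \<theta>'' s = - (inverse (\<beta> s) *\<^sub>R \<theta>' s)" using ode[OF s] by (rule add_eq_0_iff2[THEN iffD1])
    then have "(1 / \<epsilon>) *\<^sub>R (\<epsilon> *\<^sub>R \<theta>'' s) = (1 / \<epsilon>) *\<^sub>R (- (inverse (\<beta> s) *\<^sub>R \<theta>' s))" by (rule arg_cong)
    then have "\<theta>'' s = - ((1 / (\<epsilon> * \<beta> s)) *\<^sub>R \<theta>' s)" using \<epsilon> by (simp add: divide_inverse)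
    then have "inverse (layer \<epsilon> s) *\<^sub>R \<theta>'' s + (inverse (layer \<epsilon> s) / (\<epsilon> * \<beta> s)) *\<^sub>R \<theta>' s = 0" by simp
    with has_vector_derivative_scaleR[OF di d[OF s]]
    have "((\<lambda>s. inverse (layer \<epsilon> s) *\<^sub>R \<theta>' s) has_vector_derivative 0) (at s within {0..})" by simp
    then show "((\<lambda>s. inverse (layer \<epsilon> s) *\<^sub>R \<theta>' s) has_vector_derivative 0) (at s within {0..t})"
      by (rule has_vector_derivative_within_subset) auto
  qed (use t in auto)
  then have "layer \<epsilon> t *\<^sub>R (inverse (layer \<epsilon> t) *\<^sub>R \<theta>' t) = layer \<epsilon> t *\<^sub>R \<theta>' 0" by (simp add: layer_0)
  then show ?thesis using layer_pos[of \<epsilon> t] by simp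
qed

end

context kirchhoff
begin

lemma decay_bounds_mono:
  assumes "decay_bounds L U U1 t" "L \<le> L'" "t \<ge> 0"
  shows "decay_bounds L' U U1 t"
proof -
  have "y \<le> L * x \<Longrightarrow> 0 \<le> x \<Longrightarrow> y \<le> L' * x" for x y
    using mult_right_mono[OF assms(2), of x] by linarith
  then show ?thesis using assms \<beta>_pos[OF assms(3)] unfolding decay_bounds_def Let_def
    by (auto simp: zero_le_mult_iff)
qed

theorem quadratic_error:
  assumes par: "par_sol u v" and u: "B (u 0) \<noteq> 0" "B (B (u 0)) \<in> D" and u1: "u1 \<in> D"
    and w0: "w0 = u1 + ((norm (B (u 0)))\<^sup>2) powr \<gamma> *\<^sub>R B (B (u 0))"
  obtains C where "C \<ge> 0" and "\<forall>\<^sub>F \<epsilon> in at_right 0. \<epsilon> > 0 \<and> (\<forall>U U1 U2 t.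
    hyp_sol \<epsilon> U U1 U2 \<longrightarrow> U 0 = u 0 \<longrightarrow> U1 0 = u1 \<longrightarrow> t \<ge> 0 \<longrightarrow>
      (norm (U t - u t))\<^sup>2 + (norm (B (U t - u t)))\<^sup>2
      + integral {0..t} (\<lambda>s. (norm (U1 s - v s - layer \<epsilon> s *\<^sub>R w0))\<^sup>2 / ((norm (B (u s)))\<^sup>2) powr \<gamma> * (1 / \<beta> s))
      \<le> C * \<epsilon>\<^sup>2)"
proof -
  \<comment> \<open>Au(0) \<in> D(B) is used here: it gives the layer an initial slope in
    D(B).\<close>
  have w0_D: "w0 \<in> D" unfolding w0 using u u1 by (intro subspace_add[OF subspace_D] subspace_scale[OF subspace_D])
  obtain La w where La: "La > 0" "\<And>t. t \<ge> 0 \<Longrightarrow> decay_bounds La u v t"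
    "\<And>t. t \<ge> 0 \<Longrightarrow> 1 \<le> La * (((norm (B (u t)))\<^sup>2) powr \<gamma> * ((1 + t) * \<beta> t))"
    "\<And>t. t \<ge> 0 \<Longrightarrow> ((norm (B (u t)))\<^sup>2) powr \<gamma> \<le> La"
    "\<And>n t. t \<ge> 0 \<Longrightarrow> ((\<lambda>s. K n (v s)) has_vector_derivative w n t) (at t within {0..})"
    "\<And>n. continuous_on {0..} (w n)"
    "\<And>n t. t \<ge> 0 \<Longrightarrow> integral {0..t} (\<lambda>s. (norm (w n s))\<^sup>2 *
           (\<beta> s * inverse (((norm (B (u s)))\<^sup>2) powr \<gamma>) + (\<beta> s)^3)) \<le> La"
    by (rule parabolic_estimates[OF par u]) blast
  obtain Lb where Lb: "Lb > 0" "\<forall>\<^sub>F \<epsilon> in at_right 0. \<epsilon> > 0 \<and> (\<forall>U U1 U2 t.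
    hyp_sol \<epsilon> U U1 U2 \<longrightarrow> U 0 = u 0 \<longrightarrow> U1 0 = u1 \<longrightarrow> t \<ge> 0 \<longrightarrow> decay_bounds Lb U U1 t)"
    by (rule hyperbolic_estimates[OF par_D(2,3)[OF par order_refl] u1 u(1)]) blast
  define L where "L = La + Lb + 1"
  have L: "La \<le> L" "Lb \<le> L" "1 \<le> L" using La(1) Lb(1) by (auto simp: L_def)
  \<comment> \<open>The constants of \<open>singular_perturbation\<close> written out again, so that
    they are chosen before \<epsilon> and before the interpretation.\<close>
  define C where "C = 16 * \<gamma>\<^sup>2 * L\<^sup>2"
  define K1 where "K1 = C + 8 * C\<^sup>2 * (norm (B w0))\<^sup>2"
  define K2 where "K2 = K1 + 24 * C * L\<^sup>2 + L + 2 * L * norm w0 + 4 * L\<^sup>2"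
  define K where "K = 16 * K2 + 20 * C * (16 * K2) + 10 * K1"
  have C0: "C \<ge> 0" by (simp add: C_def)
  then have K1: "K1 \<ge> 0" by (simp add: K1_def)
  then have "K2 \<ge> 0" using C0 L(3) by (simp add: K2_def)
  then have "K \<ge> 0" using C0 K1 by (simp add: K_def)
  moreover have "\<forall>\<^sub>F \<epsilon> in at_right 0. 8 * \<epsilon> \<le> (1::real)" "\<forall>\<^sub>F \<epsilon> in at_right 0. 4 * \<gamma> * L * \<epsilon> \<le> 1"
    by (intro eventually_at_right_mult_le; simp)+
  with Lb(2) have "\<forall>\<^sub>F \<epsilon> in at_right 0. \<epsilon> > 0 \<and> (\<forall>U U1 U2 t.
    hyp_sol \<epsilon> U U1 U2 \<longrightarrow> U 0 = u 0 \<longrightarrow> U1 0 = u1 \<longrightarrow> t \<ge> 0 \<longrightarrow>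
      (norm (U t - u t))\<^sup>2 + (norm (B (U t - u t)))\<^sup>2
      + integral {0..t} (\<lambda>s. (norm (U1 s - v s - layer \<epsilon> s *\<^sub>R w0))\<^sup>2 / ((norm (B (u s)))\<^sup>2) powr \<gamma> * (1 / \<beta> s))
      \<le> K * \<epsilon>\<^sup>2)"
  proof eventually_elim
    case (elim \<epsilon>)
    show ?case
    proof (intro conjI allI impI)
      show \<epsilon>: "\<epsilon> > 0" using elim(1) by blast
      fix U U1 U2 and t :: real
      assume hyp: "hyp_sol \<epsilon> U U1 U2" and U0: "U 0 = u 0" and U10: "U1 0 = u1" and t: "t \<ge> 0"
      have dU: "decay_bounds Lb U U1 s" if "s \<ge> 0" for s using elim(1) hyp U0 U10 that by blast
      have v0: "U1 0 - v 0 = w0" using par unfolding w0 U10 by (simp add: par_sol_def \<beta>_def)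
      interpret sp: singular_perturbation D B _ p \<gamma> \<epsilon> L U U1 U2 u v w w0 "layer \<epsilon>"
      proof unfold_locales
        show "decay_bounds L U U1 s" "decay_bounds L u v s" if "s \<ge> 0" for s
          by (rule decay_bounds_mono[OF dU[OF that] L(2) that] decay_bounds_mono[OF La(2)[OF that] L(1) that])+
        show "1 \<le> L * (((norm (B (u s)))\<^sup>2) powr \<gamma> * ((1 + s) * \<beta> s))" if "s \<ge> 0" for s
        proof -
          have "0 \<le> ((norm (B (u s)))\<^sup>2) powr \<gamma> * ((1 + s) * \<beta> s)" using that \<beta>_pos[OF that] by simp
          then show ?thesis using La(3)[OF that] mult_right_mono[OF L(1)] by (meson order_trans)
        qed
      qed (fact hyp par \<epsilon> elim L U0 v0 w0_D layer_0 | rule layer_pos La(6)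
        | (rule DERIV_layer[OF _ \<epsilon>] layer_integral[OF _ \<epsilon>] La(5) order_trans[OF La(4) L(1)] order_trans[OF La(7) L(1)]; (rule elim | assumption)))+
      show "(norm (U t - u t))\<^sup>2 + (norm (B (U t - u t)))\<^sup>2
        + integral {0..t} (\<lambda>s. (norm (U1 s - v s - layer \<epsilon> s *\<^sub>R w0))\<^sup>2 / ((norm (B (u s)))\<^sup>2) powr \<gamma> * (1 / \<beta> s))
        \<le> K * \<epsilon>\<^sup>2"
        using sp.error_bound[OF t]
        unfolding sp.\<rho>_def sp.r_def sp.cu_def sp.Mu_def sp.K2_def sp.K1_def sp.C_def K_def K2_def K1_def C_def .
    qed
  qed
  ultimately show ?thesis using that by blast
qed

end

subsection \<open>Solutions in the sense of the definitions\<close>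

lemma dt_eq:
  assumes "(f has_vector_derivative d) (at t within {0..})" and "t \<ge> 0"
  shows "dt f t = d"
proof -
  have "at_right t \<le> at t within {0..}" using assms(2) by (intro at_le) auto
  then have "at t within {0..} \<noteq> bot" using trivial_limit_at_right_real[of t] by (metis bot.extremum_unique)
  then show ?thesis unfolding dt_def using assms(1) by (rule vector_derivative_within)
qed

lemma Ck_dom_cong:
  assumes "\<And>t. t \<ge> 0 \<Longrightarrow> u t = v t"
  shows "Ck_dom B k u \<Longrightarrow> Ck_dom B k v"
proof (cases k)
  case 0
  assume "Ck_dom B k u"
  then show ?thesis using assms 0
      continuous_on_cong[of "{0..}" "{0..}" u v] continuous_on_cong[of "{0..}" "{0..}" "\<lambda>t. app B (u t)" "\<lambda>t. app B (v t)"]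
    by auto
next
  case (Suc m)
  assume "Ck_dom B k u"
  then obtain u' where u': "\<And>t. t \<ge> 0 \<Longrightarrow> u t \<in> dom B" "\<And>t. t \<ge> 0 \<Longrightarrow> (u has_vector_derivative u' t) (at t within {0..})"
    "\<And>t. t \<ge> 0 \<Longrightarrow> ((\<lambda>s. app B (u s)) has_vector_derivative app B (u' t)) (at t within {0..})" "Ck_dom B m u'"
    unfolding Suc Ck_dom.simps by blast
  have "(v has_vector_derivative u' t) (at t within {0..})"
    "((\<lambda>s. app B (v s)) has_vector_derivative app B (u' t)) (at t within {0..})" if "t \<ge> 0" for t
    using has_vector_derivative_transform[OF _ _ u'(2)[OF that], of v]
      has_vector_derivative_transform[OF _ _ u'(3)[OF that], of "\<lambda>s. app B (v s)"] that assms by auto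
  moreover have "v t \<in> dom B" if "t \<ge> 0" for t using u'(1)[OF that] assms[OF that] by simp
  ultimately show ?thesis unfolding Suc Ck_dom.simps using u'(4) by blast
qed

text \<open>Derivatives within [0, \<infinity>[ are unique, so the witness under the existential
  quantifier agrees there with \<open>dt u\<close> and can be replaced by it.\<close>

lemma Ck_dom_Suc:
  assumes "Ck_dom B (Suc k) u"
  shows "t \<ge> 0 \<Longrightarrow> u t \<in> dom B"
    and "t \<ge> 0 \<Longrightarrow> (u has_vector_derivative dt u t) (at t within {0..})"
    and "t \<ge> 0 \<Longrightarrow> ((\<lambda>s. app B (u s)) has_vector_derivative app B (dt u t)) (at t within {0..})"
    and "Ck_dom B k (dt u)"
proof -
  obtain u' where u': "\<And>t. t \<ge> 0 \<Longrightarrow> u t \<in> dom B" "\<And>t. t \<ge> 0 \<Longrightarrow> (u has_vector_derivative u' t) (at t within {0..})"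
    "\<And>t. t \<ge> 0 \<Longrightarrow> ((\<lambda>s. app B (u s)) has_vector_derivative app B (u' t)) (at t within {0..})" "Ck_dom B k u'"
    using assms unfolding Ck_dom.simps by blast
  have eq: "dt u t = u' t" if "t \<ge> 0" for t by (rule dt_eq[OF u'(2)[OF that] that])
  show "u t \<in> dom B" "(u has_vector_derivative dt u t) (at t within {0..})"
    "((\<lambda>s. app B (u s)) has_vector_derivative app B (dt u t)) (at t within {0..})" if "t \<ge> 0"
    using u'(1-3)[OF that] eq[OF that] by auto
  show "Ck_dom B k (dt u)" by (rule Ck_dom_cong[OF _ u'(4)]) (simp add: eq)
qed

lemma half_power_1: "half_power A 1 = op_sqrt A"
  by (simp add: map_comp_def)

lemma norm_square_powr: "((norm x)\<^sup>2) powr \<gamma> = norm x powr (2 * \<gamma>)"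
  by (cases "x = 0") (simp_all add: powr_powr flip: powr_numeral)

context
  fixes A :: "'a::{real_inner, complete_space} \<rightharpoonup> 'a" and p \<gamma> :: real
  assumes sa: "self_adjoint A" and nn: "nonneg_op A" and p: "0 \<le> p" "p \<le> 1" and \<gamma>: "\<gamma> \<ge> 1"
begin

interpretation kirchhoff "dom (op_sqrt A)" "app (op_sqrt A)"
  "\<lambda>n x. resolvent A (1 / real (Suc n)) (resolvent A (1 / real (Suc n)) x)" p \<gamma>
  using regularized_sqrt[OF sa nn] p \<gamma>
  by (simp add: kirchhoff_def kirchhoff_axioms_def dissipation_def)

lemma dom_A: "x \<in> dom A \<Longrightarrow> x \<in> dom (op_sqrt A)" "x \<in> dom A \<Longrightarrow> app (op_sqrt A) x \<in> dom (op_sqrt A)"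
  "x \<in> dom A \<Longrightarrow> app A x = app (op_sqrt A) (app (op_sqrt A) x)"
  using dom_sqrt[OF sa nn, of x] app_sqrt[OF sa nn, of x] by auto

lemma Ck_dom_0_A:
  assumes "Ck_dom A 0 u"
  shows "continuous_on {0..} (\<lambda>t. app (op_sqrt A) (app (op_sqrt A) (u t)))"
  using assms continuous_on_cong[of "{0..}" "{0..}" "\<lambda>t. app A (u t)" "\<lambda>t. app (op_sqrt A) (app (op_sqrt A) (u t))"]
  by (simp add: dom_A(3))

lemma hyperbolic_solution_hyp_sol:
  assumes "hyperbolic_solution A p \<gamma> u0 u1 \<epsilon> U"
  shows "hyp_sol \<epsilon> U (dt U) (dt (dt U))" "U 0 = u0" "dt U 0 = u1"
proof -
  have C2: "Ck_dom Some (Suc (Suc 0)) U" and C1: "Ck_dom (op_sqrt A) (Suc 0) U" and C0: "Ck_dom A 0 U"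
    using assms unfolding hyperbolic_solution_def half_power_1 by (simp_all only: numeral_2_eq_2 One_nat_def)
  have ode: "\<forall>t\<ge>0. \<epsilon> *\<^sub>R dt (dt U) t + (1 + t) powr (- p) *\<^sub>R dt U t
      + norm (app (op_sqrt A) (U t)) powr (2 * \<gamma>) *\<^sub>R app A (U t) = 0"
    using assms unfolding hyperbolic_solution_def half_power_1 by blast
  have dA: "U t \<in> dom A" if "t \<ge> 0" for t using C0 that by simp
  show "hyp_sol \<epsilon> U (dt U) (dt (dt U))"
    unfolding hyp_sol_def
  proof (intro conjI allI impI)
    fix t :: real assume t: "t \<ge> 0"
    show "(U has_vector_derivative dt U t) (at t within {0..})" by (rule Ck_dom_Suc(2)[OF C2 t])
    show "(dt U has_vector_derivative dt (dt U) t) (at t within {0..})"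
      by (rule Ck_dom_Suc(2)[OF Ck_dom_Suc(4)[OF C2] t])
    show "((\<lambda>s. app (op_sqrt A) (U s)) has_vector_derivative app (op_sqrt A) (dt U t)) (at t within {0..})"
      by (rule Ck_dom_Suc(3)[OF C1 t])
    show "U t \<in> dom (op_sqrt A)" "app (op_sqrt A) (U t) \<in> dom (op_sqrt A)" by (rule dom_A[OF dA[OF t]])+
    show "dt U t \<in> dom (op_sqrt A)" using Ck_dom_Suc(4)[OF C1] t unfolding Ck_dom.simps by blast
    show "\<epsilon> *\<^sub>R dt (dt U) t + inverse (\<beta> t) *\<^sub>R dt U t + ((norm (app (op_sqrt A) (U t)))\<^sup>2) powr \<gamma> *\<^sub>R
        app (op_sqrt A) (app (op_sqrt A) (U t)) = 0"
      using ode[rule_format, OF t] unfolding inverse_\<beta>[OF t] norm_square_powr dom_A(3)[OF dA[OF t]] .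
  next
    show "continuous_on {0..} (\<lambda>t. app (op_sqrt A) (dt U t))" using Ck_dom_Suc(4)[OF C1] unfolding Ck_dom.simps by blast
    show "continuous_on {0..} (\<lambda>t. app (op_sqrt A) (app (op_sqrt A) (U t)))" by (rule Ck_dom_0_A[OF C0])
  qed
qed (use assms in \<open>simp_all add: hyperbolic_solution_def\<close>)

lemma parabolic_solution_par_sol:
  assumes "parabolic_solution A p \<gamma> u0 u"
  shows "par_sol u (dt u)" "u 0 = u0"
proof -
  have C1: "Ck_dom Some (Suc 0) u" and C0: "Ck_dom A 0 u"
    using assms unfolding parabolic_solution_def by (simp_all only: One_nat_def)
  have dA: "u t \<in> dom A" if "t \<ge> 0" for t using C0 that by simp
  show "par_sol u (dt u)"
    unfolding par_sol_def
  proof (intro conjI allI impI)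
    fix t :: real assume t: "t \<ge> 0"
    show "(u has_vector_derivative dt u t) (at t within {0..})" by (rule Ck_dom_Suc(2)[OF C1 t])
    show "u t \<in> dom (op_sqrt A)" "app (op_sqrt A) (u t) \<in> dom (op_sqrt A)" by (rule dom_A[OF dA[OF t]])+
    have "dt u t + ((1 + t) powr p * norm (app (op_sqrt A) (u t)) powr (2 * \<gamma>)) *\<^sub>R app A (u t) = 0"
      using assms t unfolding parabolic_solution_def half_power_1 by simp
    then have "dt u t = - (((1 + t) powr p * norm (app (op_sqrt A) (u t)) powr (2 * \<gamma>)) *\<^sub>R app A (u t))"
      by (rule add_eq_0_iff2[THEN iffD1])
    then show "dt u t = - (\<beta> t * ((norm (app (op_sqrt A) (u t)))\<^sup>2) powr \<gamma>) *\<^sub>R app (op_sqrt A) (app (op_sqrt A) (u t))"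
      by (simp add: \<beta>_def norm_square_powr dom_A(3)[OF dA[OF t]])
  qed (rule Ck_dom_0_A[OF C0])
qed (use assms in \<open>simp add: parabolic_solution_def\<close>)

lemma corrector_solution_layer:
  assumes "corrector_solution A p \<gamma> u0 u1 \<epsilon> \<theta>" and \<epsilon>: "\<epsilon> > 0" and t: "t \<ge> 0"
  shows "(\<theta> has_vector_derivative dt \<theta> t) (at t within {0..})"
    and "dt \<theta> t = layer \<epsilon> t *\<^sub>R (u1 + ((norm (app (op_sqrt A) u0))\<^sup>2) powr \<gamma> *\<^sub>R app A u0)"
proof -
  have C2: "Ck_dom Some (Suc (Suc 0)) \<theta>"
    using assms unfolding corrector_solution_def by (simp_all only: numeral_2_eq_2)
  show "(\<theta> has_vector_derivative dt \<theta> t) (at t within {0..})" by (rule Ck_dom_Suc(2)[OF C2 t])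
  have "dt \<theta> t = layer \<epsilon> t *\<^sub>R dt \<theta> 0"
  proof (rule layer_ode[OF \<epsilon> t Ck_dom_Suc(2)[OF Ck_dom_Suc(4)[OF C2]]])
    show "\<epsilon> *\<^sub>R dt (dt \<theta>) s + inverse (\<beta> s) *\<^sub>R dt \<theta> s = 0" if "s \<ge> 0" for s
      using assms(1) that unfolding corrector_solution_def by (simp add: inverse_\<beta>)
  qed
  then show "dt \<theta> t = layer \<epsilon> t *\<^sub>R (u1 + ((norm (app (op_sqrt A) u0))\<^sup>2) powr \<gamma> *\<^sub>R app A u0)"
    using assms(1) unfolding corrector_solution_def half_power_1 by (simp add: norm_square_powr)
qed

theorem quadratic_error_estimate:
  assumes u0: "u0 \<in> dom (half_power A 3)" and u1: "u1 \<in> dom (half_power A 1)"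
    and nz: "app (half_power A 1) u0 \<noteq> 0" and par: "parabolic_solution A p \<gamma> u0 u"
  obtains C where "C \<ge> 0" and "\<forall>\<^sub>F \<epsilon> in at_right 0. \<epsilon> > 0 \<and> (\<forall>U \<theta>.
     hyperbolic_solution A p \<gamma> u0 u1 \<epsilon> U \<longrightarrow> corrector_solution A p \<gamma> u0 u1 \<epsilon> \<theta> \<longrightarrow>
     (\<forall>t\<ge>0. error_energy A p \<gamma> U u \<theta> t \<le> C * \<epsilon>\<^sup>2))"
proof -
  let ?B = "app (op_sqrt A)"
  \<comment> \<open>Without the innermost \<open>Some\<close>, \<open>half_power A 3\<close> is a
    threefold composition, whose domain requires u0 \<in> D(A) and A u0 \<in> D(B).\<close>
  have "u0 \<in> dom (op_sqrt A \<circ>\<^sub>m (op_sqrt A \<circ>\<^sub>m op_sqrt A))"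
    using u0 by (simp add: numeral_3_eq_3 half_power_1[unfolded One_nat_def] map_comp_def)
  then obtain w where w: "(op_sqrt A \<circ>\<^sub>m (op_sqrt A \<circ>\<^sub>m op_sqrt A)) u0 = Some w" by blast
  then obtain z where z: "(op_sqrt A \<circ>\<^sub>m op_sqrt A) u0 = Some z" "z \<in> dom (op_sqrt A)"
    using map_comp_Some_iff[of "op_sqrt A" "op_sqrt A \<circ>\<^sub>m op_sqrt A" u0 w] by blast
  have u0D: "u0 \<in> dom (op_sqrt A)" "?B u0 \<in> dom (op_sqrt A)" and zz: "?B (?B u0) = z"
    using z(1) unfolding map_comp_eq_Some by blast+
  have u0A: "u0 \<in> dom A" using dom_sqrt[OF sa nn, of u0] u0D by blast
  note ps = parabolic_solution_par_sol[OF par]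
  define w0 where "w0 = u1 + ((norm (?B u0))\<^sup>2) powr \<gamma> *\<^sub>R ?B (?B u0)"
  have nz0: "?B (u 0) \<noteq> 0" using nz unfolding half_power_1 ps(2) .
  have BB0: "?B (?B (u 0)) \<in> dom (op_sqrt A)" using z(2) unfolding ps(2) zz .
  have u1D: "u1 \<in> dom (op_sqrt A)" using u1 unfolding half_power_1 .
  have w0: "w0 = u1 + ((norm (?B (u 0)))\<^sup>2) powr \<gamma> *\<^sub>R ?B (?B (u 0))" unfolding ps(2) w0_def ..
  obtain C where C: "C \<ge> 0" "\<forall>\<^sub>F \<epsilon> in at_right 0. \<epsilon> > 0 \<and> (\<forall>U U1 U2 t.
    hyp_sol \<epsilon> U U1 U2 \<longrightarrow> U 0 = u 0 \<longrightarrow> U1 0 = u1 \<longrightarrow> t \<ge> 0 \<longrightarrow>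
      (norm (U t - u t))\<^sup>2 + (norm (?B (U t - u t)))\<^sup>2
      + integral {0..t} (\<lambda>s. (norm (U1 s - dt u s - layer \<epsilon> s *\<^sub>R w0))\<^sup>2 / ((norm (?B (u s)))\<^sup>2) powr \<gamma> * (1 / \<beta> s))
      \<le> C * \<epsilon>\<^sup>2)"
    by (rule quadratic_error[OF ps(1) nz0 BB0 u1D w0])
  from C(2) have "\<forall>\<^sub>F \<epsilon> in at_right 0. \<epsilon> > 0 \<and> (\<forall>U \<theta>.
     hyperbolic_solution A p \<gamma> u0 u1 \<epsilon> U \<longrightarrow> corrector_solution A p \<gamma> u0 u1 \<epsilon> \<theta> \<longrightarrow>
     (\<forall>t\<ge>0. error_energy A p \<gamma> U u \<theta> t \<le> C * \<epsilon>\<^sup>2))"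
  proof eventually_elim
    case (elim \<epsilon>)
    show ?case
    proof (intro conjI allI impI)
      show \<epsilon>: "\<epsilon> > 0" using elim by blast
      fix U \<theta> and t :: real
      assume hyp: "hyperbolic_solution A p \<gamma> u0 u1 \<epsilon> U" and cor: "corrector_solution A p \<gamma> u0 u1 \<epsilon> \<theta>" and t: "t \<ge> 0"
      note hs = hyperbolic_solution_hyp_sol[OF hyp]
      have dt\<theta>: "dt \<theta> s = layer \<epsilon> s *\<^sub>R w0" if "s \<ge> 0" for s
        using corrector_solution_layer(2)[OF cor \<epsilon> that] unfolding dom_A(3)[OF u0A] w0_def .
      have r: "dt (\<lambda>s. U s - u s - \<theta> s) s = dt U s - dt u s - layer \<epsilon> s *\<^sub>R w0" if s: "s \<ge> 0" for s
        unfolding dt\<theta>[OF s, symmetric]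
        by (intro dt_eq[OF _ s] has_vector_derivative_diff hyp_D(1)[OF hs(1) \<epsilon> s] par_D(1)[OF ps(1) s]
            corrector_solution_layer(1)[OF cor \<epsilon> s])
      have eq: "integral {0..t} (\<lambda>s. (norm (dt (\<lambda>s. U s - u s - \<theta> s) s))\<^sup>2 / norm (?B (u s)) powr (2 * \<gamma>) * (1 / (1 + s) powr p))
        = integral {0..t} (\<lambda>s. (norm (dt U s - dt u s - layer \<epsilon> s *\<^sub>R w0))\<^sup>2 / ((norm (?B (u s)))\<^sup>2) powr \<gamma> * (1 / \<beta> s))"
        by (intro integral_cong) (simp add: r norm_square_powr \<beta>_def)
      have "U 0 = u 0" unfolding hs(2) ps(2) ..
      with elim hs(1,3) t show "error_energy A p \<gamma> U u \<theta> t \<le> C * \<epsilon>\<^sup>2"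
        unfolding error_energy_def Let_def half_power_1 eq by blast
    qed
  qed
  with C(1) show ?thesis by (rule that)
qed

end

theorem theorem2p4:
  fixes A :: "'a::{real_inner, complete_space} \<rightharpoonup> 'a"
    and p \<gamma> :: real and u\<^sub>0 u\<^sub>1 :: 'a and u :: "real \<Rightarrow> 'a"
  assumes "self_adjoint A" and "nonneg_op A"
    and "0 \<le> p" and "p \<le> 1" and "\<gamma> \<ge> 1"
    and "u\<^sub>0 \<in> dom (half_power A 3)" and "u\<^sub>1 \<in> dom (half_power A 1)"
    and "app (half_power A 1) u\<^sub>0 \<noteq> 0"
    and "parabolic_solution A p \<gamma> u\<^sub>0 u"
  shows "(\<exists>C\<^sub>3. \<forall>\<^sub>F \<epsilon> in at_right 0. \<forall>u\<^sub>\<epsilon> \<theta>\<^sub>\<epsilon>.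
            hyperbolic_solution A p \<gamma> u\<^sub>0 u\<^sub>1 \<epsilon> u\<^sub>\<epsilon> \<longrightarrow> corrector_solution A p \<gamma> u\<^sub>0 u\<^sub>1 \<epsilon> \<theta>\<^sub>\<epsilon> \<longrightarrow>
            (\<forall>t\<ge>0. error_energy A p \<gamma> u\<^sub>\<epsilon> u \<theta>\<^sub>\<epsilon> t \<le> C\<^sub>3 * \<epsilon>)) \<and>
         (coercive A \<or> p \<le> (\<gamma>\<^sup>2 + 1) / (\<gamma>\<^sup>2 + 2 * \<gamma> - 1) \<longrightarrow>
          (\<exists>C\<^sub>4. \<forall>\<^sub>F \<epsilon> in at_right 0. \<forall>u\<^sub>\<epsilon> \<theta>\<^sub>\<epsilon>.
            hyperbolic_solution A p \<gamma> u\<^sub>0 u\<^sub>1 \<epsilon> u\<^sub>\<epsilon> \<longrightarrow> corrector_solution A p \<gamma> u\<^sub>0 u\<^sub>1 \<epsilon> \<theta>\<^sub>\<epsilon> \<longrightarrow>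
            (\<forall>t\<ge>0. error_energy A p \<gamma> u\<^sub>\<epsilon> u \<theta>\<^sub>\<epsilon> t \<le> C\<^sub>4 * \<epsilon>\<^sup>2)))"
proof -
  obtain C where C: "C \<ge> 0" "\<forall>\<^sub>F \<epsilon> in at_right 0. \<epsilon> > 0 \<and> (\<forall>u\<^sub>\<epsilon> \<theta>\<^sub>\<epsilon>.
      hyperbolic_solution A p \<gamma> u\<^sub>0 u\<^sub>1 \<epsilon> u\<^sub>\<epsilon> \<longrightarrow> corrector_solution A p \<gamma> u\<^sub>0 u\<^sub>1 \<epsilon> \<theta>\<^sub>\<epsilon> \<longrightarrow>
      (\<forall>t\<ge>0. error_energy A p \<gamma> u\<^sub>\<epsilon> u \<theta>\<^sub>\<epsilon> t \<le> C * \<epsilon>\<^sup>2))"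
    by (rule quadratic_error_estimate[OF assms])
  have "\<forall>\<^sub>F \<epsilon> in at_right 0. 1 * \<epsilon> \<le> (1::real)" by (rule eventually_at_right_mult_le) simp
  with C(2) have "\<forall>\<^sub>F \<epsilon> in at_right 0. \<forall>u\<^sub>\<epsilon> \<theta>\<^sub>\<epsilon>.
      hyperbolic_solution A p \<gamma> u\<^sub>0 u\<^sub>1 \<epsilon> u\<^sub>\<epsilon> \<longrightarrow> corrector_solution A p \<gamma> u\<^sub>0 u\<^sub>1 \<epsilon> \<theta>\<^sub>\<epsilon> \<longrightarrow>
      (\<forall>t\<ge>0. error_energy A p \<gamma> u\<^sub>\<epsilon> u \<theta>\<^sub>\<epsilon> t \<le> C * \<epsilon>)"
  proof eventually_elim
    case (elim \<epsilon>)
    then have "C * \<epsilon>\<^sup>2 \<le> C * \<epsilon>" using C(1) by (intro mult_left_mono) (simp_all add: power2_eq_square mult_left_le_one_le)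
    with elim show ?case by (meson order_trans)
  qed
  moreover from C(2) have "\<forall>\<^sub>F \<epsilon> in at_right 0. \<forall>u\<^sub>\<epsilon> \<theta>\<^sub>\<epsilon>.
      hyperbolic_solution A p \<gamma> u\<^sub>0 u\<^sub>1 \<epsilon> u\<^sub>\<epsilon> \<longrightarrow> corrector_solution A p \<gamma> u\<^sub>0 u\<^sub>1 \<epsilon> \<theta>\<^sub>\<epsilon> \<longrightarrow>
      (\<forall>t\<ge>0. error_energy A p \<gamma> u\<^sub>\<epsilon> u \<theta>\<^sub>\<epsilon> t \<le> C * \<epsilon>\<^sup>2)"
    by eventually_elim blast
  ultimately show ?thesis by blast
qed

end
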